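(* Let $\mu_0\in\mathcal{M}$. For each $\mu\in\mathcal{M}$ and $\theta\in[0,1]$ define $\mu_\theta=(1-\theta)\mu_0+\theta\mu$. Then for all $\mu\in\mathcal{M}$, $$\left.\frac{d}{d\theta}\mathcal{P}(\mu_\theta)\right|_{\theta=0}=\frac12\int_0^1\zeta(r)\bigl(\alpha_\mu(r)-\alpha_{\mu_0}(r)\bigr)\bigl(\mathbb{E}u_{\mu_0}(r)^2-r\bigr)\,dr,$$ where the derivative at $\theta=0$ is understood as the right derivative. In addition, the following statements are equivalent: (i) $\mu_0$ is the Parisi measure. (ii) $\left.\frac{d}{d\theta}\mathcal{P}(\mu_\theta)\right|_{\theta=0}\ge 0$ for all $\mu\in\mathcal{M}$. (iii) $\left.\frac{d}{d\theta}\mathcal{P}(\mu_\theta)\right|_{\theta=0}\ge 0$ for all Dirac measures $\mu=\delta_q$ with $q\in[0,1]$.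
   Context: Let $\beta>0$, $h\in\mathbb{R}$, and let $(\gamma_p)_{p\ge2}$ be a nonnegative sequence, not identically zero, decaying fast enough (e.g. $\sum_{p\ge2}2^p\gamma_p^2<\infty$). Set $\xi(s)=\sum_{p\ge2}\beta^2\gamma_p^2s^p$ for $s\in[-1,1]$ and $\zeta=\xi''$. Let $\mathcal{M}$ be the set of all Borel probability measures on $[0,1]$; for $\mu\in\mathcal{M}$ let $\alpha_\mu(s)=\mu([0,s])$. For $\mu\in\mathcal{M}$, $\Phi_\mu$ denotes the (weak) solution on $[0,1]\times\mathbb{R}$ of the Parisi PDE $$\partial_s\Phi_\mu(s,x)=-\frac{\xi''(s)}{2}\Bigl(\partial_{xx}\Phi_\mu(s,x)+\alpha_\mu(s)(\partial_x\Phi_\mu(s,x))^2\Bigr),\qquad \Phi_\mu(1,x)=\log\cosh x.$$ (For $\mu$ with finitely many atoms it is explicit by the Hopf-Cole transformation: if $\alpha_\mu=m$ on $[a,b)$, then $\Phi_\mu(s,x)=\frac1m\log\mathbb{E}\exp m\Phi_\mu(b,x+z\sqrt{\xi'(b)-\xi'(s)})$ for $s\in[a,b)$ with $z$ standard Gaussian, read as $\mathbb{E}\Phi_\mu(b,\cdot)$ if $m=0$; for general $\mu$ it is the limit along atomic measures $\mu_n$ with $\int_0^1|\alpha_{\mu_n}-\alpha_\mu|ds\to0$.) The derivatives $\partial_x\Phi_\mu,\partial_{xx}\Phi_\mu$ exist and $|\partial_x\Phi_\mu|\le1$. The Parisi functional is $\mathcal{P}(\mu)=\log2+\Phi_\mu(0,h)-\frac12\int_0^1\alpha_\mu(s)s\xi''(s)\,ds$.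 It is strictly convex on $\mathcal{M}$ and has a unique minimizer, called the Parisi measure. Let $B$ be a standard Brownian motion on a filtered probability space satisfying the usual conditions. For $\mu_0\in\mathcal{M}$, $u_{\mu_0}(r)=\partial_x\Phi_{\mu_0}(r,X(r))$, $0\le r\le1$, where $X$ solves $X(r)=h+\int_0^r\alpha_{\mu_0}(w)\zeta(w)\partial_x\Phi_{\mu_0}(w,X(w))\,dw+\int_0^r\zeta(w)^{1/2}\,dB(w)$. *)

theory Defs
  imports "HOL-Probability.Probability"
begin

section \<open>The Parisi functional\<close>

text \<open>The two lowest coefficients of the mixture vanish, hence the index shift. Under the standing
  summability assumption the radius of convergence exceeds 1, so that derivatives of
  \<^term>\<open>mixture \<beta> \<gamma>\<close> at points of \<open>[-1,1]\<close> only involve the convergent series.\<close>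

definition mixture :: "real \<Rightarrow> (nat \<Rightarrow> real) \<Rightarrow> real \<Rightarrow> real" where
  "mixture \<beta> \<gamma> s = (\<Sum>p. \<beta>\<^sup>2 * (\<gamma> (p + 2))\<^sup>2 * s ^ (p + 2))"

definition prob_measures_01 :: "real measure set" where
  "prob_measures_01 = {\<mu>. prob_space \<mu> \<and> sets \<mu> = sets (restrict_space borel {0..1})}"

definition cdf01 :: "real measure \<Rightarrow> real \<Rightarrow> real" where
  "cdf01 \<mu> s = measure \<mu> {0..s}"

definition mix_measure :: "real \<Rightarrow> real measure \<Rightarrow> real measure \<Rightarrow> real measure" where
  "mix_measure \<theta> \<mu>\<^sub>0 \<mu> = measure_of (space \<mu>\<^sub>0) (sets \<mu>\<^sub>0)
     (\<lambda>A. ennreal (1 - \<theta>) * emeasure \<mu>\<^sub>0 A + ennreal \<theta> * emeasure \<mu> A)"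

lemma emeasure_mix_measure:
  assumes "sets \<mu> = sets \<mu>\<^sub>0" and "A \<in> sets \<mu>\<^sub>0"
  shows "emeasure (mix_measure \<theta> \<mu>\<^sub>0 \<mu>) A
           = ennreal (1 - \<theta>) * emeasure \<mu>\<^sub>0 A + ennreal \<theta> * emeasure \<mu> A"
proof (rule emeasure_measure_of[OF mix_measure_def])
  show "sets \<mu>\<^sub>0 \<subseteq> Pow (space \<mu>\<^sub>0)"
    by (rule sets.space_closed)
  show "A \<in> sets (mix_measure \<theta> \<mu>\<^sub>0 \<mu>)"
    using assms(2) by (simp add: mix_measure_def)
  show "positive (sets (mix_measure \<theta> \<mu>\<^sub>0 \<mu>))
          (\<lambda>A. ennreal (1 - \<theta>) * emeasure \<mu>\<^sub>0 A + ennreal \<theta> * emeasure \<mu> A)"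
    by (simp add: positive_def)
  show "countably_additive (sets (mix_measure \<theta> \<mu>\<^sub>0 \<mu>))
          (\<lambda>A. ennreal (1 - \<theta>) * emeasure \<mu>\<^sub>0 A + ennreal \<theta> * emeasure \<mu> A)"
    using assms(1)
    by (auto simp: countably_additive_def mix_measure_def suminf_add[symmetric]
        ennreal_suminf_cmult suminf_emeasure)
qed

lemma mix_measure_in:
  assumes "\<mu>\<^sub>0 \<in> prob_measures_01" "\<mu> \<in> prob_measures_01" "0 \<le> \<theta>" "\<theta> \<le> 1"
  shows "mix_measure \<theta> \<mu>\<^sub>0 \<mu> \<in> prob_measures_01"
proof -
  interpret m0: prob_space \<mu>\<^sub>0 using assms(1) by (simp add: prob_measures_01_def)
  interpret m: prob_space \<mu> using assms(2) by (simp add: prob_measures_01_def)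
  have eq: "sets \<mu> = sets \<mu>\<^sub>0" using assms by (simp add: prob_measures_01_def)
  have sp: "space \<mu> = space \<mu>\<^sub>0" using eq by (rule sets_eq_imp_space_eq)
  have "emeasure (mix_measure \<theta> \<mu>\<^sub>0 \<mu>) (space \<mu>\<^sub>0) = ennreal (1 - \<theta>) + ennreal \<theta>"
    using emeasure_mix_measure[OF eq sets.top] m0.emeasure_space_1 m.emeasure_space_1 sp by simp
  also have "\<dots> = 1" using assms by (simp flip: ennreal_plus)
  finally have "prob_space (mix_measure \<theta> \<mu>\<^sub>0 \<mu>)"
    by (intro prob_spaceI) (simp add: mix_measure_def)
  moreover have "sets (mix_measure \<theta> \<mu>\<^sub>0 \<mu>) = sets \<mu>\<^sub>0"
    by (simp add: mix_measure_def)
  ultimately show ?thesis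
    using assms(1) by (simp add: prob_measures_01_def)
qed

definition dirac01 :: "real \<Rightarrow> real measure" where
  "dirac01 q = return (restrict_space borel {0..1}) q"

lemma dirac01_in: "q \<in> {0..1} \<Longrightarrow> dirac01 q \<in> prob_measures_01"
  by (simp add: dirac01_def prob_measures_01_def prob_space_return space_restrict_space)

abbreviation dx :: "(real \<Rightarrow> real \<Rightarrow> real) \<Rightarrow> real \<Rightarrow> real \<Rightarrow> real" where
  "dx \<Phi> s x \<equiv> deriv (\<lambda>y. \<Phi> s y) x"

abbreviation dxx :: "(real \<Rightarrow> real \<Rightarrow> real) \<Rightarrow> real \<Rightarrow> real \<Rightarrow> real" where
  "dxx \<Phi> s x \<equiv> deriv (\<lambda>y. dx \<Phi> s y) x"

text \<open>Solutions of the Parisi PDE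
  \<open>\<partial>\<^sub>s \<Phi> = - \<xi>''/2 (\<partial>\<^sub>x\<^sub>x \<Phi> + \<alpha>\<^sub>\<mu> (\<partial>\<^sub>x \<Phi>)\<^sup>2)\<close>, \<open>\<Phi>(1,x) = log cosh x\<close>.
  The coefficient \<open>\<alpha>\<^sub>\<mu>\<close> may jump, so \<open>\<partial>\<^sub>s\<close> is a weak derivative: the equation is imposed in its
  integrated form, i.e. \<open>\<Phi>(\<cdot>,x)\<close> is absolutely continuous, satisfies the PDE almost
  everywhere and has the prescribed terminal value. The spatial derivatives are classical, and
  the bound \<open>\<bar>\<partial>\<^sub>x \<Phi>\<bar> \<le> 1\<close> excludes solutions of faster growth; by the maximum
  principle there is at most one such \<open>\<Phi>\<close> on \<open>[0,1] \<times> \<real>\<close>. Values outside this strip are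
  irrelevant.\<close>

definition parisi_pde_solution ::
    "(real \<Rightarrow> real) \<Rightarrow> real measure \<Rightarrow> (real \<Rightarrow> real \<Rightarrow> real) \<Rightarrow> bool" where
  "parisi_pde_solution \<xi> \<mu> \<Phi> \<longleftrightarrow>
     (\<forall>s\<in>{0..1}. \<forall>x. (\<lambda>y. \<Phi> s y) field_differentiable at x \<and>
                     (\<lambda>y. dx \<Phi> s y) field_differentiable at x \<and>
                     \<bar>dx \<Phi> s x\<bar> \<le> 1) \<and>
     continuous_on ({0..1} \<times> UNIV) (\<lambda>(s, x). \<Phi> s x) \<and>
     continuous_on ({0..1} \<times> UNIV) (\<lambda>(s, x). dx \<Phi> s x) \<and>
     continuous_on ({0..1} \<times> UNIV) (\<lambda>(s, x). dxx \<Phi> s x) \<and>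
     (\<forall>s\<in>{0..1}. \<forall>x. \<Phi> s x = ln (cosh x) +
        (LBINT r:{s..1}. deriv (deriv \<xi>) r / 2 * (dxx \<Phi> r x + cdf01 \<mu> r * (dx \<Phi> r x)\<^sup>2)))"

definition parisi_functional ::
    "(real \<Rightarrow> real) \<Rightarrow> real \<Rightarrow> (real measure \<Rightarrow> real \<Rightarrow> real \<Rightarrow> real) \<Rightarrow> real measure \<Rightarrow> real" where
  "parisi_functional \<xi> h \<Phi> \<mu> =
     ln 2 + \<Phi> \<mu> 0 h - 1 / 2 * (LBINT s:{0..1}. cdf01 \<mu> s * s * deriv (deriv \<xi>) s)"

text \<open>The minimizer is unique because the functional is strictly convex; uniqueness is a property
  of the functional and not part of the definition.\<close>

definition is_parisi_measure ::
    "(real \<Rightarrow> real) \<Rightarrow> real \<Rightarrow> (real measure \<Rightarrow> real \<Rightarrow> real \<Rightarrow> real) \<Rightarrow> real measure \<Rightarrow> bool" where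
  "is_parisi_measure \<xi> h \<Phi> \<mu> \<longleftrightarrow>
     is_arg_min (parisi_functional \<xi> h \<Phi>) (\<lambda>\<nu>. \<nu> \<in> prob_measures_01) \<mu>"

section \<open>Brownian motion and the stochastic differential equation\<close>

definition usual_filtered_space :: "'a measure \<Rightarrow> (real \<Rightarrow> 'a measure) \<Rightarrow> bool" where
  "usual_filtered_space P F \<longleftrightarrow>
     prob_space P \<and> complete_measure P \<and>
     (\<forall>t\<ge>0. subalgebra P (F t)) \<and>
     (\<forall>s\<ge>0. \<forall>t\<ge>s. sets (F s) \<subseteq> sets (F t)) \<and>
     null_sets P \<subseteq> sets (F 0) \<and>
     (\<forall>t\<ge>0. sets (F t) = (\<Inter>u\<in>{t<..}. sets (F u)))"

definition brownian_motion :: "'a measure \<Rightarrow> (real \<Rightarrow> 'a measure) \<Rightarrow> (real \<Rightarrow> 'a \<Rightarrow> real) \<Rightarrow> bool" where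
  "brownian_motion P F B \<longleftrightarrow>
     (\<forall>t\<ge>0. B t \<in> borel_measurable (F t)) \<and>
     (AE \<omega> in P. B 0 \<omega> = 0) \<and>
     (AE \<omega> in P. continuous_on {0..} (\<lambda>t. B t \<omega>)) \<and>
     (\<forall>s\<ge>0. \<forall>t>s.
        distributed P lborel (\<lambda>\<omega>. B t \<omega> - B s \<omega>) (normal_density 0 (sqrt (t - s))) \<and>
        prob_space.indep_set P (sets (F s))
          (sets (vimage_algebra (space P) (\<lambda>\<omega>. B t \<omega> - B s \<omega>) borel)))"

text \<open>The step function equal to \<open>c i\<close> on \<open>(t i, t (i+1)]\<close> for \<open>i < n\<close>, and its stochastic integral.\<close>

definition step_fun :: "nat \<Rightarrow> (nat \<Rightarrow> real) \<Rightarrow> (nat \<Rightarrow> real) \<Rightarrow> real \<Rightarrow> real" where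
  "step_fun n t c w = (\<Sum>i<n. c i * indicator {t i<..t (Suc i)} w)"

definition step_integral ::
    "(real \<Rightarrow> 'a \<Rightarrow> real) \<Rightarrow> nat \<Rightarrow> (nat \<Rightarrow> real) \<Rightarrow> (nat \<Rightarrow> real) \<Rightarrow> 'a \<Rightarrow> real" where
  "step_integral B n t c \<omega> = (\<Sum>i<n. c i * (B (t (Suc i)) \<omega> - B (t i) \<omega>))"

text \<open>\<open>Y = \<integral>\<^sub>0\<^sup>r f(w) dB(w)\<close> for a deterministic integrand \<open>f \<in> L\<^sup>2[0,r]\<close>: the stochastic integral
  is the \<open>L\<^sup>2(P)\<close>-limit of the integrals of step functions tending to \<open>f\<close> in \<open>L\<^sup>2[0,r]\<close>. By the
  isometry property it does not depend on the approximating sequence, up to null sets.\<close>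

definition has_stochastic_integral ::
    "'a measure \<Rightarrow> (real \<Rightarrow> 'a \<Rightarrow> real) \<Rightarrow> real \<Rightarrow> (real \<Rightarrow> real) \<Rightarrow> ('a \<Rightarrow> real) \<Rightarrow> bool" where
  "has_stochastic_integral P B r f Y \<longleftrightarrow>
     Y \<in> borel_measurable P \<and>
     (\<exists>n t c.
        (\<forall>k. mono_on {..n k} (t k) \<and> t k ` {..n k} \<subseteq> {0..r}) \<and>
        (\<lambda>k. \<integral>\<^sup>+w\<in>{0..r}. ennreal ((f w - step_fun (n k) (t k) (c k) w)\<^sup>2) \<partial>lborel) \<longlonglongrightarrow> 0 \<and>
        (\<lambda>k. \<integral>\<^sup>+\<omega>. ennreal ((Y \<omega> - step_integral B (n k) (t k) (c k) \<omega>)\<^sup>2) \<partial>P) \<longlonglongrightarrow> 0)"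

text \<open>\<open>X\<close> is a (continuous, adapted) solution on \<open>[0,1]\<close> of
  \<open>dX = b(r,X) dr + \<sigma>(r) dB\<close>, \<open>X(0) = h\<close>.\<close>

definition sde_solution ::
    "'a measure \<Rightarrow> (real \<Rightarrow> 'a measure) \<Rightarrow> (real \<Rightarrow> 'a \<Rightarrow> real) \<Rightarrow> real \<Rightarrow>
     (real \<Rightarrow> real \<Rightarrow> real) \<Rightarrow> (real \<Rightarrow> real) \<Rightarrow> (real \<Rightarrow> 'a \<Rightarrow> real) \<Rightarrow> bool" where
  "sde_solution P F B h b \<sigma> X \<longleftrightarrow>
     (\<forall>r\<in>{0..1}. X r \<in> borel_measurable (F r)) \<and>
     (AE \<omega> in P. continuous_on {0..1} (\<lambda>r. X r \<omega>)) \<and>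
     (\<exists>I. (\<forall>r\<in>{0..1}. has_stochastic_integral P B r \<sigma> (I r)) \<and>
          (AE \<omega> in P. \<forall>r\<in>{0..1}. X r \<omega> = h + (LBINT w:{0..r}. b w (X w \<omega>)) + I r \<omega>))"

end

theory Submission
  imports Defs "HOL-Real_Asymp.Real_Asymp"
begin

text \<open>Testing the PDE against the heat kernel gives Duhamel's formula, and from it both an Ito-type
  formula for \<open>\<Phi>\<^sub>\<mu>(r, Y\<^sub>r)\<close> along processes \<open>Y\<close> whose drift is adapted and bounded (telescoping over
  a partition: the noise increment is an independent Gaussian, the drift increment is handled
  pathwise) and the stability of \<open>\<partial>\<^sub>x \<Phi>\<^sub>\<mu>\<close> in \<open>\<alpha>\<^sub>\<mu>\<close>. Applied along the given \<open>X\<close>, the formula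
  expresses \<open>\<Phi>\<^sub>\<mu>(0,h) - \<Phi>\<^sub>\<mu>\<^sub>0(0,h)\<close> as the claimed first-order term plus an error that is quadratic
  in \<open>\<theta>\<close> along \<open>\<mu>\<^sub>\<theta>\<close>. Applied along the state driven by the optimal control of \<open>\<mu>\<^sub>0\<close>
  with gain \<open>\<alpha>\<^sub>\<mu>\<close>, it shows, by convexity of \<open>log cosh\<close>, that the first-order term is a global
  lower bound, so that stationarity implies minimality. Finally the first-order term is affine
  in \<open>\<mu>\<close>, hence an average of its values at Dirac measures.\<close>

section \<open>Power series and Lebesgue integration preliminaries\<close>

text \<open>What shapes the argument is the available regularity: \<open>\<Phi>\<close> is only
  absolutely continuous in time, no growth bound on \<open>\<Phi>\<^sub>2\<close> in space is at
  hand, and stochastic integrals are defined for deterministic integrands only. Identities are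
  therefore established after taking expectations, with \<open>\<Phi>\<^sub>2\<close> hidden in
  Gaussian averages. For a control \<open>V\<close> with gain \<open>\<zeta> \<alpha>\<close> the
  resulting formula contains \<open>\<zeta> \<alpha> / 2\<close> times
  \<open>2 V \<Phi>\<^sub>1 - \<Phi>\<^sub>1^2\<close>, which equals
  \<open>V^2 - (V - \<Phi>\<^sub>1)^2\<close>. This square is behind both main estimates. Along
  \<open>X\<close>, whose gain belongs to \<open>\<mu>\<^sub>0\<close>, the square is of second
  order since gradients are Lipschitz in \<open>\<theta>\<close>, and so is the cost of replacing
  \<open>\<Phi>\<^sub>1^2\<close> by \<open>V^2\<close> against
  \<open>\<alpha> - \<alpha>\<^sub>0\<close>. Along the state whose gain is matched to
  \<open>\<alpha>\<close>, the square has a favourable sign for every \<open>\<mu>\<close>, near or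
  far, so that a subgradient inequality results. The rate 64 in the exponential weight is tuned so
  that an arctangent integral stays below 1/2.\<close>

lemma mixture_derivatives:
  fixes \<beta> :: real and \<gamma> :: "nat \<Rightarrow> real"
  assumes "summable (\<lambda>p. 2 ^ p * (\<gamma> p)\<^sup>2)"
  defines "\<xi> \<equiv> mixture \<beta> \<gamma>"
  shows mixture_deriv2: "\<bar>x\<bar> < 2 \<Longrightarrow> (deriv \<xi> has_real_derivative deriv (deriv \<xi>) x) (at x)"
    and mixture_deriv2_continuous: "continuous_on {-1..1} (deriv (deriv \<xi>))"
    and mixture_deriv2_pos: "\<beta> > 0 \<Longrightarrow> \<exists>p\<ge>2. \<gamma> p \<noteq> 0 \<Longrightarrow> 0 < x \<Longrightarrow> x < 2 \<Longrightarrow> 0 < deriv (deriv \<xi>) x"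
proof -
  \<comment> \<open>Restoring the two vanishing coefficients gives a full power series, to which
    termwise differentiation applies. The weight \<open>2 ^ p\<close> in the hypothesis yields
    convergence on (-2,2), so the endpoints of [-1,1] are interior points for all
    derivatives.\<close>
  define c where "c p = (if p < 2 then 0 else \<beta>\<^sup>2 * (\<gamma> p)\<^sup>2)" for p
  have "summable (\<lambda>p. \<beta>\<^sup>2 * (2 ^ p * (\<gamma> p)\<^sup>2))" using assms(1) by (rule summable_mult)
  then have s2: "summable (\<lambda>p. c p * 2 ^ p)"
    by (rule summable_comparison_test_ev[rotated]) (auto simp: c_def mult_ac)
  have sm: "summable (\<lambda>p. c p * x ^ p)" if "norm x < 2" for x :: real
    using powser_inside[OF s2, of x] that by simp
  have sm1: "summable (\<lambda>p. diffs c p * x ^ p)" if "norm x < 2" for x :: real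
    by (rule termdiff_converges[OF that sm])
  have sm2: "summable (\<lambda>p. diffs (diffs c) p * x ^ p)" if "norm x < 2" for x :: real
    by (rule termdiff_converges[OF that sm1])
  have xi_eq: "\<xi> x = (\<Sum>p. c p * x ^ p)" if "norm x < 2" for x
  proof -
    have "(\<Sum>p. c p * x ^ p) = (\<Sum>p. c (p+2) * x ^ (p+2)) + (\<Sum>p<2. c p * x ^ p)"
      by (rule suminf_split_initial_segment) (rule sm[OF that])
    also have "(\<Sum>p<2. c p * x ^ p) = 0" by (simp add: c_def)
    finally show ?thesis by (simp add: \<xi>_def mixture_def c_def)
  qed
  have d1: "(\<xi> has_real_derivative (\<Sum>p. diffs c p * x ^ p)) (at x)" if "norm x < 2" for x
  proof (rule has_field_derivative_transform_within_open)
    show "((\<lambda>x. \<Sum>p. c p * x ^ p) has_real_derivative (\<Sum>p. diffs c p * x ^ p)) (at x)"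
      by (rule termdiffs_strong'[OF sm that])
    show "open {-2<..<2::real}" "x \<in> {-2<..<2}" using that by auto
    show "(\<Sum>p. c p * y ^ p) = \<xi> y" if "y \<in> {-2<..<2}" for y using xi_eq[of y] that by auto
  qed
  have dxi: "deriv \<xi> x = (\<Sum>p. diffs c p * x ^ p)" if "norm x < 2" for x
    by (rule DERIV_imp_deriv[OF d1[OF that]])
  have d2: "(deriv \<xi> has_real_derivative (\<Sum>p. diffs (diffs c) p * x ^ p)) (at x)" if "norm x < 2" for x
  proof (rule has_field_derivative_transform_within_open)
    show "((\<lambda>x. \<Sum>p. diffs c p * x ^ p) has_real_derivative (\<Sum>p. diffs (diffs c) p * x ^ p)) (at x)"
      by (rule termdiffs_strong'[OF sm1 that])
    show "open {-2<..<2::real}" "x \<in> {-2<..<2}" using that by auto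
    show "(\<Sum>p. diffs c p * y ^ p) = deriv \<xi> y" if "y \<in> {-2<..<2}" for y using dxi[of y] that by auto
  qed
  have ddxi: "deriv (deriv \<xi>) x = (\<Sum>p. diffs (diffs c) p * x ^ p)" if "norm x < 2" for x
    by (rule DERIV_imp_deriv[OF d2[OF that]])
  show "(deriv \<xi> has_real_derivative deriv (deriv \<xi>) x) (at x)" if "\<bar>x\<bar> < 2"
    using d2[of x] ddxi[of x] that by simp
  \<comment> \<open>Continuity of the second derivative follows from one more termwise
    differentiation.\<close>
  have "((\<lambda>x. \<Sum>p. diffs (diffs c) p * x ^ p) has_real_derivative
      (\<Sum>p. diffs (diffs (diffs c)) p * x ^ p)) (at x)" if "norm x < 2" for x
    by (rule termdiffs_strong'[OF sm2 that])
  then have "isCont (\<lambda>x. \<Sum>p. diffs (diffs c) p * x ^ p) x" if "norm x < 2" for x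
    using DERIV_isCont that by blast
  then have "continuous_on {-1..1} (\<lambda>x. \<Sum>p. diffs (diffs c) p * x ^ p)"
    by (intro continuous_at_imp_continuous_on ballI) auto
  then show "continuous_on {-1..1} (deriv (deriv \<xi>))"
    by (rule continuous_on_cong[THEN iffD1, rotated -1]) (auto simp: ddxi)
  show "0 < deriv (deriv \<xi>) x" if b: "\<beta> > 0" and p: "\<exists>p\<ge>2. \<gamma> p \<noteq> 0" and x: "0 < x" "x < 2"
  proof -
    obtain p where p: "p \<ge> 2" "\<gamma> p \<noteq> 0" using p by blast
    have nn: "0 \<le> diffs (diffs c) n" for n by (simp add: diffs_def c_def)
    \<comment> \<open>Each \<open>diffs\<close> lowers the index by one, so the positive coefficient
      at \<open>p\<close> contributes to the second derivative at \<open>p - 2\<close>.\<close>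
    have "0 < diffs (diffs c) (p - 2)"
    proof -
      obtain n where n: "p = Suc (Suc n)" using p(1) by (metis le_Suc_ex add_2_eq_Suc)
      have "0 < \<beta>\<^sup>2 * (\<gamma> (Suc (Suc n)))\<^sup>2" using p b n by simp
      then show ?thesis by (simp add: n diffs_def c_def)
    qed
    then have "0 < (\<Sum>n. diffs (diffs c) n * x ^ n)"
      using sm2[of x] x nn by (intro suminf_pos2[where i="p - 2"]) auto
    then show ?thesis using ddxi[of x] x by simp
  qed
qed

lemma continuous_abs_bounded:
  fixes f :: "'a::topological_space \<Rightarrow> real"
  assumes "compact S" "continuous_on S f"
  obtains B where "\<And>x. x \<in> S \<Longrightarrow> \<bar>f x\<bar> \<le> B"
proof -
  have "bounded (f ` S)"
    using compact_continuous_image[OF assms(2,1)] by (rule compact_imp_bounded)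
  then obtain B where "\<forall>y\<in>f ` S. norm y \<le> B" unfolding bounded_iff by blast
  then show ?thesis using that by auto
qed

lemma set_integrable_bounded_interval:
  fixes f :: "real \<Rightarrow> real"
  assumes "f \<in> borel_measurable borel" "\<And>x. x \<in> {a..b} \<Longrightarrow> \<bar>f x\<bar> \<le> B"
  shows "set_integrable lborel {a..b} f"
proof -
  have "set_integrable lborel {a..b} (\<lambda>x. B)"
    unfolding set_integrable_def by (intro integrable_scaleR_left integrable_real_indicator) (auto simp: emeasure_lborel_Icc_eq)
  then show ?thesis
    by (rule set_integrable_bound) (use assms in \<open>auto simp: set_borel_measurable_def intro!: AE_I2 intro: order_trans[OF _ abs_ge_self]\<close>)
qed

text \<open>Holds without integrability: a non-integrable function has integral 0 by convention, and
  the bound is nonnegative. This spares side conditions below, and for \<open>a = b\<close> it shows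
  that the integral vanishes.\<close>

lemma set_integral_abs_le:
  fixes f :: "real \<Rightarrow> real"
  assumes "a \<le> b" and B: "\<And>x. x \<in> {a..b} \<Longrightarrow> \<bar>f x\<bar> \<le> B"
  shows "\<bar>LBINT x:{a..b}. f x\<bar> \<le> B * (b - a)"
proof (cases "set_integrable lborel {a..b} f")
  case True
  have "\<bar>LBINT x:{a..b}. f x\<bar> \<le> (LBINT x:{a..b}. B)"
    unfolding set_lebesgue_integral_def real_scaleR_def
    by (rule integral_abs_bound[THEN order_trans], rule integral_mono)
      (use True set_integrable_bounded_interval[of "\<lambda>_. B" a b "\<bar>B\<bar>"] B assms(1) in \<open>auto simp: set_integrable_def indicator_def\<close>)
  then show ?thesis using assms(1) by (simp add: set_lebesgue_integral_def mult.commute)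
next
  case False
  moreover have "0 \<le> B * (b - a)" using B[of a] assms(1) by auto
  ultimately show ?thesis by (simp add: set_lebesgue_integral_def set_integrable_def not_integrable_integral_eq)
qed

lemma set_lborel_Fubini:
  fixes f :: "real \<Rightarrow> real \<Rightarrow> real"
  assumes [measurable]: "case_prod f \<in> borel_measurable (borel \<Otimes>\<^sub>M borel)"
    and bd: "\<And>x y. x \<in> {a..b} \<Longrightarrow> y \<in> {c..d} \<Longrightarrow> \<bar>f x y\<bar> \<le> B"
  shows "(LBINT x:{a..b}. LBINT y:{c..d}. f x y) = (LBINT y:{c..d}. LBINT x:{a..b}. f x y)"
proof -
  let ?g = "\<lambda>x y. indicator {a..b} x * indicator {c..d} y * f x y"
  have "integrable (lborel \<Otimes>\<^sub>M lborel) (case_prod ?g)"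
  proof (rule Bochner_Integration.integrable_bound)
    have "integrable (lborel \<Otimes>\<^sub>M lborel) (indicat_real ({a..b} \<times> {c..d}))"
      by (rule integrable_real_indicator)
        (auto simp: lborel.emeasure_pair_measure_Times ennreal_mult_less_top emeasure_lborel_Icc_eq)
    then show "integrable (lborel \<Otimes>\<^sub>M lborel) (\<lambda>p. B * indicat_real ({a..b} \<times> {c..d}) p)"
      by (rule integrable_mult_right)
    have [measurable]: "case_prod f \<in> borel_measurable (lborel \<Otimes>\<^sub>M lborel)"
      using assms(1) by (simp add: measurable_def space_pair_measure sets_pair_measure)
    show "case_prod ?g \<in> borel_measurable (lborel \<Otimes>\<^sub>M lborel)" by measurable
    show "AE p in lborel \<Otimes>\<^sub>M lborel. norm (case_prod ?g p) \<le> norm (B * indicat_real ({a..b} \<times> {c..d}) p)"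
      by (rule AE_I2) (use bd in \<open>force simp: indicator_def split: if_splits\<close>)
  qed
  then have "(\<integral>y. \<integral>x. ?g x y \<partial>lborel \<partial>lborel) = (\<integral>x. \<integral>y. ?g x y \<partial>lborel \<partial>lborel)"
    by (rule lborel_pair.Fubini_integral)
  moreover have "(\<integral>x. \<integral>y. ?g x y \<partial>lborel \<partial>lborel) = (LBINT x:{a..b}. LBINT y:{c..d}. f x y)"
    by (simp add: set_lebesgue_integral_def mult.assoc)
  moreover have "(\<integral>y. \<integral>x. ?g x y \<partial>lborel \<partial>lborel) = (LBINT y:{c..d}. LBINT x:{a..b}. f x y)"
    by (simp add: set_lebesgue_integral_def mult.assoc mult.left_commute flip: Bochner_Integration.integral_mult_right_zero)
  ultimately show ?thesis by simp
qed

lemma LBINT_FTC: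
  fixes f f' :: "real \<Rightarrow> real"
  assumes "a \<le> b" "\<And>x. x \<in> {a..b} \<Longrightarrow> (f has_real_derivative f' x) (at x within {a..b})"
    and "continuous_on {a..b} f'"
  shows "(LBINT x:{a..b}. f' x) = f b - f a"
  unfolding set_lebesgue_integral_def
  using integral_FTC_Icc[of a b f f'] assms by (simp add: has_real_derivative_iff_has_vector_derivative)

text \<open>Integration by parts when one factor is only absolutely continuous.\<close>

lemma LBINT_product_rule:
  fixes k u v v' :: "real \<Rightarrow> real"
  assumes st: "s \<le> t" and k[measurable]: "k \<in> borel_measurable borel"
    and B: "\<And>r. r \<in> {s..t} \<Longrightarrow> \<bar>k r\<bar> \<le> B"
    and v': "continuous_on {s..t} v'"
    and v: "\<And>r. r \<in> {s..t} \<Longrightarrow> (v has_real_derivative v' r) (at r within {s..t})"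
    and u: "\<And>r. r \<in> {s..t} \<Longrightarrow> u r = u t + (LBINT q:{r..t}. k q)"
  shows "(LBINT r:{s..t}. u r * v' r) = u t * v t - u s * v s + (LBINT r:{s..t}. k r * v r)"
proof -
  have [measurable]: "(\<lambda>r. indicator {s..t} r * v' r) \<in> borel_measurable borel"
    using borel_measurable_continuous_on_indicator[OF _ v'] by simp
  have cv: "continuous_on {s..t} v"
    using v by (intro continuous_on_eq_continuous_within[THEN iffD2] ballI) (rule DERIV_continuous)
  have [measurable]: "(\<lambda>r. indicator {s..t} r * v r) \<in> borel_measurable borel"
    using borel_measurable_continuous_on_indicator[OF _ cv] by simp
  obtain C where C: "\<And>r. r \<in> {s..t} \<Longrightarrow> \<bar>v' r\<bar> \<le> C"
    using continuous_abs_bounded[OF compact_Icc v'] by blast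
  obtain C' where C': "\<And>r. r \<in> {s..t} \<Longrightarrow> \<bar>v r\<bar> \<le> C'"
    using continuous_abs_bounded[OF compact_Icc cv] by blast
  have C0: "0 \<le> C" using C[of s] st by (auto intro: order_trans[OF abs_ge_zero])
  \<comment> \<open>The product \<open>v' r * k q\<close> on the triangle
    \<open>s \<le> r \<le> q \<le> t\<close>, extended by 0 to the square. Integrating in
    \<open>q\<close> first gives the increments of \<open>u\<close>, integrating in \<open>r\<close>
    first gives those of \<open>v\<close>; the indicator only makes \<open>v'\<close> globally
    measurable.\<close>
  define f where "f r q = (if s \<le> r \<and> r \<le> q \<and> q \<le> t then (indicator {s..t} r * v' r) * k q else 0)" for r q
  have f_meas: "case_prod f \<in> borel_measurable (borel \<Otimes>\<^sub>M borel)"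
    unfolding f_def by measurable
  have f_bd: "\<bar>f r q\<bar> \<le> C * B" if "r \<in> {s..t}" "q \<in> {s..t}" for r q
    using C[of r] B[of q] that C0 by (auto simp: f_def abs_mult intro!: mult_mono)
  have int_v': "set_integrable lborel {s..t} v'" by (rule borel_integrable_atLeastAtMost'[OF v'])
  have 1: "(LBINT r:{s..t}. u r * v' r) = (LBINT r:{s..t}. u t * v' r + (LBINT q:{s..t}. f r q))"
  proof (rule set_lebesgue_integral_cong)
    show "\<forall>r. r \<in> {s..t} \<longrightarrow> u r * v' r = u t * v' r + (LBINT q:{s..t}. f r q)"
    proof (intro allI impI)
      fix r assume r: "r \<in> {s..t}"
      have "(LBINT q:{s..t}. f r q) = (LBINT q:{r..t}. v' r * k q)"
        unfolding set_lebesgue_integral_def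
        by (rule Bochner_Integration.integral_cong) (use r in \<open>auto simp: f_def indicator_def\<close>)
      then show "u r * v' r = u t * v' r + (LBINT q:{s..t}. f r q)"
        using u[OF r] by (simp add: algebra_simps)
    qed
  qed simp
  have int_f: "set_integrable lborel {s..t} (\<lambda>r. LBINT q:{s..t}. f r q)"
  proof (rule set_integrable_bounded_interval)
    show "(\<lambda>r. LBINT q:{s..t}. f r q) \<in> borel_measurable borel"
      unfolding set_lebesgue_integral_def using f_meas by measurable
    show "\<bar>LBINT q:{s..t}. f r q\<bar> \<le> (t - s) * (C * B)" if r: "r \<in> {s..t}" for r
      using set_integral_abs_le[OF st f_bd[OF r]] by (simp add: mult_ac)
  qed
  have "(LBINT r:{s..t}. u t * v' r + (LBINT q:{s..t}. f r q))
      = (LBINT r:{s..t}. u t * v' r) + (LBINT r:{s..t}. LBINT q:{s..t}. f r q)"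
    by (rule set_integral_add) (use int_v' int_f in auto)
  also have "(LBINT r:{s..t}. u t * v' r) = u t * (v t - v s)"
    using LBINT_FTC[OF st v v'] by simp
  also have "(LBINT r:{s..t}. LBINT q:{s..t}. f r q) = (LBINT q:{s..t}. LBINT r:{s..t}. f r q)"
    by (rule set_lborel_Fubini[OF f_meas f_bd])
  also have "\<dots> = (LBINT q:{s..t}. k q * v q - v s * k q)"
  proof (rule set_lebesgue_integral_cong)
    show "\<forall>q. q \<in> {s..t} \<longrightarrow> (LBINT r:{s..t}. f r q) = k q * v q - v s * k q"
    proof (intro allI impI)
      fix q assume q: "q \<in> {s..t}"
      have "(LBINT r:{s..t}. f r q) = (LBINT r:{s..q}. k q * v' r)"
        unfolding set_lebesgue_integral_def
        by (rule Bochner_Integration.integral_cong) (use q in \<open>auto simp: f_def indicator_def\<close>)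
      also have "\<dots> = k q * (v q - v s)"
      proof -
        have "(LBINT r:{s..q}. v' r) = v q - v s"
          using q by (intro LBINT_FTC DERIV_subset[OF v] continuous_on_subset[OF v']) auto
        then show ?thesis by simp
      qed
      finally show "(LBINT r:{s..t}. f r q) = k q * v q - v s * k q" by (simp add: algebra_simps)
    qed
  qed simp
  also have "\<dots> = (LBINT q:{s..t}. k q * v q) - v s * (LBINT q:{s..t}. k q)"
  proof -
    have "set_integrable lborel {s..t} (\<lambda>q. k q * (indicator {s..t} q * v q))"
      by (rule set_integrable_bounded_interval[where B="B * C'"])
        (use B C' in \<open>auto simp: abs_mult intro!: mult_mono intro: order_trans[OF abs_ge_zero]\<close>)
    then have "set_integrable lborel {s..t} (\<lambda>q. k q * v q)"
      by (rule set_integrable_cong[THEN iffD1, rotated -1]) auto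
    moreover have "set_integrable lborel {s..t} k" by (rule set_integrable_bounded_interval[OF k B])
    ultimately show ?thesis by (subst set_integral_diff) auto
  qed
  finally show ?thesis using 1 u[of s] st by (simp add: algebra_simps)
qed

text \<open>Tailored to integrands with a rough factor in time only: \<open>m\<close> will be
  \<open>\<zeta> \<alpha> / 2\<close>, where \<open>\<alpha>\<close> may jump, and \<open>g\<close>
  a product of continuous functions of time and space. The integrability facts are needed to split
  sums afterwards.\<close>

lemma set_lborel_Fubini_continuous:
  fixes m :: "real \<Rightarrow> real" and g :: "real \<Rightarrow> real \<Rightarrow> real"
  assumes m[measurable]: "m \<in> borel_measurable borel" and B: "\<And>x. x \<in> {a..b} \<Longrightarrow> \<bar>m x\<bar> \<le> B"
    and ab: "a \<le> b" and cd: "c \<le> d"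
    and g: "continuous_on ({a..b} \<times> {c..d}) (case_prod g)"
  shows "(LBINT y:{c..d}. LBINT x:{a..b}. m x * g x y) = (LBINT x:{a..b}. m x * (LBINT y:{c..d}. g x y))"
    and "set_integrable lborel {a..b} (\<lambda>x. m x * (LBINT y:{c..d}. g x y))"
    and "set_integrable lborel {c..d} (\<lambda>y. LBINT x:{a..b}. m x * g x y)"
proof -
  obtain G where G: "\<And>p. p \<in> {a..b} \<times> {c..d} \<Longrightarrow> \<bar>case_prod g p\<bar> \<le> G"
    using continuous_abs_bounded[OF compact_Times[OF compact_Icc compact_Icc] g] by blast
  \<comment> \<open>Cutting off outside the rectangle makes a merely locally continuous function
    globally Borel without changing any of the integrals.\<close>
  define f where "f x y = indicator ({a..b} \<times> {c..d}) (x, y) * g x y" for x y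
  have "(\<lambda>p. indicator ({a..b} \<times> {c..d}) p *\<^sub>R case_prod g p) \<in> borel_measurable borel"
    by (rule borel_measurable_continuous_on_indicator[OF _ g]) (auto simp: borel_Times)
  then have f[measurable]: "case_prod f \<in> borel_measurable (borel \<Otimes>\<^sub>M borel)"
    by (simp add: f_def borel_prod split_beta')
  have f_eq: "f x y = g x y" if "x \<in> {a..b}" "y \<in> {c..d}" for x y
    using that by (simp add: f_def)
  have f_bd: "\<bar>f x y\<bar> \<le> G" if "x \<in> {a..b}" "y \<in> {c..d}" for x y
    using G[of "(x,y)"] that by (simp add: f_eq)
  have G0: "0 \<le> G" using f_bd[of a c] ab cd by auto
  have B0: "0 \<le> B" using B[of a] ab by auto
  have mf_bd: "\<bar>m x * f x y\<bar> \<le> B * G" if "x \<in> {a..b}" "y \<in> {c..d}" for x y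
    using B[OF that(1)] f_bd[OF that] B0 by (auto simp: abs_mult intro!: mult_mono)
  have mf: "(\<lambda>(x, y). m x * f x y) \<in> borel_measurable (borel \<Otimes>\<^sub>M borel)" by measurable
  have inner: "(LBINT y:{c..d}. f x y) = (LBINT y:{c..d}. g x y)" if "x \<in> {a..b}" for x
    by (rule set_lebesgue_integral_cong) (use that in \<open>auto simp: f_eq\<close>)
  have inner': "(LBINT x:{a..b}. m x * f x y) = (LBINT x:{a..b}. m x * g x y)" if "y \<in> {c..d}" for y
    by (rule set_lebesgue_integral_cong) (use that in \<open>auto simp: f_eq\<close>)
  have "(LBINT y:{c..d}. LBINT x:{a..b}. m x * g x y) = (LBINT y:{c..d}. LBINT x:{a..b}. m x * f x y)"
    by (rule set_lebesgue_integral_cong) (use inner' in auto)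
  also have "\<dots> = (LBINT x:{a..b}. LBINT y:{c..d}. m x * f x y)"
    by (rule set_lborel_Fubini[OF mf mf_bd, symmetric])
  also have "\<dots> = (LBINT x:{a..b}. m x * (LBINT y:{c..d}. g x y))"
    by (rule set_lebesgue_integral_cong) (use inner in auto)
  finally show "(LBINT y:{c..d}. LBINT x:{a..b}. m x * g x y) = (LBINT x:{a..b}. m x * (LBINT y:{c..d}. g x y))" .
  have "set_integrable lborel {a..b} (\<lambda>x. m x * (LBINT y:{c..d}. f x y))"
  proof (rule set_integrable_bounded_interval)
    show "(\<lambda>x. m x * (LBINT y:{c..d}. f x y)) \<in> borel_measurable borel"
      unfolding set_lebesgue_integral_def by measurable
    show "\<bar>m x * (LBINT y:{c..d}. f x y)\<bar> \<le> B * (G * (d - c))" if "x \<in> {a..b}" for x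
      unfolding abs_mult using B[OF that] B0 by (intro mult_mono set_integral_abs_le f_bd that cd) auto
  qed
  then show "set_integrable lborel {a..b} (\<lambda>x. m x * (LBINT y:{c..d}. g x y))"
    by (rule set_integrable_cong[THEN iffD1, rotated -1]) (use inner in auto)
  have "set_integrable lborel {c..d} (\<lambda>y. LBINT x:{a..b}. m x * f x y)"
  proof (rule set_integrable_bounded_interval)
    show "(\<lambda>y. LBINT x:{a..b}. m x * f x y) \<in> borel_measurable borel"
      unfolding set_lebesgue_integral_def by measurable
    show "\<bar>LBINT x:{a..b}. m x * f x y\<bar> \<le> B * G * (b - a)" if "y \<in> {c..d}" for y
      by (intro set_integral_abs_le mf_bd that ab)
  qed
  then show "set_integrable lborel {c..d} (\<lambda>y. LBINT x:{a..b}. m x * g x y)"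
    by (rule set_integrable_cong[THEN iffD1, rotated -1]) (use inner' in auto)
qed

section \<open>Gaussian averages and their smoothing effect\<close>

text \<open>The heat semigroup, parametrized by variance. Writing it through a standard normal
  variable covers \<open>V = 0\<close>, where it is the identity.\<close>

definition heat :: "real \<Rightarrow> (real \<Rightarrow> real) \<Rightarrow> real \<Rightarrow> real" where
  "heat V f x = (LINT z|std_normal_distribution. f (x + sqrt V * z))"

lemma heat_lborel:
  assumes [measurable]: "f \<in> borel_measurable borel"
  shows "heat V f x = (LBINT z. std_normal_density z * f (x + sqrt V * z))"
  unfolding heat_def by (subst integral_density) auto

lemma heat_normal_density:
  assumes [measurable]: "f \<in> borel_measurable borel" and V: "V > 0"
  shows "heat V f x = (LBINT y. normal_density 0 (sqrt V) (y - x) * f y)"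
proof -
  have "(LBINT y. normal_density 0 (sqrt V) (y - x) * f y)
      = \<bar>sqrt V\<bar> *\<^sub>R (LBINT z. normal_density 0 (sqrt V) (x + sqrt V * z - x) * f (x + sqrt V * z))"
    using V by (intro lborel_integral_real_affine) simp
  also have "\<dots> = (LBINT z. sqrt V * (normal_density 0 (sqrt V) (sqrt V * z) * f (x + sqrt V * z)))"
    using V by simp
  also have "\<dots> = heat V f x"
    unfolding heat_lborel[OF assms(1)]
  proof (rule Bochner_Integration.integral_cong)
    fix z
    have "sqrt V * normal_density 0 (sqrt V) (sqrt V * z) = std_normal_density z"
      using V by (simp add: normal_density_def real_sqrt_mult power_mult_distrib)
    then show "sqrt V * (normal_density 0 (sqrt V) (sqrt V * z) * f (x + sqrt V * z)) =
         std_normal_density z * f (x + sqrt V * z)" by (simp flip: mult.assoc)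
  qed simp
  finally show ?thesis by simp
qed

interpretation std_normal: real_distribution std_normal_distribution
  by (rule real_dist_normal_dist)

lemma integrable_std_normal_abs: "integrable std_normal_distribution (\<lambda>z. \<bar>z\<bar>)"
  using std_normal_moment_abs_odd[of 0] by (subst integrable_density) (auto simp: has_bochner_integral_iff)

lemma heat_0 [simp]: "heat 0 f x = f x"
  using std_normal.prob_space by (simp add: heat_def)

lemma heat_abs_le:
  assumes "\<And>y. \<bar>f y\<bar> \<le> G"
  shows "\<bar>heat V f x\<bar> \<le> G"
proof (cases "integrable std_normal_distribution (\<lambda>z. f (x + sqrt V * z))")
  case True
  have "\<bar>heat V f x\<bar> \<le> (LINT z|std_normal_distribution. \<bar>f (x + sqrt V * z)\<bar>)"
    unfolding heat_def by (rule integral_abs_bound)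
  also have "\<dots> \<le> (LINT z|std_normal_distribution. G)"
    using True assms by (intro integral_mono) auto
  finally show ?thesis using std_normal.prob_space by simp
next
  case False
  moreover have "0 \<le> G" using assms[of 0] by simp
  ultimately show ?thesis by (simp add: heat_def not_integrable_integral_eq)
qed

text \<open>A shift by \<open>e\<close> moves a smooth density in L1 by at most
  \<open>\<bar>e\<bar>\<close> times the L1 norm of its derivative. For the standard normal this
  norm is the first absolute moment \<open>sqrt (2 / pi)\<close>, which is below 1. The difference
  is written as an integral of the derivative along the segment, and Tonelli exchanges the
  integrals.\<close>

lemma std_normal_density_shift_L1:
  "(\<integral>\<^sup>+z. ennreal \<bar>std_normal_density (z - e) - std_normal_density z\<bar> \<partial>lborel) \<le> ennreal \<bar>e\<bar>"
proof -
  define \<phi>' where "\<phi>' y = - y * std_normal_density y" for y :: real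
  have d: "(std_normal_density has_real_derivative \<phi>' y) (at y)" for y
    unfolding normal_density_def \<phi>'_def
    by (auto intro!: derivative_eq_intros simp: power2_eq_square field_simps)
  have c: "continuous_on UNIV \<phi>'"
    unfolding \<phi>'_def using d
    by (intro continuous_intros continuous_at_imp_continuous_on ballI) (blast intro: DERIV_isCont)
  have [measurable]: "\<phi>' \<in> borel_measurable borel" by (rule borel_measurable_continuous_onI[OF c])
  have shift: "(\<integral>\<^sup>+z. ennreal \<bar>\<phi>' (z - w)\<bar> \<partial>lborel) \<le> 1" for w
  proof -
    have "(\<integral>\<^sup>+z. ennreal \<bar>\<phi>' (z - w)\<bar> \<partial>lborel) = (\<integral>\<^sup>+z. ennreal \<bar>\<phi>' z\<bar> \<partial>lborel)"
      using nn_integral_real_affine[of "\<lambda>z. ennreal \<bar>\<phi>' z\<bar>" 1 "- w"] by simp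
    also have "\<dots> = (\<integral>\<^sup>+z. ennreal (std_normal_density z * \<bar>z\<bar> ^ (2*0+1)) \<partial>lborel)"
      by (intro nn_integral_cong) (simp add: \<phi>'_def abs_mult mult.commute)
    also have "\<dots> = ennreal (sqrt (2 / pi) * 2 ^ 0 * fact 0)"
      by (subst nn_integral_eq_integral) (use std_normal_moment_abs_odd[of 0] in \<open>auto simp: has_bochner_integral_iff\<close>)
    also have "\<dots> \<le> 1"
      using pi_gt3 by (simp add: ennreal_le_1 field_simps)
    finally show ?thesis .
  qed
  have ptw: "ennreal \<bar>std_normal_density (z - e) - std_normal_density z\<bar>
      \<le> (\<integral>\<^sup>+u\<in>{0..1}. ennreal (\<bar>e\<bar> * \<bar>\<phi>' (z - u * e)\<bar>) \<partial>lborel)" for z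
  proof -
    let ?f = "\<lambda>u. \<phi>' (z - u * e) * (- e)"
    have cf: "continuous_on {0..1} ?f"
      by (intro continuous_intros continuous_on_compose2[OF c]) auto
    have i: "set_integrable lborel {0..1} ?f"
      by (rule borel_integrable_atLeastAtMost'[OF cf])
    have df: "((\<lambda>u. std_normal_density (z - u * e)) has_real_derivative ?f u) (at u within {0..1})" for u
      by (rule DERIV_chain2[OF d]) (auto intro!: derivative_eq_intros)
    have "(LBINT u:{0..1}. ?f u) = std_normal_density (z - 1 * e) - std_normal_density (z - 0 * e)"
      by (rule LBINT_FTC[OF zero_le_one _ cf]) (rule df)
    then have eq: "std_normal_density (z - e) - std_normal_density z = (LBINT u. indicator {0..1} u *\<^sub>R ?f u)"
      unfolding set_lebesgue_integral_def by simp
    have "ennreal \<bar>std_normal_density (z - e) - std_normal_density z\<bar>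
        \<le> (\<integral>\<^sup>+u. ennreal (norm (indicator {0..1} u *\<^sub>R ?f u)) \<partial>lborel)"
      unfolding eq real_norm_def[symmetric]
      by (rule integral_norm_bound_ennreal) (rule i[unfolded set_integrable_def])
    also have "\<dots> = (\<integral>\<^sup>+u\<in>{0..1}. ennreal (\<bar>e\<bar> * \<bar>\<phi>' (z - u * e)\<bar>) \<partial>lborel)"
      by (intro nn_integral_cong) (auto simp: abs_mult mult.commute split: split_indicator)
    finally show ?thesis .
  qed
  have "(\<integral>\<^sup>+z. ennreal \<bar>std_normal_density (z - e) - std_normal_density z\<bar> \<partial>lborel)
      \<le> (\<integral>\<^sup>+z. (\<integral>\<^sup>+u\<in>{0..1}. ennreal (\<bar>e\<bar> * \<bar>\<phi>' (z - u * e)\<bar>) \<partial>lborel) \<partial>lborel)"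
    by (intro nn_integral_mono ptw)
  also have "\<dots> = (\<integral>\<^sup>+u. \<integral>\<^sup>+z. ennreal (\<bar>e\<bar> * \<bar>\<phi>' (z - u * e)\<bar>) * indicator {0..1} u \<partial>lborel \<partial>lborel)"
    by (rule lborel_pair.Fubini'[symmetric]) measurable
  also have "\<dots> = (\<integral>\<^sup>+u. ennreal \<bar>e\<bar> * (\<integral>\<^sup>+z. ennreal \<bar>\<phi>' (z - u * e)\<bar> \<partial>lborel) * indicator {0..1} u \<partial>lborel)"
    by (simp add: ennreal_mult nn_integral_multc nn_integral_cmult)
  also have "\<dots> \<le> (\<integral>\<^sup>+u. ennreal \<bar>e\<bar> * indicator {0..1::real} u \<partial>lborel)"
    using shift by (intro nn_integral_mono) (auto split: split_indicator intro: mult_left_le)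
  also have "\<dots> = ennreal \<bar>e\<bar>" by (simp add: nn_integral_cmult)
  finally show ?thesis .
qed

text \<open>Translation invariance moves the shift from \<open>f\<close>, which is only bounded, to
  the Gaussian density; in units of the standard deviation it has length
  \<open>\<bar>d\<bar> / sqrt V\<close>. This gain of one derivative at the price
  \<open>1 / sqrt V\<close> produces the weakly singular kernel of the gradient estimate.\<close>

lemma heat_shift_bound:
  assumes [measurable]: "f \<in> borel_measurable borel" and V: "V > 0" and G: "\<And>y. \<bar>f y\<bar> \<le> G"
  shows "\<bar>heat V f (x + d) - heat V f x\<bar> \<le> G * (\<bar>d\<bar> / sqrt V)"
proof -
  define e where "e = d / sqrt V"
  let ?D = "\<lambda>z. std_normal_density (z - e) - std_normal_density z"
  have G0: "0 \<le> G" using G[of 0] by simp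
  have i: "integrable lborel (\<lambda>z. std_normal_density (z - w) * f (x + sqrt V * z))" for w
  proof (rule Bochner_Integration.integrable_bound)
    have "integrable lborel (\<lambda>z. std_normal_density (- w + 1 * z))"
      by (rule lborel_integrable_real_affine) simp_all
    then show "integrable lborel (\<lambda>z. std_normal_density (z - w) * G)"
      by (intro integrable_mult_left) simp
    show "(\<lambda>z. std_normal_density (z - w) * f (x + sqrt V * z)) \<in> borel_measurable lborel"
      by measurable
    show "AE z in lborel. norm (std_normal_density (z - w) * f (x + sqrt V * z)) \<le> norm (std_normal_density (z - w) * G)"
      using G by (intro AE_I2) (simp add: abs_mult mult_left_mono G0)
  qed
  have "heat V f (x + d) = (LBINT z. std_normal_density z * f (x + d + sqrt V * z))"
    by (rule heat_lborel) measurable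
  also have "\<dots> = (LBINT z. std_normal_density (z - e) * f (x + sqrt V * z))"
    using V by (subst lborel_integral_real_affine[where c=1 and t="- e"])
      (auto simp: e_def algebra_simps)
  finally have "heat V f (x + d) - heat V f x = (LBINT z. ?D z * f (x + sqrt V * z))"
    using i[of e] i[of 0] by (simp add: heat_lborel left_diff_distrib)
  then have "ennreal \<bar>heat V f (x + d) - heat V f x\<bar> \<le> (\<integral>\<^sup>+z. ennreal (norm (?D z * f (x + sqrt V * z))) \<partial>lborel)"
    using integral_norm_bound_ennreal[of lborel "\<lambda>z. ?D z * f (x + sqrt V * z)"] i[of e] i[of 0]
    by (simp add: left_diff_distrib)
  also have "\<dots> \<le> (\<integral>\<^sup>+z. ennreal G * ennreal \<bar>?D z\<bar> \<partial>lborel)"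
  proof (rule nn_integral_mono)
    fix z
    have "norm (?D z * f (x + sqrt V * z)) \<le> G * \<bar>?D z\<bar>"
      using mult_right_mono[OF G[of "x + sqrt V * z"], of "\<bar>?D z\<bar>"] by (simp add: abs_mult mult.commute)
    then show "ennreal (norm (?D z * f (x + sqrt V * z))) \<le> ennreal G * ennreal \<bar>?D z\<bar>"
      using G0 by (simp add: ennreal_leI flip: ennreal_mult)
  qed
  also have "\<dots> = ennreal G * (\<integral>\<^sup>+z. ennreal \<bar>?D z\<bar> \<partial>lborel)" by (rule nn_integral_cmult) measurable
  also have "\<dots> \<le> ennreal G * ennreal \<bar>e\<bar>" by (intro mult_left_mono std_normal_density_shift_L1) auto
  also have "\<dots> = ennreal (G * \<bar>e\<bar>)" using G0 by (simp add: ennreal_mult)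
  finally show ?thesis using V G0 by (simp add: e_def ennreal_le_iff)
qed

section \<open>The PDE tested against the heat kernel\<close>

text \<open>Comparing the first and the third formula gives the heat equation: the derivative in the
  variance is half the second space derivative.\<close>

lemma normal_density_derivs:
  fixes V :: real
  assumes V: "V > 0"
  defines "K \<equiv> \<lambda>V d. normal_density 0 (sqrt V) d"
  shows "((\<lambda>V. K V d) has_real_derivative (d\<^sup>2 / V\<^sup>2 - 1 / V) * K V d / 2) (at V)"
    and "(K V has_real_derivative - (d / V) * K V d) (at d)"
    and "((\<lambda>d. - (d / V) * K V d) has_real_derivative (d\<^sup>2 / V\<^sup>2 - 1 / V) * K V d) (at d)"
proof -
  have K: "K V d = exp (- d\<^sup>2 / (2 * V)) / sqrt (2 * pi * V)" if "V > 0" for V d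
    using that by (simp add: K_def normal_density_def)
  have s: "sqrt (2 * pi * V) > 0" "sqrt (2 * pi * V) * sqrt (2 * pi * V) = 2 * pi * V" using V by auto
  have "((\<lambda>V. exp (- d\<^sup>2 / (2 * V)) / sqrt (2 * pi * V)) has_real_derivative (d\<^sup>2 / V\<^sup>2 - 1 / V) * K V d / 2) (at V)"
  proof -
    define q where "q = sqrt (2 * pi * V)"
    define E where "E = exp (- (d\<^sup>2 / (2 * V)))"
    have q: "q > 0" "q * q = 2 * pi * V" using s by (simp_all add: q_def)
    have e1: "inverse q * pi / (2 * pi * V) = 1 / (2 * V * q)" using V q(1) by (simp add: divide_simps)
    have e2: "q / (2 * pi * V) = 1 / q" using q V by (simp add: divide_simps)
    have "(E * d\<^sup>2 * q / (2 * (V * V)) - E * (inverse q * pi)) / (2 * pi * V)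
        = E * d\<^sup>2 / (2 * (V * V)) * (q / (2 * pi * V)) - E * (inverse q * pi / (2 * pi * V))"
      by (simp add: diff_divide_distrib)
    also have "\<dots> = (d\<^sup>2 / V\<^sup>2 - 1 / V) * E / (q * 2)"
      unfolding e1 e2 using V q(1) by (simp add: divide_simps power2_eq_square) (simp add: algebra_simps)
    finally show ?thesis
      unfolding K[OF V] using V
      by (auto intro!: derivative_eq_intros simp: E_def q_def mult_less_0_iff not_less)
  qed
  then show "((\<lambda>V. K V d) has_real_derivative (d\<^sup>2 / V\<^sup>2 - 1 / V) * K V d / 2) (at V)"
    by (rule has_field_derivative_transform_within_open[where S="{0<..}"]) (use V K in auto)
  have 2: "(K V has_real_derivative - (d / V) * K V d) (at d)" for d
    unfolding K[OF V, abs_def] using V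
    by (auto intro!: derivative_eq_intros simp: divide_simps power2_eq_square)
  show "(K V has_real_derivative - (d / V) * K V d) (at d)" by (rule 2)
  show "((\<lambda>d. - (d / V) * K V d) has_real_derivative (d\<^sup>2 / V\<^sup>2 - 1 / V) * K V d) (at d)"
    using V by (auto intro!: derivative_eq_intros 2 simp: divide_simps power2_eq_square)
      (simp add: algebra_simps)
qed

text \<open>Here \<open>\<tau>\<close> stands for \<open>\<xi>'\<close> and \<open>\<zeta>\<close>
  for \<open>\<xi>''\<close>: the increment \<open>\<tau> t - \<tau> s\<close> is the variance of
  the noise collected over [s,t]. Positivity is asked away from time 0 only, since
  \<open>\<xi>''\<close> vanishes at 0 when \<open>\<gamma> 2 = 0\<close>; it makes
  \<open>\<tau>\<close> strictly increasing and every kernel over a nontrivial time span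
  nondegenerate.\<close>

locale parisi_clock =
  fixes \<zeta> \<tau> :: "real \<Rightarrow> real"
  assumes tau_deriv: "s \<in> {0..1} \<Longrightarrow> (\<tau> has_real_derivative \<zeta> s) (at s)"
    and zeta_cont: "continuous_on {0..1} \<zeta>"
    and zeta_pos: "0 < s \<Longrightarrow> s \<le> 1 \<Longrightarrow> 0 < \<zeta> s"
begin

lemma zeta_nonneg: "s \<in> {0..1} \<Longrightarrow> 0 \<le> \<zeta> s"
proof -
  assume s: "s \<in> {0..1}"
  have c: "((\<lambda>n. \<zeta> (inverse (real (Suc n)))) \<longlonglongrightarrow> \<zeta> 0)"
    by (rule continuous_on_tendsto_compose[OF zeta_cont LIMSEQ_inverse_real_of_nat])
      (auto simp: inverse_le_1_iff)
  have "0 \<le> \<zeta> 0"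
  proof (rule LIMSEQ_le_const[OF c], intro exI allI impI)
    fix n show "0 \<le> \<zeta> (inverse (real (Suc n)))"
      using zeta_pos[of "inverse (real (Suc n))"] by (auto simp: inverse_le_1_iff)
  qed
  then show ?thesis using zeta_pos[of s] s by (cases "s = 0") auto
qed

lemma tau_cont: "continuous_on {0..1} \<tau>"
  using tau_deriv by (intro continuous_at_imp_continuous_on ballI) (blast intro: DERIV_isCont)

lemma tau_less: "0 \<le> s \<Longrightarrow> s < t \<Longrightarrow> t \<le> 1 \<Longrightarrow> \<tau> s < \<tau> t"
  by (rule DERIV_pos_imp_increasing_open[where f=\<tau>])
    (auto intro!: tau_deriv zeta_pos exI continuous_on_subset[OF tau_cont])

lemma tau_le: "0 \<le> s \<Longrightarrow> s \<le> t \<Longrightarrow> t \<le> 1 \<Longrightarrow> \<tau> s \<le> \<tau> t"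
  using tau_less[of s t] by (cases "s = t") auto

lemma zeta_integral: "0 \<le> s \<Longrightarrow> s \<le> t \<Longrightarrow> t \<le> 1 \<Longrightarrow> (LBINT r:{s..t}. \<zeta> r) = \<tau> t - \<tau> s"
  by (rule LBINT_FTC)
    (auto intro!: has_field_derivative_at_within tau_deriv continuous_on_subset[OF zeta_cont])

definition Z :: real where "Z = Sup (\<zeta> ` {0..1})"

lemma zeta_le: "s \<in> {0..1} \<Longrightarrow> \<zeta> s \<le> Z"
  unfolding Z_def using compact_continuous_image[OF zeta_cont compact_Icc]
  by (intro cSup_upper) (auto dest: compact_imp_bounded bounded_imp_bdd_above)

lemma Z_nonneg: "0 \<le> Z" using zeta_le[of 0] zeta_nonneg[of 0] by auto

text \<open>Extension by 0, because \<open>\<zeta>\<close> is controlled on [0,1] only while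
  coefficients are required to be Borel and bounded on the whole line.\<close>

definition zeta_ext :: "real \<Rightarrow> real" where "zeta_ext r = indicator {0..1} r * \<zeta> r"

lemma zeta_ext_measurable [measurable]: "zeta_ext \<in> borel_measurable borel"
  using borel_measurable_continuous_on_indicator[OF _ zeta_cont] by (simp add: zeta_ext_def[abs_def])

lemma zeta_ext_eq: "r \<in> {0..1} \<Longrightarrow> zeta_ext r = \<zeta> r" by (simp add: zeta_ext_def)

lemma zeta_ext_abs_le: "\<bar>zeta_ext r\<bar> \<le> Z"
  using zeta_le[of r] zeta_nonneg[of r] Z_nonneg by (auto simp: zeta_ext_def indicator_def)

end

text \<open>The two space derivatives are named parameters, so that solutions for different measures
  can be compared by instantiating the locale several times over one clock. The coefficient
  \<open>\<alpha>\<close> enters as a measurable function with values in [0,1].\<close>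

locale parisi_pde = parisi_clock +
  fixes \<alpha> :: "real \<Rightarrow> real" and \<Phi> \<Phi>\<^sub>1 \<Phi>\<^sub>2 :: "real \<Rightarrow> real \<Rightarrow> real"
  assumes alpha_measurable [measurable]: "\<alpha> \<in> borel_measurable borel"
    and alpha_nonneg: "0 \<le> \<alpha> s" and alpha_le: "\<alpha> s \<le> 1"
    and Phi_deriv: "s \<in> {0..1} \<Longrightarrow> (\<Phi> s has_real_derivative \<Phi>\<^sub>1 s x) (at x)"
    and Phi1_deriv: "s \<in> {0..1} \<Longrightarrow> (\<Phi>\<^sub>1 s has_real_derivative \<Phi>\<^sub>2 s x) (at x)"
    and Phi1_le: "s \<in> {0..1} \<Longrightarrow> \<bar>\<Phi>\<^sub>1 s x\<bar> \<le> 1"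
    and Phi_cont: "continuous_on ({0..1} \<times> UNIV) (case_prod \<Phi>)"
    and Phi1_cont: "continuous_on ({0..1} \<times> UNIV) (case_prod \<Phi>\<^sub>1)"
    and Phi2_cont: "continuous_on ({0..1} \<times> UNIV) (case_prod \<Phi>\<^sub>2)"
    and Phi_eq: "s \<in> {0..1} \<Longrightarrow> \<Phi> s x = ln (cosh x) +
        (LBINT r:{s..1}. \<zeta> r / 2 * (\<Phi>\<^sub>2 r x + \<alpha> r * (\<Phi>\<^sub>1 r x)\<^sup>2))"
begin

lemma Phi_terminal: "\<Phi> 1 x = ln (cosh x)"
  \<comment> \<open>The integral over the single point 1 vanishes by the length bound with
    \<open>b - a = 0\<close>.\<close>
  using Phi_eq[of 1 x] set_integral_abs_le[of 1 1 "\<lambda>r. \<zeta> r / 2 * (\<Phi>\<^sub>2 r x + \<alpha> r * (\<Phi>\<^sub>1 r x)\<^sup>2)" "\<bar>\<zeta> 1 / 2 * (\<Phi>\<^sub>2 1 x + \<alpha> 1 * (\<Phi>\<^sub>1 1 x)\<^sup>2)\<bar>"]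
  by simp

lemma Phi_measurable: "s \<in> {0..1} \<Longrightarrow> \<Phi> s \<in> borel_measurable borel"
  using Phi_deriv by (intro borel_measurable_continuous_onI continuous_at_imp_continuous_on ballI)
    (blast intro: DERIV_isCont)

lemma Phi1_measurable: "s \<in> {0..1} \<Longrightarrow> \<Phi>\<^sub>1 s \<in> borel_measurable borel"
  using Phi1_deriv by (intro borel_measurable_continuous_onI continuous_at_imp_continuous_on ballI)
    (blast intro: DERIV_isCont)

lemma Phi_lipschitz: "s \<in> {0..1} \<Longrightarrow> \<bar>\<Phi> s y - \<Phi> s x\<bar> \<le> \<bar>y - x\<bar>"
  using field_differentiable_bound[of UNIV "\<Phi> s" "\<Phi>\<^sub>1 s" 1 y x] Phi_deriv Phi1_le by auto

text \<open>The gradient bound gives growth with slope 1, and continuity in time at the one point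
  \<open>x\<close> makes the constant uniform in \<open>s\<close>. This is the domination for all
  Gaussian averages of \<open>\<Phi>\<close>.\<close>

lemma Phi_bound: obtains A where "A \<ge> 0" "\<And>s y. s \<in> {0..1} \<Longrightarrow> \<bar>\<Phi> s y\<bar> \<le> A + \<bar>y - x\<bar>"
proof -
  have "continuous_on {0..1} (\<lambda>s. \<Phi> s x)"
    by (rule continuous_on_compose2[OF Phi_cont, of _ "\<lambda>s. (s, x)", simplified]) (auto intro!: continuous_intros)
  then obtain A where A: "\<And>s. s \<in> {0..1} \<Longrightarrow> \<bar>\<Phi> s x\<bar> \<le> A"
    using continuous_abs_bounded[OF compact_Icc, of 0 1 "\<lambda>s. \<Phi> s x"] by blast
  show ?thesis
  proof (rule that[of "\<bar>A\<bar>"])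
    show "\<bar>\<Phi> s y\<bar> \<le> \<bar>A\<bar> + \<bar>y - x\<bar>" if "s \<in> {0..1}" for s y
      using A[OF that] Phi_lipschitz[OF that, of y x] by linarith
  qed simp
qed

lemma cont_comp:
  assumes "continuous_on ({0..1} \<times> UNIV) (case_prod f)" "continuous_on S g" "continuous_on S h"
    "\<And>p. p \<in> S \<Longrightarrow> g p \<in> {0..1::real}"
  shows "continuous_on S (\<lambda>p. f (g p) (h p))"
  using continuous_on_compose2[OF assms(1) continuous_on_Pair[OF assms(2,3)]] assms(4) by fastforce

text \<open>Integrating by parts in space on a bounded window leaves only boundary terms, so that no growth
  bound on the second derivative is needed.\<close>

lemma duhamel_window:
  fixes x :: real and n :: real
  assumes s: "0 \<le> s" "s < s'" "s' \<le> t" "t \<le> 1" and n: "0 \<le> n"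
  defines "K \<equiv> \<lambda>r y. normal_density 0 (sqrt (\<tau> r - \<tau> s)) (y - x)"
  defines "K\<^sub>1 \<equiv> \<lambda>r y. - ((y - x) / (\<tau> r - \<tau> s)) * K r y"
  shows "(LBINT y:{x-n..x+n}. \<Phi> s' y * K s' y) = (LBINT y:{x-n..x+n}. \<Phi> t y * K t y)
    + (LBINT r:{s'..t}. \<zeta> r / 2 * \<alpha> r * (LBINT y:{x-n..x+n}. (\<Phi>\<^sub>1 r y)\<^sup>2 * K r y))
    + (LBINT r:{s'..t}. \<zeta> r / 2 * (\<Phi>\<^sub>1 r (x+n) * K r (x+n) - \<Phi> r (x+n) * K\<^sub>1 r (x+n)
        - (\<Phi>\<^sub>1 r (x-n) * K r (x-n) - \<Phi> r (x-n) * K\<^sub>1 r (x-n))))"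
    and "set_integrable lborel {s'..t} (\<lambda>r. \<zeta> r / 2 * \<alpha> r * (LBINT y:{x-n..x+n}. (\<Phi>\<^sub>1 r y)\<^sup>2 * K r y))"
proof -
  let ?I = "{x-n..x+n}"
  \<comment> \<open>The second space derivative of the kernel; by the heat equation and the chain
    rule its time derivative is \<open>\<zeta> r / 2 * K2 r y\<close>.\<close>
  define K2 where "K2 r y = ((y - x)\<^sup>2 / (\<tau> r - \<tau> s)\<^sup>2 - 1 / (\<tau> r - \<tau> s)) * K r y" for r y
  \<comment> \<open>Starting at \<open>s' > s\<close> keeps the variance away from 0, so that the
    kernel and its derivatives are continuous on the compact window.\<close>
  have st: "s' \<le> t" and sub: "r \<in> {s'..t} \<Longrightarrow> r \<in> {0..1}" and T: "r \<in> {s'..t} \<Longrightarrow> \<tau> r - \<tau> s > 0" for r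
    using s tau_less[of s r] by auto
  have ct: "continuous_on ({s'..t} \<times> ?I) (\<lambda>p. \<tau> (fst p))"
    by (rule continuous_on_compose2[OF tau_cont]) (use sub in \<open>auto intro!: continuous_intros\<close>)
  have K_eq: "K r y = exp (- (y - x)\<^sup>2 / (2 * (\<tau> r - \<tau> s))) / sqrt (2 * pi * (\<tau> r - \<tau> s))"
    if "r \<in> {s'..t}" for r y
    using T[OF that] by (simp add: K_def normal_density_def)
  have cK: "continuous_on ({s'..t} \<times> ?I) (\<lambda>p. K (fst p) (snd p))"
  proof (rule continuous_on_cong[THEN iffD1, rotated -1])
    show "continuous_on ({s'..t} \<times> ?I) (\<lambda>p. exp (- (snd p - x)\<^sup>2 / (2 * (\<tau> (fst p) - \<tau> s))) / sqrt (2 * pi * (\<tau> (fst p) - \<tau> s)))"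
      by (intro continuous_intros ct) (use T in fastforce)+
  qed (auto simp: K_eq)
  have cK1: "continuous_on ({s'..t} \<times> ?I) (\<lambda>p. K\<^sub>1 (fst p) (snd p))"
    unfolding K\<^sub>1_def by (intro continuous_intros ct cK) (use T in fastforce)+
  have cK2: "continuous_on ({s'..t} \<times> ?I) (\<lambda>p. K2 (fst p) (snd p))"
    unfolding K2_def by (intro continuous_intros ct cK) (use T in fastforce)+
  have cz: "continuous_on ({s'..t} \<times> ?I) (\<lambda>p. \<zeta> (fst p))"
    by (rule continuous_on_compose2[OF zeta_cont]) (use sub in \<open>auto intro!: continuous_intros\<close>)
  have cP: "continuous_on ({s'..t} \<times> ?I) (\<lambda>p. \<Phi> (fst p) (snd p))"
      "continuous_on ({s'..t} \<times> ?I) (\<lambda>p. \<Phi>\<^sub>1 (fst p) (snd p))"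
      "continuous_on ({s'..t} \<times> ?I) (\<lambda>p. \<Phi>\<^sub>2 (fst p) (snd p))"
    by (rule cont_comp[OF Phi_cont] cont_comp[OF Phi1_cont] cont_comp[OF Phi2_cont];
        (use sub in \<open>auto intro!: continuous_intros\<close>))+
  have slice: "continuous_on {s'..t} (\<lambda>r. f r y)"
    if "continuous_on ({s'..t} \<times> ?I) (\<lambda>p. f (fst p) (snd p))" "y \<in> ?I" for y and f :: "real \<Rightarrow> real \<Rightarrow> real"
  proof -
    have "continuous_on {s'..t} (\<lambda>r. (\<lambda>p. f (fst p) (snd p)) (r, y))"
      by (rule continuous_on_compose2[OF that(1)]) (use that(2) in \<open>auto intro!: continuous_intros\<close>)
    then show ?thesis by simp
  qed
  have slice': "continuous_on ?I (\<lambda>y. f r y)"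
    if "continuous_on ({s'..t} \<times> ?I) (\<lambda>p. f (fst p) (snd p))" "r \<in> {s'..t}" for r and f :: "real \<Rightarrow> real \<Rightarrow> real"
  proof -
    have "continuous_on ?I (\<lambda>y. (\<lambda>p. f (fst p) (snd p)) (r, y))"
      by (rule continuous_on_compose2[OF that(1)]) (use that(2) in \<open>auto intro!: continuous_intros\<close>)
    then show ?thesis by simp
  qed
  define f where "f r y = (\<Phi>\<^sub>1 r y)\<^sup>2 * K r y" for r y
  \<comment> \<open>The part that is a complete space derivative, namely of \<open>\<zeta> r / 2 *
    (\<Phi>\<^sub>1 r y * K r y - \<Phi> r y * K\<^sub>1 r y)\<close>; only the nonlinear term
    collected in \<open>f\<close> survives in the interior of the window.\<close>
  define g where "g r y = \<zeta> r / 2 * (\<Phi>\<^sub>2 r y * K r y - \<Phi> r y * K2 r y)" for r y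
  define m where "m r = zeta_ext r / 2 * \<alpha> r" for r
  have [measurable]: "m \<in> borel_measurable borel" unfolding m_def by measurable
  have m_bd: "\<bar>m r\<bar> \<le> Z" for r
  proof -
    have "\<bar>m r\<bar> = \<bar>zeta_ext r\<bar> / 2 * \<alpha> r" using alpha_nonneg[of r] by (simp add: m_def abs_mult)
    also have "\<dots> \<le> Z / 2 * 1" using zeta_ext_abs_le[of r] alpha_nonneg[of r] alpha_le[of r] by (intro mult_mono) auto
    finally show ?thesis using Z_nonneg by simp
  qed
  have m_eq: "m r = \<zeta> r / 2 * \<alpha> r" if "r \<in> {s'..t}" for r using sub[OF that] by (simp add: m_def zeta_ext_eq)
  have cf: "continuous_on ({s'..t} \<times> ?I) (\<lambda>p. f (fst p) (snd p))"
    unfolding f_def by (intro continuous_intros cP cK)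
  have cg: "continuous_on ({s'..t} \<times> ?I) (\<lambda>p. g (fst p) (snd p))"
    unfolding g_def by (intro continuous_intros cP cK cK2 cz) auto
  have pointwise: "\<Phi> s' y * K s' y = \<Phi> t y * K t y + (LBINT r:{s'..t}. m r * f r y) + (LBINT r:{s'..t}. 1 * g r y)"
    if y: "y \<in> ?I" for y
  proof -
    \<comment> \<open>The integrand of the PDE, cut off in time so that it is globally Borel; the
      jumps of \<open>\<alpha>\<close> are confined to the factor \<open>m\<close>.\<close>
    define k where "k r = indicator {s'..t} r * (\<zeta> r / 2 * \<Phi>\<^sub>2 r y) + m r * (indicator {s'..t} r * (\<Phi>\<^sub>1 r y)\<^sup>2)" for r
    have c2: "continuous_on {s'..t} (\<lambda>r. \<zeta> r / 2 * \<Phi>\<^sub>2 r y)"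
      by (rule slice[OF _ y, of "\<lambda>r y. \<zeta> r / 2 * \<Phi>\<^sub>2 r y"]) (intro continuous_intros cz cP, simp)
    have c1: "continuous_on {s'..t} (\<lambda>r. (\<Phi>\<^sub>1 r y)\<^sup>2)"
      by (rule slice[OF _ y, of "\<lambda>r y. (\<Phi>\<^sub>1 r y)\<^sup>2"]) (intro continuous_intros cP)
    have [measurable]: "(\<lambda>r. indicator {s'..t} r * (\<zeta> r / 2 * \<Phi>\<^sub>2 r y)) \<in> borel_measurable borel"
      "(\<lambda>r. indicator {s'..t} r * (\<Phi>\<^sub>1 r y)\<^sup>2) \<in> borel_measurable borel"
      using borel_measurable_continuous_on_indicator[OF _ c2] borel_measurable_continuous_on_indicator[OF _ c1] by auto
    have k_meas: "k \<in> borel_measurable borel" unfolding k_def by measurable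
    obtain B where B: "\<And>r. r \<in> {s'..t} \<Longrightarrow> \<bar>\<zeta> r / 2 * \<Phi>\<^sub>2 r y\<bar> \<le> B"
      using continuous_abs_bounded[OF compact_Icc c2] by blast
    have k_bd: "\<bar>k r\<bar> \<le> B + Z" if r: "r \<in> {s'..t}" for r
    proof -
      have "(\<Phi>\<^sub>1 r y)\<^sup>2 \<le> 1" using Phi1_le[OF sub[OF r], of y] by (simp add: abs_square_le_1)
      then have "\<bar>m r * (\<Phi>\<^sub>1 r y)\<^sup>2\<bar> \<le> Z * 1" unfolding abs_mult using m_bd[of r] Z_nonneg by (intro mult_mono) auto
      then show ?thesis using B[OF r] r by (simp add: k_def)
    qed
    have k_eq: "k r = \<zeta> r / 2 * (\<Phi>\<^sub>2 r y + \<alpha> r * (\<Phi>\<^sub>1 r y)\<^sup>2)" if "r \<in> {s'..t}" for r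
      using that by (simp add: k_def m_eq algebra_simps)
    have u: "\<Phi> r y = \<Phi> t y + (LBINT q:{r..t}. k q)" if r: "r \<in> {s'..t}" for r
    proof -
      let ?k = "\<lambda>q. \<zeta> q / 2 * (\<Phi>\<^sub>2 q y + \<alpha> q * (\<Phi>\<^sub>1 q y)\<^sup>2)"
      have si: "set_integrable lborel {0..1} ?k"
      proof -
        have "continuous_on {0..1} (\<lambda>q. \<zeta> q / 2 * \<Phi>\<^sub>2 q y)"
          by (intro continuous_intros zeta_cont cont_comp[OF Phi2_cont]) auto
        then have 1: "set_integrable lborel {0..1} (\<lambda>q. \<zeta> q / 2 * \<Phi>\<^sub>2 q y)"
          by (rule borel_integrable_atLeastAtMost')
        have c: "continuous_on {0..1} (\<lambda>q. (\<Phi>\<^sub>1 q y)\<^sup>2)"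
          by (intro continuous_intros cont_comp[OF Phi1_cont]) auto
        have [measurable]: "(\<lambda>q. indicator {0..1} q * (\<Phi>\<^sub>1 q y)\<^sup>2) \<in> borel_measurable borel"
          using borel_measurable_continuous_on_indicator[OF _ c] by auto
        have "set_integrable lborel {0..1} (\<lambda>q. m q * (indicator {0..1} q * (\<Phi>\<^sub>1 q y)\<^sup>2))"
        proof (rule set_integrable_bounded_interval)
          fix q :: real assume q: "q \<in> {0..1}"
          have "(\<Phi>\<^sub>1 q y)\<^sup>2 \<le> 1" using Phi1_le[OF q, of y] by (simp add: abs_square_le_1)
          then show "\<bar>m q * (indicator {0..1} q * (\<Phi>\<^sub>1 q y)\<^sup>2)\<bar> \<le> Z * 1"
            unfolding abs_mult using m_bd[of q] Z_nonneg q by (intro mult_mono) auto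
        qed measurable
        then have "set_integrable lborel {0..1} (\<lambda>q. \<zeta> q / 2 * \<alpha> q * (\<Phi>\<^sub>1 q y)\<^sup>2)"
          by (rule set_integrable_cong[THEN iffD1, rotated -1]) (auto simp: m_def zeta_ext_eq)
        with 1 have "set_integrable lborel {0..1} (\<lambda>q. \<zeta> q / 2 * \<Phi>\<^sub>2 q y + \<zeta> q / 2 * \<alpha> q * (\<Phi>\<^sub>1 q y)\<^sup>2)"
          by (rule set_integral_add)
        then show ?thesis by (simp add: algebra_simps)
      qed
      have "AE q in lborel. q \<noteq> t" by (rule AE_lborel_singleton)
      then have "(LBINT q:{r..1}. ?k q) = (LBINT q:{r..t} \<union> {t..1}. ?k q)"
        using r s by (simp add: ivl_disj_un)
      also have "\<dots> = (LBINT q:{r..t}. ?k q) + (LBINT q:{t..1}. ?k q)"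
      proof (rule set_integral_Un_AE)
        show "AE q in lborel. \<not> (q \<in> {r..t} \<and> q \<in> {t..1})"
          using \<open>AE q in lborel. q \<noteq> t\<close> by eventually_elim auto
        show "set_integrable lborel {r..t} ?k" "set_integrable lborel {t..1} ?k"
          by (rule set_integrable_subset[OF si]; use r s in auto)+
      qed (use r s in auto)
      finally have "\<Phi> r y = \<Phi> t y + (LBINT q:{r..t}. ?k q)"
        using Phi_eq[of r y] Phi_eq[of t y] sub[OF r] sub[of t] st by simp
      also have "(LBINT q:{r..t}. ?k q) = (LBINT q:{r..t}. k q)"
        by (rule set_lebesgue_integral_cong) (use r k_eq in auto)
      finally show ?thesis .
    qed
    have v: "((\<lambda>r. K r y) has_real_derivative \<zeta> r / 2 * K2 r y) (at r within {s'..t})" if r: "r \<in> {s'..t}" for r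
    proof -
      have "((\<lambda>r. \<tau> r - \<tau> s) has_real_derivative \<zeta> r) (at r)"
        using tau_deriv[OF sub[OF r]] by (auto intro!: derivative_eq_intros)
      note DERIV_chain2[where f="\<lambda>V. normal_density 0 (sqrt V) (y - x)" and g="\<lambda>r. \<tau> r - \<tau> s",
          OF normal_density_derivs(1)[OF T[OF r]] this]
      then have "((\<lambda>r. K r y) has_real_derivative \<zeta> r / 2 * K2 r y) (at r)"
        by (simp add: K_def K2_def mult_ac)
      then show ?thesis by (rule has_field_derivative_at_within)
    qed
    have v': "continuous_on {s'..t} (\<lambda>r. \<zeta> r / 2 * K2 r y)"
      by (rule slice[OF _ y, of "\<lambda>r y. \<zeta> r / 2 * K2 r y"]) (intro continuous_intros cz cK2, simp)
    \<comment> \<open>Integration by parts in time at fixed \<open>y\<close>: the kernel is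
      continuously differentiable, and \<open>\<Phi>\<close> has the density \<open>k\<close> in
      integrated form.\<close>
    have "(LBINT r:{s'..t}. \<Phi> r y * (\<zeta> r / 2 * K2 r y)) = \<Phi> t y * K t y - \<Phi> s' y * K s' y + (LBINT r:{s'..t}. k r * K r y)"
      by (rule LBINT_product_rule[OF st k_meas k_bd v' v u])
    then have "\<Phi> s' y * K s' y = \<Phi> t y * K t y + ((LBINT r:{s'..t}. k r * K r y) - (LBINT r:{s'..t}. \<Phi> r y * (\<zeta> r / 2 * K2 r y)))"
      by linarith
    also have "(LBINT r:{s'..t}. k r * K r y) = (LBINT r:{s'..t}. m r * f r y) + (LBINT r:{s'..t}. \<zeta> r / 2 * \<Phi>\<^sub>2 r y * K r y)"
    proof -
      have i1: "set_integrable lborel {s'..t} (\<lambda>r. m r * f r y)"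
      proof -
        have c: "continuous_on {s'..t} (\<lambda>r. f r y)" by (rule slice[OF cf y])
        obtain D where D: "\<And>r. r \<in> {s'..t} \<Longrightarrow> \<bar>f r y\<bar> \<le> D"
          using continuous_abs_bounded[OF compact_Icc c] by blast
        have [measurable]: "(\<lambda>r. indicator {s'..t} r * f r y) \<in> borel_measurable borel"
          using borel_measurable_continuous_on_indicator[OF _ c] by auto
        have "set_integrable lborel {s'..t} (\<lambda>r. m r * (indicator {s'..t} r * f r y))"
          by (rule set_integrable_bounded_interval[where B="Z * D"])
            (use m_bd D Z_nonneg in \<open>auto simp: abs_mult intro!: mult_mono\<close>)
        then show ?thesis by (rule set_integrable_cong[THEN iffD1, rotated -1]) auto
      qed
      have i2: "set_integrable lborel {s'..t} (\<lambda>r. \<zeta> r / 2 * \<Phi>\<^sub>2 r y * K r y)"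
        by (rule borel_integrable_atLeastAtMost', rule slice[OF _ y, of "\<lambda>r y. \<zeta> r / 2 * \<Phi>\<^sub>2 r y * K r y"])
          (intro continuous_intros cz cP cK, simp)
      have "(LBINT r:{s'..t}. k r * K r y) = (LBINT r:{s'..t}. m r * f r y + \<zeta> r / 2 * \<Phi>\<^sub>2 r y * K r y)"
        by (rule set_lebesgue_integral_cong) (auto simp: k_def f_def algebra_simps)
      also have "\<dots> = (LBINT r:{s'..t}. m r * f r y) + (LBINT r:{s'..t}. \<zeta> r / 2 * \<Phi>\<^sub>2 r y * K r y)"
        by (rule set_integral_add(2)[OF i1 i2])
      finally show ?thesis .
    qed
    also have "(LBINT r:{s'..t}. \<zeta> r / 2 * \<Phi>\<^sub>2 r y * K r y) = (LBINT r:{s'..t}. 1 * g r y) + (LBINT r:{s'..t}. \<Phi> r y * (\<zeta> r / 2 * K2 r y))"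
    proof -
      have i1: "set_integrable lborel {s'..t} (\<lambda>r. g r y)"
        by (rule borel_integrable_atLeastAtMost', rule slice[OF cg y])
      have i2: "set_integrable lborel {s'..t} (\<lambda>r. \<Phi> r y * (\<zeta> r / 2 * K2 r y))"
        by (rule borel_integrable_atLeastAtMost', rule slice[OF _ y, of "\<lambda>r y. \<Phi> r y * (\<zeta> r / 2 * K2 r y)"])
          (intro continuous_intros cz cP cK2, simp)
      show ?thesis unfolding mult_1 set_integral_add(2)[OF i1 i2, symmetric]
        by (rule set_lebesgue_integral_cong) (auto simp: g_def algebra_simps)
    qed
    finally show ?thesis by simp
  qed
  have m1: "(\<lambda>_::real. 1::real) \<in> borel_measurable borel" and b1: "\<bar>1::real\<bar> \<le> 1" by auto
  have nn: "x - n \<le> x + n" using n by simp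
  note Ff = set_lborel_Fubini_continuous[OF \<open>m \<in> _\<close> m_bd st nn, of "f"]
  note Fg = set_lborel_Fubini_continuous[OF m1 b1 st nn, of "g"]
  have cf': "continuous_on ({s'..t} \<times> ?I) (case_prod f)" and cg': "continuous_on ({s'..t} \<times> ?I) (case_prod g)"
    using cf cg by (simp_all add: split_beta')
  have it: "set_integrable lborel ?I (\<lambda>y. \<Phi> t y * K t y)"
    by (rule borel_integrable_atLeastAtMost', rule slice'[of "\<lambda>r y. \<Phi> r y * K r y"])
      (use st in \<open>auto intro!: continuous_intros cP cK\<close>)
  have "(LBINT y:?I. \<Phi> s' y * K s' y)
      = (LBINT y:?I. \<Phi> t y * K t y + (LBINT r:{s'..t}. m r * f r y) + (LBINT r:{s'..t}. 1 * g r y))"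
    by (rule set_lebesgue_integral_cong) (use pointwise in auto)
  also have "\<dots> = (LBINT y:?I. \<Phi> t y * K t y) + (LBINT y:?I. LBINT r:{s'..t}. m r * f r y)
      + (LBINT y:?I. LBINT r:{s'..t}. 1 * g r y)"
    using it Ff(3)[OF cf'] Fg(3)[OF cg'] by (simp add: set_integral_add)
  also have "(LBINT y:?I. LBINT r:{s'..t}. m r * f r y) = (LBINT r:{s'..t}. m r * (LBINT y:?I. f r y))"
    by (rule Ff(1)[OF cf'])
  also have "(LBINT r:{s'..t}. m r * (LBINT y:?I. f r y)) = (LBINT r:{s'..t}. \<zeta> r / 2 * \<alpha> r * (LBINT y:?I. (\<Phi>\<^sub>1 r y)\<^sup>2 * K r y))"
    by (rule set_lebesgue_integral_cong) (auto simp: m_eq f_def)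
  also have "(LBINT y:?I. LBINT r:{s'..t}. 1 * g r y) = (LBINT r:{s'..t}. 1 * (LBINT y:?I. g r y))"
    by (rule Fg(1)[OF cg'])
  also have "\<dots> = (LBINT r:{s'..t}. \<zeta> r / 2 * (\<Phi>\<^sub>1 r (x+n) * K r (x+n) - \<Phi> r (x+n) * K\<^sub>1 r (x+n)
        - (\<Phi>\<^sub>1 r (x-n) * K r (x-n) - \<Phi> r (x-n) * K\<^sub>1 r (x-n))))"
  proof (rule set_lebesgue_integral_cong)
    show "\<forall>r. r \<in> {s'..t} \<longrightarrow> 1 * (LBINT y:?I. g r y) = \<zeta> r / 2 * (\<Phi>\<^sub>1 r (x+n) * K r (x+n) - \<Phi> r (x+n) * K\<^sub>1 r (x+n)
        - (\<Phi>\<^sub>1 r (x-n) * K r (x-n) - \<Phi> r (x-n) * K\<^sub>1 r (x-n)))"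
    proof (intro allI impI)
      fix r assume r: "r \<in> {s'..t}"
      have dK: "(K r has_real_derivative K\<^sub>1 r y) (at y)" "(K\<^sub>1 r has_real_derivative K2 r y) (at y)" for y
      proof -
        have g: "((\<lambda>y. y - x) has_real_derivative 1) (at y)" by (auto intro!: derivative_eq_intros)
        show "(K r has_real_derivative K\<^sub>1 r y) (at y)"
          using DERIV_chain2[where f="normal_density 0 (sqrt (\<tau> r - \<tau> s))" and g="\<lambda>y. y - x",
              OF normal_density_derivs(2)[OF T[OF r]] g]
          by (simp add: K_def[abs_def] K\<^sub>1_def)
        show "(K\<^sub>1 r has_real_derivative K2 r y) (at y)"
          using DERIV_chain2[where f="\<lambda>d. - (d / (\<tau> r - \<tau> s)) * normal_density 0 (sqrt (\<tau> r - \<tau> s)) d" and g="\<lambda>y. y - x",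
              OF normal_density_derivs(3)[OF T[OF r]] g]
          by (simp add: K_def[abs_def] K\<^sub>1_def[abs_def] K2_def)
      qed
      \<comment> \<open>Green's identity: in the derivative the two mixed products of
        \<open>\<Phi>\<^sub>1\<close> and \<open>K\<^sub>1\<close> cancel.\<close>
      have d: "((\<lambda>y. \<zeta> r / 2 * (\<Phi>\<^sub>1 r y * K r y - \<Phi> r y * K\<^sub>1 r y)) has_real_derivative g r y) (at y)" for y
        using DERIV_cmult[OF DERIV_diff[OF DERIV_mult[OF Phi1_deriv[OF sub[OF r]] dK(1)] DERIV_mult[OF Phi_deriv[OF sub[OF r]] dK(2)]], of "\<zeta> r / 2" y]
        by (simp add: g_def algebra_simps)
      have "(LBINT y:?I. g r y) = \<zeta> r / 2 * (\<Phi>\<^sub>1 r (x+n) * K r (x+n) - \<Phi> r (x+n) * K\<^sub>1 r (x+n))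
        - \<zeta> r / 2 * (\<Phi>\<^sub>1 r (x-n) * K r (x-n) - \<Phi> r (x-n) * K\<^sub>1 r (x-n))"
        by (rule LBINT_FTC[where f="\<lambda>y. \<zeta> r / 2 * (\<Phi>\<^sub>1 r y * K r y - \<Phi> r y * K\<^sub>1 r y)", OF nn _ slice'[OF cg r]])
          (rule has_field_derivative_at_within[OF d])
      then show "1 * (LBINT y:?I. g r y) = \<zeta> r / 2 * (\<Phi>\<^sub>1 r (x+n) * K r (x+n) - \<Phi> r (x+n) * K\<^sub>1 r (x+n)
        - (\<Phi>\<^sub>1 r (x-n) * K r (x-n) - \<Phi> r (x-n) * K\<^sub>1 r (x-n)))"
        by (simp add: algebra_simps)
    qed
  qed simp
  finally show "(LBINT y:?I. \<Phi> s' y * K s' y) = (LBINT y:?I. \<Phi> t y * K t y)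
    + (LBINT r:{s'..t}. \<zeta> r / 2 * \<alpha> r * (LBINT y:?I. (\<Phi>\<^sub>1 r y)\<^sup>2 * K r y))
    + (LBINT r:{s'..t}. \<zeta> r / 2 * (\<Phi>\<^sub>1 r (x+n) * K r (x+n) - \<Phi> r (x+n) * K\<^sub>1 r (x+n)
        - (\<Phi>\<^sub>1 r (x-n) * K r (x-n) - \<Phi> r (x-n) * K\<^sub>1 r (x-n))))" .
  show "set_integrable lborel {s'..t} (\<lambda>r. \<zeta> r / 2 * \<alpha> r * (LBINT y:?I. (\<Phi>\<^sub>1 r y)\<^sup>2 * K r y))"
    by (rule set_integrable_cong[THEN iffD1, rotated -1, OF Ff(2)[OF cf']]) (auto simp: m_eq f_def)
qed

end

section \<open>Duhamel's formula\<close>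

lemma integrable_std_normal_linear: "integrable std_normal_distribution (\<lambda>z. A + c * \<bar>z\<bar>)"
  using integrable_std_normal_abs by simp

lemma heat_window:
  fixes f :: "real \<Rightarrow> real"
  assumes "f \<in> borel_measurable borel" "V > 0"
  shows "(LBINT y:{a..b}. f y * normal_density 0 (sqrt V) (y - x)) = heat V (\<lambda>y. indicator {a..b} y * f y) x"
  using assms by (subst heat_normal_density) (auto simp: set_lebesgue_integral_def mult_ac)

lemma heat_window_limit:
  fixes f :: "real \<Rightarrow> real"
  assumes [measurable]: "f \<in> borel_measurable borel" and V: "V > 0"
    and A: "\<And>y. \<bar>f y\<bar> \<le> A + \<bar>y - x\<bar>"
  shows "(\<lambda>n. LBINT y:{x - real n..x + real n}. f y * normal_density 0 (sqrt V) (y - x)) \<longlonglongrightarrow> heat V f x"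
  unfolding heat_window[OF assms(1) V] unfolding heat_def
proof (rule integral_dominated_convergence)
  show "integrable std_normal_distribution (\<lambda>z. A + sqrt V * \<bar>z\<bar>)" by (rule integrable_std_normal_linear)
  show "AE z in std_normal_distribution. (\<lambda>n. indicator {x - real n..x + real n} (x + sqrt V * z) * f (x + sqrt V * z))
      \<longlonglongrightarrow> f (x + sqrt V * z)"
  proof (rule AE_I2)
    fix z
    obtain N :: nat where N: "\<bar>sqrt V * z\<bar> \<le> real N" using real_arch_simple by blast
    have "eventually (\<lambda>n. indicator {x - real n..x + real n} (x + sqrt V * z) * f (x + sqrt V * z) = f (x + sqrt V * z)) sequentially"
      using eventually_ge_at_top[of N]
    proof eventually_elim
      case (elim n)
      then have "\<bar>sqrt V * z\<bar> \<le> real n" using N by linarith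
      then show ?case by (auto simp: abs_le_iff)
    qed
    then show "(\<lambda>n. indicator {x - real n..x + real n} (x + sqrt V * z) * f (x + sqrt V * z)) \<longlonglongrightarrow> f (x + sqrt V * z)"
      by (rule tendsto_eventually)
  qed
  show "AE z in std_normal_distribution. norm (indicator {x - real n..x + real n} (x + sqrt V * z) * f (x + sqrt V * z)) \<le> A + sqrt V * \<bar>z\<bar>" for n
  proof (rule AE_I2)
    fix z
    have "\<bar>f (x + sqrt V * z)\<bar> \<le> A + sqrt V * \<bar>z\<bar>" using A[of "x + sqrt V * z"] V by (simp add: abs_mult)
    then show "norm (indicator {x - real n..x + real n} (x + sqrt V * z) * f (x + sqrt V * z)) \<le> A + sqrt V * \<bar>z\<bar>"
      by (auto simp: indicator_def)
  qed
qed (use assms in measurable)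

text \<open>The bound is required on the half-open interval only, and the left endpoint is a null
  set. Dominated convergence is applied to the half-open integrals, and changing one point passes to
  the closed interval.\<close>

lemma LBINT_left_limit:
  fixes f :: "real \<Rightarrow> real"
  assumes sk: "sk \<longlonglongrightarrow> s" "\<And>k. s < sk k" "\<And>k. sk k \<le> t"
    and B: "\<And>r. r \<in> {s<..t} \<Longrightarrow> \<bar>f r\<bar> \<le> B"
    and si: "\<And>k. set_integrable lborel {sk k..t} f"
  shows "set_integrable lborel {s..t} f"
    and "(\<lambda>k. LBINT r:{sk k..t}. f r) \<longlonglongrightarrow> (LBINT r:{s..t}. f r)"
proof -
  have st: "s \<le> t" using sk(2,3)[of 0] by linarith
  have lim: "(\<lambda>k. indicator {sk k..t} r * f r) \<longlonglongrightarrow> indicator {s<..t} r * f r" for r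
  proof (cases "s < r")
    case True
    then have "eventually (\<lambda>k. sk k < r) sequentially" using sk(1) by (simp add: order_tendstoD)
    then have "eventually (\<lambda>k. indicator {sk k..t} r * f r = indicator {s<..t} r * f r) sequentially"
      by eventually_elim (use True in \<open>auto simp: indicator_def\<close>)
    then show ?thesis by (rule tendsto_eventually)
  next
    case False
    then have "\<not> sk k \<le> r" for k using sk(2)[of k] by linarith
    then show ?thesis using False by (simp add: indicator_def)
  qed
  have m: "(\<lambda>r. indicator {sk k..t} r * f r) \<in> borel_measurable lborel" for k
    using si[of k] unfolding set_integrable_def by (auto dest: borel_measurable_integrable)
  have m': "(\<lambda>r. indicator {s<..t} r * f r) \<in> borel_measurable lborel"
    by (rule borel_measurable_LIMSEQ_real[OF lim m])
  have w: "integrable lborel (\<lambda>r. B * indicator {s..t} r)"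
    by (intro integrable_mult_right integrable_real_indicator) (auto simp: emeasure_lborel_Icc_eq)
  have b: "AE r in lborel. norm (indicator {sk k..t} r * f r) \<le> B * indicator {s..t} r" for k
  proof -
    have "0 \<le> B" using B[of "sk 0"] sk(2,3)[of 0] by (auto intro: order_trans[OF abs_ge_zero])
    then show ?thesis using B sk(2)[of k] by (intro AE_I2) (auto simp: indicator_def)
  qed
  have ae: "AE r in lborel. indicator {s<..t} r * f r = indicator {s..t} r * f r"
    using AE_lborel_singleton[of s] by eventually_elim (auto simp: indicator_def)
  have i: "integrable lborel (\<lambda>r. indicator {s<..t} r * f r)"
    and l: "(\<lambda>k. \<integral>r. indicator {sk k..t} r * f r \<partial>lborel) \<longlonglongrightarrow> (\<integral>r. indicator {s<..t} r * f r \<partial>lborel)"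
    using integrable_dominated_convergence[OF m' m w AE_I2[OF lim] b]
      integral_dominated_convergence[OF m' m w AE_I2[OF lim] b] by auto
  have m'': "(\<lambda>r. indicator {s..t} r * f r) \<in> borel_measurable lborel"
  proof -
    have "(\<lambda>r. indicator {s..t} r * f r) = (\<lambda>r. indicator {s<..t} r * f r + f s * indicator {s} r)"
      using st by (auto simp: indicator_def fun_eq_iff)
    then show ?thesis using m' by simp
  qed
  show "set_integrable lborel {s..t} f"
    unfolding set_integrable_def real_scaleR_def
    using integrable_cong_AE[OF m' m'' ae] i by simp
  show "(\<lambda>k. LBINT r:{sk k..t}. f r) \<longlonglongrightarrow> (LBINT r:{s..t}. f r)"
    unfolding set_lebesgue_integral_def real_scaleR_def
    using integral_cong_AE[OF m' m'' ae] l by simp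
qed

context parisi_pde
begin

lemma Phi1_sq_le: "s \<in> {0..1} \<Longrightarrow> (\<Phi>\<^sub>1 s x)\<^sup>2 \<le> 1"
  using Phi1_le[of s x] by (simp add: abs_square_le_1)

lemma zeta_alpha_half_bound: "r \<in> {0..1} \<Longrightarrow> 0 \<le> q \<Longrightarrow> q \<le> 1 \<Longrightarrow> \<bar>\<zeta> r / 2 * \<alpha> r * q\<bar> \<le> Z"
proof -
  assume r: "r \<in> {0..1}" and q: "0 \<le> q" "q \<le> 1"
  have "\<zeta> r / 2 * \<alpha> r * q \<le> Z / 2 * 1 * 1"
    using zeta_le[OF r] zeta_nonneg[OF r] alpha_nonneg[of r] alpha_le[of r] q Z_nonneg
    by (intro mult_mono) auto
  then show ?thesis
    using zeta_nonneg[OF r] alpha_nonneg[of r] q Z_nonneg by simp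
qed

lemma heat_Phi1_sq: "r \<in> {0..1} \<Longrightarrow> 0 \<le> heat V (\<lambda>y. (\<Phi>\<^sub>1 r y)\<^sup>2) x" "r \<in> {0..1} \<Longrightarrow> heat V (\<lambda>y. (\<Phi>\<^sub>1 r y)\<^sup>2) x \<le> 1"
proof -
  show "0 \<le> heat V (\<lambda>y. (\<Phi>\<^sub>1 r y)\<^sup>2) x" by (simp add: heat_def)
  show "heat V (\<lambda>y. (\<Phi>\<^sub>1 r y)\<^sup>2) x \<le> 1" if "r \<in> {0..1}"
    using heat_abs_le[of "\<lambda>y. (\<Phi>\<^sub>1 r y)\<^sup>2" 1 V x] Phi1_sq_le[OF that] by auto
qed

text \<open>Letting the window grow: at distance \<open>n\<close> the boundary terms carry a
  Gaussian factor in \<open>n\<close> against polynomial growth, hence vanish. The interior terms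
  converge by domination with \<open>Z\<close> and with the linear growth of
  \<open>\<Phi>\<close>.\<close>

lemma duhamel_off_start:
  assumes s: "0 \<le> s" "s < s'" "s' \<le> t" "t \<le> 1"
  shows "heat (\<tau> s' - \<tau> s) (\<Phi> s') x = heat (\<tau> t - \<tau> s) (\<Phi> t) x
      + (LBINT r:{s'..t}. \<zeta> r / 2 * \<alpha> r * heat (\<tau> r - \<tau> s) (\<lambda>y. (\<Phi>\<^sub>1 r y)\<^sup>2) x)"
    and "set_integrable lborel {s'..t} (\<lambda>r. \<zeta> r / 2 * \<alpha> r * heat (\<tau> r - \<tau> s) (\<lambda>y. (\<Phi>\<^sub>1 r y)\<^sup>2) x)"
proof -
  let ?T = "\<lambda>r. \<tau> r - \<tau> s"
  define K where "K r y = normal_density 0 (sqrt (\<tau> r - \<tau> s)) (y - x)" for r y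
  define K1 where "K1 r y = - ((y - x) / (\<tau> r - \<tau> s)) * K r y" for r y
  have sub: "r \<in> {s'..t} \<Longrightarrow> r \<in> {0..1}" and T: "r \<in> {s'..t} \<Longrightarrow> ?T r > 0" for r
    using s tau_less[of s r] by auto
  have T_le: "?T s' \<le> ?T r" "?T r \<le> ?T t" if "r \<in> {s'..t}" for r
    using s that tau_le[of s' r] tau_le[of r t] by auto
  obtain A where A0: "A \<ge> 0" and A: "\<And>s y. s \<in> {0..1} \<Longrightarrow> \<bar>\<Phi> s y\<bar> \<le> A + \<bar>y - x\<bar>" using Phi_bound[of x] by blast
  \<comment> \<open>Bound for one boundary term: 1 for the gradient, \<open>A + n\<close> for the
    solution at distance \<open>n\<close>, \<open>n / (\<tau> s' - \<tau> s)\<close> for the factor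
    of \<open>K1\<close>. The exponential is taken at the largest variance, all prefactors at the
    smallest.\<close>
  define bnd where "bnd n = (1 + (A + n) * (n / ?T s')) * (exp (- n\<^sup>2 / (2 * ?T t)) / sqrt (2 * pi * ?T s'))" for n
  define b where "b n r = \<zeta> r / 2 * (\<Phi>\<^sub>1 r (x+n) * K r (x+n) - \<Phi> r (x+n) * K1 r (x+n)
        - (\<Phi>\<^sub>1 r (x-n) * K r (x-n) - \<Phi> r (x-n) * K1 r (x-n)))" for n r
  define f where "f n r = \<zeta> r / 2 * \<alpha> r * (LBINT y:{x-real n..x+real n}. (\<Phi>\<^sub>1 r y)\<^sup>2 * K r y)" for n r
  define g where "g r = \<zeta> r / 2 * \<alpha> r * heat (?T r) (\<lambda>y. (\<Phi>\<^sub>1 r y)\<^sup>2) x" for r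
  have win: "(LBINT y:{x-real n..x+real n}. \<Phi> s' y * K s' y) = (LBINT y:{x-real n..x+real n}. \<Phi> t y * K t y)
    + (LBINT r:{s'..t}. f n r) + (LBINT r:{s'..t}. b (real n) r)"
    and f_int: "set_integrable lborel {s'..t} (f n)" for n
    using duhamel_window[OF s of_nat_0_le_iff[of n], of x] unfolding K_def K1_def b_def f_def by auto
  have b_bd: "\<bar>b n r\<bar> \<le> Z * bnd n" if r: "r \<in> {s'..t}" and n: "0 \<le> n" for n r
  proof -
    note Tr = T[OF r] T_le[OF r]
    have Ts': "?T s' > 0" using T[of s'] s by auto
    have Kb: "\<bar>K r (x + e)\<bar> \<le> exp (- n\<^sup>2 / (2 * ?T t)) / sqrt (2 * pi * ?T s')" (is "_ \<le> ?E") if "e\<^sup>2 = n\<^sup>2" for e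
    proof -
      have "K r (x + e) = exp (- n\<^sup>2 / (2 * ?T r)) / sqrt (2 * pi * ?T r)"
        using Tr that by (simp add: K_def normal_density_def)
      also have "\<dots> \<le> ?E"
      proof (rule frac_le)
        show "exp (- n\<^sup>2 / (2 * ?T r)) \<le> exp (- n\<^sup>2 / (2 * ?T t))"
          using Tr by (simp add: frac_le)
        show "sqrt (2 * pi * ?T s') \<le> sqrt (2 * pi * ?T r)" using Tr Ts' by (simp add: mult_left_mono)
        show "0 < sqrt (2 * pi * ?T s')" using Ts' by simp
      qed simp
      finally show ?thesis by (simp add: K_def)
    qed
    have E0: "0 \<le> ?E" using Kb[of n] by (auto intro: order_trans[OF abs_ge_zero])
    have one: "\<bar>\<Phi>\<^sub>1 r (x+e) * K r (x+e) - \<Phi> r (x+e) * K1 r (x+e)\<bar> \<le> bnd n" if e: "\<bar>e\<bar> = n" for e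
    proof -
      have e2: "e\<^sup>2 = n\<^sup>2" using e by (metis power2_abs)
      have 1: "\<bar>\<Phi>\<^sub>1 r (x+e) * K r (x+e)\<bar> \<le> 1 * ?E" unfolding abs_mult
        by (intro mult_mono Phi1_le[OF sub[OF r]] Kb e2) auto
      have "\<bar>e / ?T r\<bar> \<le> n / ?T s'" using Tr Ts' e n by (simp add: frac_le)
      then have "\<bar>K1 r (x+e)\<bar> \<le> n / ?T s' * ?E" unfolding K1_def abs_mult abs_minus_cancel
        using Kb[OF e2] n Ts' by (intro mult_mono) auto
      moreover have "\<bar>\<Phi> r (x+e)\<bar> \<le> A + n" using A[OF sub[OF r], of "x+e"] e by simp
      ultimately have "\<bar>\<Phi> r (x+e) * K1 r (x+e)\<bar> \<le> (A + n) * (n / ?T s' * ?E)"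
        unfolding abs_mult using A0 n by (intro mult_mono) auto
      with 1 have "\<bar>\<Phi>\<^sub>1 r (x+e) * K r (x+e) - \<Phi> r (x+e) * K1 r (x+e)\<bar> \<le> 1 * ?E + (A + n) * (n / ?T s' * ?E)"
        by linarith
      then show ?thesis unfolding bnd_def by (simp only: distrib_right mult.assoc)
    qed
    have "\<bar>b n r\<bar> \<le> Z / 2 * (bnd n + bnd n)"
      unfolding b_def abs_mult using one[of n] one[of "-n"] n zeta_le[OF sub[OF r]] zeta_nonneg[OF sub[OF r]] Z_nonneg
      by (intro mult_mono) auto
    then show ?thesis by simp
  qed
  have bnd0: "(\<lambda>n. bnd (real n)) \<longlonglongrightarrow> 0"
  proof -
    define p q where "p = ?T s'" and "q = ?T t"
    have "p > 0" "q > 0" using T[of s'] T[of t] s by (auto simp: p_def q_def)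
    then show ?thesis unfolding bnd_def p_def[symmetric] q_def[symmetric] by real_asymp
  qed
  have b_lim: "(\<lambda>n. LBINT r:{s'..t}. b (real n) r) \<longlonglongrightarrow> 0"
  proof (rule Lim_null_comparison)
    show "\<forall>\<^sub>F n in sequentially. norm (LBINT r:{s'..t}. b (real n) r) \<le> Z * bnd (real n) * (t - s')"
      using s b_bd by (intro always_eventually allI) (auto intro!: set_integral_abs_le)
    show "(\<lambda>n. Z * bnd (real n) * (t - s')) \<longlonglongrightarrow> 0"
      using tendsto_mult_left[OF tendsto_mult_right[OF bnd0, of Z], of "t - s'"] by (simp add: mult_ac)
  qed
  have Phi_lim: "(\<lambda>n. LBINT y:{x-real n..x+real n}. \<Phi> q y * K q y) \<longlonglongrightarrow> heat (?T q) (\<Phi> q) x" if "q \<in> {s'..t}" for q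
    unfolding K_def by (rule heat_window_limit[OF Phi_measurable[OF sub[OF that]] T[OF that] A[OF sub[OF that]]])
  have f_bd: "\<bar>f n r\<bar> \<le> Z" if r: "r \<in> {s'..t}" for n r
  proof -
    have [measurable]: "\<Phi>\<^sub>1 r \<in> borel_measurable borel" by (rule Phi1_measurable[OF sub[OF r]])
    have "f n r = \<zeta> r / 2 * \<alpha> r * heat (?T r) (\<lambda>y. indicator {x-real n..x+real n} y * (\<Phi>\<^sub>1 r y)\<^sup>2) x"
      unfolding f_def K_def by (subst heat_window[OF _ T[OF r]]) auto
    moreover have "0 \<le> heat (?T r) (\<lambda>y. indicator {x-real n..x+real n} y * (\<Phi>\<^sub>1 r y)\<^sup>2) x" by (simp add: heat_def)
    moreover have "heat (?T r) (\<lambda>y. indicator {x-real n..x+real n} y * (\<Phi>\<^sub>1 r y)\<^sup>2) x \<le> 1"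
    proof (rule abs_le_D1, rule heat_abs_le)
      show "\<bar>indicator {x-real n..x+real n} y * (\<Phi>\<^sub>1 r y)\<^sup>2\<bar> \<le> 1" for y
        using Phi1_sq_le[OF sub[OF r], of y] by (auto simp: indicator_def)
    qed
    ultimately show ?thesis
      using zeta_alpha_half_bound[OF sub[OF r], of "heat (?T r) (\<lambda>y. indicator {x-real n..x+real n} y * (\<Phi>\<^sub>1 r y)\<^sup>2) x"]
      by (simp only:)
  qed
  have f_lim: "(\<lambda>n. f n r) \<longlonglongrightarrow> g r" if r: "r \<in> {s'..t}" for r
    unfolding f_def g_def K_def
  proof (intro tendsto_mult tendsto_const heat_window_limit[where A=1])
    show "(\<lambda>y. (\<Phi>\<^sub>1 r y)\<^sup>2) \<in> borel_measurable borel" using Phi1_measurable[OF sub[OF r]] by measurable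
    show "\<bar>(\<Phi>\<^sub>1 r y)\<^sup>2\<bar> \<le> 1 + \<bar>y - x\<bar>" for y using Phi1_sq_le[OF sub[OF r], of y] by auto
  qed (rule T[OF r])
  have m: "(\<lambda>r. indicator {s'..t} r * f n r) \<in> borel_measurable lborel" for n
    using f_int[of n] unfolding set_integrable_def by (auto dest: borel_measurable_integrable)
  have lim: "(\<lambda>n. indicator {s'..t} r * f n r) \<longlonglongrightarrow> indicator {s'..t} r * g r" for r
    using f_lim[of r] by (cases "r \<in> {s'..t}") auto
  have m': "(\<lambda>r. indicator {s'..t} r * g r) \<in> borel_measurable lborel"
    by (rule borel_measurable_LIMSEQ_real[OF lim m])
  have w: "integrable lborel (\<lambda>r. Z * indicator {s'..t} r)"
    by (intro integrable_mult_right integrable_real_indicator) (auto simp: emeasure_lborel_Icc_eq)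
  have bd: "AE r in lborel. norm (indicator {s'..t} r * f n r) \<le> Z * indicator {s'..t} r" for n
    using f_bd by (intro AE_I2) (auto simp: indicator_def)
  have i: "integrable lborel (\<lambda>r. indicator {s'..t} r * g r)"
    and l: "(\<lambda>k. \<integral>r. indicator {s'..t} r * f k r \<partial>lborel) \<longlonglongrightarrow> (\<integral>r. indicator {s'..t} r * g r \<partial>lborel)"
    using integrable_dominated_convergence[OF m' m w AE_I2[OF lim] bd]
      integral_dominated_convergence[OF m' m w AE_I2[OF lim] bd] by auto
  show "set_integrable lborel {s'..t} (\<lambda>r. \<zeta> r / 2 * \<alpha> r * heat (?T r) (\<lambda>y. (\<Phi>\<^sub>1 r y)\<^sup>2) x)"
    using i by (simp add: set_integrable_def g_def)
  have "(\<lambda>n. (LBINT y:{x-real n..x+real n}. \<Phi> t y * K t y)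
    + (LBINT r:{s'..t}. f n r) + (LBINT r:{s'..t}. b (real n) r)) \<longlonglongrightarrow> heat (?T t) (\<Phi> t) x + (LBINT r:{s'..t}. g r) + 0"
    using s by (intro tendsto_add b_lim Phi_lim) (use l in \<open>auto simp: set_lebesgue_integral_def\<close>)
  moreover have "(\<lambda>n. LBINT y:{x-real n..x+real n}. \<Phi> s' y * K s' y) \<longlonglongrightarrow> heat (?T s') (\<Phi> s') x"
    using s by (intro Phi_lim) auto
  ultimately show "heat (?T s') (\<Phi> s') x = heat (?T t) (\<Phi> t) x
      + (LBINT r:{s'..t}. \<zeta> r / 2 * \<alpha> r * heat (?T r) (\<lambda>y. (\<Phi>\<^sub>1 r y)\<^sup>2) x)"
    unfolding win g_def by (simp add: LIMSEQ_unique)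
qed

text \<open>The mild form of the PDE: the second derivative is gone and the nonlinear term is an
  average of a function bounded by 1. It arises from the previous lemma as \<open>s'\<close>
  decreases to \<open>s\<close>. The left side concentrates at \<open>x\<close> by joint continuity
  and linear growth, and the bounded integrand passes to the limit in time.\<close>

theorem duhamel:
  assumes s: "0 \<le> s" "s \<le> t" "t \<le> 1"
  shows "\<Phi> s x = heat (\<tau> t - \<tau> s) (\<Phi> t) x
      + (LBINT r:{s..t}. \<zeta> r / 2 * \<alpha> r * heat (\<tau> r - \<tau> s) (\<lambda>y. (\<Phi>\<^sub>1 r y)\<^sup>2) x)"
    and "set_integrable lborel {s..t} (\<lambda>r. \<zeta> r / 2 * \<alpha> r * heat (\<tau> r - \<tau> s) (\<lambda>y. (\<Phi>\<^sub>1 r y)\<^sup>2) x)"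
proof -
  let ?g = "\<lambda>r. \<zeta> r / 2 * \<alpha> r * heat (\<tau> r - \<tau> s) (\<lambda>y. (\<Phi>\<^sub>1 r y)\<^sup>2) x"
  have g_bd: "\<bar>?g r\<bar> \<le> Z" if "r \<in> {s..t}" for r
    using that s by (intro zeta_alpha_half_bound heat_Phi1_sq) auto
  have *: "\<Phi> s x = heat (\<tau> t - \<tau> s) (\<Phi> t) x + (LBINT r:{s..t}. ?g r) \<and> set_integrable lborel {s..t} ?g"
  proof (cases "s = t")
    case True
    have "\<bar>LBINT r:{s..t}. ?g r\<bar> \<le> Z * (t - s)" by (intro set_integral_abs_le g_bd s)
    moreover have "set_integrable lborel {s..t} ?g"
    proof -
      have "(\<lambda>r. indicator {s..t} r * ?g r) = (\<lambda>r. ?g s * indicator {s} r)" using True by (auto simp: indicator_def)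
      then show ?thesis unfolding set_integrable_def real_scaleR_def
        by (simp only:) (intro integrable_mult_right integrable_real_indicator, auto)
    qed
    ultimately show ?thesis using True by simp
  next
    case False
    then have lt: "s < t" using s by simp
    define sk where "sk k = s + (t - s) / (real k + 1)" for k
    have sk: "s < sk k" "sk k \<le> t" for k
    proof -
      have "(t - s) / (real k + 1) \<le> (t - s) / 1" using lt by (intro divide_left_mono) auto
      then show "s < sk k" "sk k \<le> t" using lt by (auto simp: sk_def)
    qed
    have sk_lim: "sk \<longlonglongrightarrow> s" unfolding sk_def by real_asymp
    have "set_integrable lborel {s..t} ?g" and l: "(\<lambda>k. LBINT r:{sk k..t}. ?g r) \<longlonglongrightarrow> (LBINT r:{s..t}. ?g r)"
      using LBINT_left_limit[OF sk_lim sk, of ?g Z] g_bd duhamel_off_start(2)[OF s(1) sk s(3)] by auto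
    obtain A where A0: "A \<ge> 0" and A: "\<And>s y. s \<in> {0..1} \<Longrightarrow> \<bar>\<Phi> s y\<bar> \<le> A + \<bar>y - x\<bar>" using Phi_bound[of x] by blast
    have sk01: "sk k \<in> {0..1}" for k using sk[of k] s by auto
    have "(\<lambda>k. heat (\<tau> (sk k) - \<tau> s) (\<Phi> (sk k)) x) \<longlonglongrightarrow> (LINT z|std_normal_distribution. \<Phi> s x)"
      unfolding heat_def
    proof (rule integral_dominated_convergence)
      show "integrable std_normal_distribution (\<lambda>z. A + sqrt (\<tau> t - \<tau> s) * \<bar>z\<bar>)" by (rule integrable_std_normal_linear)
      show "(\<lambda>z. \<Phi> (sk k) (x + sqrt (\<tau> (sk k) - \<tau> s) * z)) \<in> borel_measurable std_normal_distribution" for k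
        using Phi_measurable[OF sk01[of k]] by measurable
      have tl: "(\<lambda>k. sqrt (\<tau> (sk k) - \<tau> s)) \<longlonglongrightarrow> sqrt (\<tau> s - \<tau> s)"
        by (intro tendsto_intros continuous_on_tendsto_compose[OF tau_cont sk_lim]) (use sk01 s in auto)
      show "AE z in std_normal_distribution. (\<lambda>k. \<Phi> (sk k) (x + sqrt (\<tau> (sk k) - \<tau> s) * z)) \<longlonglongrightarrow> \<Phi> s x"
      proof (rule AE_I2)
        fix z
        have "(\<lambda>k. (sk k, x + sqrt (\<tau> (sk k) - \<tau> s) * z)) \<longlonglongrightarrow> (s, x + sqrt (\<tau> s - \<tau> s) * z)"
          by (intro tendsto_intros sk_lim tl)
        from continuous_on_tendsto_compose[OF Phi_cont this]
        show "(\<lambda>k. \<Phi> (sk k) (x + sqrt (\<tau> (sk k) - \<tau> s) * z)) \<longlonglongrightarrow> \<Phi> s x"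
          using sk01 s by auto
      qed
      show "AE z in std_normal_distribution. norm (\<Phi> (sk k) (x + sqrt (\<tau> (sk k) - \<tau> s) * z)) \<le> A + sqrt (\<tau> t - \<tau> s) * \<bar>z\<bar>" for k
      proof (rule AE_I2)
        fix z
        have "\<tau> s \<le> \<tau> (sk k)" "\<tau> (sk k) \<le> \<tau> t" using sk[of k] s by (auto intro!: tau_le)
        then have "\<bar>sqrt (\<tau> (sk k) - \<tau> s) * z\<bar> \<le> sqrt (\<tau> t - \<tau> s) * \<bar>z\<bar>"
          by (simp add: abs_mult mult_right_mono)
        then show "norm (\<Phi> (sk k) (x + sqrt (\<tau> (sk k) - \<tau> s) * z)) \<le> A + sqrt (\<tau> t - \<tau> s) * \<bar>z\<bar>"
          using A[OF sk01[of k], of "x + sqrt (\<tau> (sk k) - \<tau> s) * z"] by auto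
      qed
    qed simp
    moreover have "(\<lambda>k. heat (\<tau> (sk k) - \<tau> s) (\<Phi> (sk k)) x) \<longlonglongrightarrow> heat (\<tau> t - \<tau> s) (\<Phi> t) x + (LBINT r:{s..t}. ?g r)"
      unfolding duhamel_off_start(1)[OF s(1) sk s(3)] by (intro tendsto_intros l)
    ultimately show ?thesis
      using \<open>set_integrable lborel {s..t} ?g\<close> std_normal.prob_space by (simp add: LIMSEQ_unique)
  qed
  from * show "\<Phi> s x = heat (\<tau> t - \<tau> s) (\<Phi> t) x + (LBINT r:{s..t}. ?g r)" "set_integrable lborel {s..t} ?g" by auto
qed

end

section \<open>Stability of the gradient\<close>

lemma DERIV_abs_le_lipschitz:
  fixes f :: "real \<Rightarrow> real"
  assumes D: "(f has_real_derivative D) (at x)" and L: "\<And>d. \<bar>f (x + d) - f x\<bar> \<le> L * \<bar>d\<bar>"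
  shows "\<bar>D\<bar> \<le> L"
proof -
  have "((\<lambda>h. \<bar>(f (x + h) - f x) / h\<bar>) \<longlongrightarrow> \<bar>D\<bar>) (at 0)"
    using D by (intro tendsto_rabs) (simp add: DERIV_def)
  moreover have "eventually (\<lambda>h. \<bar>(f (x + h) - f x) / h\<bar> \<le> L) (at 0)"
    unfolding eventually_at_filter
    by (rule always_eventually) (use L in \<open>auto simp: abs_divide divide_le_eq\<close>)
  ultimately show ?thesis by (rule tendsto_upperbound) simp
qed

lemma heat_diff:
  assumes [measurable]: "f \<in> borel_measurable borel" "g \<in> borel_measurable borel"
    and f: "\<And>y. \<bar>f y\<bar> \<le> F" and g: "\<And>y. \<bar>g y\<bar> \<le> G"
  shows "heat V (\<lambda>y. a * f y - b * g y) x = a * heat V f x - b * heat V g x"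
proof -
  have "integrable std_normal_distribution (\<lambda>z. f (x + sqrt V * z))"
    by (rule std_normal.integrable_const_bound[where B=F]) (use f in auto)
  moreover have "integrable std_normal_distribution (\<lambda>z. g (x + sqrt V * z))"
    by (rule std_normal.integrable_const_bound[where B=G]) (use g in auto)
  ultimately show ?thesis unfolding heat_def by simp
qed

text \<open>Trades the exponential weight for a rational one, so that the singular time integral has
  an elementary antiderivative.\<close>

lemma exp_neg_le: "0 \<le> x \<Longrightarrow> exp (- x) \<le> 1 / (1 + x)" for x :: real
  using exp_ge_add_one_self[of x] by (simp add: exp_minus inverse_eq_divide frac_le)

locale parisi_pde_pair = parisi_clock \<zeta> \<tau> +
  p: parisi_pde \<zeta> \<tau> \<alpha> \<Phi> \<Phi>\<^sub>1 \<Phi>\<^sub>2 + q: parisi_pde \<zeta> \<tau> \<alpha>' \<Psi> \<Psi>\<^sub>1 \<Psi>\<^sub>2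
  for \<zeta> \<tau> \<alpha> \<Phi> \<Phi>\<^sub>1 \<Phi>\<^sub>2 \<alpha>' \<Psi> \<Psi>\<^sub>1 \<Psi>\<^sub>2
begin

text \<open>By Duhamel's formula the gradient difference satisfies a linear Volterra inequality with the
  weakly singular kernel \<open>1 / sqrt (\<tau> r - \<tau> s)\<close>; an exponential weight makes it a contraction.\<close>

lemma gradient_volterra:
  assumes s: "0 \<le> s" "s < 1" and \<theta>: "\<And>r. r \<in> {0..1} \<Longrightarrow> \<bar>\<alpha> r - \<alpha>' r\<bar> \<le> \<theta>"
    and K: "\<And>r y. r \<in> {0..1} \<Longrightarrow> \<bar>\<Phi>\<^sub>1 r y - \<Psi>\<^sub>1 r y\<bar> \<le> K * exp (64 * (\<tau> 1 - \<tau> r))"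
  shows "\<bar>\<Phi>\<^sub>1 s x - \<Psi>\<^sub>1 s x\<bar> \<le> \<theta> * sqrt (\<tau> 1 - \<tau> s) + K * exp (64 * (\<tau> 1 - \<tau> s)) / 2"
proof -
  let ?T = "\<lambda>r. \<tau> r - \<tau> s"
  define E where "E = exp (64 * (\<tau> 1 - \<tau> s))"
  have \<theta>0: "0 \<le> \<theta>" using \<theta>[of 0] by auto
  have K0: "0 \<le> K" using order_trans[OF abs_ge_zero K[of 0]] by (simp add: zero_le_mult_iff)
  define g where "g r y = \<alpha> r * (\<Phi>\<^sub>1 r y)\<^sup>2 - \<alpha>' r * (\<Psi>\<^sub>1 r y)\<^sup>2" for r y
  define e where "e r x = \<zeta> r / 2 * \<alpha> r * heat (?T r) (\<lambda>y. (\<Phi>\<^sub>1 r y)\<^sup>2) x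
      - \<zeta> r / 2 * \<alpha>' r * heat (?T r) (\<lambda>y. (\<Psi>\<^sub>1 r y)\<^sup>2) x" for r x
  have meas: "(\<lambda>y. (\<Phi>\<^sub>1 r y)\<^sup>2) \<in> borel_measurable borel" "(\<lambda>y. (\<Psi>\<^sub>1 r y)\<^sup>2) \<in> borel_measurable borel" if "r \<in> {0..1}" for r
    using p.Phi1_measurable[OF that] q.Phi1_measurable[OF that] by measurable
  have e_eq: "e r x = \<zeta> r / 2 * heat (?T r) (g r) x" if r: "r \<in> {0..1}" for r x
  proof -
    have "heat (?T r) (g r) x = \<alpha> r * heat (?T r) (\<lambda>y. (\<Phi>\<^sub>1 r y)\<^sup>2) x - \<alpha>' r * heat (?T r) (\<lambda>y. (\<Psi>\<^sub>1 r y)\<^sup>2) x"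
      unfolding g_def by (rule heat_diff[OF meas[OF r], where F=1 and G=1]) (use p.Phi1_sq_le[OF r] q.Phi1_sq_le[OF r] in auto)
    then show ?thesis by (simp add: e_def right_diff_distrib mult.assoc)
  qed
  have e_int: "set_integrable lborel {s..1} (\<lambda>r. e r x)" for x
    unfolding e_def by (intro set_integral_diff p.duhamel q.duhamel) (use s in auto)
  have w: "\<Phi> s x - \<Psi> s x = (LBINT r:{s..1}. e r x)" for x
  proof -
    have "\<Phi> 1 = \<Psi> 1" using p.Phi_terminal q.Phi_terminal by (simp add: fun_eq_iff)
    then have "\<Phi> s x - \<Psi> s x = (LBINT r:{s..1}. \<zeta> r / 2 * \<alpha> r * heat (?T r) (\<lambda>y. (\<Phi>\<^sub>1 r y)\<^sup>2) x)
       - (LBINT r:{s..1}. \<zeta> r / 2 * \<alpha>' r * heat (?T r) (\<lambda>y. (\<Psi>\<^sub>1 r y)\<^sup>2) x)"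
      using p.duhamel(1)[of s 1 x] q.duhamel(1)[of s 1 x] s by simp
    also have "\<dots> = (LBINT r:{s..1}. e r x)"
      unfolding e_def by (rule set_integral_diff(2)[symmetric]; (rule p.duhamel q.duhamel; use s in auto))
    finally show ?thesis .
  qed
  have g_bd: "\<bar>g r y\<bar> \<le> \<theta> + 2 * (K * exp (64 * (\<tau> 1 - \<tau> r)))" if r: "r \<in> {0..1}" for r y
  proof -
    \<comment> \<open>The coefficient difference meets a square bounded by 1, and the gradient
      difference meets a sum of gradients bounded by 2.\<close>
    have "g r y = (\<alpha> r - \<alpha>' r) * (\<Phi>\<^sub>1 r y)\<^sup>2 + \<alpha>' r * ((\<Phi>\<^sub>1 r y - \<Psi>\<^sub>1 r y) * (\<Phi>\<^sub>1 r y + \<Psi>\<^sub>1 r y))"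
      by (simp add: g_def power2_eq_square algebra_simps)
    moreover have "\<bar>(\<alpha> r - \<alpha>' r) * (\<Phi>\<^sub>1 r y)\<^sup>2\<bar> \<le> \<theta> * 1"
      unfolding abs_mult using \<theta>[OF r] p.Phi1_sq_le[OF r, of y] \<theta>0 by (intro mult_mono) auto
    moreover have "\<bar>\<alpha>' r * ((\<Phi>\<^sub>1 r y - \<Psi>\<^sub>1 r y) * (\<Phi>\<^sub>1 r y + \<Psi>\<^sub>1 r y))\<bar> \<le> 1 * (K * exp (64 * (\<tau> 1 - \<tau> r)) * 2)"
      unfolding abs_mult using K[OF r, of y] K0 p.Phi1_le[OF r, of y] q.Phi1_le[OF r, of y] q.alpha_le[of r] q.alpha_nonneg[of r]
      by (intro mult_mono) auto
    ultimately show ?thesis by linarith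
  qed
  \<comment> \<open>Antiderivative in \<open>r\<close> of the singular bound. In the variable
    \<open>T = \<tau> r - \<tau> s\<close>, the function \<open>sqrt T\<close> has derivative
    \<open>1 / (2 * sqrt T)\<close> and \<open>arctan (8 * sqrt T) / 4\<close> has derivative
    \<open>1 / (sqrt T * (1 + 64 * T))\<close>; the factor \<open>\<zeta> r\<close> comes from the
    clock.\<close>
  define J where "J r = \<theta> * sqrt (?T r) + K * E * (arctan (8 * sqrt (?T r)) / 4)" for r
  \<comment> \<open>The kernel is singular at \<open>r = s\<close>. The value chosen there is an
    arbitrary nonnegative number, so that the pointwise comparison below includes the
    endpoint.\<close>
  define J' where "J' r = (if r = s then \<bar>e s x\<bar> else \<zeta> r / 2 * ((\<theta> + 2 * (K * (E / (1 + 64 * ?T r)))) / sqrt (?T r)))" for r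
  have lip: "\<bar>e r (x + d) - e r x\<bar> \<le> \<bar>d\<bar> * (\<zeta> r / 2 * ((\<theta> + 2 * (K * (E / (1 + 64 * ?T r)))) / sqrt (?T r)))"
    if r: "s < r" "r \<le> 1" for r d
  proof -
    have r01: "r \<in> {0..1}" and T: "0 < ?T r" using r s tau_less[of s r] by auto
    have gm: "g r \<in> borel_measurable borel" unfolding g_def using meas[OF r01] by measurable
    have "\<bar>e r (x + d) - e r x\<bar> = \<zeta> r / 2 * \<bar>heat (?T r) (g r) (x + d) - heat (?T r) (g r) x\<bar>"
      using zeta_nonneg[OF r01] unfolding e_eq[OF r01] right_diff_distrib[symmetric] abs_mult by simp
    also have "\<dots> \<le> \<zeta> r / 2 * ((\<theta> + 2 * (K * exp (64 * (\<tau> 1 - \<tau> r)))) * (\<bar>d\<bar> / sqrt (?T r)))"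
      using zeta_nonneg[OF r01] by (intro mult_left_mono heat_shift_bound gm T g_bd r01) auto
    also have "\<dots> \<le> \<zeta> r / 2 * ((\<theta> + 2 * (K * (E / (1 + 64 * ?T r)))) * (\<bar>d\<bar> / sqrt (?T r)))"
    proof -
      have "exp (64 * (\<tau> 1 - \<tau> r)) = E * exp (- (64 * ?T r))" by (simp add: E_def algebra_simps flip: exp_add)
      also have "\<dots> \<le> E * (1 / (1 + 64 * ?T r))" using T by (intro mult_left_mono exp_neg_le) (auto simp: E_def)
      finally have "K * exp (64 * (\<tau> 1 - \<tau> r)) \<le> K * (E / (1 + 64 * ?T r))" using K0 by (intro mult_left_mono) auto
      then show ?thesis using zeta_nonneg[OF r01] T by (intro mult_left_mono mult_right_mono) auto
    qed
    finally show ?thesis by (simp add: mult_ac)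
  qed
  have ct: "continuous_on {s..1} \<tau>" by (rule continuous_on_subset[OF tau_cont]) (use s in auto)
  \<comment> \<open>The gauge integral takes the unbounded derivative directly: continuity of
    \<open>J\<close> up to the endpoints and differentiability inside suffice.\<close>
  have J'_int: "(J' has_integral (J 1 - J s)) {s..1}"
  proof (rule fundamental_theorem_of_calculus_interior)
    show "continuous_on {s..1} J" unfolding J_def by (intro continuous_intros ct) auto
    fix r assume r: "r \<in> {s<..<1}"
    then have T: "0 < ?T r" using s tau_less[of s r] by auto
    have dT: "(?T has_real_derivative \<zeta> r) (at r)"
      using tau_deriv[of r] r s by (auto intro!: derivative_eq_intros)
    have dS: "((\<lambda>r. sqrt (?T r)) has_real_derivative \<zeta> r / (2 * sqrt (?T r))) (at r)"
      by (rule DERIV_cong[OF DERIV_chain2[where f=sqrt and g="?T", OF DERIV_real_sqrt[OF T] dT]]) (use T in \<open>simp add: field_simps\<close>)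
    have dA: "((\<lambda>r. arctan (8 * sqrt (?T r))) has_real_derivative (8 * (\<zeta> r / (2 * sqrt (?T r)))) / (1 + (8 * sqrt (?T r))\<^sup>2)) (at r)"
      by (rule DERIV_cong[OF DERIV_chain2[where f=arctan and g="\<lambda>r. 8 * sqrt (?T r)", OF DERIV_arctan DERIV_cmult[OF dS, of 8]]])
        (simp only: divide_inverse mult.commute)
    have "(J has_real_derivative \<theta> * (\<zeta> r / (2 * sqrt (?T r))) + K * E * ((8 * (\<zeta> r / (2 * sqrt (?T r)))) / (1 + (8 * sqrt (?T r))\<^sup>2) / 4)) (at r)"
      unfolding J_def by (intro DERIV_add DERIV_cmult DERIV_cdivide dS dA)
    moreover have "\<theta> * (\<zeta> r / (2 * sqrt (?T r))) + K * E * ((8 * (\<zeta> r / (2 * sqrt (?T r)))) / (1 + (8 * sqrt (?T r))\<^sup>2) / 4) = J' r"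
    proof -
      have sq: "(8 * sqrt (?T r))\<^sup>2 = 64 * ?T r" using T by (simp add: power_mult_distrib)
      define a b where "a = sqrt (?T r)" and "b = 1 + 64 * ?T r"
      have "a > 0" "b > 0" using T by (auto simp: a_def b_def)
      moreover have "1 + (8 * a)\<^sup>2 = b" unfolding a_def b_def sq ..
      ultimately have "\<theta> * (\<zeta> r / (2 * a)) + K * E * (8 * (\<zeta> r / (2 * a)) / (1 + (8 * a)\<^sup>2) / 4)
          = \<zeta> r / 2 * ((\<theta> + 2 * (K * (E / b))) / a)"
        by (simp only:) (simp add: divide_simps, simp add: algebra_simps)
      then show ?thesis using r by (simp add: J'_def a_def b_def)
    qed
    ultimately show "(J has_vector_derivative J' r) (at r)"
      by (simp add: has_real_derivative_iff_has_vector_derivative)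
  qed (use s in auto)
  have increment_le: "\<bar>(\<Phi> s (x + d) - \<Psi> s (x + d)) - (\<Phi> s x - \<Psi> s x)\<bar> \<le> (J 1 - J s) * \<bar>d\<bar>" for d
  proof -
    define f where "f r = (if r = s then 0 else e r (x + d) - e r x)" for r
    have "set_integrable lborel {s..1} (\<lambda>r. e r (x + d) - e r x)"
      by (intro set_integral_diff e_int)
    then have 1: "((\<lambda>r. e r (x + d) - e r x) has_integral (LBINT r:{s..1}. e r (x + d) - e r x)) {s..1}"
      using set_borel_integral_eq_integral[of "{s..1}" "\<lambda>r. e r (x + d) - e r x"] by (simp add: integrable_integral)
    have f: "(f has_integral (LBINT r:{s..1}. e r (x + d) - e r x)) {s..1}"
      by (rule has_integral_spike_finite[OF _ _ 1, of "{s}"]) (auto simp: f_def)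
    have J: "((\<lambda>r. \<bar>d\<bar> * J' r) has_integral \<bar>d\<bar> * (J 1 - J s)) {s..1}"
      using has_integral_mult_right[OF J'_int] .
    have "norm (integral {s..1} f) \<le> integral {s..1} (\<lambda>r. \<bar>d\<bar> * J' r)"
    proof (rule integral_norm_bound_integral)
      fix r assume "r \<in> {s..1}"
      then show "norm (f r) \<le> \<bar>d\<bar> * J' r" using lip[of r d] by (auto simp: f_def J'_def)
    qed (use f J in \<open>auto intro: has_integral_integrable\<close>)
    then show ?thesis
      using integral_unique[OF f] integral_unique[OF J'_int] w[of "x + d"] w[of x] set_integral_diff(2)[OF e_int e_int]
      by (simp add: mult.commute)
  qed
  have "\<bar>\<Phi>\<^sub>1 s x - \<Psi>\<^sub>1 s x\<bar> \<le> J 1 - J s"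
  proof (rule DERIV_abs_le_lipschitz[where f="\<lambda>x. \<Phi> s x - \<Psi> s x", rotated])
    have "s \<in> {0..1}" using s by simp
    from DERIV_diff[OF p.Phi_deriv[OF this] q.Phi_deriv[OF this]]
    show "((\<lambda>x. \<Phi> s x - \<Psi> s x) has_real_derivative \<Phi>\<^sub>1 s x - \<Psi>\<^sub>1 s x) (at x)" .
    show "\<bar>(\<Phi> s (x + d) - \<Psi> s (x + d)) - (\<Phi> s x - \<Psi> s x)\<bar> \<le> (J 1 - J s) * \<bar>d\<bar>" for d
      by (rule increment_le)
  qed
  also have "\<dots> \<le> \<theta> * sqrt (?T 1) + K * E * (1 / 2)"
  proof -
    \<comment> \<open>Here the rate 64 pays off: an arctangent is below \<open>pi / 2 < 2\<close>,
      so the operator contracts by 1/2.\<close>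
    have "arctan (8 * sqrt (?T 1)) / 4 \<le> 1 / 2" using arctan_ubound[of "8 * sqrt (?T 1)"] pi_less_4 by linarith
    then have "K * E * (arctan (8 * sqrt (?T 1)) / 4) \<le> K * E * (1 / 2)"
      using K0 by (intro mult_left_mono) (auto simp: E_def)
    then show ?thesis by (simp add: J_def)
  qed
  finally show ?thesis by (simp add: E_def)
qed

text \<open>Let \<open>K\<close> be the best constant in the exponentially weighted bound. It is
  finite because both gradients are bounded by 1, so the term \<open>K / 2\<close> from the Volterra
  estimate can be absorbed into the left side. Removing the weight costs the factor
  \<open>exp (64 * (\<tau> 1 - \<tau> 0))\<close>.\<close>

lemma gradient_stability:
  assumes \<theta>: "\<And>r. r \<in> {0..1} \<Longrightarrow> \<bar>\<alpha> r - \<alpha>' r\<bar> \<le> \<theta>" and s: "s \<in> {0..1}"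
  shows "\<bar>\<Phi>\<^sub>1 s x - \<Psi>\<^sub>1 s x\<bar> \<le> 2 * sqrt (\<tau> 1 - \<tau> 0) * exp (64 * (\<tau> 1 - \<tau> 0)) * \<theta>"
proof -
  define D where "D = (\<lambda>(s, x). \<bar>\<Phi>\<^sub>1 s x - \<Psi>\<^sub>1 s x\<bar> * exp (- (64 * (\<tau> 1 - \<tau> s))))"
  define K where "K = Sup (D ` ({0..1} \<times> UNIV))"
  have \<theta>0: "0 \<le> \<theta>" using \<theta>[of 0] by auto
  have exp_le: "exp (- (64 * (\<tau> 1 - \<tau> r))) \<le> 1" if "r \<in> {0..1}" for r using tau_le[of r 1] that by simp
  have "D p \<le> 2" if "p \<in> {0..1} \<times> UNIV" for p
  proof -
    obtain r y where p: "p = (r, y)" "r \<in> {0..1}" using \<open>p \<in> _\<close> by auto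
    have "\<bar>\<Phi>\<^sub>1 r y - \<Psi>\<^sub>1 r y\<bar> * exp (- (64 * (\<tau> 1 - \<tau> r))) \<le> 2 * 1"
      using p.Phi1_le[OF p(2), of y] q.Phi1_le[OF p(2), of y] exp_le[OF p(2)] by (intro mult_mono) auto
    then show ?thesis by (simp add: D_def p(1))
  qed
  then have bdd: "bdd_above (D ` ({0..1} \<times> UNIV))" by (auto intro!: bdd_aboveI[of _ 2])
  have D_eq: "\<bar>\<Phi>\<^sub>1 r y - \<Psi>\<^sub>1 r y\<bar> = D (r, y) * exp (64 * (\<tau> 1 - \<tau> r))" for r y
    by (simp add: D_def mult.assoc flip: exp_add)
  have K: "\<bar>\<Phi>\<^sub>1 r y - \<Psi>\<^sub>1 r y\<bar> \<le> K * exp (64 * (\<tau> 1 - \<tau> r))" if "r \<in> {0..1}" for r y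
    unfolding D_eq K_def using bdd that by (intro mult_right_mono cSup_upper) auto
  have "D p \<le> \<theta> * sqrt (\<tau> 1 - \<tau> 0) + K / 2" if "p \<in> {0..1} \<times> UNIV" for p
  proof -
    obtain r y where p: "p = (r, y)" "r \<in> {0..1}" using \<open>p \<in> _\<close> by auto
    have K0: "0 \<le> K" using order_trans[OF abs_ge_zero K[of 0]] by (simp add: zero_le_mult_iff)
    show ?thesis
    proof (cases "r = 1")
      \<comment> \<open>The Volterra estimate starts before time 1; at time 1 the solutions
        coincide, hence so do their gradients.\<close>
      case True
      have "\<Phi> 1 = \<Psi> 1" using p.Phi_terminal q.Phi_terminal by (simp add: fun_eq_iff)
      then have "\<Phi>\<^sub>1 1 y = \<Psi>\<^sub>1 1 y" using DERIV_unique[OF p.Phi_deriv[of 1 y]] q.Phi_deriv[of 1 y] by simp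
      then show ?thesis using True p K0 \<theta>0 tau_le[of 0 1] by (simp add: D_def)
    next
      case False
      then have "\<bar>\<Phi>\<^sub>1 r y - \<Psi>\<^sub>1 r y\<bar> \<le> \<theta> * sqrt (\<tau> 1 - \<tau> r) + K * exp (64 * (\<tau> 1 - \<tau> r)) / 2"
        using p by (intro gradient_volterra \<theta> K) auto
      then have "D p \<le> (\<theta> * sqrt (\<tau> 1 - \<tau> r) + K * exp (64 * (\<tau> 1 - \<tau> r)) / 2) * exp (- (64 * (\<tau> 1 - \<tau> r)))"
        unfolding D_def p(1) by (auto intro: mult_right_mono)
      also have "\<dots> = \<theta> * sqrt (\<tau> 1 - \<tau> r) * exp (- (64 * (\<tau> 1 - \<tau> r))) + K / 2"
        by (simp add: distrib_right mult.assoc flip: exp_add)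
      also have "\<theta> * sqrt (\<tau> 1 - \<tau> r) * exp (- (64 * (\<tau> 1 - \<tau> r))) \<le> \<theta> * sqrt (\<tau> 1 - \<tau> 0) * 1"
        using \<theta>0 tau_le[of 0 r] tau_le[of r 1] p by (intro mult_mono exp_le) auto
      finally show ?thesis by simp
    qed
  qed
  then have "K \<le> \<theta> * sqrt (\<tau> 1 - \<tau> 0) + K / 2" unfolding K_def by (intro cSup_least) auto
  then have K2: "K \<le> 2 * sqrt (\<tau> 1 - \<tau> 0) * \<theta>" by (simp add: mult_ac)
  have "\<bar>\<Phi>\<^sub>1 s x - \<Psi>\<^sub>1 s x\<bar> \<le> K * exp (64 * (\<tau> 1 - \<tau> s))" by (rule K[OF s])
  also have "\<dots> \<le> 2 * sqrt (\<tau> 1 - \<tau> 0) * \<theta> * exp (64 * (\<tau> 1 - \<tau> 0))"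
    using K2 \<theta>0 tau_le[of 0 s] tau_le[of 0 1] s by (intro mult_mono) auto
  finally show ?thesis by (simp add: mult_ac)
qed

end

section \<open>Mean-square limits and Brownian increments\<close>

text \<open>Mean-square convergence to 0, phrased with the nonnegative integral: it makes sense
  before integrability is known and matches \<open>has_stochastic_integral\<close>. It is used over
  \<open>P\<close> and over \<open>lborel\<close>, the two sides of the isometry.\<close>

definition L2_null :: "'b measure \<Rightarrow> (nat \<Rightarrow> 'b \<Rightarrow> real) \<Rightarrow> bool" where
  "L2_null M f \<longleftrightarrow> (\<forall>k. f k \<in> borel_measurable M) \<and> (\<lambda>k. \<integral>\<^sup>+x. ennreal ((f k x)\<^sup>2) \<partial>M) \<longlonglongrightarrow> 0"

lemma L2_null_measurable: "L2_null M f \<Longrightarrow> f k \<in> borel_measurable M"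
  by (simp add: L2_null_def)

lemma ennreal_tendsto_0_bound:
  fixes f g :: "nat \<Rightarrow> ennreal"
  assumes "\<And>k. f k \<le> g k" "g \<longlonglongrightarrow> 0"
  shows "f \<longlonglongrightarrow> 0"
  by (rule tendsto_sandwich[where f="\<lambda>_. 0" and h=g]) (use assms in auto)

lemma L2_null_mono:
  assumes "L2_null M g" "\<And>k. f k \<in> borel_measurable M" "\<And>k x. x \<in> space M \<Longrightarrow> \<bar>f k x\<bar> \<le> \<bar>g k x\<bar>"
  shows "L2_null M f"
proof -
  have le: "(\<integral>\<^sup>+x. ennreal ((f k x)\<^sup>2) \<partial>M) \<le> (\<integral>\<^sup>+x. ennreal ((g k x)\<^sup>2) \<partial>M)" for k
    using assms(3) by (intro nn_integral_mono ennreal_leI) (simp add: abs_le_square_iff)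
  have "(\<lambda>k. \<integral>\<^sup>+x. ennreal ((f k x)\<^sup>2) \<partial>M) \<longlonglongrightarrow> 0"
    by (rule ennreal_tendsto_0_bound[OF le]) (use assms(1) in \<open>simp add: L2_null_def\<close>)
  then show ?thesis using assms(2) by (simp add: L2_null_def)
qed

lemma L2_null_add:
  assumes f: "L2_null M f" and g: "L2_null M g"
  shows "L2_null M (\<lambda>k x. f k x + g k x)"
proof -
  note [measurable] = L2_null_measurable[OF f] L2_null_measurable[OF g]
  have le: "(\<integral>\<^sup>+x. ennreal ((f k x + g k x)\<^sup>2) \<partial>M)
      \<le> 2 * (\<integral>\<^sup>+x. ennreal ((f k x)\<^sup>2) \<partial>M) + 2 * (\<integral>\<^sup>+x. ennreal ((g k x)\<^sup>2) \<partial>M)" for k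
  proof -
    have "ennreal ((f k x + g k x)\<^sup>2) \<le> 2 * ennreal ((f k x)\<^sup>2) + 2 * ennreal ((g k x)\<^sup>2)" for x
    proof -
      have "(f k x + g k x)\<^sup>2 \<le> 2 * (f k x)\<^sup>2 + 2 * (g k x)\<^sup>2"
        using zero_le_power2[of "f k x - g k x"] by (simp add: power2_eq_square algebra_simps)
      then have "ennreal ((f k x + g k x)\<^sup>2) \<le> ennreal (2 * (f k x)\<^sup>2 + 2 * (g k x)\<^sup>2)" by (rule ennreal_leI)
      also have "\<dots> = 2 * ennreal ((f k x)\<^sup>2) + 2 * ennreal ((g k x)\<^sup>2)"
        by (simp add: ennreal_mult)
      finally show ?thesis .
    qed
    then have "(\<integral>\<^sup>+x. ennreal ((f k x + g k x)\<^sup>2) \<partial>M) \<le> (\<integral>\<^sup>+x. 2 * ennreal ((f k x)\<^sup>2) + 2 * ennreal ((g k x)\<^sup>2) \<partial>M)"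
      by (intro nn_integral_mono) auto
    also have "\<dots> = 2 * (\<integral>\<^sup>+x. ennreal ((f k x)\<^sup>2) \<partial>M) + 2 * (\<integral>\<^sup>+x. ennreal ((g k x)\<^sup>2) \<partial>M)"
      by (subst nn_integral_add) (auto simp: nn_integral_cmult)
    finally show ?thesis .
  qed
  have "(\<lambda>k. 2 * (\<integral>\<^sup>+x. ennreal ((f k x)\<^sup>2) \<partial>M) + 2 * (\<integral>\<^sup>+x. ennreal ((g k x)\<^sup>2) \<partial>M)) \<longlonglongrightarrow> 2 * 0 + 2 * 0"
    using f g unfolding L2_null_def
    by (intro tendsto_add ennreal_tendsto_cmult) auto
  then have "(\<lambda>k. \<integral>\<^sup>+x. ennreal ((f k x + g k x)\<^sup>2) \<partial>M) \<longlonglongrightarrow> 0"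
    by (intro ennreal_tendsto_0_bound[OF le]) simp
  then show ?thesis by (simp add: L2_null_def)
qed

lemma L2_null_uminus: "L2_null M f \<Longrightarrow> L2_null M (\<lambda>k x. - f k x)"
  using L2_null_mono[of M f "\<lambda>k x. - f k x"] by (simp add: L2_null_measurable)

lemma L2_null_diff:
  assumes f: "L2_null M f" and g: "L2_null M g"
  shows "L2_null M (\<lambda>k x. f k x - g k x)"
  using L2_null_add[OF f L2_null_uminus[OF g]] by simp

lemma L2_null_integral:
  assumes "L2_null M f" "\<And>k. integrable M (\<lambda>x. (f k x)\<^sup>2)"
  shows "(\<lambda>k. LINT x|M. (f k x)\<^sup>2) \<longlonglongrightarrow> 0"
proof -
  have "(\<integral>\<^sup>+x. ennreal ((f k x)\<^sup>2) \<partial>M) = ennreal (LINT x|M. (f k x)\<^sup>2)" for k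
    by (rule nn_integral_eq_integral) (use assms in auto)
  then have "(\<lambda>k. ennreal (LINT x|M. (f k x)\<^sup>2)) \<longlonglongrightarrow> ennreal 0" using assms(1) by (simp add: L2_null_def)
  then show ?thesis by (subst (asm) tendsto_ennreal_iff) auto
qed

text \<open>Young's inequality bounds the difference of squares by
  \<open>(1 + 1 / \<epsilon>) * (f - g)^2 + \<epsilon> * g^2\<close>; the first part tends to 0 for
  fixed \<open>\<epsilon>\<close>, the second is small by the choice of
  \<open>\<epsilon>\<close>.\<close>

lemma L2_null_norm_convergence:
  assumes d: "L2_null M (\<lambda>k x. f k x - g x)" and fi: "\<And>k. integrable M (\<lambda>x. (f k x)\<^sup>2)"
    and gi: "integrable M (\<lambda>x. (g x)\<^sup>2)" and [measurable]: "\<And>k. f k \<in> borel_measurable M" "g \<in> borel_measurable M"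
  shows "(\<lambda>k. LINT x|M. (f k x)\<^sup>2) \<longlonglongrightarrow> (LINT x|M. (g x)\<^sup>2)"
proof (rule LIMSEQ_I)
  let ?G = "LINT x|M. (g x)\<^sup>2" and ?D = "\<lambda>k. LINT x|M. (f k x - g x)\<^sup>2"
  have di: "integrable M (\<lambda>x. (f k x - g x)\<^sup>2)" for k
  proof (rule Bochner_Integration.integrable_bound)
    show "integrable M (\<lambda>x. 2 * (f k x)\<^sup>2 + 2 * (g x)\<^sup>2)" using fi gi by auto
    show "AE x in M. norm ((f k x - g x)\<^sup>2) \<le> norm (2 * (f k x)\<^sup>2 + 2 * (g x)\<^sup>2)"
    proof (rule AE_I2)
      fix x
      have "(f k x - g x)\<^sup>2 \<le> 2 * (f k x)\<^sup>2 + 2 * (g x)\<^sup>2"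
        using zero_le_power2[of "f k x + g x"] by (simp add: power2_eq_square algebra_simps)
      then show "norm ((f k x - g x)\<^sup>2) \<le> norm (2 * (f k x)\<^sup>2 + 2 * (g x)\<^sup>2)" by simp
    qed
  qed measurable
  have D: "?D \<longlonglongrightarrow> 0" by (rule L2_null_integral[OF d di])
  fix r :: real assume r: "0 < r"
  \<comment> \<open>Makes \<open>\<epsilon> * ?G < r / 2\<close>; the summand 1 guards against
    \<open>?G = 0\<close>.\<close>
  define \<epsilon> where "\<epsilon> = r / (2 * (?G + 1))"
  have G0: "0 \<le> ?G" by simp
  have \<epsilon>: "\<epsilon> > 0" "\<epsilon> * ?G < r / 2"
  proof -
    have G1: "0 < ?G + 1" using G0 by linarith
    then show "\<epsilon> > 0" unfolding \<epsilon>_def using r by (intro divide_pos_pos mult_pos_pos) auto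
    have "\<epsilon> * ?G = r / 2 * (?G / (?G + 1))" by (simp add: \<epsilon>_def)
    also have "\<dots> < r / 2 * 1" using r G1 by (intro mult_strict_left_mono) (simp_all add: divide_less_eq)
    finally show "\<epsilon> * ?G < r / 2" by simp
  qed
  have "0 < r / (2 * (1 + 1 / \<epsilon>))" using r \<epsilon> by (simp add: add_pos_pos)
  from LIMSEQ_D[OF D this] obtain N where N: "\<And>k. k \<ge> N \<Longrightarrow> norm (?D k - 0) < r / (2 * (1 + 1 / \<epsilon>))" by blast
  show "\<exists>N. \<forall>k\<ge>N. norm ((LINT x|M. (f k x)\<^sup>2) - ?G) < r"
  proof (intro exI allI impI)
    fix k assume k: "k \<ge> N"
    have pt: "\<bar>(f k x)\<^sup>2 - (g x)\<^sup>2\<bar> \<le> (1 + 1 / \<epsilon>) * (f k x - g x)\<^sup>2 + \<epsilon> * (g x)\<^sup>2" for x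
    proof -
      let ?d = "f k x - g x"
      have e: "(f k x)\<^sup>2 - (g x)\<^sup>2 = ?d\<^sup>2 + 2 * (g x * ?d)" by (simp add: power2_eq_square algebra_simps)
      have "0 \<le> (\<bar>?d\<bar> - \<epsilon> * \<bar>g x\<bar>)\<^sup>2 / \<epsilon>" using \<epsilon> by simp
      also have "\<dots> = ?d\<^sup>2 / \<epsilon> - 2 * (\<bar>g x\<bar> * \<bar>?d\<bar>) + \<epsilon> * (g x)\<^sup>2"
        using \<epsilon> by (simp add: power2_diff power_mult_distrib add_divide_distrib diff_divide_distrib) (simp add: power2_eq_square)
      finally have "\<bar>2 * (g x * ?d)\<bar> \<le> ?d\<^sup>2 / \<epsilon> + \<epsilon> * (g x)\<^sup>2" by (simp add: abs_mult)
      moreover have "(1 + 1 / \<epsilon>) * ?d\<^sup>2 = ?d\<^sup>2 + ?d\<^sup>2 / \<epsilon>" by (simp add: distrib_right)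
      moreover have "\<bar>(f k x)\<^sup>2 - (g x)\<^sup>2\<bar> \<le> ?d\<^sup>2 + \<bar>2 * (g x * ?d)\<bar>" unfolding e using zero_le_power2[of ?d] by linarith
      ultimately show ?thesis by linarith
    qed
    have "norm ((LINT x|M. (f k x)\<^sup>2) - ?G) = \<bar>LINT x|M. (f k x)\<^sup>2 - (g x)\<^sup>2\<bar>"
      using fi gi by simp
    also have "\<dots> \<le> (LINT x|M. \<bar>(f k x)\<^sup>2 - (g x)\<^sup>2\<bar>)" by (rule integral_abs_bound)
    also have "\<dots> \<le> (LINT x|M. (1 + 1 / \<epsilon>) * (f k x - g x)\<^sup>2 + \<epsilon> * (g x)\<^sup>2)"
      using pt fi gi di by (intro integral_mono) auto
    also have "\<dots> = (1 + 1 / \<epsilon>) * ?D k + \<epsilon> * ?G" using di gi by simp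
    also have "\<dots> < (1 + 1 / \<epsilon>) * (r / (2 * (1 + 1 / \<epsilon>))) + r / 2"
    proof -
      have "?D k < r / (2 * (1 + 1 / \<epsilon>))" using N[OF k] by simp
      then have "(1 + 1 / \<epsilon>) * ?D k < (1 + 1 / \<epsilon>) * (r / (2 * (1 + 1 / \<epsilon>)))"
        using \<epsilon> by (intro mult_strict_left_mono) (auto simp: add_pos_pos)
      then show ?thesis using \<epsilon> by linarith
    qed
    also have "\<dots> = r"
    proof -
      have "1 + 1 / \<epsilon> > 0" using \<epsilon> by (simp add: add_pos_pos)
      then show ?thesis by (simp add: divide_simps)
    qed
    finally show "norm ((LINT x|M. (f k x)\<^sup>2) - ?G) < r" .
  qed
qed

lemma iexp_lipschitz: "cmod (iexp a - iexp b) \<le> \<bar>a - b\<bar>"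
proof -
  have "iexp a - iexp b = iexp b * (iexp (a - b) - 1)"
    by (simp add: algebra_simps flip: exp_add)
  then have "cmod (iexp a - iexp b) = cmod (iexp (a - b) - 1)" by (simp add: norm_mult)
  also have "\<dots> \<le> \<bar>a - b\<bar>" using iexp_approx1[of "a - b" 0] by simp
  finally show ?thesis .
qed

text \<open>The exponential is Lipschitz, and
  \<open>\<bar>d\<bar> \<le> \<epsilon> + d^2 / \<epsilon>\<close> turns a first moment into a
  second one. The bounded weight \<open>g\<close> will be the indicator of a past event, so the
  limit keeps conditional information.\<close>

lemma (in prob_space) L2_null_char_convergence:
  fixes g :: "'a \<Rightarrow> complex"
  assumes d: "L2_null M (\<lambda>k \<omega>. Y k \<omega> - X \<omega>)" and [measurable]: "\<And>k. Y k \<in> borel_measurable M" "X \<in> borel_measurable M"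
    and g[measurable]: "g \<in> borel_measurable M" and gb: "\<And>\<omega>. cmod (g \<omega>) \<le> 1"
  shows "(\<lambda>k. LINT \<omega>|M. g \<omega> * iexp (l * Y k \<omega>)) \<longlonglongrightarrow> (LINT \<omega>|M. g \<omega> * iexp (l * X \<omega>))"
proof (rule LIMSEQ_I)
  fix r :: real assume r: "0 < r"
  define \<epsilon> where "\<epsilon> = r / (2 * (\<bar>l\<bar> + 1))"
  have \<epsilon>: "\<epsilon> > 0" "\<bar>l\<bar> * \<epsilon> < r / 2" using r by (auto simp: \<epsilon>_def field_simps)
  let ?D = "\<lambda>k. \<integral>\<^sup>+\<omega>. ennreal ((Y k \<omega> - X \<omega>)\<^sup>2) \<partial>M"
  have "?D \<longlonglongrightarrow> 0" using d by (simp add: L2_null_def)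
  moreover have "0 < ennreal (\<epsilon> * r / (2 * (\<bar>l\<bar> + 1)))" using r \<epsilon> by (simp add: ennreal_less_zero_iff)
  ultimately have "eventually (\<lambda>k. ?D k < ennreal (\<epsilon> * r / (2 * (\<bar>l\<bar> + 1)))) sequentially"
    by (rule order_tendstoD)
  then obtain N where N: "\<And>k. k \<ge> N \<Longrightarrow> ?D k < ennreal (\<epsilon> * r / (2 * (\<bar>l\<bar> + 1)))"
    unfolding eventually_sequentially by blast
  show "\<exists>N. \<forall>k\<ge>N. norm ((LINT \<omega>|M. g \<omega> * iexp (l * Y k \<omega>)) - (LINT \<omega>|M. g \<omega> * iexp (l * X \<omega>))) < r"
  proof (intro exI allI impI)
    fix k assume k: "k \<ge> N"
    have Di: "integrable M (\<lambda>\<omega>. (Y k \<omega> - X \<omega>)\<^sup>2)"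
      by (rule integrableI_nonneg) (use N[OF k] in \<open>auto intro: less_trans\<close>)
    have D: "(LINT \<omega>|M. (Y k \<omega> - X \<omega>)\<^sup>2) < \<epsilon> * r / (2 * (\<bar>l\<bar> + 1))"
      using N[OF k] r \<epsilon> by (subst (asm) nn_integral_eq_integral[OF Di]) (auto simp: ennreal_less_iff)
    have i: "integrable M (\<lambda>\<omega>. g \<omega> * iexp (l * Z \<omega>))" if [measurable]: "Z \<in> borel_measurable M" for Z
      by (rule integrable_const_bound[where B=1]) (use gb in \<open>auto simp: norm_mult\<close>)
    have pt: "norm (g \<omega> * iexp (l * Y k \<omega>) - g \<omega> * iexp (l * X \<omega>)) \<le> \<bar>l\<bar> * (\<epsilon> + (Y k \<omega> - X \<omega>)\<^sup>2 / \<epsilon>)" for \<omega>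
    proof -
      let ?d = "Y k \<omega> - X \<omega>"
      have "norm (g \<omega> * iexp (l * Y k \<omega>) - g \<omega> * iexp (l * X \<omega>)) = cmod (g \<omega>) * cmod (iexp (l * Y k \<omega>) - iexp (l * X \<omega>))"
        by (simp only: right_diff_distrib[symmetric] norm_mult)
      also have "\<dots> \<le> 1 * \<bar>l * Y k \<omega> - l * X \<omega>\<bar>" by (intro mult_mono gb iexp_lipschitz) auto
      also have "\<dots> = \<bar>l\<bar> * \<bar>?d\<bar>" by (simp only: right_diff_distrib[symmetric] abs_mult mult_1)
      also have "\<bar>?d\<bar> \<le> \<epsilon> + ?d\<^sup>2 / \<epsilon>"
      proof (cases "\<bar>?d\<bar> \<le> \<epsilon>")
        case False
        then have "\<bar>?d\<bar> * \<epsilon> \<le> \<bar>?d\<bar> * \<bar>?d\<bar>" by (intro mult_left_mono) auto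
        then have "\<bar>?d\<bar> \<le> ?d\<^sup>2 / \<epsilon>" using \<epsilon> by (simp add: le_divide_eq power2_eq_square)
        then show ?thesis using \<epsilon> by linarith
      qed (use \<epsilon> in \<open>simp add: add_increasing2\<close>)
      finally show ?thesis by (simp add: mult_left_mono)
    qed
    have "norm ((LINT \<omega>|M. g \<omega> * iexp (l * Y k \<omega>)) - (LINT \<omega>|M. g \<omega> * iexp (l * X \<omega>)))
        = norm (LINT \<omega>|M. g \<omega> * iexp (l * Y k \<omega>) - g \<omega> * iexp (l * X \<omega>))"
      by (rule arg_cong[where f=norm], rule Bochner_Integration.integral_diff[symmetric]; rule i) measurable
    also have "\<dots> \<le> (LINT \<omega>|M. norm (g \<omega> * iexp (l * Y k \<omega>) - g \<omega> * iexp (l * X \<omega>)))"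
      by (rule integral_norm_bound)
    also have "\<dots> \<le> (LINT \<omega>|M. \<bar>l\<bar> * (\<epsilon> + (Y k \<omega> - X \<omega>)\<^sup>2 / \<epsilon>))"
    proof (rule integral_mono[OF _ _ pt])
      show "integrable M (\<lambda>\<omega>. norm (g \<omega> * iexp (l * Y k \<omega>) - g \<omega> * iexp (l * X \<omega>)))"
        by (intro integrable_norm Bochner_Integration.integrable_diff; rule i) measurable
      show "integrable M (\<lambda>\<omega>. \<bar>l\<bar> * (\<epsilon> + (Y k \<omega> - X \<omega>)\<^sup>2 / \<epsilon>))" using Di by auto
    qed
    also have "\<dots> = \<bar>l\<bar> * \<epsilon> + \<bar>l\<bar> / \<epsilon> * (LINT \<omega>|M. (Y k \<omega> - X \<omega>)\<^sup>2)"
      using Di prob_space by (simp add: distrib_left)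
    also have "\<dots> < r / 2 + r / 2"
    proof -
      have "\<bar>l\<bar> / \<epsilon> * (LINT \<omega>|M. (Y k \<omega> - X \<omega>)\<^sup>2) \<le> \<bar>l\<bar> / \<epsilon> * (\<epsilon> * r / (2 * (\<bar>l\<bar> + 1)))"
        using D \<epsilon> by (intro mult_left_mono) auto
      also have "\<dots> = r / 2 * (\<bar>l\<bar> / (\<bar>l\<bar> + 1))" using \<epsilon> by simp
      also have "\<dots> \<le> r / 2 * 1" using r by (intro mult_left_mono) auto
      finally show ?thesis using \<epsilon>(2) by linarith
    qed
    finally show "norm ((LINT \<omega>|M. g \<omega> * iexp (l * Y k \<omega>)) - (LINT \<omega>|M. g \<omega> * iexp (l * X \<omega>))) < r" by simp
  qed
qed

section \<open>Brownian increments relative to the filtration\<close>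

locale filtered_brownian = prob_space P for P :: "'a measure" +
  fixes F :: "real \<Rightarrow> 'a measure" and B :: "real \<Rightarrow> 'a \<Rightarrow> real"
  assumes filtration: "usual_filtered_space P F" and brownian: "brownian_motion P F B"
begin

lemma F_subalgebra: "0 \<le> t \<Longrightarrow> subalgebra P (F t)"
  using filtration by (simp add: usual_filtered_space_def)

lemma space_F: "0 \<le> t \<Longrightarrow> space (F t) = space P"
  using F_subalgebra[of t] unfolding subalgebra_def by blast

lemma F_mono:
  assumes "0 \<le> s" "s \<le> t"
  shows "subalgebra (F t) (F s)"
proof -
  have "sets (F s) \<subseteq> sets (F t)"
    using filtration assms unfolding usual_filtered_space_def by blast
  then show ?thesis using assms by (simp add: subalgebra_def space_F)
qed

lemma F_measurable_mono: "f \<in> measurable (F s) N \<Longrightarrow> 0 \<le> s \<Longrightarrow> s \<le> t \<Longrightarrow> f \<in> measurable (F t) N"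
  by (rule measurable_from_subalg[OF F_mono])

lemma F_measurable: "f \<in> measurable (F s) N \<Longrightarrow> 0 \<le> s \<Longrightarrow> f \<in> measurable P N"
  by (rule measurable_from_subalg[OF F_subalgebra])

lemma B_adapted:
  assumes "0 \<le> s" "s \<le> t"
  shows "B s \<in> borel_measurable (F t)"
proof -
  have "B s \<in> borel_measurable (F s)"
    using brownian assms(1) unfolding brownian_motion_def by blast
  then show ?thesis using assms by (rule F_measurable_mono)
qed

lemma B_measurable: "0 \<le> s \<Longrightarrow> B s \<in> borel_measurable P"
  using F_measurable[OF B_adapted[of s s]] by simp

lemma increment_distributed: "0 \<le> s \<Longrightarrow> s < t \<Longrightarrow>
    distributed P lborel (\<lambda>\<omega>. B t \<omega> - B s \<omega>) (normal_density 0 (sqrt (t - s)))"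
  using brownian unfolding brownian_motion_def by blast

lemma increment_indep:
  fixes g :: "'a \<Rightarrow> 'b::{real_normed_field, banach, second_countable_topology}" and h :: "real \<Rightarrow> 'b"
  assumes st: "0 \<le> s" "s \<le> t" and g: "g \<in> borel_measurable (F s)" "integrable P g"
    and h[measurable]: "h \<in> borel_measurable borel" and hi: "integrable P (\<lambda>\<omega>. h (B t \<omega> - B s \<omega>))"
  shows "integrable P (\<lambda>\<omega>. g \<omega> * h (B t \<omega> - B s \<omega>))"
    and "(LINT \<omega>|P. g \<omega> * h (B t \<omega> - B s \<omega>)) = (LINT \<omega>|P. g \<omega>) * (LINT \<omega>|P. h (B t \<omega> - B s \<omega>))"
proof -
  let ?X = "\<lambda>\<omega>. B t \<omega> - B s \<omega>"
  have *: "integrable P (\<lambda>\<omega>. g \<omega> * h (?X \<omega>)) \<and>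
    (LINT \<omega>|P. g \<omega> * h (?X \<omega>)) = (LINT \<omega>|P. g \<omega>) * (LINT \<omega>|P. h (?X \<omega>))"
  proof (cases "s = t")
    case True
    then show ?thesis using g prob_space by simp
  next
    case False
    then have ind: "indep_set (sets (F s)) (sets (vimage_algebra (space P) ?X borel))"
      using brownian st unfolding brownian_motion_def by (metis less_le)
    have [measurable]: "?X \<in> borel_measurable P" using B_measurable[of s] B_measurable[of t] st by simp
    note sp = space_F[OF st(1)]
    have "indep_set (sigma_sets (space P) {g -` A \<inter> space P |A. A \<in> sets borel})
       (sigma_sets (space P) {(\<lambda>\<omega>. h (?X \<omega>)) -` A \<inter> space P |A. A \<in> sets borel})"
      unfolding indep_set_def
    proof (rule indep_sets_mono_sets[OF ind[unfolded indep_set_def]])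
      have 1: "sigma_sets (space P) {g -` A \<inter> space P |A. A \<in> sets borel} \<subseteq> sets (F s)"
        unfolding sp[symmetric] by (rule sets.sigma_sets_subset) (use g(1) in \<open>auto intro: measurable_sets\<close>)
      have 2: "sigma_sets (space P) {(\<lambda>\<omega>. h (?X \<omega>)) -` A \<inter> space P |A. A \<in> sets borel} \<subseteq> sets (vimage_algebra (space P) ?X borel)"
      proof -
        have "(\<lambda>\<omega>. h (?X \<omega>)) -` A \<inter> space P \<in> sets (vimage_algebra (space P) ?X borel)" if "A \<in> sets borel" for A
        proof -
          have "h -` A \<in> sets borel" using measurable_sets[OF h that] by simp
          from in_vimage_algebra[OF this, of ?X "space P"] show ?thesis by (simp add: vimage_def)
        qed
        then show ?thesis
          using sets.sigma_sets_subset[of "{(\<lambda>\<omega>. h (?X \<omega>)) -` A \<inter> space P |A. A \<in> sets borel}" "vimage_algebra (space P) ?X borel"]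
          by auto
      qed
      show "case_bool (sigma_sets (space P) {g -` A \<inter> space P |A. A \<in> sets borel})
          (sigma_sets (space P) {(\<lambda>\<omega>. h (?X \<omega>)) -` A \<inter> space P |A. A \<in> sets borel}) i
        \<subseteq> case_bool (sets (F s)) (sets (vimage_algebra (space P) ?X borel)) i" for i
        using 1 2 by (cases i) auto
    qed
    then have iv: "indep_var borel g borel (\<lambda>\<omega>. h (?X \<omega>))"
      unfolding indep_var_eq using F_measurable[OF g(1) st(1)] by simp
    show ?thesis using indep_var_integrable[OF iv g(2) hi] indep_var_lebesgue_integral[OF iv g(2) hi] by simp
  qed
  from * show "integrable P (\<lambda>\<omega>. g \<omega> * h (?X \<omega>))"
    "(LINT \<omega>|P. g \<omega> * h (?X \<omega>)) = (LINT \<omega>|P. g \<omega>) * (LINT \<omega>|P. h (?X \<omega>))" by auto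
qed

lemma increment_char:
  assumes st: "0 \<le> s" "s \<le> t"
  shows "(LINT \<omega>|P. iexp (l * (B t \<omega> - B s \<omega>))) = complex_of_real (exp (- (l\<^sup>2 * (t - s) / 2)))"
proof (cases "s = t")
  case True
  then show ?thesis using prob_space by simp
next
  case False
  then have lt: "0 < t - s" using st by simp
  let ?Z = "\<lambda>\<omega>. (B t \<omega> - B s \<omega> - 0) / sqrt (t - s)"
  have d: "distributed P lborel ?Z std_normal_density"
    using increment_distributed[of s t] st lt by (subst normal_standard_normal_convert[symmetric]) auto
  have [measurable]: "?Z \<in> borel_measurable P" using B_measurable[of s] B_measurable[of t] st by simp
  have "(LINT \<omega>|P. iexp (l * (B t \<omega> - B s \<omega>))) = (LINT \<omega>|P. iexp (l * sqrt (t - s) * ?Z \<omega>))"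
    using lt by simp
  also have "\<dots> = (LINT x|distr P lborel ?Z. iexp (l * sqrt (t - s) * x))"
    by (subst integral_distr) (use \<open>?Z \<in> borel_measurable P\<close> in auto)
  also have "distr P lborel ?Z = density lborel std_normal_density" using d by (simp add: distributed_def)
  also have "(LINT x|density lborel std_normal_density. iexp (l * sqrt (t - s) * x)) = char std_normal_distribution (l * sqrt (t - s))"
    by (simp add: char_def mult_ac)
  also have "\<dots> = complex_of_real (exp (- (l\<^sup>2 * (t - s) / 2)))"
    using lt by (simp add: char_std_normal_distribution power_mult_distrib)
  finally show ?thesis .
qed

lemma step_integral_measurable:
  assumes "mono_on {..n} t" "0 \<le> t 0"
  shows "step_integral B n t c \<in> borel_measurable (F (t n))"
proof -
  have ge: "0 \<le> t i" if "i \<le> n" for i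
    using mono_onD[OF assms(1), of 0 i] that assms(2) by auto
  have "B (t i) \<in> borel_measurable (F (t n))" if "i \<le> n" for i
    using B_adapted[OF ge[OF that], of "t n"] mono_onD[OF assms(1), of i n] that by auto
  then show ?thesis unfolding step_integral_def
    by (intro borel_measurable_sum borel_measurable_times borel_measurable_diff) auto
qed

text \<open>Induction on the number of steps: \<open>g\<close> times the exponential of the earlier
  increments is measurable at time \<open>t n\<close>, so the last increment factors out. Each step
  contributes its Gaussian exponent, and these add up to the squared L2 norm of the step
  function.\<close>

lemma step_integral_char:
  fixes g :: "'a \<Rightarrow> complex"
  assumes s: "0 \<le> s" and t: "mono_on {..n} t" "\<And>i. i \<le> n \<Longrightarrow> s \<le> t i"
    and g: "g \<in> borel_measurable (F s)" "\<And>\<omega>. cmod (g \<omega>) \<le> 1"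
  shows "(LINT \<omega>|P. g \<omega> * iexp (l * step_integral B n t c \<omega>))
      = (LINT \<omega>|P. g \<omega>) * complex_of_real (exp (- (l\<^sup>2 * (\<Sum>i<n. (c i)\<^sup>2 * (t (Suc i) - t i)) / 2)))"
  using t
proof (induction n)
  case 0
  then show ?case by (simp add: step_integral_def)
next
  case (Suc n)
  have m: "mono_on {..n} t" using Suc.prems(1) by (rule mono_on_subset) auto
  have tn: "0 \<le> t n" "t n \<le> t (Suc n)" "s \<le> t n" "0 \<le> t 0"
    using Suc.prems(2)[of n] Suc.prems(2)[of 0] mono_onD[OF Suc.prems(1), of n "Suc n"] s by auto
  let ?g = "\<lambda>\<omega>. g \<omega> * iexp (l * step_integral B n t c \<omega>)"
  have gm: "?g \<in> borel_measurable (F (t n))"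
    using F_measurable_mono[OF g(1) s tn(3)] step_integral_measurable[OF m tn(4), of c] by measurable
  have gi: "integrable P ?g"
    by (rule integrable_const_bound[where B=1]) (use g(2) F_measurable[OF gm tn(1)] in \<open>auto simp: norm_mult\<close>)
  have [measurable]: "B (t n) \<in> borel_measurable P" "B (t (Suc n)) \<in> borel_measurable P"
    using B_measurable[of "t n"] B_measurable[of "t (Suc n)"] tn by auto
  have hi: "integrable P (\<lambda>\<omega>. iexp (l * c n * (B (t (Suc n)) \<omega> - B (t n) \<omega>)))"
    by (rule integrable_const_bound[where B=1]) auto
  have "(LINT \<omega>|P. g \<omega> * iexp (l * step_integral B (Suc n) t c \<omega>))
      = (LINT \<omega>|P. ?g \<omega> * iexp (l * c n * (B (t (Suc n)) \<omega> - B (t n) \<omega>)))"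
    by (rule Bochner_Integration.integral_cong) (simp_all add: step_integral_def distrib_left mult.assoc exp_add)
  also have "\<dots> = (LINT \<omega>|P. ?g \<omega>) * (LINT \<omega>|P. iexp (l * c n * (B (t (Suc n)) \<omega> - B (t n) \<omega>)))"
    by (rule increment_indep(2)[OF tn(1,2) gm gi _ hi]) measurable
  also have "(LINT \<omega>|P. ?g \<omega>) = (LINT \<omega>|P. g \<omega>) * complex_of_real (exp (- (l\<^sup>2 * (\<Sum>i<n. (c i)\<^sup>2 * (t (Suc i) - t i)) / 2)))"
    by (rule Suc.IH[OF m]) (use Suc.prems(2) in auto)
  also have "(LINT \<omega>|P. iexp (l * c n * (B (t (Suc n)) \<omega> - B (t n) \<omega>))) = complex_of_real (exp (- ((l * c n)\<^sup>2 * (t (Suc n) - t n) / 2)))"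
    by (rule increment_char[OF tn(1,2)])
  also have "(LINT \<omega>|P. g \<omega>) * complex_of_real (exp (- (l\<^sup>2 * (\<Sum>i<n. (c i)\<^sup>2 * (t (Suc i) - t i)) / 2))) * complex_of_real (exp (- ((l * c n)\<^sup>2 * (t (Suc n) - t n) / 2)))
      = (LINT \<omega>|P. g \<omega>) * complex_of_real (exp (- (l\<^sup>2 * (\<Sum>i<Suc n. (c i)\<^sup>2 * (t (Suc i) - t i)) / 2)))"
    unfolding mult.assoc of_real_mult[symmetric] exp_add[symmetric]
    by (simp add: power_mult_distrib distrib_left add_divide_distrib mult_ac)
  finally show ?case .
qed

end

section \<open>The Wiener integral of a deterministic integrand\<close>

lemma heat_measurable:
  assumes [measurable]: "f \<in> borel_measurable borel"
  shows "heat V f \<in> borel_measurable borel"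
  unfolding heat_def[abs_def] by (rule std_normal.borel_measurable_lebesgue_integral) measurable

lemma Int_stable_vimages: "Int_stable {f -` A \<inter> S |A. A \<in> sets M}"
proof (rule Int_stableI)
  fix a b assume "a \<in> {f -` A \<inter> S |A. A \<in> sets M}" "b \<in> {f -` A \<inter> S |A. A \<in> sets M}"
  then obtain A A' where "a = f -` A \<inter> S" "A \<in> sets M" "b = f -` A' \<inter> S" "A' \<in> sets M" by blast
  then have "a \<inter> b = f -` (A \<inter> A') \<inter> S" "A \<inter> A' \<in> sets M" by auto
  then show "a \<inter> b \<in> {f -` A \<inter> S |A. A \<in> sets M}" by blast
qed

lemma interval_inner_product:
  fixes a b c d :: real
  assumes "a \<le> b" "c \<le> d"
  shows "integrable lborel (\<lambda>w. indicator {a<..b} w * indicator {c<..d} w :: real)"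
    and "(LBINT w. indicator {a<..b} w * indicator {c<..d} w) = min b d - min b c - min a d + min a c"
proof -
  have eq: "(\<lambda>w. indicator {a<..b} w * indicator {c<..d} w :: real) = indicator {max a c<..min b d}"
    by (auto simp: fun_eq_iff indicator_def)
  show "integrable lborel (\<lambda>w. indicator {a<..b} w * indicator {c<..d} w :: real)"
    unfolding eq by (rule integrable_real_indicator) (cases "max a c \<le> min b d"; auto)+
  show "(LBINT w. indicator {a<..b} w * indicator {c<..d} w) = min b d - min b c - min a d + min a c"
    unfolding eq using assms by (cases "max a c \<le> min b d") (auto simp: min_def max_def split: if_splits)
qed

lemma step_fun_square:
  assumes "mono_on {..n} t"
  shows "(step_fun n t c w)\<^sup>2 = (\<Sum>i<n. (c i)\<^sup>2 * indicator {t i<..t (Suc i)} w)"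
  using assms
proof (induction n)
  case 0
  then show ?case by (simp add: step_fun_def)
next
  case (Suc n)
  have m: "mono_on {..n} t" using Suc.prems by (rule mono_on_subset) auto
  have disj: "c i * indicator {t i<..t (Suc i)} w * indicator {t n<..t (Suc n)} w = 0" if "i < n" for i
    using mono_onD[OF Suc.prems, of "Suc i" n] that by (auto simp: indicator_def)
  have z: "step_fun n t c w * indicator {t n<..t (Suc n)} w = 0"
    unfolding step_fun_def sum_distrib_right by (rule sum.neutral, rule ballI, rule disj) simp
  have "(step_fun (Suc n) t c w)\<^sup>2 = (step_fun n t c w + c n * indicator {t n<..t (Suc n)} w)\<^sup>2"
    by (simp add: step_fun_def)
  also have "\<dots> = (step_fun n t c w)\<^sup>2 + 2 * c n * (step_fun n t c w * indicator {t n<..t (Suc n)} w)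
      + (c n)\<^sup>2 * indicator {t n<..t (Suc n)} w"
    by (simp add: power2_eq_square algebra_simps indicator_def)
  finally show ?case using Suc.IH[OF m] z by simp
qed

context filtered_brownian
begin

lemma increment_moments:
  assumes st: "0 \<le> s" "s \<le> t"
  shows "integrable P (\<lambda>\<omega>. B t \<omega> - B s \<omega>)" "(LINT \<omega>|P. B t \<omega> - B s \<omega>) = 0"
    "integrable P (\<lambda>\<omega>. (B t \<omega> - B s \<omega>)\<^sup>2)" "(LINT \<omega>|P. (B t \<omega> - B s \<omega>)\<^sup>2) = t - s"
proof -
  let ?X = "\<lambda>\<omega>. B t \<omega> - B s \<omega>" and ?d = "normal_density 0 (sqrt (t - s))"
  have *: "integrable P ?X \<and> (LINT \<omega>|P. ?X \<omega>) = 0 \<and> integrable P (\<lambda>\<omega>. (?X \<omega>)\<^sup>2) \<and> (LINT \<omega>|P. (?X \<omega>)\<^sup>2) = t - s"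
  proof (cases "s = t")
    case False
    then have lt: "0 < sqrt (t - s)" using st by simp
    have d: "distributed P lborel ?X ?d" using increment_distributed[of s t] st False by simp
    have 1: "has_bochner_integral lborel (\<lambda>x. ?d x * x) 0"
      using normal_moment_odd[OF lt, of 0 0] by simp
    have 2: "has_bochner_integral lborel (\<lambda>x. ?d x * x\<^sup>2) (t - s)"
      using normal_moment_even[OF lt, of 0 1] lt by simp
    show ?thesis
      using distributed_integrable[OF d, of "\<lambda>x. x"] distributed_integral[OF d, of "\<lambda>x. x"]
        distributed_integrable[OF d, of "\<lambda>x. x\<^sup>2"] distributed_integral[OF d, of "\<lambda>x. x\<^sup>2"] 1 2
      by (simp add: has_bochner_integral_iff)
  qed simp
  from * show "integrable P ?X" "(LINT \<omega>|P. ?X \<omega>) = 0" "integrable P (\<lambda>\<omega>. (?X \<omega>)\<^sup>2)" "(LINT \<omega>|P. (?X \<omega>)\<^sup>2) = t - s"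
    by auto
qed

text \<open>Splitting the later increment at \<open>a\<close> leaves a square and a product of
  independent centred factors. Subtracting \<open>B 0\<close> keeps the algebra pointwise, since
  \<open>B 0\<close> vanishes only almost surely.\<close>

lemma increment_covariance_le:
  assumes ab: "0 \<le> a" "a \<le> b"
  shows "integrable P (\<lambda>\<omega>. (B a \<omega> - B 0 \<omega>) * (B b \<omega> - B 0 \<omega>))"
    and "(LINT \<omega>|P. (B a \<omega> - B 0 \<omega>) * (B b \<omega> - B 0 \<omega>)) = a"
proof -
  let ?W = "\<lambda>\<omega>. B a \<omega> - B 0 \<omega>"
  have m: "?W \<in> borel_measurable (F a)" using B_adapted[of 0 a] B_adapted[of a a] ab by simp
  note W = increment_moments[OF order_refl ab(1)] and D = increment_moments[OF ab]
  have id: "(\<lambda>x::real. x) \<in> borel_measurable borel" by simp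
  note I = increment_indep[OF ab m W(1) id D(1)]
  have eq: "(B a \<omega> - B 0 \<omega>) * (B b \<omega> - B 0 \<omega>) = (?W \<omega>)\<^sup>2 + ?W \<omega> * (B b \<omega> - B a \<omega>)" for \<omega>
    by (simp add: power2_eq_square algebra_simps)
  show "integrable P (\<lambda>\<omega>. (B a \<omega> - B 0 \<omega>) * (B b \<omega> - B 0 \<omega>))"
    unfolding eq by (rule Bochner_Integration.integrable_add[OF W(3) I(1)])
  show "(LINT \<omega>|P. (B a \<omega> - B 0 \<omega>) * (B b \<omega> - B 0 \<omega>)) = a"
    unfolding eq Bochner_Integration.integral_add[OF W(3) I(1)] W(4) I(2) D(2) by simp
qed

lemma increment_covariance:
  assumes "0 \<le> a" "0 \<le> b"
  shows "has_bochner_integral P (\<lambda>\<omega>. (B a \<omega> - B 0 \<omega>) * (B b \<omega> - B 0 \<omega>)) (min a b)"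
proof (cases "a \<le> b")
  case True
  then show ?thesis using increment_covariance_le[OF assms(1) True] by (simp add: has_bochner_integral_iff)
next
  case False
  then show ?thesis using increment_covariance_le[OF assms(2), of a]
    by (simp add: has_bochner_integral_iff mult.commute min_def)
qed

text \<open>Both sides expand into the same four minima: the covariance of Brownian motion at two
  times is their minimum, and the overlap of two intervals is the same alternating sum.\<close>

lemma increment_isometry:
  assumes "0 \<le> a" "a \<le> b" "0 \<le> c" "c \<le> d"
  shows "has_bochner_integral P (\<lambda>\<omega>. (B b \<omega> - B a \<omega>) * (B d \<omega> - B c \<omega>))
      (LBINT w. indicator {a<..b} w * indicator {c<..d} w)"
proof -
  have "has_bochner_integral P (\<lambda>\<omega>. (B b \<omega> - B 0 \<omega>) * (B d \<omega> - B 0 \<omega>) - (B b \<omega> - B 0 \<omega>) * (B c \<omega> - B 0 \<omega>)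
      - (B a \<omega> - B 0 \<omega>) * (B d \<omega> - B 0 \<omega>) + (B a \<omega> - B 0 \<omega>) * (B c \<omega> - B 0 \<omega>)) (min b d - min b c - min a d + min a c)"
    using assms by (intro has_bochner_integral_add has_bochner_integral_diff increment_covariance) auto
  then show ?thesis unfolding interval_inner_product(2)[OF assms(2,4)]
    by (rule has_bochner_integral_cong[THEN iffD1, rotated -1]) (auto simp: algebra_simps)
qed

text \<open>The intervals may overlap in any way. This generality, which bilinearity makes free of
  charge, allows step functions over unrelated grids to be compared.\<close>

lemma step_family_isometry:
  fixes a b c :: "'i \<Rightarrow> real"
  assumes "finite J" and ab: "\<And>j. j \<in> J \<Longrightarrow> 0 \<le> a j \<and> a j \<le> b j"
  shows "integrable P (\<lambda>\<omega>. (\<Sum>j\<in>J. c j * (B (b j) \<omega> - B (a j) \<omega>))\<^sup>2)"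
    and "integrable lborel (\<lambda>w. (\<Sum>j\<in>J. c j * indicator {a j<..b j} w)\<^sup>2)"
    and "(LINT \<omega>|P. (\<Sum>j\<in>J. c j * (B (b j) \<omega> - B (a j) \<omega>))\<^sup>2) = (LBINT w. (\<Sum>j\<in>J. c j * indicator {a j<..b j} w)\<^sup>2)"
proof -
  have 1: "has_bochner_integral P (\<lambda>\<omega>. (\<Sum>j\<in>J. \<Sum>i\<in>J. (c j * c i) * ((B (b j) \<omega> - B (a j) \<omega>) * (B (b i) \<omega> - B (a i) \<omega>))))
     (\<Sum>j\<in>J. \<Sum>i\<in>J. (c j * c i) * (LBINT w. indicator {a j<..b j} w * indicator {a i<..b i} w))"
    using ab by (intro has_bochner_integral_sum has_bochner_integral_mult_right increment_isometry) auto
  have 2: "has_bochner_integral lborel (\<lambda>w. (\<Sum>j\<in>J. \<Sum>i\<in>J. (c j * c i) * (indicator {a j<..b j} w * indicator {a i<..b i} w)))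
     (\<Sum>j\<in>J. \<Sum>i\<in>J. (c j * c i) * (LBINT w. indicator {a j<..b j} w * indicator {a i<..b i} w))"
    using ab by (intro has_bochner_integral_sum has_bochner_integral_mult_right has_bochner_integral_integrable interval_inner_product(1)) auto
  have e1: "(\<Sum>j\<in>J. c j * (B (b j) \<omega> - B (a j) \<omega>))\<^sup>2 = (\<Sum>j\<in>J. \<Sum>i\<in>J. (c j * c i) * ((B (b j) \<omega> - B (a j) \<omega>) * (B (b i) \<omega> - B (a i) \<omega>)))" for \<omega>
    unfolding power2_eq_square sum_product by (intro sum.cong refl) (simp only: mult_ac)
  have e2: "(\<Sum>j\<in>J. c j * indicator {a j<..b j} w)\<^sup>2 = (\<Sum>j\<in>J. \<Sum>i\<in>J. (c j * c i) * (indicator {a j<..b j} w * indicator {a i<..b i} w :: real))" for w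
    unfolding power2_eq_square sum_product by (intro sum.cong refl) (simp only: mult_ac)
  show "integrable P (\<lambda>\<omega>. (\<Sum>j\<in>J. c j * (B (b j) \<omega> - B (a j) \<omega>))\<^sup>2)"
    "integrable lborel (\<lambda>w. (\<Sum>j\<in>J. c j * indicator {a j<..b j} w)\<^sup>2)"
    "(LINT \<omega>|P. (\<Sum>j\<in>J. c j * (B (b j) \<omega> - B (a j) \<omega>))\<^sup>2) = (LBINT w. (\<Sum>j\<in>J. c j * indicator {a j<..b j} w)\<^sup>2)"
    using 1 2 unfolding e1 e2 by (auto simp: has_bochner_integral_iff)
qed

text \<open>In place of a common refinement of two grids, the index sets are joined disjointly and
  the second family gets the opposite sign.\<close>

lemma two_step_isometry:
  fixes a b c a' b' c' :: "nat \<Rightarrow> real"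
  assumes "\<And>i. i < n \<Longrightarrow> 0 \<le> a i \<and> a i \<le> b i" "\<And>i. i < m \<Longrightarrow> 0 \<le> a' i \<and> a' i \<le> b' i"
  shows "(\<integral>\<^sup>+\<omega>. ennreal (((\<Sum>i<n. c i * (B (b i) \<omega> - B (a i) \<omega>)) - (\<Sum>i<m. c' i * (B (b' i) \<omega> - B (a' i) \<omega>)))\<^sup>2) \<partial>P)
    = (\<integral>\<^sup>+w. ennreal (((\<Sum>i<n. c i * indicator {a i<..b i} w) - (\<Sum>i<m. c' i * indicator {a' i<..b' i} w))\<^sup>2) \<partial>lborel)"
proof -
  let ?J = "{..<n} <+> {..<m}" and ?a = "case_sum a a'" and ?b = "case_sum b b'" and ?c = "case_sum c (\<lambda>i. - c' i)"
  have ab: "0 \<le> ?a j \<and> ?a j \<le> ?b j" if "j \<in> ?J" for j using that assms by auto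
  have fin: "finite ?J" by simp
  note iso = step_family_isometry[where J="?J" and a="?a" and b="?b" and c="?c", OF fin ab]
  have e1: "(\<Sum>j\<in>?J. ?c j * (B (?b j) \<omega> - B (?a j) \<omega>)) = (\<Sum>i<n. c i * (B (b i) \<omega> - B (a i) \<omega>)) - (\<Sum>i<m. c' i * (B (b' i) \<omega> - B (a' i) \<omega>))" for \<omega>
    by (subst sum.Plus) (auto simp: sum_negf comp_def)
  have e2: "(\<Sum>j\<in>?J. ?c j * indicator {?a j<..?b j} w) = (\<Sum>i<n. c i * indicator {a i<..b i} w) - (\<Sum>i<m. c' i * indicator {a' i<..b' i} w :: real)" for w
    by (subst sum.Plus) (auto simp: sum_negf comp_def)
  show ?thesis
    using nn_integral_eq_integral[OF iso(1)] nn_integral_eq_integral[OF iso(2)] iso(3) unfolding e1 e2 by simp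
qed

text \<open>The integrals up to \<open>s\<close> and up to \<open>t\<close> come with unrelated
  approximating sequences. The grid for \<open>It\<close> is cut at \<open>s\<close>: by the
  isometry its lower part is asymptotically the approximation of \<open>Is\<close>, while its upper
  part is a step integral after time \<open>s\<close>, whose characteristic function against
  \<open>g\<close> is known.\<close>

lemma stochastic_integral_increment_char:
  fixes g :: "'a \<Rightarrow> complex" and \<sigma> :: "real \<Rightarrow> real"
  assumes st: "0 \<le> s" "s \<le> t"
    and \<sigma>: "(\<lambda>w. indicator {0..t} w * \<sigma> w) \<in> borel_measurable borel" "set_integrable lborel {s..t} (\<lambda>w. (\<sigma> w)\<^sup>2)"
    and It: "has_stochastic_integral P B t \<sigma> It" and Is: "has_stochastic_integral P B s \<sigma> Is"
    and g: "g \<in> borel_measurable (F s)" "\<And>\<omega>. cmod (g \<omega>) \<le> 1"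
  shows "(LINT \<omega>|P. g \<omega> * iexp (l * (It \<omega> - Is \<omega>)))
     = (LINT \<omega>|P. g \<omega>) * complex_of_real (exp (- (l\<^sup>2 * (LBINT w:{s..t}. (\<sigma> w)\<^sup>2) / 2)))"
proof -
  have meas_on: "(\<lambda>w. indicator {0..r} w * \<sigma> w) \<in> borel_measurable borel" if "r \<le> t" for r
  proof -
    have "(\<lambda>w. indicator {0..r} w * \<sigma> w) = (\<lambda>w. indicator {0..r} w * (indicator {0..t} w * \<sigma> w))"
      using that by (auto simp: indicator_def fun_eq_iff)
    then show ?thesis using \<sigma>(1) by simp
  qed
  have approx: "\<exists>n tt c. (\<forall>k. mono_on {..n k} (tt k)) \<and> (\<forall>k i. i \<le> n k \<longrightarrow> 0 \<le> tt k i \<and> tt k i \<le> r) \<and>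
      L2_null lborel (\<lambda>k w. indicator {0..r} w * (\<sigma> w - step_fun (n k) (tt k) (c k) w)) \<and>
      L2_null P (\<lambda>k \<omega>. Y \<omega> - step_integral B (n k) (tt k) (c k) \<omega>)"
    if Y: "has_stochastic_integral P B r \<sigma> Y" and r: "0 \<le> r" "r \<le> t" for r Y
  proof -
    obtain n tt c where 1: "\<And>k. mono_on {..n k} (tt k)" and 2: "\<And>k. tt k ` {..n k} \<subseteq> {0..r}"
      and 3: "(\<lambda>k. \<integral>\<^sup>+w\<in>{0..r}. ennreal ((\<sigma> w - step_fun (n k) (tt k) (c k) w)\<^sup>2) \<partial>lborel) \<longlonglongrightarrow> 0"
      and 4: "(\<lambda>k. \<integral>\<^sup>+\<omega>. ennreal ((Y \<omega> - step_integral B (n k) (tt k) (c k) \<omega>)\<^sup>2) \<partial>P) \<longlonglongrightarrow> 0"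
      and Ym: "Y \<in> borel_measurable P"
      using Y unfolding has_stochastic_integral_def by blast
    have range: "0 \<le> tt k i \<and> tt k i \<le> r" if "i \<le> n k" for k i using 2[of k] that by auto
    have "L2_null lborel (\<lambda>k w. indicator {0..r} w * (\<sigma> w - step_fun (n k) (tt k) (c k) w))"
      unfolding L2_null_def
    proof
      note [measurable] = meas_on[OF r(2)]
      show "\<forall>k. (\<lambda>w. indicator {0..r} w * (\<sigma> w - step_fun (n k) (tt k) (c k) w)) \<in> borel_measurable lborel"
        unfolding right_diff_distrib step_fun_def by (intro allI borel_measurable_diff) measurable
      have "ennreal ((indicator {0..r} w * (\<sigma> w - step_fun (n k) (tt k) (c k) w))\<^sup>2)
          = ennreal ((\<sigma> w - step_fun (n k) (tt k) (c k) w)\<^sup>2) * indicator {0..r} w" for k w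
        by (simp add: indicator_def)
      then show "(\<lambda>k. \<integral>\<^sup>+w. ennreal ((indicator {0..r} w * (\<sigma> w - step_fun (n k) (tt k) (c k) w))\<^sup>2) \<partial>lborel) \<longlonglongrightarrow> 0"
        using 3 by simp
    qed
    moreover have "step_integral B (n k) (tt k) (c k) \<in> borel_measurable P" for k
      using F_measurable[OF step_integral_measurable[OF 1, of k "c k"]] range[of 0 k] range[of "n k" k] by auto
    then have "L2_null P (\<lambda>k \<omega>. Y \<omega> - step_integral B (n k) (tt k) (c k) \<omega>)"
      unfolding L2_null_def using Ym 4 by auto
    ultimately show ?thesis using 1 range by blast
  qed
  obtain n tt c where m: "\<And>k. mono_on {..n k} (tt k)" and rg: "\<And>k i. i \<le> n k \<Longrightarrow> 0 \<le> tt k i \<and> tt k i \<le> t"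
    and Ut: "L2_null lborel (\<lambda>k w. indicator {0..t} w * (\<sigma> w - step_fun (n k) (tt k) (c k) w))"
    and Nt: "L2_null P (\<lambda>k \<omega>. It \<omega> - step_integral B (n k) (tt k) (c k) \<omega>)"
    using approx[OF It] st by auto
  obtain n' tt' c' where m': "\<And>k. mono_on {..n' k} (tt' k)" and rg': "\<And>k i. i \<le> n' k \<Longrightarrow> 0 \<le> tt' k i \<and> tt' k i \<le> s"
    and Us: "L2_null lborel (\<lambda>k w. indicator {0..s} w * (\<sigma> w - step_fun (n' k) (tt' k) (c' k) w))"
    and Ns: "L2_null P (\<lambda>k \<omega>. Is \<omega> - step_integral B (n' k) (tt' k) (c' k) \<omega>)"
    using approx[OF Is] st by auto
  define ft where "ft k = step_fun (n k) (tt k) (c k)" for k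
  define fs where "fs k = step_fun (n' k) (tt' k) (c' k)" for k
  \<comment> \<open>Clipping the grid points with \<open>min _ s\<close> and \<open>max _ s\<close>
    restricts the step function to times up to \<open>s\<close> and after \<open>s\<close>; grid
    intervals beyond the cut become empty, so no reindexing is necessary.\<close>
  define lo where "lo k w = (\<Sum>i<n k. c k i * indicator {min (tt k i) s<..min (tt k (Suc i)) s} w)" for k w
  define u where "u k i = max (tt k i) s" for k i
  define hi where "hi k = step_fun (n k) (u k) (c k)" for k
  define Lo where "Lo k \<omega> = (\<Sum>i<n k. c k i * (B (min (tt k (Suc i)) s) \<omega> - B (min (tt k i) s) \<omega>))" for k \<omega>
  define Hi where "Hi k = step_integral B (n k) (u k) (c k)" for k
  define Ss where "Ss k = step_integral B (n' k) (tt' k) (c' k)" for k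
  have step_le: "tt k i \<le> tt k (Suc i)" if "i < n k" for k i using mono_onD[OF m[of k], of i "Suc i"] that by auto
  have step_le': "tt' k i \<le> tt' k (Suc i)" if "i < n' k" for k i using mono_onD[OF m'[of k], of i "Suc i"] that by auto
  have mu: "mono_on {..n k} (u k)" for k
    unfolding u_def by (rule mono_onI, rule max.mono) (auto intro: mono_onD[OF m[of k]])
  have split: "step_integral B (n k) (tt k) (c k) \<omega> = Lo k \<omega> + Hi k \<omega>" for k \<omega>
  proof -
    \<comment> \<open>One of the two clipped times is \<open>x\<close> and the other is
      \<open>s\<close>, so every increment splits at \<open>s\<close>.\<close>
    have "B x \<omega> = B (min x s) \<omega> + B (max x s) \<omega> - B s \<omega>" for x by (simp add: min_def max_def)
    then have "B y \<omega> - B x \<omega> = (B (min y s) \<omega> - B (min x s) \<omega>) + (B (max y s) \<omega> - B (max x s) \<omega>)" for x y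
      by (metis add_diff_add add_diff_cancel_right add.commute diff_diff_eq2 add_diff_eq)
    then show ?thesis unfolding step_integral_def Lo_def Hi_def u_def sum.distrib[symmetric] distrib_left[symmetric] by metis
  qed
  have lo_eq: "lo k w = (if w \<le> s then ft k w else 0)" for k w
    unfolding lo_def ft_def step_fun_def by (auto intro!: sum.cong sum.neutral simp: indicator_def)
  have hi_eq: "hi k w = (if s < w then ft k w else 0)" for k w
    unfolding hi_def ft_def step_fun_def u_def by (auto intro!: sum.cong sum.neutral simp: indicator_def)
  have ft_0: "ft k w = 0" if "w < 0 \<or> t < w" for k w
    unfolding ft_def step_fun_def
  proof (intro sum.neutral ballI)
    fix i assume "i \<in> {..<n k}"
    then show "c k i * indicator {tt k i<..tt k (Suc i)} w = 0" using rg[of i k] rg[of "Suc i" k] that by (auto simp: indicator_def)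
  qed
  have fs_0: "fs k w = 0" if "w < 0 \<or> s < w" for k w
    unfolding fs_def step_fun_def
  proof (intro sum.neutral ballI)
    fix i assume "i \<in> {..<n' k}"
    then show "c' k i * indicator {tt' k i<..tt' k (Suc i)} w = 0" using rg'[of i k] rg'[of "Suc i" k] that by (auto simp: indicator_def)
  qed
  have [measurable]: "ft k \<in> borel_measurable borel" "fs k \<in> borel_measurable borel" "lo k \<in> borel_measurable borel" "hi k \<in> borel_measurable borel" for k
    unfolding ft_def fs_def lo_def hi_def step_fun_def by measurable
  have low: "L2_null lborel (\<lambda>k w. indicator {0..s} w * (\<sigma> w - ft k w))"
  proof (rule L2_null_mono[OF Ut[folded ft_def]])
    show "(\<lambda>w. indicator {0..s} w * (\<sigma> w - ft k w)) \<in> borel_measurable lborel" for k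
      unfolding right_diff_distrib using meas_on[OF st(2)] by measurable
  qed (use st in \<open>auto simp: indicator_def\<close>)
  have "L2_null lborel (\<lambda>k w. lo k w - fs k w)"
  proof -
    have "indicator {0..s} w * (\<sigma> w - fs k w) - indicator {0..s} w * (\<sigma> w - ft k w) = lo k w - fs k w" for k w
      using ft_0[of w k] fs_0[of w k] st by (auto simp: lo_eq indicator_def)
    then show ?thesis using L2_null_diff[OF Us[folded fs_def] low] by simp
  qed
  then have D: "L2_null P (\<lambda>k \<omega>. Lo k \<omega> - Ss k \<omega>)"
  proof -
    assume null: "L2_null lborel (\<lambda>k w. lo k w - fs k w)"
    have "(\<integral>\<^sup>+\<omega>. ennreal ((Lo k \<omega> - Ss k \<omega>)\<^sup>2) \<partial>P) = (\<integral>\<^sup>+w. ennreal ((lo k w - fs k w)\<^sup>2) \<partial>lborel)" for k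
      unfolding Lo_def Ss_def step_integral_def lo_def fs_def step_fun_def
    proof (rule two_step_isometry)
      show "0 \<le> min (tt k i) s \<and> min (tt k i) s \<le> min (tt k (Suc i)) s" if "i < n k" for i
        using rg[of i k] step_le[OF that] that st by (auto intro: min.mono)
      show "0 \<le> tt' k i \<and> tt' k i \<le> tt' k (Suc i)" if "i < n' k" for i
        using rg'[of i k] step_le'[OF that] that by auto
    qed
    moreover have "Lo k \<in> borel_measurable P" for k
      unfolding Lo_def using rg[of _ k] st
      by (intro borel_measurable_sum borel_measurable_times borel_measurable_diff B_measurable borel_measurable_const) auto
    moreover have "Ss k \<in> borel_measurable P" for k
      unfolding Ss_def step_integral_def using rg'[of _ k] st
      by (intro borel_measurable_sum borel_measurable_times borel_measurable_diff B_measurable borel_measurable_const) auto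
    ultimately show ?thesis using null unfolding L2_null_def by simp
  qed
  have null: "L2_null P (\<lambda>k \<omega>. Hi k \<omega> - (It \<omega> - Is \<omega>))"
  proof -
    \<comment> \<open>The error of the upper part consists of the two approximation errors and the
      discrepancy of the lower parts, each tending to 0 in mean square.\<close>
    have eq: "(Is \<omega> - Ss k \<omega>) - (It \<omega> - step_integral B (n k) (tt k) (c k) \<omega>) - (Lo k \<omega> - Ss k \<omega>) = Hi k \<omega> - (It \<omega> - Is \<omega>)" for k \<omega>
      unfolding split by simp
    show ?thesis by (rule L2_null_diff[OF L2_null_diff[OF Ns[folded Ss_def] Nt] D, unfolded eq])
  qed
  have Hi_m: "Hi k \<in> borel_measurable P" for k
    unfolding Hi_def step_integral_def u_def using st
    by (intro borel_measurable_sum borel_measurable_times borel_measurable_diff B_measurable borel_measurable_const) auto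
  have [measurable]: "It \<in> borel_measurable P" "Is \<in> borel_measurable P"
    using It Is by (auto simp: has_stochastic_integral_def)
  have char: "(LINT \<omega>|P. g \<omega> * iexp (l * Hi k \<omega>)) = (LINT \<omega>|P. g \<omega>) * complex_of_real (exp (- (l\<^sup>2 * (LBINT w. (hi k w)\<^sup>2) / 2)))" for k
  proof -
    have "(LBINT w. (hi k w)\<^sup>2) = (\<Sum>i<n k. (c k i)\<^sup>2 * (u k (Suc i) - u k i))"
    proof -
      have ule: "u k i \<le> u k (Suc i)" if "i < n k" for i using mono_onD[OF mu[of k], of i "Suc i"] that by auto
      have "(LBINT w. (hi k w)\<^sup>2) = (\<Sum>i<n k. LBINT w. (c k i)\<^sup>2 * indicator {u k i<..u k (Suc i)} w)"
        unfolding hi_def step_fun_square[OF mu] using ule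
        by (intro Bochner_Integration.integral_sum integrable_mult_right integrable_real_indicator) auto
      also have "\<dots> = (\<Sum>i<n k. (c k i)\<^sup>2 * (u k (Suc i) - u k i))"
        using ule by (intro sum.cong refl) simp
      finally show ?thesis .
    qed
    then show ?thesis unfolding Hi_def
      using step_integral_char[OF st(1) mu, of k g l "c k"] g by (simp add: u_def)
  qed
  have si': "set_integrable lborel {s<..t} (\<lambda>w. (\<sigma> w)\<^sup>2)"
    by (rule set_integrable_subset[OF \<sigma>(2)]) auto
  \<comment> \<open>The variances of the approximations converge to the squared norm of
    \<open>\<sigma>\<close> after time \<open>s\<close>, which identifies the exponent.\<close>
  have "(\<lambda>k. LBINT w. (hi k w)\<^sup>2) \<longlonglongrightarrow> (LBINT w. (indicator {s<..t} w * \<sigma> w)\<^sup>2)"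
  proof (rule L2_null_norm_convergence)
    have gm: "(\<lambda>w. indicator {s<..t} w * \<sigma> w) \<in> borel_measurable borel"
    proof -
      have "(\<lambda>w. indicator {s<..t} w * \<sigma> w) = (\<lambda>w. indicator {s<..t} w * (indicator {0..t} w * \<sigma> w))"
        using st by (auto simp: indicator_def fun_eq_iff)
      then show ?thesis using \<sigma>(1) by simp
    qed
    then show "(\<lambda>w. indicator {s<..t} w * \<sigma> w) \<in> borel_measurable lborel" by simp
    show "L2_null lborel (\<lambda>k w. hi k w - indicator {s<..t} w * \<sigma> w)"
    proof (rule L2_null_mono[OF Ut[folded ft_def]])
      show "(\<lambda>w. hi k w - indicator {s<..t} w * \<sigma> w) \<in> borel_measurable lborel" for k using gm by measurable
      show "\<bar>hi k w - indicator {s<..t} w * \<sigma> w\<bar> \<le> \<bar>indicator {0..t} w * (\<sigma> w - ft k w)\<bar>" for k w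
        using ft_0[of w k] st by (auto simp: hi_eq indicator_def)
    qed
    show "integrable lborel (\<lambda>w. (hi k w)\<^sup>2)" for k
      unfolding hi_def step_fun_square[OF mu]
      by (intro Bochner_Integration.integrable_sum integrable_mult_right integrable_real_indicator)
        (use mono_onD[OF mu[of k]] in auto)
    have "(indicator {s<..t} w * \<sigma> w)\<^sup>2 = indicator {s<..t} w *\<^sub>R (\<sigma> w)\<^sup>2" for w
      by (simp add: indicator_def)
    then show "integrable lborel (\<lambda>w. (indicator {s<..t} w * \<sigma> w)\<^sup>2)"
      using si' by (simp add: set_integrable_def)
  qed measurable
  also have "(LBINT w. (indicator {s<..t} w * \<sigma> w)\<^sup>2) = (LBINT w:{s<..t}. (\<sigma> w)\<^sup>2)"
    unfolding set_lebesgue_integral_def by (intro Bochner_Integration.integral_cong) (auto simp: indicator_def)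
  also have "\<dots> = (LBINT w:{s..t}. (\<sigma> w)\<^sup>2)"
  proof (rule set_integral_cong_set)
    show "set_borel_measurable lborel {s<..t} (\<lambda>w. (\<sigma> w)\<^sup>2)"
      using si' unfolding set_integrable_def set_borel_measurable_def
      by (auto dest: borel_measurable_integrable)
    show "set_borel_measurable lborel {s..t} (\<lambda>w. (\<sigma> w)\<^sup>2)"
      using \<sigma>(2) unfolding set_integrable_def set_borel_measurable_def by (auto dest: borel_measurable_integrable)
    show "AE x in lborel. (x \<in> {s..t}) = (x \<in> {s<..t})" using AE_lborel_singleton[of s] by eventually_elim auto
  qed
  finally have v: "(\<lambda>k. LBINT w. (hi k w)\<^sup>2) \<longlonglongrightarrow> (LBINT w:{s..t}. (\<sigma> w)\<^sup>2)" .
  have "(\<lambda>k. LINT \<omega>|P. g \<omega> * iexp (l * Hi k \<omega>)) \<longlonglongrightarrow> (LINT \<omega>|P. g \<omega> * iexp (l * (It \<omega> - Is \<omega>)))"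
    by (rule L2_null_char_convergence[OF null Hi_m _ F_measurable[OF g(1) st(1)] g(2)]) measurable
  moreover have "(\<lambda>k. LINT \<omega>|P. g \<omega> * iexp (l * Hi k \<omega>)) \<longlonglongrightarrow>
      (LINT \<omega>|P. g \<omega>) * complex_of_real (exp (- (l\<^sup>2 * (LBINT w:{s..t}. (\<sigma> w)\<^sup>2) / 2)))"
    unfolding char by (intro tendsto_intros v) auto
  ultimately show ?thesis by (rule LIMSEQ_unique)
qed

text \<open>The conditional law of \<open>N\<close> given any event of \<open>F s\<close> is centred normal, so \<open>N\<close> is normal and
  independent of \<open>F s\<close>.\<close>

lemma noise_heat:
  assumes s: "0 \<le> s" and N[measurable]: "N \<in> borel_measurable P" and V: "0 \<le> V"
    and char: "\<And>A l. A \<in> sets (F s) \<Longrightarrow> (LINT \<omega>|P. complex_of_real (indicator A \<omega>) * iexp (l * N \<omega>))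
        = (LINT \<omega>|P. complex_of_real (indicator A \<omega>)) * complex_of_real (exp (- (l\<^sup>2 * V / 2)))"
    and Z: "Z \<in> borel_measurable (F s)" and f[measurable]: "f \<in> borel_measurable borel"
    and fi: "integrable P (\<lambda>\<omega>. f (Z \<omega> + N \<omega>))"
  shows "(LINT \<omega>|P. f (Z \<omega> + N \<omega>)) = (LINT \<omega>|P. heat V f (Z \<omega>))"
    and "integrable P (\<lambda>\<omega>. heat V f (Z \<omega>))"
proof -
  \<comment> \<open>The centred normal law of variance \<open>V\<close>, as an image measure so that
    \<open>V = 0\<close> gives the point mass at 0.\<close>
  define \<gamma> where "\<gamma> = distr std_normal_distribution borel (\<lambda>z. sqrt V * z)"
  have \<gamma>: "real_distribution \<gamma>" unfolding \<gamma>_def by (rule std_normal.real_distribution_distr) simp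
  interpret \<gamma>: real_distribution \<gamma> by (rule \<gamma>)
  have [measurable]: "Z \<in> borel_measurable P" by (rule F_measurable[OF Z s])
  have char_\<gamma>: "char \<gamma> l = complex_of_real (exp (- (l\<^sup>2 * V / 2)))" for l
  proof -
    have "char \<gamma> l = char std_normal_distribution (l * sqrt V)"
      unfolding \<gamma>_def char_def by (subst integral_distr) (auto simp: mult_ac)
    then show ?thesis using V by (simp add: char_std_normal_distribution power_mult_distrib)
  qed
  have law: "prob (A \<inter> (N -` E \<inter> space P)) = prob A * measure \<gamma> E" if A: "A \<in> sets (F s)" and E: "E \<in> sets borel" for A E
  proof (cases "prob A = 0")
    case True
    then have "prob (A \<inter> (N -` E \<inter> space P)) \<le> 0" using A F_subalgebra[OF s]
      by (metis finite_measure_mono inf_le1 subalgebra_def subsetD)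
    then show ?thesis using True by (simp add: measure_le_0_iff)
  next
    case False
    have Am[measurable]: "A \<in> sets P" using A F_subalgebra[OF s] by (auto simp: subalgebra_def)
    have pA: "0 < prob A" using False by (simp add: zero_less_measure_iff)
    \<comment> \<open>Conditioning on an event of positive probability. The hypothesis
      \<open>char\<close>, divided by \<open>prob A\<close>, is the characteristic function of
      \<open>N\<close> under \<open>U\<close>, so Levy's uniqueness theorem gives its law.\<close>
    define U where "U = uniform_measure P A"
    have eA: "emeasure P A \<noteq> 0" "emeasure P A \<noteq> \<infinity>" using pA by (auto simp: emeasure_eq_measure)
    interpret U: prob_space U unfolding U_def by (rule prob_space_uniform_measure[OF eA])
    have sU[simp]: "sets U = sets P" "space U = space P" by (simp_all add: U_def)
    have Nm: "N \<in> borel_measurable U" using N by (simp add: measurable_def)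
    have dens: "U = density P (\<lambda>\<omega>. ennreal (indicator A \<omega> / prob A))"
      unfolding U_def uniform_measure_def emeasure_eq_measure
      by (intro density_cong) (auto simp: indicator_def divide_ennreal pA ennreal_1[symmetric] simp del: ennreal_1)
    have "char (distr U borel N) = char \<gamma>"
    proof
      fix l
      have "char (distr U borel N) l = (LINT \<omega>|U. iexp (l * N \<omega>))"
        unfolding char_def by (subst integral_distr[OF Nm]) auto
      also have "\<dots> = (LINT \<omega>|P. (indicator A \<omega> / prob A) *\<^sub>R iexp (l * N \<omega>))"
        unfolding dens by (subst integral_density) auto
      also have "\<dots> = (LINT \<omega>|P. complex_of_real (1 / prob A) * (complex_of_real (indicator A \<omega>) * iexp (l * N \<omega>)))"
        by (intro Bochner_Integration.integral_cong) (simp_all add: scaleR_conv_of_real)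
      also have "\<dots> = complex_of_real (1 / prob A) * (complex_of_real (prob A) * complex_of_real (exp (- (l\<^sup>2 * V / 2))))"
        unfolding integral_mult_right_zero char[OF A] by simp
      finally show "char (distr U borel N) l = char \<gamma> l" using pA by (simp add: char_\<gamma>)
    qed
    then have "distr U borel N = \<gamma>"
      by (intro Levy_uniqueness U.real_distribution_distr Nm \<gamma>)
    then have "measure \<gamma> E = measure U (N -` E \<inter> space P)"
      using measure_distr[OF Nm E] by simp
    also have "\<dots> = prob (A \<inter> (N -` E \<inter> space P)) / prob A"
      unfolding U_def using E by (subst measure_uniform_measure[OF eA]) auto
    finally show ?thesis using pA by simp
  qed
  have lawN: "distr P borel N = \<gamma>"
  proof (rule measure_eqI)
    fix E assume "E \<in> sets (distr P borel N)"
    then have E: "E \<in> sets borel" by simp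
    have "space P \<in> sets (F s)" using sets.top[of "F s"] space_F[OF s] by simp
    from law[OF this E] have "prob (N -` E \<inter> space P) = measure \<gamma> E" by (simp add: prob_space Int_absorb1)
    then show "emeasure (distr P borel N) E = emeasure \<gamma> E"
      using E by (simp add: emeasure_distr emeasure_eq_measure \<gamma>.emeasure_eq_measure)
  qed (simp add: \<gamma>_def)
  have "indep_var borel Z borel N"
    unfolding indep_var_eq
  proof (intro conjI)
    show "indep_set (sigma_sets (space P) {Z -` A \<inter> space P |A. A \<in> sets borel}) (sigma_sets (space P) {N -` A \<inter> space P |A. A \<in> sets borel})"
    proof (rule indep_set_sigma_sets)
      show "Int_stable {Z -` A \<inter> space P |A. A \<in> sets borel}" by (rule Int_stable_vimages)
      show "Int_stable {N -` A \<inter> space P |A. A \<in> sets borel}" by (rule Int_stable_vimages)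
      show "indep_set {Z -` A \<inter> space P |A. A \<in> sets borel} {N -` A \<inter> space P |A. A \<in> sets borel}"
        unfolding indep_sets2_eq
      proof (intro conjI ballI)
        fix a b assume "a \<in> {Z -` A \<inter> space P |A. A \<in> sets borel}" "b \<in> {N -` A \<inter> space P |A. A \<in> sets borel}"
        then obtain A E where a: "a = Z -` A \<inter> space P" "A \<in> sets borel" and b: "b = N -` E \<inter> space P" "E \<in> sets borel" by auto
        have "a \<in> sets (F s)" using measurable_sets[OF Z a(2)] space_F[OF s] a(1) by simp
        moreover have "prob b = measure \<gamma> E" unfolding lawN[symmetric] b(1) using b(2) by (simp add: measure_distr)
        ultimately show "prob (a \<inter> b) = prob a * prob b" using law[of a E] b by simp
      qed auto
    qed
  qed auto
  \<comment> \<open>Independence makes the joint law a product; integrating out the normal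
    coordinate produces \<open>heat V f\<close>.\<close>
  then have joint: "distr P (borel \<Otimes>\<^sub>M borel) (\<lambda>\<omega>. (Z \<omega>, N \<omega>)) = distr P borel Z \<Otimes>\<^sub>M \<gamma>"
    unfolding indep_var_distribution_eq lawN by simp
  interpret Zd: prob_space "distr P borel Z" by (rule prob_space_distr) simp
  interpret pair: pair_prob_space "distr P borel Z" \<gamma> ..
  have int: "integrable (distr P borel Z \<Otimes>\<^sub>M \<gamma>) (\<lambda>(x, y). f (x + y))"
    unfolding joint[symmetric] by (subst integrable_distr_eq) (use fi in auto)
  have hV: "(LINT y|\<gamma>. f (x + y)) = heat V f x" for x
    unfolding \<gamma>_def heat_def by (subst integral_distr) auto
  have "(LINT \<omega>|P. f (Z \<omega> + N \<omega>)) = (LINT p|distr P (borel \<Otimes>\<^sub>M borel) (\<lambda>\<omega>. (Z \<omega>, N \<omega>)). (case p of (x, y) \<Rightarrow> f (x + y)))"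
    by (subst integral_distr) auto
  also have "\<dots> = (LINT x|distr P borel Z. LINT y|\<gamma>. f (x + y))"
    unfolding joint using pair.integral_fst'[OF int] by simp
  also have "\<dots> = (LINT x|distr P borel Z. heat V f x)" unfolding hV ..
  also have "\<dots> = (LINT \<omega>|P. heat V f (Z \<omega>))"
  proof (subst integral_distr)
    show "heat V f \<in> borel_measurable borel" by (rule heat_measurable[OF f])
  qed auto
  finally show "(LINT \<omega>|P. f (Z \<omega> + N \<omega>)) = (LINT \<omega>|P. heat V f (Z \<omega>))" .
  have "integrable (distr P borel Z) (\<lambda>x. heat V f x)"
    using pair.integrable_fst'[OF int] unfolding hV[symmetric] by simp
  then show "integrable P (\<lambda>\<omega>. heat V f (Z \<omega>))"
    by (subst (asm) integrable_distr_eq) (auto intro: heat_measurable[OF f])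
qed

end

section \<open>One step along a controlled process\<close>

text \<open>For \<open>0 < r \<le> 1\<close>, \<open>cell n r\<close> is the \<open>i\<close> with \<open>i / n < r \<le> (i + 1) / n\<close>.\<close>

definition cell :: "nat \<Rightarrow> real \<Rightarrow> nat" where "cell n r = nat \<lceil>real n * r\<rceil> - 1"

lemma cell_bounds:
  assumes "0 < n" "0 < r" "r \<le> 1"
  shows "cell n r < n" "real (cell n r) / real n < r" "r \<le> real (Suc (cell n r)) / real n"
proof -
  have p: "0 < real n * r" using assms by simp
  have le: "real n * r \<le> real n" using assms by (simp add: mult_left_le)
  have c: "1 \<le> \<lceil>real n * r\<rceil>" using p by linarith
  then have e: "real (Suc (cell n r)) = of_int \<lceil>real n * r\<rceil>" by (simp add: cell_def)
  have "\<lceil>real n * r\<rceil> \<le> int n" using le by (simp add: ceiling_le_iff)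
  then show "cell n r < n" unfolding cell_def using c assms(1) by linarith
  show "real (cell n r) / real n < r" using e assms ceiling_correct[of "real n * r"] by (simp add: divide_less_eq mult.commute)
  show "r \<le> real (Suc (cell n r)) / real n" unfolding e using assms by (simp add: le_divide_eq mult.commute)
qed

lemma cell_eq:
  assumes "0 < n" "real i / real n < r" "r \<le> real (Suc i) / real n"
  shows "cell n r = i"
proof -
  have "real i < real n * r" "real n * r \<le> real (Suc i)" using assms by (auto simp: divide_less_eq le_divide_eq mult.commute)
  then have "\<lceil>real n * r\<rceil> = int (Suc i)" by (intro ceiling_unique) auto
  then show ?thesis by (simp add: cell_def)
qed

lemma cell_limits:
  assumes "0 < r" "r \<le> 1"
  shows "(\<lambda>m. real (cell (Suc m) r) / real (Suc m)) \<longlonglongrightarrow> r" "(\<lambda>m. real (Suc (cell (Suc m) r)) / real (Suc m)) \<longlonglongrightarrow> r"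
proof -
  note c = cell_bounds[OF _ assms, of "Suc _"]
  have d: "real (Suc (cell (Suc m) r)) / real (Suc m) = real (cell (Suc m) r) / real (Suc m) + inverse (real (Suc m))" for m
    by (simp add: field_simps)
  have l: "(\<lambda>m. r - inverse (real (Suc m))) \<longlonglongrightarrow> r - 0" and u: "(\<lambda>m. r + inverse (real (Suc m))) \<longlonglongrightarrow> r + 0"
    by (intro tendsto_intros LIMSEQ_inverse_real_of_nat)+
  have 1: "r - inverse (real (Suc m)) \<le> real (cell (Suc m) r) / real (Suc m)" "real (cell (Suc m) r) / real (Suc m) \<le> r" for m
    using c[of m] d[of m] by (auto intro: less_imp_le)
  have 2: "r \<le> real (Suc (cell (Suc m) r)) / real (Suc m)" "real (Suc (cell (Suc m) r)) / real (Suc m) \<le> r + inverse (real (Suc m))" for m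
    using c[of m] d[of m] by (auto intro: less_imp_le)
  show "(\<lambda>m. real (cell (Suc m) r) / real (Suc m)) \<longlonglongrightarrow> r"
    by (rule tendsto_sandwich[where f="\<lambda>m. r - inverse (real (Suc m))" and h="\<lambda>_. r"]) (use 1 l in auto)
  show "(\<lambda>m. real (Suc (cell (Suc m) r)) / real (Suc m)) \<longlonglongrightarrow> r"
    by (rule tendsto_sandwich[where h="\<lambda>m. r + inverse (real (Suc m))" and f="\<lambda>_. r"]) (use 2 u in auto)
qed

lemma set_integral_half_open:
  fixes f :: "real \<Rightarrow> real"
  assumes "set_integrable lborel {a..b} f"
  shows "set_integrable lborel {a<..b} f" "(LBINT r:{a..b}. f r) = (LBINT r:{a<..b}. f r)"
proof -
  show i: "set_integrable lborel {a<..b} f" by (rule set_integrable_subset[OF assms]) auto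
  show "(LBINT r:{a..b}. f r) = (LBINT r:{a<..b}. f r)"
  proof (rule set_integral_cong_set)
    show "set_borel_measurable lborel {a..b} f" "set_borel_measurable lborel {a<..b} f"
      using assms i unfolding set_integrable_def set_borel_measurable_def by (auto dest: borel_measurable_integrable)
    show "AE x in lborel. (x \<in> {a<..b}) = (x \<in> {a..b})" using AE_lborel_singleton[of a] by eventually_elim auto
  qed
qed

text \<open>A Riemann-type sum whose integrand may depend on the cell is one integral of the
  function evaluated at the cell containing \<open>r\<close>, so dominated convergence applies. The
  cells are made half-open on the left, so that each point of (0,1] lies in exactly one.\<close>

lemma partition_sum_limit:
  fixes f :: "nat \<Rightarrow> nat \<Rightarrow> real \<Rightarrow> real"
  assumes int: "\<And>m i. i < Suc m \<Longrightarrow> set_integrable lborel {real i / real (Suc m)..real (Suc i) / real (Suc m)} (f m i)"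
    and bd: "\<And>m i r. i < Suc m \<Longrightarrow> real i / real (Suc m) \<le> r \<Longrightarrow> r \<le> real (Suc i) / real (Suc m) \<Longrightarrow> \<bar>f m i r\<bar> \<le> C"
    and lim: "\<And>r. 0 < r \<Longrightarrow> r \<le> 1 \<Longrightarrow> (\<lambda>m. f m (cell (Suc m) r) r) \<longlonglongrightarrow> g r"
  shows "(\<lambda>m. \<Sum>i<Suc m. LBINT r:{real i / real (Suc m)..real (Suc i) / real (Suc m)}. f m i r) \<longlonglongrightarrow> (LBINT r:{0<..1}. g r)"
    and "set_integrable lborel {0<..1} g"
proof -
  let ?I = "\<lambda>m i. {real i / real (Suc m)<..real (Suc i) / real (Suc m)}"
  define F where "F m r = (\<Sum>i<Suc m. indicator (?I m i) r * f m i r)" for m r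
  have in_unit: "0 < r \<and> r \<le> 1" if "r \<in> ?I m i" "i < Suc m" for r m i
  proof -
    have "0 \<le> real i / real (Suc m)" by simp
    moreover have "real (Suc i) / real (Suc m) \<le> 1" using that(2) by simp
    moreover have "real i / real (Suc m) < r" "r \<le> real (Suc i) / real (Suc m)" using that(1) by (simp_all del: of_nat_Suc)
    ultimately show ?thesis by linarith
  qed
  have F_eq: "F m r = (if 0 < r \<and> r \<le> 1 then f m (cell (Suc m) r) r else 0)" for m r
  proof (cases "0 < r \<and> r \<le> 1")
    case True
    then have c: "cell (Suc m) r < Suc m" "r \<in> ?I m (cell (Suc m) r)" using cell_bounds[of "Suc m" r] by auto
    have "F m r = (\<Sum>i<Suc m. if i = cell (Suc m) r then f m i r else 0)"
      unfolding F_def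
    proof (rule sum.cong[OF refl])
      fix i assume "i \<in> {..<Suc m}"
      show "indicator (?I m i) r * f m i r = (if i = cell (Suc m) r then f m i r else 0)"
      proof (cases "r \<in> ?I m i")
        case True
        then have "cell (Suc m) r = i" by (intro cell_eq) (simp_all del: of_nat_Suc)
        then show ?thesis using True by (simp del: of_nat_Suc)
      next
        case False
        then have "i \<noteq> cell (Suc m) r" using c(2) by blast
        then show ?thesis using False by (simp del: of_nat_Suc)
      qed
    qed
    then show ?thesis using c(1) True by (simp add: sum.delta)
  next
    case False
    then have "r \<notin> ?I m i" if "i < Suc m" for i using in_unit that by blast
    then have "F m r = 0" unfolding F_def by (intro sum.neutral ballI) (simp del: of_nat_Suc)
    then show ?thesis by (simp only: False if_False)
  qed
  have Fi: "integrable lborel (F m)" for m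
    unfolding F_def using set_integral_half_open(1)[OF int] unfolding set_integrable_def
    by (intro Bochner_Integration.integrable_sum) auto
  have sum_eq: "(\<Sum>i<Suc m. LBINT r:{real i / real (Suc m)..real (Suc i) / real (Suc m)}. f m i r) = integral\<^sup>L lborel (F m)" for m
  proof -
    have "(\<Sum>i<Suc m. LBINT r:{real i / real (Suc m)..real (Suc i) / real (Suc m)}. f m i r) = (\<Sum>i<Suc m. LBINT r. indicator (?I m i) r * f m i r)"
      by (rule sum.cong[OF refl]) (use set_integral_half_open(2)[OF int] in \<open>simp add: set_lebesgue_integral_def del: of_nat_Suc\<close>)
    also have "\<dots> = integral\<^sup>L lborel (F m)"
      unfolding F_def using set_integral_half_open(1)[OF int] unfolding set_integrable_def
      by (intro Bochner_Integration.integral_sum[symmetric]) auto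
    finally show ?thesis .
  qed
  have lim': "(\<lambda>m. F m r) \<longlonglongrightarrow> indicator {0<..1} r * g r" for r
    using lim[of r] by (cases "0 < r \<and> r \<le> 1") (auto simp: F_eq indicator_def)
  have m: "F m \<in> borel_measurable lborel" for m using Fi[of m] by (rule borel_measurable_integrable)
  have m': "(\<lambda>r. indicator {0<..1} r * g r) \<in> borel_measurable lborel" by (rule borel_measurable_LIMSEQ_real[OF lim' m])
  have w: "integrable lborel (\<lambda>r. C * indicator {0<..1::real} r)"
    by (intro integrable_mult_right integrable_real_indicator) auto
  have b: "AE r in lborel. norm (F m r) \<le> C * indicator {0<..1} r" for m
  proof (rule AE_I2)
    fix r show "norm (F m r) \<le> C * indicator {0<..1} r"
      using cell_bounds[of "Suc m" r] bd[of "cell (Suc m) r" m r] by (auto simp: F_eq simp del: of_nat_Suc)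
  qed
  note D = integrable_dominated_convergence[OF m' m w AE_I2[OF lim'] b] integral_dominated_convergence[OF m' m w AE_I2[OF lim'] b]
  show "set_integrable lborel {0<..1} g" using D(1) by (simp add: set_integrable_def)
  show "(\<lambda>m. \<Sum>i<Suc m. LBINT r:{real i / real (Suc m)..real (Suc i) / real (Suc m)}. f m i r) \<longlonglongrightarrow> (LBINT r:{0<..1}. g r)"
    unfolding sum_eq using D(2) by (simp add: set_lebesgue_integral_def)
qed

text \<open>Sampling the path at the grid point below \<open>r\<close> gives approximations that use
  countably many times only, hence are jointly measurable; they converge by continuity of the
  paths.\<close>

lemma continuous_paths_joint_measurable:
  fixes W :: "real \<Rightarrow> 'a \<Rightarrow> real"
  assumes ab: "a \<le> b" and W: "\<And>r. r \<in> {a..b} \<Longrightarrow> W r \<in> borel_measurable M"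
    and c: "\<And>\<omega>. \<omega> \<in> space M \<Longrightarrow> continuous_on {a..b} (\<lambda>r. W r \<omega>)"
  shows "(\<lambda>p. indicator {a..b} (snd p) * W (snd p) (fst p)) \<in> borel_measurable (M \<Otimes>\<^sub>M borel)"
proof (rule borel_measurable_LIMSEQ_real)
  \<comment> \<open>Clamping keeps every sampling time inside the interval on which measurability
    and continuity are known.\<close>
  define g where "g n i = max a (min b (real_of_int i / real (Suc n)))" for n and i :: int
  have g: "g n i \<in> {a..b}" for n i using ab by (auto simp: g_def)
  show "(\<lambda>p. indicator {a..b} (snd p) * W (g n \<lfloor>real (Suc n) * snd p\<rfloor>) (fst p)) \<in> borel_measurable (M \<Otimes>\<^sub>M borel)" for n
  proof -
    have [measurable]: "(\<lambda>p. W (g n \<lfloor>real (Suc n) * snd p\<rfloor>) (fst p)) \<in> borel_measurable (M \<Otimes>\<^sub>M borel)"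
    proof (rule measurable_compose_countable)
      show "(\<lambda>p. W (g n i) (fst p)) \<in> borel_measurable (M \<Otimes>\<^sub>M (borel :: real measure))" for i
        using W[OF g[of n i]] by measurable
      show "(\<lambda>p. \<lfloor>real (Suc n) * snd p\<rfloor>) \<in> M \<Otimes>\<^sub>M borel \<rightarrow>\<^sub>M count_space UNIV" by measurable
    qed
    show ?thesis by measurable
  qed
  fix p :: "'a \<times> real" assume p: "p \<in> space (M \<Otimes>\<^sub>M borel)"
  show "(\<lambda>n. indicator {a..b} (snd p) * W (g n \<lfloor>real (Suc n) * snd p\<rfloor>) (fst p)) \<longlonglongrightarrow> indicator {a..b} (snd p) * W (snd p) (fst p)"
  proof (cases "snd p \<in> {a..b}")
    case True
    have "(\<lambda>n. real_of_int \<lfloor>real (Suc n) * snd p\<rfloor> / real (Suc n)) \<longlonglongrightarrow> snd p"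
    proof (rule tendsto_sandwich)
      have "(\<lambda>n. snd p - inverse (real (Suc n))) \<longlonglongrightarrow> snd p - 0" by (intro tendsto_intros LIMSEQ_inverse_real_of_nat)
      then show "(\<lambda>n. snd p - inverse (real (Suc n))) \<longlonglongrightarrow> snd p" by simp
      show "\<forall>\<^sub>F n in sequentially. snd p - inverse (real (Suc n)) \<le> real_of_int \<lfloor>real (Suc n) * snd p\<rfloor> / real (Suc n)"
      proof (rule always_eventually, rule allI)
        fix n
        have "real (Suc n) * snd p - 1 \<le> real_of_int \<lfloor>real (Suc n) * snd p\<rfloor>" by linarith
        then have "(real (Suc n) * snd p - 1) / real (Suc n) \<le> real_of_int \<lfloor>real (Suc n) * snd p\<rfloor> / real (Suc n)"
          by (rule divide_right_mono) simp
        then show "snd p - inverse (real (Suc n)) \<le> real_of_int \<lfloor>real (Suc n) * snd p\<rfloor> / real (Suc n)"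
          by (simp add: diff_divide_distrib inverse_eq_divide del: of_nat_Suc)
      qed
      show "\<forall>\<^sub>F n in sequentially. real_of_int \<lfloor>real (Suc n) * snd p\<rfloor> / real (Suc n) \<le> snd p"
        by (rule always_eventually, rule allI) (simp add: divide_le_eq mult.commute del: of_nat_Suc)
    qed simp
    then have "(\<lambda>n. g n \<lfloor>real (Suc n) * snd p\<rfloor>) \<longlonglongrightarrow> max a (min b (snd p))"
      unfolding g_def by (intro tendsto_max tendsto_min tendsto_const)
    then have l: "(\<lambda>n. g n \<lfloor>real (Suc n) * snd p\<rfloor>) \<longlonglongrightarrow> snd p" using True by simp
    have "fst p \<in> space M" using p by (auto simp: space_pair_measure)
    from continuous_on_tendsto_compose[OF c[OF this] l True]
    have "(\<lambda>n. W (g n \<lfloor>real (Suc n) * snd p\<rfloor>) (fst p)) \<longlonglongrightarrow> W (snd p) (fst p)" using g by simp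
    then show ?thesis by (rule tendsto_mult_left)
  qed simp
qed

text \<open>\<open>noise_char\<close> encodes, through characteristic functions, that the driving noise has Gaussian
  increments that are independent of the past.\<close>

locale controlled_noise = filtered_brownian P F B + parisi_clock \<zeta> \<tau>
  for P :: "'a measure" and F B \<zeta> \<tau> +
  fixes X U :: "real \<Rightarrow> 'a \<Rightarrow> real" and h :: real and a :: "real \<Rightarrow> real" and A :: real
  assumes X_adapted: "r \<in> {0..1} \<Longrightarrow> X r \<in> borel_measurable (F r)"
    and X_continuous: "\<omega> \<in> space P \<Longrightarrow> continuous_on {0..1} (\<lambda>r. X r \<omega>)"
    and X_start: "AE \<omega> in P. X 0 \<omega> = h"
    and X_integrable: "r \<in> {0..1} \<Longrightarrow> integrable P (X r)"
    and U_adapted: "r \<in> {0..1} \<Longrightarrow> U r \<in> borel_measurable (F r)"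
    and U_continuous: "\<omega> \<in> space P \<Longrightarrow> continuous_on {0..1} (\<lambda>r. U r \<omega>)"
    and U_le: "r \<in> {0..1} \<Longrightarrow> \<bar>U r \<omega>\<bar> \<le> 1"
    and a_measurable [measurable]: "a \<in> borel_measurable borel" and a_le: "\<bar>a r\<bar> \<le> A"
    and noise_char: "0 \<le> s \<Longrightarrow> s \<le> t \<Longrightarrow> t \<le> 1 \<Longrightarrow> E \<in> sets (F s) \<Longrightarrow>
        (LINT \<omega>|P. complex_of_real (indicator E \<omega>) * iexp (l * (X t \<omega> - X s \<omega> - (LBINT w:{s..t}. a w * U w \<omega>))))
        = (LINT \<omega>|P. complex_of_real (indicator E \<omega>)) * complex_of_real (exp (- (l\<^sup>2 * (\<tau> t - \<tau> s) / 2)))"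
begin

lemma F_space [simp]: "0 \<le> r \<Longrightarrow> space (F r) = space P" by (rule space_F)

lemma U_measurable_F: "0 \<le> r \<Longrightarrow> r \<le> t \<Longrightarrow> t \<le> 1 \<Longrightarrow> U r \<in> borel_measurable (F t)"
  using F_measurable_mono[OF U_adapted[of r], of t] by auto

lemma drift_joint:
  assumes k: "k \<in> borel_measurable borel" and st: "0 \<le> s" "s \<le> t" "t \<le> 1"
  shows "(\<lambda>(\<omega>, w). indicator {s..t} w *\<^sub>R (k w * U w \<omega>)) \<in> borel_measurable (F t \<Otimes>\<^sub>M lborel)"
proof -
  have "(\<lambda>p. indicator {s..t} (snd p) * U (snd p) (fst p)) \<in> borel_measurable (F t \<Otimes>\<^sub>M borel)"
    using st by (intro continuous_paths_joint_measurable U_measurable_F continuous_on_subset[OF U_continuous]) auto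
  then have "(\<lambda>p. k (snd p) * (indicator {s..t} (snd p) * U (snd p) (fst p))) \<in> borel_measurable (F t \<Otimes>\<^sub>M borel)"
    using k by measurable
  moreover have "sets (F t \<Otimes>\<^sub>M borel) = sets (F t \<Otimes>\<^sub>M (lborel :: real measure))" by (rule sets_pair_measure_cong) auto
  ultimately have "(\<lambda>p. k (snd p) * (indicator {s..t} (snd p) * U (snd p) (fst p))) \<in> borel_measurable (F t \<Otimes>\<^sub>M lborel)"
    using measurable_cong_sets by blast
  then show ?thesis by (simp add: split_beta' mult_ac)
qed

lemma drift_measurable:
  assumes k: "k \<in> borel_measurable borel" and st: "0 \<le> s" "s \<le> t" "t \<le> 1"
  shows "(\<lambda>\<omega>. LBINT w:{s..t}. k w * U w \<omega>) \<in> borel_measurable (F t)"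
  unfolding set_lebesgue_integral_def
  by (rule lborel.borel_measurable_lebesgue_integral[OF drift_joint[OF assms]])

lemma drift_integrable:
  assumes [measurable]: "k \<in> borel_measurable borel" and K: "\<And>r. \<bar>k r\<bar> \<le> K" and st: "0 \<le> s" "t \<le> 1" and \<omega>: "\<omega> \<in> space P"
  shows "set_integrable lborel {s..t} (\<lambda>w. k w * U w \<omega>)"
proof -
  have [measurable]: "(\<lambda>w. indicator {0..1} w * U w \<omega>) \<in> borel_measurable borel"
    using borel_measurable_continuous_on_indicator[OF _ U_continuous[OF \<omega>]] by simp
  have "set_integrable lborel {s..t} (\<lambda>w. k w * (indicator {0..1} w * U w \<omega>))"
  proof (rule set_integrable_bounded_interval)
    fix w assume "w \<in> {s..t}"
    then have "\<bar>k w * U w \<omega>\<bar> \<le> K * 1" unfolding abs_mult using K[of w] U_le[of w \<omega>] st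
      by (intro mult_mono) auto
    then show "\<bar>k w * (indicator {0..1} w * U w \<omega>)\<bar> \<le> K * 1" using K[of w] by (auto simp: indicator_def)
  qed measurable
  then show ?thesis by (rule set_integrable_cong[THEN iffD1, rotated -1]) (use st in auto)
qed

lemma drift_le:
  assumes K: "\<And>r. \<bar>k r\<bar> \<le> K" and st: "0 \<le> s" "s \<le> t" "t \<le> 1"
  shows "\<bar>LBINT w:{s..t}. k w * U w \<omega>\<bar> \<le> K * (t - s)"
proof (rule set_integral_abs_le[OF st(2)])
  fix w assume "w \<in> {s..t}"
  then have "\<bar>k w * U w \<omega>\<bar> \<le> K * 1" unfolding abs_mult using K[of w] U_le[of w \<omega>] st
    by (intro mult_mono) auto
  then show "\<bar>k w * U w \<omega>\<bar> \<le> K" by simp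
qed

lemma drift_split:
  assumes k: "k \<in> borel_measurable borel" "\<And>r. \<bar>k r\<bar> \<le> K" and st: "0 \<le> s" "s \<le> t" "t \<le> 1" and \<omega>: "\<omega> \<in> space P"
  shows "(LBINT w:{0..t}. k w * U w \<omega>) = (LBINT w:{0..s}. k w * U w \<omega>) + (LBINT w:{s..t}. k w * U w \<omega>)"
proof -
  have "(LBINT w:{0..t}. k w * U w \<omega>) = (LBINT w:{0..s} \<union> {s..t}. k w * U w \<omega>)"
    using st by (simp add: ivl_disj_un)
  also have "\<dots> = (LBINT w:{0..s}. k w * U w \<omega>) + (LBINT w:{s..t}. k w * U w \<omega>)"
  proof (rule set_integral_Un_AE)
    show "AE w in lborel. \<not> (w \<in> {0..s} \<and> w \<in> {s..t})" using AE_lborel_singleton[of s] by eventually_elim auto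
    show "set_integrable lborel {0..s} (\<lambda>w. k w * U w \<omega>)" "set_integrable lborel {s..t} (\<lambda>w. k w * U w \<omega>)"
      using st by (auto intro!: drift_integrable[OF k _ _ \<omega>])
  qed auto
  finally show ?thesis .
qed

end

lemma (in parisi_pde) Phi1_joint: "(\<lambda>p. indicator {0..1} (fst p) * \<Phi>\<^sub>1 (fst p) (snd p)) \<in> borel_measurable (borel \<Otimes>\<^sub>M borel)"
proof -
  have "(\<lambda>p. indicator ({0..1} \<times> UNIV) p *\<^sub>R case_prod \<Phi>\<^sub>1 p) \<in> borel_measurable borel"
    by (rule borel_measurable_continuous_on_indicator[OF _ Phi1_cont]) (auto simp: borel_closed closed_Times)
  moreover have "(\<lambda>p. indicator ({0..1} \<times> UNIV) p *\<^sub>R case_prod \<Phi>\<^sub>1 p) = (\<lambda>p. indicator {0..1} (fst p) * \<Phi>\<^sub>1 (fst p) (snd p))"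
    by (auto simp: fun_eq_iff indicator_def)
  ultimately show ?thesis by (simp add: borel_prod)
qed

text \<open>The function \<open>k\<close> changes the gain from \<open>a\<close> to
  \<open>a + k\<close> while the noise stays that of \<open>X\<close>. The control \<open>U\<close>
  is kept as a given process and is not re-evaluated along the new state, so no new equation has to
  be solved.\<close>

locale controlled_ito = controlled_noise P F B \<zeta> \<tau> X U h a A + parisi_pde \<zeta> \<tau> \<alpha> \<Phi> \<Phi>\<^sub>1 \<Phi>\<^sub>2
  for P :: "'a measure" and F B \<zeta> \<tau> X U h a A \<alpha> \<Phi> \<Phi>\<^sub>1 \<Phi>\<^sub>2 +
  fixes k :: "real \<Rightarrow> real" and Kb :: real
  assumes k_measurable [measurable]: "k \<in> borel_measurable borel" and k_le: "\<bar>k r\<bar> \<le> Kb"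
begin

definition Y :: "real \<Rightarrow> 'a \<Rightarrow> real" where "Y t \<omega> = X t \<omega> + (LBINT w:{0..t}. k w * U w \<omega>)"

text \<open>The increment of \<open>X\<close> with its drift removed. It is the noise of
  \<open>X\<close> and of \<open>Y\<close> alike, because the two differ by a drift only.\<close>

definition N :: "real \<Rightarrow> real \<Rightarrow> 'a \<Rightarrow> real" where
  "N s t \<omega> = X t \<omega> - X s \<omega> - (LBINT w:{s..t}. a w * U w \<omega>)"

definition D :: "real \<Rightarrow> real \<Rightarrow> 'a \<Rightarrow> real" where
  "D s t \<omega> = (LBINT w:{s..t}. (a w + k w) * U w \<omega>)"

abbreviation "C \<equiv> A + Kb"

lemma ak_measurable: "(\<lambda>w. a w + k w) \<in> borel_measurable borel" by measurable
lemma ak_le: "\<bar>a r + k r\<bar> \<le> C" using a_le[of r] k_le[of r] by linarith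
lemma C_nonneg: "0 \<le> C" using ak_le[of 0] by linarith

lemma Y_step: "0 \<le> s \<Longrightarrow> s \<le> t \<Longrightarrow> t \<le> 1 \<Longrightarrow> \<omega> \<in> space P \<Longrightarrow> Y t \<omega> = Y s \<omega> + N s t \<omega> + D s t \<omega>"
proof -
  assume st: "0 \<le> s" "s \<le> t" "t \<le> 1" and \<omega>: "\<omega> \<in> space P"
  have "D s t \<omega> = (LBINT w:{s..t}. a w * U w \<omega>) + (LBINT w:{s..t}. k w * U w \<omega>)"
    unfolding D_def distrib_right
    by (rule set_integral_add(2)) (rule drift_integrable[OF a_measurable a_le st(1,3) \<omega>] drift_integrable[OF k_measurable k_le st(1,3) \<omega>])+
  then show ?thesis using drift_split[OF k_measurable k_le st \<omega>] by (simp add: Y_def N_def)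
qed

lemma D_le: "0 \<le> s \<Longrightarrow> s \<le> t \<Longrightarrow> t \<le> 1 \<Longrightarrow> \<bar>D s t \<omega>\<bar> \<le> C * (t - s)"
  unfolding D_def by (rule drift_le[OF ak_le])

lemma Y_adapted: "0 \<le> t \<Longrightarrow> t \<le> 1 \<Longrightarrow> Y t \<in> borel_measurable (F t)"
  unfolding Y_def[abs_def]
  by (intro borel_measurable_add X_adapted drift_measurable k_measurable) auto

lemma Y_measurable: "0 \<le> t \<Longrightarrow> t \<le> 1 \<Longrightarrow> Y t \<in> borel_measurable P"
  by (rule F_measurable[OF Y_adapted])

lemma N_measurable: "0 \<le> s \<Longrightarrow> s \<le> t \<Longrightarrow> t \<le> 1 \<Longrightarrow> N s t \<in> borel_measurable P"
  unfolding N_def[abs_def]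
  by (intro borel_measurable_diff F_measurable[OF X_adapted] F_measurable[OF drift_measurable] a_measurable) auto

lemma D_measurable: "0 \<le> s \<Longrightarrow> s \<le> t \<Longrightarrow> t \<le> 1 \<Longrightarrow> D s t \<in> borel_measurable P"
  unfolding D_def[abs_def] by (intro F_measurable[OF drift_measurable] ak_measurable) auto

lemma Y_integrable:
  assumes t: "0 \<le> t" "t \<le> 1"
  shows "integrable P (Y t)"
  unfolding Y_def
proof (rule Bochner_Integration.integrable_add)
  show "integrable P (X t)" using X_integrable t by auto
  show "integrable P (\<lambda>\<omega>. LBINT w:{0..t}. k w * U w \<omega>)"
    using drift_le[OF k_le order_refl t] F_measurable[OF drift_measurable[OF k_measurable order_refl t] t(1)]
    by (intro integrable_const_bound[where B="Kb * (t - 0)"]) auto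
qed

lemma Y_continuous:
  assumes \<omega>: "\<omega> \<in> space P"
  shows "continuous_on {0..1} (\<lambda>t. Y t \<omega>)"
  unfolding Y_def
proof (rule continuous_on_add[OF X_continuous[OF \<omega>]])
  let ?J = "\<lambda>t. LBINT w:{0..t}. k w * U w \<omega>"
  have *: "\<bar>?J t - ?J s\<bar> \<le> Kb * \<bar>t - s\<bar>" if "0 \<le> s" "s \<le> t" "t \<le> 1" for s t
    using drift_split[OF k_measurable k_le that \<omega>] drift_le[OF k_le that, where \<omega>=\<omega>] that by simp
  have "\<bar>?J t - ?J s\<bar> \<le> Kb * \<bar>t - s\<bar>" if "s \<in> {0..1}" "t \<in> {0..1}" for s t
    using *[of s t] *[of t s] that by (cases "s \<le> t") (auto simp: abs_minus_commute)
  moreover have "0 \<le> Kb" using k_le[of 0] by linarith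
  ultimately have "Kb-lipschitz_on {0..1} ?J"
    by (intro lipschitz_onI) (auto simp: dist_real_def)
  then show "continuous_on {0..1} ?J" by (rule lipschitz_on_continuous_on)
qed

lemma Phi_integrable:
  assumes t: "0 \<le> t" "t \<le> 1" and Wi: "integrable P W"
  shows "integrable P (\<lambda>\<omega>. \<Phi> t (W \<omega>))"
proof -
  obtain M where M0: "M \<ge> 0" and M: "\<And>s y. s \<in> {0..1} \<Longrightarrow> \<bar>\<Phi> s y\<bar> \<le> M + \<bar>y - 0\<bar>" using Phi_bound[of 0] by blast
  show ?thesis
  proof (rule Bochner_Integration.integrable_bound)
    show "integrable P (\<lambda>\<omega>. M + \<bar>W \<omega>\<bar>)" using Wi by auto
    show "(\<lambda>\<omega>. \<Phi> t (W \<omega>)) \<in> borel_measurable P"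
      using measurable_compose[OF borel_measurable_integrable[OF Wi] Phi_measurable] t by auto
    show "AE \<omega> in P. norm (\<Phi> t (W \<omega>)) \<le> norm (M + \<bar>W \<omega>\<bar>)"
      using M[of t] t M0 by (intro AE_I2) (auto intro: order_trans)
  qed
qed

lemma Y_minus_D_integrable:
  assumes st: "0 \<le> s" "s \<le> t" "t \<le> 1"
  shows "integrable P (\<lambda>\<omega>. Y t \<omega> - D s t \<omega>)"
proof (rule Bochner_Integration.integrable_diff)
  show "integrable P (Y t)" using Y_integrable st by auto
  show "integrable P (D s t)" using D_le[OF st] D_measurable[OF st]
    by (intro integrable_const_bound[where B="C * (t - s)"]) auto
qed

text \<open>With the drift since \<open>s\<close> removed, \<open>Y t\<close> is \<open>Y s\<close>
  plus a Gaussian independent of the past, so averaging over that Gaussian is the heat semigroup at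
  \<open>Y s\<close>.\<close>

lemma noise_step:
  assumes st: "0 \<le> s" "s \<le> t" "t \<le> 1" and f: "f \<in> borel_measurable borel" and fi: "integrable P (\<lambda>\<omega>. f (Y t \<omega> - D s t \<omega>))"
  shows "(LINT \<omega>|P. heat (\<tau> t - \<tau> s) f (Y s \<omega>)) = (LINT \<omega>|P. f (Y t \<omega> - D s t \<omega>))"
    and "integrable P (\<lambda>\<omega>. heat (\<tau> t - \<tau> s) f (Y s \<omega>))"
proof -
  have eq: "Y t \<omega> - D s t \<omega> = Y s \<omega> + N s t \<omega>" if "\<omega> \<in> space P" for \<omega>
    using Y_step[OF st that] by simp
  have V: "0 \<le> \<tau> t - \<tau> s" using tau_le[OF st] by simp
  have fi': "integrable P (\<lambda>\<omega>. f (Y s \<omega> + N s t \<omega>))"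
    by (rule Bochner_Integration.integrable_cong[THEN iffD1, OF refl _ fi]) (simp add: eq)
  have Ys: "Y s \<in> borel_measurable (F s)" using Y_adapted st by auto
  note nh = noise_heat[OF st(1) N_measurable[OF st] V _ Ys f fi']
  have char: "(LINT \<omega>|P. complex_of_real (indicator E \<omega>) * iexp (l * N s t \<omega>))
        = (LINT \<omega>|P. complex_of_real (indicator E \<omega>)) * complex_of_real (exp (- (l\<^sup>2 * (\<tau> t - \<tau> s) / 2)))"
    if "E \<in> sets (F s)" for E l unfolding N_def by (rule noise_char[OF st that])
  show "integrable P (\<lambda>\<omega>. heat (\<tau> t - \<tau> s) f (Y s \<omega>))" by (rule nh(2)[OF char])
  have "(LINT \<omega>|P. heat (\<tau> t - \<tau> s) f (Y s \<omega>)) = (LINT \<omega>|P. f (Y s \<omega> + N s t \<omega>))" by (rule nh(1)[OF char, symmetric])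
  also have "\<dots> = (LINT \<omega>|P. f (Y t \<omega> - D s t \<omega>))"
    by (rule Bochner_Integration.integral_cong) (simp_all add: eq)
  finally show "(LINT \<omega>|P. heat (\<tau> t - \<tau> s) f (Y s \<omega>)) = (LINT \<omega>|P. f (Y t \<omega> - D s t \<omega>))" .
qed

text \<open>Duhamel's formula evaluated at the random point \<open>Y s\<close>: in expectation its
  Gaussian averages become expectations at the true later times, except that the drift accumulated
  since \<open>s\<close> is still missing.\<close>

lemma ito_step:
  assumes st: "0 \<le> s" "s \<le> t" "t \<le> 1"
  shows "(LINT \<omega>|P. \<Phi> s (Y s \<omega>)) = (LINT \<omega>|P. \<Phi> t (Y t \<omega> - D s t \<omega>))
      + (LBINT r:{s..t}. \<zeta> r / 2 * \<alpha> r * (LINT \<omega>|P. (\<Phi>\<^sub>1 r (Y r \<omega> - D s r \<omega>))\<^sup>2))"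
    and "set_integrable lborel {s..t} (\<lambda>r. \<zeta> r / 2 * \<alpha> r * (LINT \<omega>|P. (\<Phi>\<^sub>1 r (Y r \<omega> - D s r \<omega>))\<^sup>2))"
proof -
  have s01: "s \<in> {0..1}" "t \<in> {0..1}" using st by auto
  have [measurable]: "Y s \<in> borel_measurable P" using Y_measurable st by auto
  let ?G = "\<lambda>x r. \<zeta> r / 2 * \<alpha> r * heat (\<tau> r - \<tau> s) (\<lambda>y. (\<Phi>\<^sub>1 r y)\<^sup>2) x"
  let ?H = "\<lambda>\<omega> r. indicator {s..t} r * ?G (Y s \<omega>) r"
  have Phi1_m: "(\<lambda>y. (\<Phi>\<^sub>1 r y)\<^sup>2) \<in> borel_measurable borel" if "r \<in> {0..1}" for r
    using Phi1_measurable[OF that] by measurable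
  have E_heat: "(LINT \<omega>|P. heat (\<tau> r - \<tau> s) (\<lambda>y. (\<Phi>\<^sub>1 r y)\<^sup>2) (Y s \<omega>)) = (LINT \<omega>|P. (\<Phi>\<^sub>1 r (Y r \<omega> - D s r \<omega>))\<^sup>2)"
    if r: "r \<in> {s..t}" for r
  proof (rule noise_step(1))
    have r01: "r \<in> {0..1}" using r st by auto
    have [measurable]: "Y r \<in> borel_measurable P" "D s r \<in> borel_measurable P" "(\<lambda>y. (\<Phi>\<^sub>1 r y)\<^sup>2) \<in> borel_measurable borel"
      using Y_measurable[of r] D_measurable[of s r] Phi1_m[OF r01] r st by auto
    show "integrable P (\<lambda>\<omega>. (\<Phi>\<^sub>1 r (Y r \<omega> - D s r \<omega>))\<^sup>2)"
      by (rule integrable_const_bound[where B=1]) (use Phi1_sq_le[OF r01] in auto)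
  qed (use r st Phi1_m in auto)
  have H_joint: "(\<lambda>(\<omega>, r). ?H \<omega> r) \<in> borel_measurable (P \<Otimes>\<^sub>M lborel)"
  proof -
    \<comment> \<open>A globally Borel version of the heat average as a function of time and place;
      the indicators confine \<open>\<Phi>\<^sub>1\<close> and \<open>\<tau>\<close> to [0,1], where
      \<open>G\<close> agrees with \<open>heat\<close>.\<close>
    define G where "G = (\<lambda>p. LINT z|std_normal_distribution. (indicator {0..1} (fst p) * \<Phi>\<^sub>1 (fst p) (snd p + sqrt (indicator {0..1} (fst p) * \<tau> (fst p) - \<tau> s) * z))\<^sup>2)"
    have [measurable]: "(\<lambda>r. indicator {0..1} r * \<tau> r) \<in> borel_measurable borel"
      using borel_measurable_continuous_on_indicator[OF _ tau_cont] by simp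
    have [measurable]: "G \<in> borel_measurable (borel \<Otimes>\<^sub>M borel)"
      unfolding G_def
    proof (rule std_normal.borel_measurable_lebesgue_integral)
      have m: "(\<lambda>q. (fst (fst q), snd (fst q) + sqrt (indicator {0..1} (fst (fst q)) * \<tau> (fst (fst q)) - \<tau> s) * snd q))
          \<in> (borel \<Otimes>\<^sub>M borel) \<Otimes>\<^sub>M std_normal_distribution \<rightarrow>\<^sub>M (borel \<Otimes>\<^sub>M borel :: (real \<times> real) measure)"
        by measurable
      show "(\<lambda>(p, z). (indicator {0..1} (fst p) * \<Phi>\<^sub>1 (fst p) (snd p + sqrt (indicator {0..1} (fst p) * \<tau> (fst p) - \<tau> s) * z))\<^sup>2)
          \<in> borel_measurable ((borel \<Otimes>\<^sub>M borel) \<Otimes>\<^sub>M std_normal_distribution)"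
        using measurable_compose[OF m Phi1_joint] by (simp add: split_beta')
    qed
    have eq: "?H \<omega> r = indicator {s..t} r * (zeta_ext r / 2 * \<alpha> r * G (r, Y s \<omega>))" for \<omega> r
      using st by (auto simp: indicator_def G_def heat_def zeta_ext_eq)
    have "(\<lambda>p. indicator {s..t} (snd p) * (zeta_ext (snd p) / 2 * \<alpha> (snd p) * G (snd p, Y s (fst p)))) \<in> borel_measurable (P \<Otimes>\<^sub>M lborel)"
      by measurable
    then show ?thesis unfolding eq by (simp add: split_beta')
  qed
  have H_bd: "\<bar>?H \<omega> r\<bar> \<le> Z * indicator {s..t} r" for \<omega> r
    using zeta_alpha_half_bound[of r] heat_Phi1_sq[of r] st by (auto simp: indicator_def)
  have i_ind: "integrable lborel (\<lambda>r. Z * indicator {s..t} r)"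
    by (intro integrable_mult_right integrable_real_indicator) (auto simp: emeasure_lborel_Icc_eq)
  interpret pair: pair_sigma_finite P lborel ..
  have H_int: "integrable (P \<Otimes>\<^sub>M lborel) (\<lambda>(\<omega>, r). ?H \<omega> r)"
  proof (rule Bochner_Integration.integrable_bound[OF _ H_joint])
    show "integrable (P \<Otimes>\<^sub>M lborel) (\<lambda>(\<omega>, r). Z * indicator {s..t} r)"
    proof (rule pair.Fubini_integrable)
      show "(\<lambda>(\<omega>, r). Z * indicator {s..t} r) \<in> borel_measurable (P \<Otimes>\<^sub>M lborel)" by measurable
      show "integrable P (\<lambda>\<omega>. LINT r|lborel. norm (case (\<omega>, r) of (\<omega>, r) \<Rightarrow> Z * indicator {s..t} r))" by simp
      show "AE \<omega> in P. integrable lborel (\<lambda>r. case (\<omega>, r) of (\<omega>, r) \<Rightarrow> Z * indicator {s..t} r)" using i_ind by simp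
    qed
    show "AE p in P \<Otimes>\<^sub>M lborel. norm (case p of (\<omega>, r) \<Rightarrow> ?H \<omega> r) \<le> norm (case p of (\<omega>, r) \<Rightarrow> Z * indicator {s..t} r)"
      using H_bd Z_nonneg by (intro AE_I2) (auto simp: split_beta')
  qed
  have inner: "(LINT \<omega>|P. ?H \<omega> r) = indicator {s..t} r * (\<zeta> r / 2 * \<alpha> r * (LINT \<omega>|P. (\<Phi>\<^sub>1 r (Y r \<omega> - D s r \<omega>))\<^sup>2))" for r
    using E_heat[of r] by (cases "r \<in> {s..t}") auto
  have outer: "integrable lborel (\<lambda>r. LINT \<omega>|P. ?H \<omega> r)" by (rule pair.integrable_snd[OF H_int])
  then show "set_integrable lborel {s..t} (\<lambda>r. \<zeta> r / 2 * \<alpha> r * (LINT \<omega>|P. (\<Phi>\<^sub>1 r (Y r \<omega> - D s r \<omega>))\<^sup>2))"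
    unfolding inner by (simp add: set_integrable_def)
  have Phi_i: "integrable P (\<lambda>\<omega>. \<Phi> t (Y t \<omega> - D s t \<omega>))"
    using st by (intro Phi_integrable Y_minus_D_integrable) auto
  note ns = noise_step[OF st Phi_measurable[OF s01(2)] Phi_i]
  have i2: "integrable P (\<lambda>\<omega>. LBINT r. ?H \<omega> r)" using pair.integrable_fst[OF H_int] by simp
  have "(LINT \<omega>|P. \<Phi> s (Y s \<omega>)) = (LINT \<omega>|P. heat (\<tau> t - \<tau> s) (\<Phi> t) (Y s \<omega>) + (LBINT r. ?H \<omega> r))"
    using duhamel(1)[OF st] by (simp add: set_lebesgue_integral_def)
  also have "\<dots> = (LINT \<omega>|P. heat (\<tau> t - \<tau> s) (\<Phi> t) (Y s \<omega>)) + (LINT \<omega>|P. (LBINT r. ?H \<omega> r))"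
    by (rule Bochner_Integration.integral_add[OF ns(2) i2])
  also have "(LINT \<omega>|P. (LBINT r. ?H \<omega> r)) = (LBINT r. (LINT \<omega>|P. ?H \<omega> r))"
    by (rule pair.Fubini_integral[OF H_int, symmetric])
  also have "\<dots> = (LBINT r:{s..t}. \<zeta> r / 2 * \<alpha> r * (LINT \<omega>|P. (\<Phi>\<^sub>1 r (Y r \<omega> - D s r \<omega>))\<^sup>2))"
    unfolding inner by (simp add: set_lebesgue_integral_def)
  finally show "(LINT \<omega>|P. \<Phi> s (Y s \<omega>)) = (LINT \<omega>|P. \<Phi> t (Y t \<omega> - D s t \<omega>))
      + (LBINT r:{s..t}. \<zeta> r / 2 * \<alpha> r * (LINT \<omega>|P. (\<Phi>\<^sub>1 r (Y r \<omega> - D s r \<omega>))\<^sup>2))"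
    unfolding ns(1) .
qed

end

section \<open>Ito formula along a controlled process\<close>

lemma (in parisi_pde) Phi_mvt:
  assumes t: "t \<in> {0..1}"
  shows "\<exists>\<eta>. \<bar>\<eta> - y\<bar> \<le> \<bar>d\<bar> \<and> \<Phi> t y - \<Phi> t (y - d) = d * \<Phi>\<^sub>1 t \<eta>"
proof -
  consider "d = 0" | "d > 0" | "d < 0" by linarith
  then show ?thesis
  proof cases
    case 1
    then show ?thesis by (intro exI[of _ y]) simp
  next
    case 2
    then obtain z where "y - d < z" "z < y" "\<Phi> t y - \<Phi> t (y - d) = (y - (y - d)) * \<Phi>\<^sub>1 t z"
      using MVT2[of "y - d" y "\<Phi> t" "\<Phi>\<^sub>1 t"] Phi_deriv[OF t] by auto
    then show ?thesis using 2 by (intro exI[of _ z]) auto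
  next
    case 3
    then obtain z where "y < z" "z < y - d" "\<Phi> t (y - d) - \<Phi> t y = ((y - d) - y) * \<Phi>\<^sub>1 t z"
      using MVT2[of y "y - d" "\<Phi> t" "\<Phi>\<^sub>1 t"] Phi_deriv[OF t] by auto
    then show ?thesis using 3 by (intro exI[of _ z]) auto
  qed
qed

lemma (in parisi_pde) Phi1_isCont: "t \<in> {0..1} \<Longrightarrow> isCont (\<Phi>\<^sub>1 t) y"
  using Phi1_deriv[of t y] by (rule DERIV_isCont)

context controlled_ito
begin

lemma Phi1_Y_continuous:
  assumes "\<omega> \<in> space P"
  shows "continuous_on {0..1} (\<lambda>r. \<Phi>\<^sub>1 r (Y r \<omega>))"
  by (rule cont_comp[OF Phi1_cont continuous_on_id Y_continuous[OF assms]]) auto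

lemma Phi1_Y_measurable:
  assumes "r \<in> {0..1}"
  shows "(\<lambda>\<omega>. \<Phi>\<^sub>1 r (Y r \<omega>)) \<in> borel_measurable P"
  using measurable_compose[OF Y_measurable Phi1_measurable[OF assms]] assms by auto

text \<open>The drift missing within one cell is at most \<open>C\<close> times the distance to the
  left end of the cell, so it disappears under the continuous and bounded
  \<open>\<Phi>\<^sub>1\<close>.\<close>

lemma quadratic_limit:
  "(\<lambda>m. \<Sum>i<Suc m. LBINT r:{real i / real (Suc m)..real (Suc i) / real (Suc m)}.
        \<zeta> r / 2 * \<alpha> r * (LINT \<omega>|P. (\<Phi>\<^sub>1 r (Y r \<omega> - D (real i / real (Suc m)) r \<omega>))\<^sup>2))
    \<longlonglongrightarrow> (LBINT r:{0<..1}. \<zeta> r / 2 * \<alpha> r * (LINT \<omega>|P. (\<Phi>\<^sub>1 r (Y r \<omega>))\<^sup>2))"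
  "set_integrable lborel {0<..1} (\<lambda>r. \<zeta> r / 2 * \<alpha> r * (LINT \<omega>|P. (\<Phi>\<^sub>1 r (Y r \<omega>))\<^sup>2))"
proof -
  let ?f = "\<lambda>m i r. \<zeta> r / 2 * \<alpha> r * (LINT \<omega>|P. (\<Phi>\<^sub>1 r (Y r \<omega> - D (real i / real (Suc m)) r \<omega>))\<^sup>2)"
  have bnds: "0 \<le> real i / real (Suc m)" "real i / real (Suc m) \<le> real (Suc i) / real (Suc m)"
    "real (Suc i) / real (Suc m) \<le> 1" if "i < Suc m" for i m
    using that by (auto simp: divide_right_mono)
  have E_bd: "0 \<le> (LINT \<omega>|P. (\<Phi>\<^sub>1 r (W \<omega>))\<^sup>2)" "(LINT \<omega>|P. (\<Phi>\<^sub>1 r (W \<omega>))\<^sup>2) \<le> 1"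
    if r: "r \<in> {0..1}" and [measurable]: "W \<in> borel_measurable P" for r W
  proof -
    have [measurable]: "\<Phi>\<^sub>1 r \<in> borel_measurable borel" by (rule Phi1_measurable[OF r])
    have "integrable P (\<lambda>\<omega>. (\<Phi>\<^sub>1 r (W \<omega>))\<^sup>2)"
      by (rule integrable_const_bound[where B=1]) (use Phi1_sq_le[OF r] in auto)
    then have "(LINT \<omega>|P. (\<Phi>\<^sub>1 r (W \<omega>))\<^sup>2) \<le> (LINT \<omega>|P. 1)"
      by (intro integral_mono) (use Phi1_sq_le[OF r] in auto)
    then show "(LINT \<omega>|P. (\<Phi>\<^sub>1 r (W \<omega>))\<^sup>2) \<le> 1" using prob_space by simp
  qed simp
  have int: "set_integrable lborel {real i / real (Suc m)..real (Suc i) / real (Suc m)} (?f m i)" if "i < Suc m" for m i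
    by (rule ito_step(2)[OF bnds[OF that]])
  have bd: "\<bar>?f m i r\<bar> \<le> Z" if i: "i < Suc m" and r: "real i / real (Suc m) \<le> r" "r \<le> real (Suc i) / real (Suc m)" for m i r
  proof -
    have r01: "0 \<le> r" "r \<le> 1" "r \<in> {0..1}" using order_trans[OF bnds(1)[OF i] r(1)] order_trans[OF r(2) bnds(3)[OF i]] by auto
    have "(\<lambda>\<omega>. Y r \<omega> - D (real i / real (Suc m)) r \<omega>) \<in> borel_measurable P"
      using Y_measurable[OF r01(1,2)] D_measurable[OF bnds(1)[OF i] r(1) r01(2)] by (rule borel_measurable_diff)
    from E_bd[OF r01(3) this] show ?thesis by (intro zeta_alpha_half_bound r01(3))
  qed
  have lim: "(\<lambda>m. ?f m (cell (Suc m) r) r) \<longlonglongrightarrow> \<zeta> r / 2 * \<alpha> r * (LINT \<omega>|P. (\<Phi>\<^sub>1 r (Y r \<omega>))\<^sup>2)" if r: "0 < r" "r \<le> 1" for r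
  proof (intro tendsto_mult tendsto_const)
    have r01: "r \<in> {0..1}" using r by auto
    let ?s = "\<lambda>m. real (cell (Suc m) r) / real (Suc m)"
    have s: "0 \<le> ?s m" "?s m \<le> r" for m using cell_bounds(2)[of "Suc m" r] r by auto
    have [measurable]: "\<Phi>\<^sub>1 r \<in> borel_measurable borel" "Y r \<in> borel_measurable P" "\<And>m. D (?s m) r \<in> borel_measurable P"
      using Phi1_measurable[OF r01] Y_measurable[of r] D_measurable[OF s r(2)] r by auto
    show "(\<lambda>m. LINT \<omega>|P. (\<Phi>\<^sub>1 r (Y r \<omega> - D (?s m) r \<omega>))\<^sup>2) \<longlonglongrightarrow> (LINT \<omega>|P. (\<Phi>\<^sub>1 r (Y r \<omega>))\<^sup>2)"
    proof (rule integral_dominated_convergence[where w="\<lambda>_. 1"])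
      show "(\<lambda>\<omega>. (\<Phi>\<^sub>1 r (Y r \<omega> - D (?s m) r \<omega>))\<^sup>2) \<in> borel_measurable P" for m by measurable
      show "AE \<omega> in P. (\<lambda>m. (\<Phi>\<^sub>1 r (Y r \<omega> - D (?s m) r \<omega>))\<^sup>2) \<longlonglongrightarrow> (\<Phi>\<^sub>1 r (Y r \<omega>))\<^sup>2"
      proof (rule AE_I2)
        fix \<omega>
        have "(\<lambda>m. D (?s m) r \<omega>) \<longlonglongrightarrow> 0"
        proof (rule Lim_null_comparison)
          show "\<forall>\<^sub>F m in sequentially. norm (D (?s m) r \<omega>) \<le> C * (r - ?s m)"
            using D_le[OF s r(2)] by simp
          have "(\<lambda>m. C * (r - ?s m)) \<longlonglongrightarrow> C * (r - r)" by (intro tendsto_intros cell_limits r)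
          then show "(\<lambda>m. C * (r - ?s m)) \<longlonglongrightarrow> 0" by simp
        qed
        then have "(\<lambda>m. Y r \<omega> - D (?s m) r \<omega>) \<longlonglongrightarrow> Y r \<omega> - 0" by (intro tendsto_intros)
        then have "(\<lambda>m. \<Phi>\<^sub>1 r (Y r \<omega> - D (?s m) r \<omega>)) \<longlonglongrightarrow> \<Phi>\<^sub>1 r (Y r \<omega>)"
          using isCont_tendsto_compose[OF Phi1_isCont[OF r01]] by simp
        then show "(\<lambda>m. (\<Phi>\<^sub>1 r (Y r \<omega> - D (?s m) r \<omega>))\<^sup>2) \<longlonglongrightarrow> (\<Phi>\<^sub>1 r (Y r \<omega>))\<^sup>2" by (rule tendsto_power)
      qed
    qed (use Phi1_sq_le[OF r01] in auto)
  qed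
  show "(\<lambda>m. \<Sum>i<Suc m. LBINT r:{real i / real (Suc m)..real (Suc i) / real (Suc m)}. ?f m i r)
    \<longlonglongrightarrow> (LBINT r:{0<..1}. \<zeta> r / 2 * \<alpha> r * (LINT \<omega>|P. (\<Phi>\<^sub>1 r (Y r \<omega>))\<^sup>2))"
    by (rule partition_sum_limit(1)[OF int bd lim])
  show "set_integrable lborel {0<..1} (\<lambda>r. \<zeta> r / 2 * \<alpha> r * (LINT \<omega>|P. (\<Phi>\<^sub>1 r (Y r \<omega>))\<^sup>2))"
    by (rule partition_sum_limit(2)[OF int bd lim])
qed

text \<open>The effect of restoring the drift at the end of a step, complementary to the noise part
  treated by Duhamel's formula.\<close>

definition R :: "real \<Rightarrow> real \<Rightarrow> 'a \<Rightarrow> real" where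
  "R s t \<omega> = \<Phi> t (Y t \<omega>) - \<Phi> t (Y t \<omega> - D s t \<omega>)"

text \<open>For a fixed path the drift is Lipschitz in time, so this is a first-order chain rule:
  the mean value theorem writes each \<open>R\<close> as an integral with
  \<open>\<Phi>\<^sub>1\<close> frozen at an intermediate point, and that point approaches the path.
  The intermediate points are chosen path by path; measurability is inherited by the limit.\<close>

lemma drift_pathwise_limit:
  assumes \<omega>: "\<omega> \<in> space P"
  shows "(\<lambda>m. \<Sum>i<Suc m. R (real i / real (Suc m)) (real (Suc i) / real (Suc m)) \<omega>)
    \<longlonglongrightarrow> (LBINT r:{0<..1}. (a r + k r) * U r \<omega> * \<Phi>\<^sub>1 r (Y r \<omega>))"
proof -
  let ?s = "\<lambda>m i. real i / real (Suc m)"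
  have bnds: "0 \<le> ?s m i" "?s m i \<le> ?s m (Suc i)" "?s m (Suc i) \<le> 1" if "i < Suc m" for i m
    using that by (auto simp: divide_right_mono)
  have ex: "\<exists>\<eta>. i < Suc m \<longrightarrow> \<bar>\<eta> - Y (?s m (Suc i)) \<omega>\<bar> \<le> \<bar>D (?s m i) (?s m (Suc i)) \<omega>\<bar>
      \<and> R (?s m i) (?s m (Suc i)) \<omega> = D (?s m i) (?s m (Suc i)) \<omega> * \<Phi>\<^sub>1 (?s m (Suc i)) \<eta>" for m i
  proof (cases "i < Suc m")
    case True
    then have "?s m (Suc i) \<in> {0..1}" using bnds[OF True] by (auto simp del: of_nat_Suc intro: order_trans)
    from Phi_mvt[OF this, of "Y (?s m (Suc i)) \<omega>" "D (?s m i) (?s m (Suc i)) \<omega>"] show ?thesis unfolding R_def by blast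
  qed simp
  have "\<forall>m i. \<exists>\<eta>. i < Suc m \<longrightarrow> \<bar>\<eta> - Y (?s m (Suc i)) \<omega>\<bar> \<le> \<bar>D (?s m i) (?s m (Suc i)) \<omega>\<bar>
      \<and> R (?s m i) (?s m (Suc i)) \<omega> = D (?s m i) (?s m (Suc i)) \<omega> * \<Phi>\<^sub>1 (?s m (Suc i)) \<eta>"
    using ex by blast
  then obtain \<eta> where \<eta>: "\<And>m i. i < Suc m \<Longrightarrow> \<bar>\<eta> m i - Y (?s m (Suc i)) \<omega>\<bar> \<le> \<bar>D (?s m i) (?s m (Suc i)) \<omega>\<bar>"
    and R: "\<And>m i. i < Suc m \<Longrightarrow> R (?s m i) (?s m (Suc i)) \<omega> = D (?s m i) (?s m (Suc i)) \<omega> * \<Phi>\<^sub>1 (?s m (Suc i)) (\<eta> m i)"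
    unfolding choice_iff by blast
  let ?f = "\<lambda>m i r. (a r + k r) * U r \<omega> * \<Phi>\<^sub>1 (?s m (Suc i)) (\<eta> m i)"
  have int: "set_integrable lborel {?s m i..?s m (Suc i)} (?f m i)" if "i < Suc m" for m i
    by (rule set_integrable_mult_left) (rule drift_integrable[OF ak_measurable ak_le bnds(1,3)[OF that] \<omega>])
  have R_int: "R (?s m i) (?s m (Suc i)) \<omega> = (LBINT r:{?s m i..?s m (Suc i)}. ?f m i r)" if "i < Suc m" for m i
    unfolding R[OF that] D_def by simp
  have bd: "\<bar>?f m i r\<bar> \<le> C" if i: "i < Suc m" and r: "?s m i \<le> r" "r \<le> ?s m (Suc i)" for m i r
  proof -
    have r01: "r \<in> {0..1}" and s01: "?s m (Suc i) \<in> {0..1}"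
      using order_trans[OF bnds(1)[OF i] r(1)] order_trans[OF r(2) bnds(3)[OF i]] order_trans[OF bnds(1,2)[OF i]] bnds(3)[OF i]
      by auto
    have "\<bar>?f m i r\<bar> \<le> C * 1 * 1"
      unfolding abs_mult using ak_le[of r] U_le[OF r01, of \<omega>] Phi1_le[OF s01, of "\<eta> m i"] C_nonneg
      by (intro mult_mono) auto
    then show ?thesis by simp
  qed
  have lim: "(\<lambda>m. ?f m (cell (Suc m) r) r) \<longlonglongrightarrow> (a r + k r) * U r \<omega> * \<Phi>\<^sub>1 r (Y r \<omega>)" if r: "0 < r" "r \<le> 1" for r
  proof (intro tendsto_mult tendsto_const)
    let ?c = "\<lambda>m. cell (Suc m) r"
    have r01: "r \<in> {0..1}" using r by auto
    have c: "?c m < Suc m" for m by (rule cell_bounds(1)) (use r in auto)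
    have t01: "?s m (Suc (?c m)) \<in> {0..1}" for m using bnds[OF c[of m]] by (auto simp del: of_nat_Suc intro: order_trans)
    have tl: "(\<lambda>m. ?s m (Suc (?c m))) \<longlonglongrightarrow> r" by (rule cell_limits(2)[OF r])
    have sl: "(\<lambda>m. ?s m (?c m)) \<longlonglongrightarrow> r" by (rule cell_limits(1)[OF r])
    have Yl: "(\<lambda>m. Y (?s m (Suc (?c m))) \<omega>) \<longlonglongrightarrow> Y r \<omega>"
      by (rule continuous_on_tendsto_compose[OF Y_continuous[OF \<omega>] tl r01]) (use t01 in simp)
    have "(\<lambda>m. \<eta> m (?c m) - Y (?s m (Suc (?c m))) \<omega>) \<longlonglongrightarrow> 0"
    proof (rule Lim_null_comparison)
      show "\<forall>\<^sub>F m in sequentially. norm (\<eta> m (?c m) - Y (?s m (Suc (?c m))) \<omega>) \<le> C * (?s m (Suc (?c m)) - ?s m (?c m))"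
      proof (rule always_eventually, rule allI)
        fix m
        show "norm (\<eta> m (?c m) - Y (?s m (Suc (?c m))) \<omega>) \<le> C * (?s m (Suc (?c m)) - ?s m (?c m))"
          using \<eta>[OF c[of m]] D_le[OF bnds[OF c[of m]], where \<omega>=\<omega>] unfolding real_norm_def by linarith
      qed
      have "(\<lambda>m. C * (?s m (Suc (?c m)) - ?s m (?c m))) \<longlonglongrightarrow> C * (r - r)" by (intro tendsto_intros tl sl)
      then show "(\<lambda>m. C * (?s m (Suc (?c m)) - ?s m (?c m))) \<longlonglongrightarrow> 0" by simp
    qed
    from tendsto_add[OF this Yl] have "(\<lambda>m. \<eta> m (?c m)) \<longlonglongrightarrow> Y r \<omega>" by simp
    from continuous_on_tendsto_compose[OF Phi1_cont tendsto_Pair[OF tl this]]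
    show "(\<lambda>m. \<Phi>\<^sub>1 (?s m (Suc (?c m))) (\<eta> m (?c m))) \<longlonglongrightarrow> \<Phi>\<^sub>1 r (Y r \<omega>)"
      using t01 r01 by simp
  qed
  have "(\<lambda>m. \<Sum>i<Suc m. LBINT r:{?s m i..?s m (Suc i)}. ?f m i r) \<longlonglongrightarrow> (LBINT r:{0<..1}. (a r + k r) * U r \<omega> * \<Phi>\<^sub>1 r (Y r \<omega>))"
    by (rule partition_sum_limit(1)[OF int bd lim])
  moreover have "(\<Sum>i<Suc m. LBINT r:{?s m i..?s m (Suc i)}. ?f m i r) = (\<Sum>i<Suc m. R (?s m i) (?s m (Suc i)) \<omega>)" for m
    by (rule sum.cong[OF refl]) (rule R_int[symmetric], simp)
  ultimately show ?thesis by simp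
qed

lemma R_measurable:
  assumes "0 \<le> s" "s \<le> t" "t \<le> 1"
  shows "R s t \<in> borel_measurable P"
proof -
  have [measurable]: "\<Phi> t \<in> borel_measurable borel" "Y t \<in> borel_measurable P" "D s t \<in> borel_measurable P"
    using assms by (auto intro!: Phi_measurable Y_measurable D_measurable)
  show ?thesis unfolding R_def[abs_def] by measurable
qed

lemma R_le:
  assumes "0 \<le> s" "s \<le> t" "t \<le> 1"
  shows "\<bar>R s t \<omega>\<bar> \<le> C * (t - s)"
  using Phi_lipschitz[of t "Y t \<omega>" "Y t \<omega> - D s t \<omega>"] D_le[OF assms, of \<omega>] assms by (auto simp: R_def)

lemma drift_expectation:
  "set_integrable lborel {0<..1} (\<lambda>r. (a r + k r) * (LINT \<omega>|P. U r \<omega> * \<Phi>\<^sub>1 r (Y r \<omega>)))"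
  "(LINT \<omega>|P. (LBINT r:{0<..1}. (a r + k r) * U r \<omega> * \<Phi>\<^sub>1 r (Y r \<omega>)))
     = (LBINT r:{0<..1}. (a r + k r) * (LINT \<omega>|P. U r \<omega> * \<Phi>\<^sub>1 r (Y r \<omega>)))"
proof -
  interpret pair: pair_sigma_finite P lborel ..
  let ?H = "\<lambda>\<omega> r. indicator {0<..1} r * ((a r + k r) * U r \<omega> * \<Phi>\<^sub>1 r (Y r \<omega>))"
  have joint: "(\<lambda>p. indicator {0..1} (snd p) * (U (snd p) (fst p) * \<Phi>\<^sub>1 (snd p) (Y (snd p) (fst p)))) \<in> borel_measurable (P \<Otimes>\<^sub>M borel)"
    by (intro continuous_paths_joint_measurable[where W="\<lambda>r \<omega>. U r \<omega> * \<Phi>\<^sub>1 r (Y r \<omega>)"] continuous_on_mult U_continuous Phi1_Y_continuous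
        borel_measurable_times Phi1_Y_measurable F_measurable[OF U_adapted]) auto
  have "sets (P \<Otimes>\<^sub>M borel) = sets (P \<Otimes>\<^sub>M (lborel :: real measure))" by (rule sets_pair_measure_cong) auto
  then have [measurable]: "(\<lambda>p. indicator {0..1} (snd p) * (U (snd p) (fst p) * \<Phi>\<^sub>1 (snd p) (Y (snd p) (fst p)))) \<in> borel_measurable (P \<Otimes>\<^sub>M lborel)"
    using joint measurable_cong_sets by blast
  have eq: "?H \<omega> r = indicator {0<..1} r * ((a r + k r) * (indicator {0..1} r * (U r \<omega> * \<Phi>\<^sub>1 r (Y r \<omega>))))" for \<omega> r
    by (auto simp: indicator_def)
  have H_joint: "(\<lambda>(\<omega>, r). ?H \<omega> r) \<in> borel_measurable (P \<Otimes>\<^sub>M lborel)"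
  proof -
    have 1: "(\<lambda>p. indicator {0<..1::real} (snd p) :: real) \<in> borel_measurable (P \<Otimes>\<^sub>M lborel)"
      by (rule measurable_compose[OF measurable_snd]) simp
    have 2: "(\<lambda>p. (a (snd p) + k (snd p)) * (indicator {0..1} (snd p) * (U (snd p) (fst p) * \<Phi>\<^sub>1 (snd p) (Y (snd p) (fst p)))))
        \<in> borel_measurable (P \<Otimes>\<^sub>M lborel)" by measurable
    show ?thesis unfolding eq split_beta' by (rule borel_measurable_times[OF 1 2])
  qed
  have i_ind: "integrable lborel (\<lambda>r. C * indicator {0<..1::real} r)"
    by (intro integrable_mult_right integrable_real_indicator) auto
  have H_bd: "\<bar>?H \<omega> r\<bar> \<le> C * indicator {0<..1} r" for \<omega> r
  proof (cases "r \<in> {0<..1}")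
    case True
    then have r01: "r \<in> {0..1}" by auto
    have "\<bar>(a r + k r) * U r \<omega> * \<Phi>\<^sub>1 r (Y r \<omega>)\<bar> \<le> C * 1 * 1"
      unfolding abs_mult using ak_le[of r] U_le[OF r01, of \<omega>] Phi1_le[OF r01, of "Y r \<omega>"] C_nonneg
      by (intro mult_mono) auto
    then show ?thesis using True by simp
  qed simp
  have H_int: "integrable (P \<Otimes>\<^sub>M lborel) (\<lambda>(\<omega>, r). ?H \<omega> r)"
  proof (rule Bochner_Integration.integrable_bound[OF _ H_joint])
    show "integrable (P \<Otimes>\<^sub>M lborel) (\<lambda>(\<omega>, r). C * indicator {0<..1::real} r)"
    proof (rule pair.Fubini_integrable)
      show "(\<lambda>(\<omega>, r). C * indicator {0<..1::real} r) \<in> borel_measurable (P \<Otimes>\<^sub>M lborel)"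
        unfolding split_beta' by (intro borel_measurable_times borel_measurable_const measurable_compose[OF measurable_snd] borel_measurable_indicator) simp
      show "integrable P (\<lambda>\<omega>. LINT r|lborel. norm (case (\<omega>, r) of (\<omega>, r) \<Rightarrow> C * indicator {0<..1::real} r))" by simp
      show "AE \<omega> in P. integrable lborel (\<lambda>r. case (\<omega>, r) of (\<omega>, r) \<Rightarrow> C * indicator {0<..1::real} r)" using i_ind by simp
    qed
    show "AE p in P \<Otimes>\<^sub>M lborel. norm (case p of (\<omega>, r) \<Rightarrow> ?H \<omega> r) \<le> norm (case p of (\<omega>, r) \<Rightarrow> C * indicator {0<..1::real} r)"
      using H_bd C_nonneg by (intro AE_I2) (auto simp: split_beta')
  qed
  have inner: "(LINT \<omega>|P. ?H \<omega> r) = indicator {0<..1} r * ((a r + k r) * (LINT \<omega>|P. U r \<omega> * \<Phi>\<^sub>1 r (Y r \<omega>)))" for r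
    by (simp add: mult.assoc)
  show "set_integrable lborel {0<..1} (\<lambda>r. (a r + k r) * (LINT \<omega>|P. U r \<omega> * \<Phi>\<^sub>1 r (Y r \<omega>)))"
    using pair.integrable_snd[OF H_int] unfolding inner by (simp add: set_integrable_def)
  have "(LINT \<omega>|P. (LBINT r. ?H \<omega> r)) = (LBINT r. (LINT \<omega>|P. ?H \<omega> r))"
    by (rule pair.Fubini_integral[OF H_int, symmetric])
  then show "(LINT \<omega>|P. (LBINT r:{0<..1}. (a r + k r) * U r \<omega> * \<Phi>\<^sub>1 r (Y r \<omega>)))
     = (LBINT r:{0<..1}. (a r + k r) * (LINT \<omega>|P. U r \<omega> * \<Phi>\<^sub>1 r (Y r \<omega>)))"
    unfolding inner by (simp add: set_lebesgue_integral_def)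
qed

text \<open>The change of the expected value between times 0 and 1 does not depend on the partition,
  so the telescoped sums may be replaced by their limits. The quadratic term is an expectation from
  the outset; the drift term converges pathwise and is dominated by \<open>C\<close>.\<close>

theorem ito_formula:
  "(LINT \<omega>|P. ln (cosh (Y 1 \<omega>))) = \<Phi> 0 h
     + (LBINT r:{0<..1}. (a r + k r) * (LINT \<omega>|P. U r \<omega> * \<Phi>\<^sub>1 r (Y r \<omega>)))
     - (LBINT r:{0<..1}. \<zeta> r / 2 * \<alpha> r * (LINT \<omega>|P. (\<Phi>\<^sub>1 r (Y r \<omega>))\<^sup>2))"
proof -
  let ?s = "\<lambda>m i. real i / real (Suc m)"
  let ?e = "\<lambda>t. LINT \<omega>|P. \<Phi> t (Y t \<omega>)"
  let ?Q = "\<lambda>m i. LBINT r:{?s m i..?s m (Suc i)}. \<zeta> r / 2 * \<alpha> r * (LINT \<omega>|P. (\<Phi>\<^sub>1 r (Y r \<omega> - D (?s m i) r \<omega>))\<^sup>2)"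
  have bnds: "0 \<le> ?s m i" "?s m i \<le> ?s m (Suc i)" "?s m (Suc i) \<le> 1" if "i < Suc m" for i m
    using that by (auto simp: divide_right_mono)
  have Ri: "integrable P (R (?s m i) (?s m (Suc i)))" if "i < Suc m" for m i
    by (rule integrable_const_bound[where B="C * (?s m (Suc i) - ?s m i)"])
      (use R_le[OF bnds[OF that]] R_measurable[OF bnds[OF that]] in auto)
  have step: "?e (?s m (Suc i)) - ?e (?s m i) = (LINT \<omega>|P. R (?s m i) (?s m (Suc i)) \<omega>) - ?Q m i" if i: "i < Suc m" for m i
  proof -
    note b = bnds[OF i]
    have t0: "0 \<le> ?s m (Suc i)" using b by linarith
    have 1: "integrable P (\<lambda>\<omega>. \<Phi> (?s m (Suc i)) (Y (?s m (Suc i)) \<omega>))"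
      by (intro Phi_integrable Y_integrable t0 b(3))
    have 2: "integrable P (\<lambda>\<omega>. \<Phi> (?s m (Suc i)) (Y (?s m (Suc i)) \<omega> - D (?s m i) (?s m (Suc i)) \<omega>))"
      by (intro Phi_integrable Y_minus_D_integrable t0 b)
    have "(LINT \<omega>|P. R (?s m i) (?s m (Suc i)) \<omega>) = ?e (?s m (Suc i)) - (LINT \<omega>|P. \<Phi> (?s m (Suc i)) (Y (?s m (Suc i)) \<omega> - D (?s m i) (?s m (Suc i)) \<omega>))"
      unfolding R_def by (rule Bochner_Integration.integral_diff[OF 1 2])
    then show ?thesis using ito_step(1)[OF b] by linarith
  qed
  have tele: "?e 1 - ?e 0 = (LINT \<omega>|P. (\<Sum>i<Suc m. R (?s m i) (?s m (Suc i)) \<omega>)) - (\<Sum>i<Suc m. ?Q m i)" for m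
  proof -
    have "?e 1 - ?e 0 = ?e (?s m (Suc m)) - ?e (?s m 0)" by simp
    also have "\<dots> = (\<Sum>i<Suc m. ?e (?s m (Suc i)) - ?e (?s m i))"
      by (rule sum_lessThan_telescope[where f="\<lambda>i. ?e (?s m i)", symmetric])
    also have "\<dots> = (\<Sum>i<Suc m. (LINT \<omega>|P. R (?s m i) (?s m (Suc i)) \<omega>) - ?Q m i)"
      by (rule sum.cong[OF refl], rule step) simp
    also have "\<dots> = (\<Sum>i<Suc m. LINT \<omega>|P. R (?s m i) (?s m (Suc i)) \<omega>) - (\<Sum>i<Suc m. ?Q m i)"
      by (rule sum_subtractf)
    also have "(\<Sum>i<Suc m. LINT \<omega>|P. R (?s m i) (?s m (Suc i)) \<omega>) = (LINT \<omega>|P. (\<Sum>i<Suc m. R (?s m i) (?s m (Suc i)) \<omega>))"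
      by (rule Bochner_Integration.integral_sum[symmetric], rule Ri) simp
    finally show ?thesis .
  qed
  have "(\<lambda>m. LINT \<omega>|P. (\<Sum>i<Suc m. R (?s m i) (?s m (Suc i)) \<omega>)) \<longlonglongrightarrow> (LINT \<omega>|P. (LBINT r:{0<..1}. (a r + k r) * U r \<omega> * \<Phi>\<^sub>1 r (Y r \<omega>)))"
  proof (rule integral_dominated_convergence[where w="\<lambda>_. C"])
    show m: "(\<lambda>\<omega>. \<Sum>i<Suc m. R (?s m i) (?s m (Suc i)) \<omega>) \<in> borel_measurable P" for m
      by (rule borel_measurable_sum, rule R_measurable, (rule bnds, simp)+)
    show "(\<lambda>\<omega>. LBINT r:{0<..1}. (a r + k r) * U r \<omega> * \<Phi>\<^sub>1 r (Y r \<omega>)) \<in> borel_measurable P"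
      by (rule borel_measurable_LIMSEQ_real[OF drift_pathwise_limit m])
    show "AE \<omega> in P. (\<lambda>m. \<Sum>i<Suc m. R (?s m i) (?s m (Suc i)) \<omega>) \<longlonglongrightarrow> (LBINT r:{0<..1}. (a r + k r) * U r \<omega> * \<Phi>\<^sub>1 r (Y r \<omega>))"
      by (rule AE_I2, rule drift_pathwise_limit)
    show "AE \<omega> in P. norm (\<Sum>i<Suc m. R (?s m i) (?s m (Suc i)) \<omega>) \<le> C" for m
    proof (rule AE_I2)
      fix \<omega>
      have "norm (\<Sum>i<Suc m. R (?s m i) (?s m (Suc i)) \<omega>) \<le> (\<Sum>i<Suc m. C * (?s m (Suc i) - ?s m i))"
        by (rule sum_norm_le) (use R_le[OF bnds] in simp)
      also have "\<dots> = C * (\<Sum>i<Suc m. ?s m (Suc i) - ?s m i)" by (simp only: sum_distrib_left)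
      also have "(\<Sum>i<Suc m. ?s m (Suc i) - ?s m i) = ?s m (Suc m) - ?s m 0"
        by (rule sum_lessThan_telescope[where f="\<lambda>i. ?s m i"])
      finally show "norm (\<Sum>i<Suc m. R (?s m i) (?s m (Suc i)) \<omega>) \<le> C" by simp
    qed
  qed simp
  from tendsto_diff[OF this quadratic_limit(1)]
  have "(\<lambda>m. ?e 1 - ?e 0) \<longlonglongrightarrow> (LINT \<omega>|P. (LBINT r:{0<..1}. (a r + k r) * U r \<omega> * \<Phi>\<^sub>1 r (Y r \<omega>)))
      - (LBINT r:{0<..1}. \<zeta> r / 2 * \<alpha> r * (LINT \<omega>|P. (\<Phi>\<^sub>1 r (Y r \<omega>))\<^sup>2))"
    unfolding tele[symmetric] .
  then have "?e 1 - ?e 0 = (LINT \<omega>|P. (LBINT r:{0<..1}. (a r + k r) * U r \<omega> * \<Phi>\<^sub>1 r (Y r \<omega>)))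
      - (LBINT r:{0<..1}. \<zeta> r / 2 * \<alpha> r * (LINT \<omega>|P. (\<Phi>\<^sub>1 r (Y r \<omega>))\<^sup>2))"
    by (rule LIMSEQ_unique[OF tendsto_const])
  moreover have "?e 0 = \<Phi> 0 h"
  proof -
    \<comment> \<open>At time 0 the drift is an integral over one point, and \<open>X 0 = h\<close>
      almost surely.\<close>
    have ae: "AE \<omega> in P. \<Phi> 0 (Y 0 \<omega>) = \<Phi> 0 h"
      using X_start
    proof eventually_elim
      case (elim \<omega>)
      have "\<bar>LBINT w:{0..0}. k w * U w \<omega>\<bar> \<le> Kb * (0 - 0)" by (rule drift_le[OF k_le]) auto
      then show ?case using elim by (simp add: Y_def)
    qed
    have "?e 0 = (LINT \<omega>|P. \<Phi> 0 h)"
      using measurable_compose[OF Y_measurable[of 0] Phi_measurable[of 0]] by (intro integral_cong_AE ae) auto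
    then show ?thesis using prob_space by simp
  qed
  moreover have "?e 1 = (LINT \<omega>|P. ln (cosh (Y 1 \<omega>)))" by (simp add: Phi_terminal)
  ultimately show ?thesis using drift_expectation(2) by linarith
qed

end

section \<open>First-order expansion and adjoint inequality\<close>

lemma ln_cosh_deriv: "((\<lambda>x. ln (cosh x)) has_real_derivative tanh x) (at x)" for x :: real
  by (auto intro!: derivative_eq_intros simp: tanh_def cosh_real_pos)

text \<open>Convexity of the terminal value, in the form that is integrated over paths below: the
  derivative \<open>tanh\<close> has the nonnegative derivative \<open>1 - tanh^2\<close>.\<close>

lemma ln_cosh_tangent: "ln (cosh x) + d * tanh x \<le> ln (cosh (x + d))" for x d :: real
proof -
  have "convex_on UNIV (\<lambda>x::real. ln (cosh x))"
  proof (rule f''_ge0_imp_convex)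
    show "((\<lambda>x::real. ln (cosh x)) has_real_derivative tanh x) (at x)" for x by (rule ln_cosh_deriv)
    show "(tanh has_real_derivative 1 - (tanh x)\<^sup>2) (at x)" for x :: real
      by (auto intro!: derivative_eq_intros simp: cosh_real_pos[THEN less_imp_neq, symmetric])
    show "0 \<le> 1 - (tanh x)\<^sup>2" for x :: real
      using tanh_real_bounds[of x] by (auto simp: abs_square_le_1 abs_le_iff less_imp_le)
  qed simp
  from convex_on_imp_above_tangent[OF this, of x "x + d" "tanh x"] ln_cosh_deriv[of x]
  show ?thesis by (simp add: mult.commute)
qed

lemma ln_cosh_lipschitz: "\<bar>ln (cosh x)\<bar> \<le> \<bar>x\<bar>" for x :: real
proof -
  have "\<bar>ln (cosh x) - ln (cosh 0)\<bar> \<le> 1 * \<bar>x - 0\<bar>"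
    using field_differentiable_bound[of UNIV "\<lambda>x::real. ln (cosh x)" tanh 1 x 0] ln_cosh_deriv
      tanh_real_bounds by (fastforce simp: abs_le_iff less_imp_le)
  then show ?thesis by simp
qed

lemma integrable_ln_cosh:
  fixes f :: "'a \<Rightarrow> real"
  assumes f: "integrable M f"
  shows "integrable M (\<lambda>x. ln (cosh (f x)))"
proof (rule Bochner_Integration.integrable_bound[OF f])
  have "(\<lambda>x::real. ln (cosh x)) \<in> borel_measurable borel"
    using ln_cosh_deriv by (intro borel_measurable_continuous_onI continuous_at_imp_continuous_on ballI)
      (blast intro: DERIV_isCont)
  then show "(\<lambda>x. ln (cosh (f x))) \<in> borel_measurable M"
    by (rule measurable_compose[OF borel_measurable_integrable[OF f]])
  show "AE x in M. norm (ln (cosh (f x))) \<le> norm (f x)"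
    using ln_cosh_lipschitz by (intro AE_I2) simp
qed

lemma set_integrable_coeff_continuous:
  fixes c e :: "real \<Rightarrow> real"
  assumes [measurable]: "c \<in> borel_measurable borel" and c: "\<And>r. \<bar>c r\<bar> \<le> K" and e: "continuous_on {a..b} e"
  shows "set_integrable lborel {a..b} (\<lambda>r. c r * e r)"
proof -
  obtain M where M: "\<And>r. r \<in> {a..b} \<Longrightarrow> \<bar>e r\<bar> \<le> M"
    using continuous_abs_bounded[OF compact_Icc e] by blast
  have [measurable]: "(\<lambda>r. indicator {a..b} r * e r) \<in> borel_measurable borel"
    using borel_measurable_continuous_on_indicator[OF _ e] by simp
  have "set_integrable lborel {a..b} (\<lambda>r. c r * (indicator {a..b} r * e r))"
  proof (rule set_integrable_bounded_interval)
    fix r assume r: "r \<in> {a..b}"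
    have "0 \<le> K" using c[of 0] by linarith
    then show "\<bar>c r * (indicator {a..b} r * e r)\<bar> \<le> K * M"
      unfolding abs_mult using c[of r] M[OF r] r by (intro mult_mono) auto
  qed measurable
  then show ?thesis by (rule set_integrable_cong[THEN iffD1, rotated -1]) auto
qed

lemma (in prob_space) expectation_continuous_on:
  fixes W :: "real \<Rightarrow> 'a \<Rightarrow> real"
  assumes m: "\<And>r. r \<in> S \<Longrightarrow> W r \<in> borel_measurable M"
    and c: "\<And>\<omega>. \<omega> \<in> space M \<Longrightarrow> continuous_on S (\<lambda>r. W r \<omega>)"
    and b: "\<And>r \<omega>. r \<in> S \<Longrightarrow> \<bar>W r \<omega>\<bar> \<le> K"
  shows "continuous_on S (\<lambda>r. LINT \<omega>|M. W r \<omega>)"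
proof (rule continuous_on_sequentiallyI)
  fix u r assume u: "\<forall>n. u n \<in> S" "r \<in> S" "u \<longlonglongrightarrow> r"
  show "(\<lambda>n. LINT \<omega>|M. W (u n) \<omega>) \<longlonglongrightarrow> (LINT \<omega>|M. W r \<omega>)"
  proof (rule integral_dominated_convergence[where w="\<lambda>_. K"])
    show "AE \<omega> in M. (\<lambda>n. W (u n) \<omega>) \<longlonglongrightarrow> W r \<omega>"
      using u by (intro AE_I2 continuous_on_tendsto_compose[OF c]) auto
  qed (use u m b in auto)
qed

text \<open>A cleaned-up form of the state equation: all paths are continuous, and the stochastic
  integral is encoded by the characteristic function of the increments with the drift
  removed.\<close>

locale parisi_sde = filtered_brownian P F B + parisi_pde \<zeta> \<tau> \<alpha>\<^sub>0 \<Psi> \<Psi>\<^sub>1 \<Psi>\<^sub>2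
  for P :: "'a measure" and F B \<zeta> \<tau> \<alpha>\<^sub>0 \<Psi> \<Psi>\<^sub>1 \<Psi>\<^sub>2 +
  fixes X :: "real \<Rightarrow> 'a \<Rightarrow> real" and h :: real
  assumes X_adapted: "r \<in> {0..1} \<Longrightarrow> X r \<in> borel_measurable (F r)"
    and X_continuous: "\<omega> \<in> space P \<Longrightarrow> continuous_on {0..1} (\<lambda>r. X r \<omega>)"
    and X_start: "AE \<omega> in P. X 0 \<omega> = h"
    and X_integrable: "r \<in> {0..1} \<Longrightarrow> integrable P (X r)"
    and noise_char: "0 \<le> s \<Longrightarrow> s \<le> t \<Longrightarrow> t \<le> 1 \<Longrightarrow> E \<in> sets (F s) \<Longrightarrow>
        (LINT \<omega>|P. complex_of_real (indicator E \<omega>) * iexp (l * (X t \<omega> - X s \<omega> - (LBINT w:{s..t}. zeta_ext w * \<alpha>\<^sub>0 w * \<Psi>\<^sub>1 w (X w \<omega>)))))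
        = (LINT \<omega>|P. complex_of_real (indicator E \<omega>)) * complex_of_real (exp (- (l\<^sup>2 * (\<tau> t - \<tau> s) / 2)))"
begin

text \<open>The process \<open>u\<close> of the theorem, regarded as a control: \<open>X\<close> is
  the state that it drives with gain \<open>b\<close>.\<close>

definition V :: "real \<Rightarrow> 'a \<Rightarrow> real" where "V r \<omega> = \<Psi>\<^sub>1 r (X r \<omega>)"

definition b :: "real \<Rightarrow> real" where "b r = zeta_ext r * \<alpha>\<^sub>0 r"

lemma b_measurable [measurable]: "b \<in> borel_measurable borel" unfolding b_def by measurable

lemma coeff_le:
  assumes "\<bar>c\<bar> \<le> 1"
  shows "\<bar>zeta_ext r * c\<bar> \<le> Z"
  using mult_mono[OF zeta_ext_abs_le[of r] assms] Z_nonneg by (simp add: abs_mult)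

lemma b_le: "\<bar>b r\<bar> \<le> Z"
  unfolding b_def using alpha_nonneg[of r] alpha_le[of r] by (intro coeff_le) auto

lemma V_le: "r \<in> {0..1} \<Longrightarrow> \<bar>V r \<omega>\<bar> \<le> 1" unfolding V_def by (rule Phi1_le)

lemma noise: "controlled_noise P F B \<zeta> \<tau> X V h b Z"
proof
  show "X r \<in> borel_measurable (F r)" if "r \<in> {0..1}" for r by (rule X_adapted[OF that])
  show "continuous_on {0..1} (\<lambda>r. X r \<omega>)" if "\<omega> \<in> space P" for \<omega> by (rule X_continuous[OF that])
  show "AE \<omega> in P. X 0 \<omega> = h" by (rule X_start)
  show "integrable P (X r)" if "r \<in> {0..1}" for r by (rule X_integrable[OF that])
  show "V r \<in> borel_measurable (F r)" if "r \<in> {0..1}" for r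
    unfolding V_def[abs_def] by (rule measurable_compose[OF X_adapted[OF that] Phi1_measurable[OF that]])
  show "continuous_on {0..1} (\<lambda>r. V r \<omega>)" if "\<omega> \<in> space P" for \<omega>
    unfolding V_def by (rule cont_comp[OF Phi1_cont continuous_on_id X_continuous[OF that]]) auto
  show "\<bar>V r \<omega>\<bar> \<le> 1" if "r \<in> {0..1}" for r \<omega> by (rule V_le[OF that])
  show "b \<in> borel_measurable borel" by (rule b_measurable)
  show "\<bar>b r\<bar> \<le> Z" for r by (rule b_le)
  show "(LINT \<omega>|P. complex_of_real (indicator E \<omega>) * iexp (l * (X t \<omega> - X s \<omega> - (LBINT w:{s..t}. b w * V w \<omega>))))
        = (LINT \<omega>|P. complex_of_real (indicator E \<omega>)) * complex_of_real (exp (- (l\<^sup>2 * (\<tau> t - \<tau> s) / 2)))"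
    if "0 \<le> s" "s \<le> t" "t \<le> 1" "E \<in> sets (F s)" for s t E l
    using noise_char[OF that] by (simp add: b_def V_def)
qed

sublocale noise: controlled_noise P F B \<zeta> \<tau> X V h b Z by (rule noise)

definition m\<^sub>2 :: "real \<Rightarrow> real" where "m\<^sub>2 r = (LINT \<omega>|P. (V r \<omega>)\<^sup>2)"

text \<open>\<open>cY k\<close> is the state driven by the optimal control for \<open>\<alpha>\<^sub>0\<close> with its gain perturbed by \<open>k\<close>.\<close>

definition cY :: "(real \<Rightarrow> real) \<Rightarrow> real \<Rightarrow> 'a \<Rightarrow> real" where
  "cY k t \<omega> = X t \<omega> + (LBINT w:{0..t}. k w * V w \<omega>)"

lemma V_measurable: "r \<in> {0..1} \<Longrightarrow> V r \<in> borel_measurable P"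
  using F_measurable[OF noise.U_adapted] by auto

lemma m2_continuous: "continuous_on {0..1} m\<^sub>2"
  unfolding m\<^sub>2_def
proof (rule expectation_continuous_on[where K=1])
  show "(\<lambda>\<omega>. (V r \<omega>)\<^sup>2) \<in> borel_measurable P" if "r \<in> {0..1}" for r using V_measurable[OF that] by measurable
  show "continuous_on {0..1} (\<lambda>r. (V r \<omega>)\<^sup>2)" if "\<omega> \<in> space P" for \<omega>
    by (intro continuous_intros noise.U_continuous that)
  show "\<bar>(V r \<omega>)\<^sup>2\<bar> \<le> 1" if "r \<in> {0..1}" for r \<omega> using V_le[OF that, of \<omega>] by (simp add: abs_square_le_1)
qed

text \<open>The solution \<open>\<Phi>\<close> and the perturbation \<open>k\<close> are free, while
  the control \<open>V\<close> always belongs to \<open>\<Psi>\<close>. Three choices matter: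
  \<open>k = 0\<close> with another \<open>\<Phi>\<close> for the expansion, a small
  \<open>k\<close> with \<open>\<Phi> = \<Psi>\<close> for the adjoint inequality, and the
  \<open>k\<close> that matches the gain to \<open>\<Phi>\<close> for the lower bound.\<close>

lemma ito:
  assumes pde: "parisi_pde \<zeta> \<tau> \<alpha> \<Phi> \<Phi>\<^sub>1 \<Phi>\<^sub>2" and k: "k \<in> borel_measurable borel" "\<And>r. \<bar>k r\<bar> \<le> K"
  shows "(LINT \<omega>|P. ln (cosh (cY k 1 \<omega>))) = \<Phi> 0 h
     + (LBINT r:{0..1}. (b r + k r) * (LINT \<omega>|P. V r \<omega> * \<Phi>\<^sub>1 r (cY k r \<omega>)))
     - (LBINT r:{0..1}. \<zeta> r / 2 * \<alpha> r * (LINT \<omega>|P. (\<Phi>\<^sub>1 r (cY k r \<omega>))\<^sup>2))"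
    and "continuous_on {0..1} (\<lambda>r. LINT \<omega>|P. V r \<omega> * \<Phi>\<^sub>1 r (cY k r \<omega>))"
    and "continuous_on {0..1} (\<lambda>r. LINT \<omega>|P. (\<Phi>\<^sub>1 r (cY k r \<omega>))\<^sup>2)"
    and "r \<in> {0..1} \<Longrightarrow> (\<lambda>\<omega>. \<Phi>\<^sub>1 r (cY k r \<omega>)) \<in> borel_measurable P"
    and "cY k 1 \<in> borel_measurable P" and "integrable P (cY k 1)"
proof -
  interpret p: parisi_pde \<zeta> \<tau> \<alpha> \<Phi> \<Phi>\<^sub>1 \<Phi>\<^sub>2 by (rule pde)
  interpret i: controlled_ito P F B \<zeta> \<tau> X V h b Z \<alpha> \<Phi> \<Phi>\<^sub>1 \<Phi>\<^sub>2 k K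
    by unfold_locales (rule k)+
  have Y: "i.Y = cY k" by (simp add: i.Y_def cY_def fun_eq_iff)
  show meas: "(\<lambda>\<omega>. \<Phi>\<^sub>1 r (cY k r \<omega>)) \<in> borel_measurable P" if "r \<in> {0..1}" for r
    using i.Phi1_Y_measurable[OF that] unfolding Y .
  show "cY k 1 \<in> borel_measurable P" "integrable P (cY k 1)"
    using i.Y_measurable[of 1] i.Y_integrable[of 1] unfolding Y by auto
  note cont = i.Phi1_Y_continuous[unfolded Y]
  show c1: "continuous_on {0..1} (\<lambda>r. LINT \<omega>|P. V r \<omega> * \<Phi>\<^sub>1 r (cY k r \<omega>))"
  proof (rule expectation_continuous_on[where K=1])
    show "(\<lambda>\<omega>. V r \<omega> * \<Phi>\<^sub>1 r (cY k r \<omega>)) \<in> borel_measurable P" if "r \<in> {0..1}" for r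
      by (intro borel_measurable_times V_measurable meas that)
    show "continuous_on {0..1} (\<lambda>r. V r \<omega> * \<Phi>\<^sub>1 r (cY k r \<omega>))" if "\<omega> \<in> space P" for \<omega>
      by (intro continuous_on_mult noise.U_continuous cont that)
    show "\<bar>V r \<omega> * \<Phi>\<^sub>1 r (cY k r \<omega>)\<bar> \<le> 1" if "r \<in> {0..1}" for r \<omega>
      using mult_mono[OF V_le[OF that, of \<omega>] p.Phi1_le[OF that, of "cY k r \<omega>"]] by (simp add: abs_mult)
  qed
  show c2: "continuous_on {0..1} (\<lambda>r. LINT \<omega>|P. (\<Phi>\<^sub>1 r (cY k r \<omega>))\<^sup>2)"
  proof (rule expectation_continuous_on[where K=1])
    show "(\<lambda>\<omega>. (\<Phi>\<^sub>1 r (cY k r \<omega>))\<^sup>2) \<in> borel_measurable P" if "r \<in> {0..1}" for r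
      by (intro borel_measurable_power meas that)
    show "continuous_on {0..1} (\<lambda>r. (\<Phi>\<^sub>1 r (cY k r \<omega>))\<^sup>2)" if "\<omega> \<in> space P" for \<omega>
      by (intro continuous_on_power cont that)
    show "\<bar>(\<Phi>\<^sub>1 r (cY k r \<omega>))\<^sup>2\<bar> \<le> 1" if "r \<in> {0..1}" for r \<omega> using p.Phi1_sq_le[OF that] by simp
  qed
  have s1: "set_integrable lborel {0..1} (\<lambda>r. (b r + k r) * (LINT \<omega>|P. V r \<omega> * \<Phi>\<^sub>1 r (cY k r \<omega>)))"
    by (rule set_integrable_coeff_continuous[OF i.ak_measurable i.ak_le c1])
  have "set_integrable lborel {0..1} (\<lambda>r. (zeta_ext r * (\<alpha> r / 2)) * (LINT \<omega>|P. (\<Phi>\<^sub>1 r (cY k r \<omega>))\<^sup>2))"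
    using p.alpha_nonneg p.alpha_le
    by (intro set_integrable_coeff_continuous[OF _ coeff_le c2]) (auto simp: order_trans[OF p.alpha_le])
  then have s2: "set_integrable lborel {0..1} (\<lambda>r. \<zeta> r / 2 * \<alpha> r * (LINT \<omega>|P. (\<Phi>\<^sub>1 r (cY k r \<omega>))\<^sup>2))"
    by (rule set_integrable_cong[THEN iffD1, rotated -1]) (auto simp: zeta_ext_eq)
  show "(LINT \<omega>|P. ln (cosh (cY k 1 \<omega>))) = \<Phi> 0 h
     + (LBINT r:{0..1}. (b r + k r) * (LINT \<omega>|P. V r \<omega> * \<Phi>\<^sub>1 r (cY k r \<omega>)))
     - (LBINT r:{0..1}. \<zeta> r / 2 * \<alpha> r * (LINT \<omega>|P. (\<Phi>\<^sub>1 r (cY k r \<omega>))\<^sup>2))"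
    using i.ito_formula unfolding Y set_integral_half_open(2)[OF s1] set_integral_half_open(2)[OF s2] .
qed

lemma cY_0 [simp]: "cY (\<lambda>_. 0) = X"
  by (simp add: cY_def fun_eq_iff set_lebesgue_integral_def)

lemma half_coeff_integrable:
  assumes "\<alpha> \<in> borel_measurable borel" "\<And>r. \<bar>\<alpha> r\<bar> \<le> 1" "continuous_on {0..1} e"
  shows "set_integrable lborel {0..1} (\<lambda>r. \<zeta> r / 2 * \<alpha> r * e r)"
proof -
  have "set_integrable lborel {0..1} (\<lambda>r. (zeta_ext r * (\<alpha> r / 2)) * e r)"
  proof (rule set_integrable_coeff_continuous[OF _ coeff_le assms(3)])
    show "(\<lambda>r. zeta_ext r * (\<alpha> r / 2)) \<in> borel_measurable borel" using assms(1) by measurable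
    show "\<bar>\<alpha> r / 2\<bar> \<le> 1" for r using assms(2)[of r] by simp
  qed
  then show ?thesis by (rule set_integrable_cong[THEN iffD1, rotated -1]) (auto simp: zeta_ext_eq)
qed

text \<open>For \<open>\<Phi> = \<Psi>\<close> along \<open>X\<close> the control is the gradient
  itself, so the drift term is twice the quadratic term and half of it remains.\<close>

lemma ito_unperturbed:
  "(LINT \<omega>|P. ln (cosh (X 1 \<omega>))) = \<Psi> 0 h + (LBINT r:{0..1}. \<zeta> r / 2 * \<alpha>\<^sub>0 r * m\<^sub>2 r)"
proof -
  have pde: "parisi_pde \<zeta> \<tau> \<alpha>\<^sub>0 \<Psi> \<Psi>\<^sub>1 \<Psi>\<^sub>2" by unfold_locales
  have al: "\<bar>\<alpha>\<^sub>0 r\<bar> \<le> 1" for r using alpha_nonneg[of r] alpha_le[of r] by simp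
  have m: "(LINT \<omega>|P. (\<Psi>\<^sub>1 r (X r \<omega>))\<^sup>2) = m\<^sub>2 r" "(LINT \<omega>|P. V r \<omega> * \<Psi>\<^sub>1 r (X r \<omega>)) = m\<^sub>2 r" for r
    by (simp_all add: m\<^sub>2_def V_def power2_eq_square)
  have s1: "set_integrable lborel {0..1} (\<lambda>r. b r * m\<^sub>2 r)"
    by (rule set_integrable_coeff_continuous[OF b_measurable b_le m2_continuous])
  have s2: "set_integrable lborel {0..1} (\<lambda>r. \<zeta> r / 2 * \<alpha>\<^sub>0 r * m\<^sub>2 r)"
    by (rule half_coeff_integrable[OF alpha_measurable al m2_continuous])
  have "(LINT \<omega>|P. ln (cosh (X 1 \<omega>))) = \<Psi> 0 h + (LBINT r:{0..1}. b r * m\<^sub>2 r) - (LBINT r:{0..1}. \<zeta> r / 2 * \<alpha>\<^sub>0 r * m\<^sub>2 r)"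
    using ito(1)[OF pde, of "\<lambda>_. 0" 0] by (simp add: m)
  moreover have "(LBINT r:{0..1}. b r * m\<^sub>2 r) - (LBINT r:{0..1}. \<zeta> r / 2 * \<alpha>\<^sub>0 r * m\<^sub>2 r) = (LBINT r:{0..1}. b r * m\<^sub>2 r - \<zeta> r / 2 * \<alpha>\<^sub>0 r * m\<^sub>2 r)"
    by (rule set_integral_diff(2)[OF s1 s2, symmetric])
  moreover have "\<dots> = (LBINT r:{0..1}. \<zeta> r / 2 * \<alpha>\<^sub>0 r * m\<^sub>2 r)"
  proof (rule set_lebesgue_integral_cong, simp, intro allI impI)
    fix r :: real assume "r \<in> {0..1}"
    then have "b r * m\<^sub>2 r = 2 * (\<zeta> r / 2 * \<alpha>\<^sub>0 r * m\<^sub>2 r)" by (simp add: b_def zeta_ext_eq)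
    then show "b r * m\<^sub>2 r - \<zeta> r / 2 * \<alpha>\<^sub>0 r * m\<^sub>2 r = \<zeta> r / 2 * \<alpha>\<^sub>0 r * m\<^sub>2 r" by linarith
  qed
  ultimately show ?thesis by linarith
qed

text \<open>Both solutions are followed along the same \<open>X\<close>, so their terminal
  expectations cancel on subtraction. After the first-order term is removed the integrand is
  \<open>\<zeta> / 2\<close> times the sum of
  \<open>\<alpha>\<^sub>0 * E (\<Phi>\<^sub>1 - V)^2\<close> and
  \<open>(\<alpha> - \<alpha>\<^sub>0) * (E \<Phi>\<^sub>1^2 - E V^2)\<close>, which is quadratic
  when \<open>\<theta>\<close> and \<open>\<delta>\<close> are of the same order.\<close>

lemma first_order_expansion:
  assumes pde: "parisi_pde \<zeta> \<tau> \<alpha> \<Phi> \<Phi>\<^sub>1 \<Phi>\<^sub>2"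
    and \<theta>: "\<And>r. r \<in> {0..1} \<Longrightarrow> \<bar>\<alpha> r - \<alpha>\<^sub>0 r\<bar> \<le> \<theta>"
    and \<delta>: "\<And>r x. r \<in> {0..1} \<Longrightarrow> \<bar>\<Phi>\<^sub>1 r x - \<Psi>\<^sub>1 r x\<bar> \<le> \<delta>"
  shows "\<bar>\<Phi> 0 h - \<Psi> 0 h - (LBINT r:{0..1}. \<zeta> r / 2 * (\<alpha> r - \<alpha>\<^sub>0 r) * m\<^sub>2 r)\<bar> \<le> Z * (\<delta>\<^sup>2 + 2 * \<theta> * \<delta>)"
proof -
  interpret p: parisi_pde \<zeta> \<tau> \<alpha> \<Phi> \<Phi>\<^sub>1 \<Phi>\<^sub>2 by (rule pde)
  have k0: "(\<lambda>_. 0) \<in> borel_measurable (borel :: real measure)" "\<bar>0\<bar> \<le> (0::real)" by auto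
  note I = ito[OF pde k0, simplified]
  define e1 where "e1 r = (LINT \<omega>|P. V r \<omega> * \<Phi>\<^sub>1 r (X r \<omega>))" for r
  define e2 where "e2 r = (LINT \<omega>|P. (\<Phi>\<^sub>1 r (X r \<omega>))\<^sup>2)" for r
  have c: "continuous_on {0..1} e1" "continuous_on {0..1} e2" using I(2,3) by (simp_all add: e1_def[abs_def] e2_def[abs_def])
  have al: "\<bar>\<alpha> r\<bar> \<le> 1" "\<bar>\<alpha>\<^sub>0 r\<bar> \<le> 1" "\<bar>\<alpha> r - \<alpha>\<^sub>0 r\<bar> \<le> 1" for r
    using alpha_nonneg[of r] alpha_le[of r] p.alpha_nonneg[of r] p.alpha_le[of r] by auto
  have s1: "set_integrable lborel {0..1} (\<lambda>r. b r * e1 r)"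
    by (rule set_integrable_coeff_continuous[OF b_measurable b_le c(1)])
  have s2: "set_integrable lborel {0..1} (\<lambda>r. \<zeta> r / 2 * \<alpha> r * e2 r)"
    by (rule half_coeff_integrable[OF p.alpha_measurable al(1) c(2)])
  have s3: "set_integrable lborel {0..1} (\<lambda>r. \<zeta> r / 2 * \<alpha>\<^sub>0 r * m\<^sub>2 r)"
    by (rule half_coeff_integrable[OF alpha_measurable al(2) m2_continuous])
  have s4: "set_integrable lborel {0..1} (\<lambda>r. \<zeta> r / 2 * (\<alpha> r - \<alpha>\<^sub>0 r) * m\<^sub>2 r)"
    by (rule half_coeff_integrable[OF _ al(3) m2_continuous]) measurable
  have "\<Phi> 0 h - \<Psi> 0 h - (LBINT r:{0..1}. \<zeta> r / 2 * (\<alpha> r - \<alpha>\<^sub>0 r) * m\<^sub>2 r)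
      = (LBINT r:{0..1}. \<zeta> r / 2 * \<alpha>\<^sub>0 r * m\<^sub>2 r) - (LBINT r:{0..1}. b r * e1 r) + (LBINT r:{0..1}. \<zeta> r / 2 * \<alpha> r * e2 r)
        - (LBINT r:{0..1}. \<zeta> r / 2 * (\<alpha> r - \<alpha>\<^sub>0 r) * m\<^sub>2 r)"
    using I(1) ito_unperturbed by (simp add: e1_def e2_def)
  also have "\<dots> = (LBINT r:{0..1}. \<zeta> r / 2 * \<alpha>\<^sub>0 r * m\<^sub>2 r - b r * e1 r + \<zeta> r / 2 * \<alpha> r * e2 r - \<zeta> r / 2 * (\<alpha> r - \<alpha>\<^sub>0 r) * m\<^sub>2 r)"
    using s1 s2 s3 s4 by (simp only: set_integral_add set_integral_diff)
  finally have eq: "\<Phi> 0 h - \<Psi> 0 h - (LBINT r:{0..1}. \<zeta> r / 2 * (\<alpha> r - \<alpha>\<^sub>0 r) * m\<^sub>2 r) = \<dots>" .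
  have bd: "\<bar>\<zeta> r / 2 * \<alpha>\<^sub>0 r * m\<^sub>2 r - b r * e1 r + \<zeta> r / 2 * \<alpha> r * e2 r - \<zeta> r / 2 * (\<alpha> r - \<alpha>\<^sub>0 r) * m\<^sub>2 r\<bar> \<le> Z * (\<delta>\<^sup>2 + 2 * \<theta> * \<delta>)"
    if r: "r \<in> {0..1}" for r
  proof -
    let ?w = "\<lambda>\<omega>. \<Phi>\<^sub>1 r (X r \<omega>) - V r \<omega>"
    have [measurable]: "V r \<in> borel_measurable P" "(\<lambda>\<omega>. \<Phi>\<^sub>1 r (X r \<omega>)) \<in> borel_measurable P"
      using V_measurable[OF r] I(4)[of r] r by auto
    have bnd: "\<bar>V r \<omega>\<bar> \<le> 1" "\<bar>\<Phi>\<^sub>1 r (X r \<omega>)\<bar> \<le> 1" for \<omega> using V_le[OF r] p.Phi1_le[OF r] by auto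
    have i: "integrable P (\<lambda>\<omega>. f \<omega> * g \<omega>)"
      if [measurable]: "f \<in> borel_measurable P" "g \<in> borel_measurable P" and "\<And>\<omega>. \<bar>f \<omega>\<bar> \<le> 1" "\<And>\<omega>. \<bar>g \<omega>\<bar> \<le> 1" for f g :: "'a \<Rightarrow> real"
    proof (rule integrable_const_bound[where B=1])
      show "AE \<omega> in P. norm (f \<omega> * g \<omega>) \<le> 1"
        using mult_mono[OF that(3,4)] by (intro AE_I2) (simp add: abs_mult)
    qed measurable
    have i1: "integrable P (\<lambda>\<omega>. V r \<omega> * V r \<omega>)" and i2: "integrable P (\<lambda>\<omega>. V r \<omega> * \<Phi>\<^sub>1 r (X r \<omega>))"
      and i3: "integrable P (\<lambda>\<omega>. \<Phi>\<^sub>1 r (X r \<omega>) * \<Phi>\<^sub>1 r (X r \<omega>))"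
      by (intro i bnd; measurable)+
    have \<delta>w: "\<bar>?w \<omega>\<bar> \<le> \<delta>" for \<omega> using \<delta>[OF r] by (simp add: V_def)
    have \<delta>0: "0 \<le> \<delta>" using \<delta>[OF r, of 0] by linarith
    have \<theta>0: "0 \<le> \<theta>" using \<theta>[OF r] by linarith
    have sq: "m\<^sub>2 r - 2 * e1 r + e2 r = (LINT \<omega>|P. (?w \<omega>)\<^sup>2)"
    proof -
      have "(LINT \<omega>|P. (?w \<omega>)\<^sup>2) = (LINT \<omega>|P. V r \<omega> * V r \<omega> - 2 * (V r \<omega> * \<Phi>\<^sub>1 r (X r \<omega>)) + \<Phi>\<^sub>1 r (X r \<omega>) * \<Phi>\<^sub>1 r (X r \<omega>))"
        by (intro Bochner_Integration.integral_cong) (auto simp: power2_eq_square algebra_simps)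
      then show ?thesis using i1 i2 i3 by (simp add: m\<^sub>2_def e1_def e2_def power2_eq_square)
    qed
    have sq_le: "\<bar>m\<^sub>2 r - 2 * e1 r + e2 r\<bar> \<le> \<delta>\<^sup>2"
    proof -
      have w2: "(?w \<omega>)\<^sup>2 \<le> \<delta>\<^sup>2" for \<omega> using \<delta>w[of \<omega>] \<delta>0 by (simp add: abs_le_square_iff[symmetric])
      have "integrable P (\<lambda>\<omega>. (?w \<omega>)\<^sup>2)"
        by (rule integrable_const_bound[where B="\<delta>\<^sup>2"]) (use w2 in auto)
      then have "(LINT \<omega>|P. (?w \<omega>)\<^sup>2) \<le> (LINT \<omega>|P. \<delta>\<^sup>2)" using w2 by (intro integral_mono) auto
      then show ?thesis unfolding sq using prob_space by simp
    qed
    have df_le: "\<bar>e2 r - m\<^sub>2 r\<bar> \<le> 2 * \<delta>"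
    proof -
      have eq: "e2 r - m\<^sub>2 r = (LINT \<omega>|P. \<Phi>\<^sub>1 r (X r \<omega>) * \<Phi>\<^sub>1 r (X r \<omega>) - V r \<omega> * V r \<omega>)"
        using i1 i3 by (simp add: e2_def m\<^sub>2_def power2_eq_square)
      have "\<bar>e2 r - m\<^sub>2 r\<bar> \<le> (LINT \<omega>|P. \<bar>\<Phi>\<^sub>1 r (X r \<omega>) * \<Phi>\<^sub>1 r (X r \<omega>) - V r \<omega> * V r \<omega>\<bar>)" unfolding eq by (rule integral_abs_bound)
      also have "\<dots> \<le> (LINT \<omega>|P. 2 * \<delta>)"
      proof (rule integral_mono)
        show "integrable P (\<lambda>\<omega>. \<bar>\<Phi>\<^sub>1 r (X r \<omega>) * \<Phi>\<^sub>1 r (X r \<omega>) - V r \<omega> * V r \<omega>\<bar>)" using i1 i3 by auto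
        fix \<omega>
        have "\<bar>?w \<omega>\<bar> * \<bar>\<Phi>\<^sub>1 r (X r \<omega>) + V r \<omega>\<bar> \<le> \<delta> * 2" using \<delta>w[of \<omega>] bnd[of \<omega>] \<delta>0 by (intro mult_mono) auto
        moreover have "\<Phi>\<^sub>1 r (X r \<omega>) * \<Phi>\<^sub>1 r (X r \<omega>) - V r \<omega> * V r \<omega> = ?w \<omega> * (\<Phi>\<^sub>1 r (X r \<omega>) + V r \<omega>)" by (simp add: algebra_simps)
        ultimately show "\<bar>\<Phi>\<^sub>1 r (X r \<omega>) * \<Phi>\<^sub>1 r (X r \<omega>) - V r \<omega> * V r \<omega>\<bar> \<le> 2 * \<delta>" by (simp add: abs_mult)
      qed simp
      finally show ?thesis using prob_space by simp
    qed
    have id: "\<zeta> r / 2 * \<alpha>\<^sub>0 r * m\<^sub>2 r - b r * e1 r + \<zeta> r / 2 * \<alpha> r * e2 r - \<zeta> r / 2 * (\<alpha> r - \<alpha>\<^sub>0 r) * m\<^sub>2 r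
        = \<zeta> r / 2 * (\<alpha>\<^sub>0 r * (m\<^sub>2 r - 2 * e1 r + e2 r) + (\<alpha> r - \<alpha>\<^sub>0 r) * (e2 r - m\<^sub>2 r))"
    proof -
      obtain z where z: "\<zeta> r / 2 = z" by blast
      have "b r = 2 * z * \<alpha>\<^sub>0 r" using r by (simp add: b_def zeta_ext_eq flip: z)
      then show ?thesis unfolding z by (simp add: algebra_simps)
    qed
    have "\<bar>\<alpha>\<^sub>0 r * (m\<^sub>2 r - 2 * e1 r + e2 r)\<bar> \<le> 1 * \<delta>\<^sup>2" unfolding abs_mult by (intro mult_mono al sq_le) auto
    moreover have "\<bar>(\<alpha> r - \<alpha>\<^sub>0 r) * (e2 r - m\<^sub>2 r)\<bar> \<le> \<theta> * (2 * \<delta>)" unfolding abs_mult by (intro mult_mono \<theta> r df_le \<theta>0) auto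
    ultimately have "\<bar>\<alpha>\<^sub>0 r * (m\<^sub>2 r - 2 * e1 r + e2 r) + (\<alpha> r - \<alpha>\<^sub>0 r) * (e2 r - m\<^sub>2 r)\<bar> \<le> \<delta>\<^sup>2 + 2 * \<theta> * \<delta>" by linarith
    then show ?thesis unfolding id abs_mult[of "\<zeta> r / 2"]
      using zeta_nonneg[OF r] zeta_le[OF r] Z_nonneg by (intro mult_mono) auto
  qed
  show ?thesis unfolding eq using set_integral_abs_le[OF _ bd, of 0 1] by simp
qed

lemma expectation_product_le:
  assumes r: "r \<in> {0..1}" and [measurable]: "f \<in> borel_measurable P" and f: "\<And>\<omega>. \<bar>f \<omega>\<bar> \<le> 1"
  shows "integrable P (\<lambda>\<omega>. V r \<omega> * f \<omega>)" "\<bar>LINT \<omega>|P. V r \<omega> * f \<omega>\<bar> \<le> 1"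
proof -
  have bd: "\<bar>V r \<omega> * f \<omega>\<bar> \<le> 1" for \<omega>
    using mult_mono[OF V_le[OF r, of \<omega>] f[of \<omega>]] by (simp add: abs_mult)
  show i: "integrable P (\<lambda>\<omega>. V r \<omega> * f \<omega>)"
    using V_measurable[OF r] by (intro integrable_const_bound[where B=1] AE_I2) (use bd in auto)
  have "\<bar>LINT \<omega>|P. V r \<omega> * f \<omega>\<bar> \<le> (LINT \<omega>|P. \<bar>V r \<omega> * f \<omega>\<bar>)" by (rule integral_abs_bound)
  also have "\<dots> \<le> (LINT \<omega>|P. 1)" using i bd by (intro integral_mono) auto
  finally show "\<bar>LINT \<omega>|P. V r \<omega> * f \<omega>\<bar> \<le> 1" using prob_space by simp
qed

text \<open>The expectation of \<open>(V - f)^2\<close> is nonnegative; with \<open>f\<close> a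
  gradient this is the square dropped in both one-sided estimates.\<close>

lemma two_expectation_le:
  assumes r: "r \<in> {0..1}" and f_m[measurable]: "f \<in> borel_measurable P" and f: "\<And>\<omega>. \<bar>f \<omega>\<bar> \<le> 1"
  shows "2 * (LINT \<omega>|P. V r \<omega> * f \<omega>) \<le> m\<^sub>2 r + (LINT \<omega>|P. (f \<omega>)\<^sup>2)"
proof -
  have [measurable]: "V r \<in> borel_measurable P" by (rule V_measurable[OF r])
  have i1: "integrable P (\<lambda>\<omega>. (V r \<omega>)\<^sup>2)" and i2: "integrable P (\<lambda>\<omega>. (f \<omega>)\<^sup>2)"
    by (rule integrable_const_bound[where B=1], use V_le[OF r] f in \<open>auto simp: abs_square_le_1\<close>)+
  have "2 * (LINT \<omega>|P. V r \<omega> * f \<omega>) = (LINT \<omega>|P. 2 * (V r \<omega> * f \<omega>))" by simp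
  also have "\<dots> \<le> (LINT \<omega>|P. (V r \<omega>)\<^sup>2 + (f \<omega>)\<^sup>2)"
  proof (rule integral_mono)
    show "integrable P (\<lambda>\<omega>. 2 * (V r \<omega> * f \<omega>))" using expectation_product_le(1)[OF assms] by simp
    show "2 * (V r \<omega> * f \<omega>) \<le> (V r \<omega>)\<^sup>2 + (f \<omega>)\<^sup>2" for \<omega>
      using sum_squares_bound[of "V r \<omega>" "f \<omega>"] by simp
  qed (use i1 i2 in auto)
  also have "\<dots> = m\<^sub>2 r + (LINT \<omega>|P. (f \<omega>)\<^sup>2)" using i1 i2 by (simp add: m\<^sub>2_def)
  finally show ?thesis .
qed

text \<open>Replaces the martingale property of \<open>V\<close>, whose proof would need a third derivative: perturb the
  optimal gain by \<open>-\<epsilon> k\<close>, drop the square term of definite sign in the Ito formula, divide by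
  \<open>-\<epsilon>\<close> and let \<open>\<epsilon>\<close> tend to 0.\<close>

lemma adjoint_inequality:
  assumes k[measurable]: "k \<in> borel_measurable borel" and K: "\<And>r. \<bar>k r\<bar> \<le> K"
  shows "(LBINT r:{0..1}. k r * m\<^sub>2 r) \<le> (LINT \<omega>|P. tanh (X 1 \<omega>) * (LBINT w:{0..1}. k w * V w \<omega>))"
proof -
  have pde: "parisi_pde \<zeta> \<tau> \<alpha>\<^sub>0 \<Psi> \<Psi>\<^sub>1 \<Psi>\<^sub>2" by unfold_locales
  let ?C = "\<lambda>\<omega>. LBINT w:{0..1}. k w * V w \<omega>"
  let ?\<epsilon> = "\<lambda>n. inverse (real (Suc n))"
  let ?k = "\<lambda>n r. - ?\<epsilon> n * k r"
  let ?e = "\<lambda>n r. LINT \<omega>|P. V r \<omega> * \<Psi>\<^sub>1 r (cY (?k n) r \<omega>)"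
  let ?q = "\<lambda>n r. LINT \<omega>|P. (\<Psi>\<^sub>1 r (cY (?k n) r \<omega>))\<^sup>2"
  have al: "\<bar>\<alpha>\<^sub>0 r\<bar> \<le> 1" for r using alpha_nonneg[of r] alpha_le[of r] by simp
  have K0: "0 \<le> K" using K[of 0] by linarith
  have km: "?k n \<in> borel_measurable borel" for n by measurable
  have \<epsilon>: "0 < ?\<epsilon> n" "?\<epsilon> n \<le> 1" for n by (auto simp: inverse_le_1_iff)
  \<comment> \<open>Since \<open>?\<epsilon> n \<le> 1\<close>, one bound serves all
    perturbations.\<close>
  have kb: "\<bar>?k n r\<bar> \<le> K" for n r
    using mult_mono[of "?\<epsilon> n" 1 "\<bar>k r\<bar>" K] \<epsilon>[of n] K[of r] by (auto simp: abs_mult)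
  note I = ito[OF pde km kb]
  have C_m[measurable]: "?C \<in> borel_measurable P"
    using F_measurable[OF noise.drift_measurable[OF k, of 0 1]] by auto
  have C_le: "\<bar>?C \<omega>\<bar> \<le> K" for \<omega> using noise.drift_le[OF K order_refl zero_le_one order_refl, where \<omega>=\<omega>] by simp
  have X1[measurable]: "X 1 \<in> borel_measurable P" and X1i: "integrable P (X 1)"
    using F_measurable[OF X_adapted[of 1]] X_integrable[of 1] by auto
  have Y: "cY (?k n) r \<omega> = X r \<omega> - ?\<epsilon> n * (LBINT w:{0..r}. k w * V w \<omega>)" for n r \<omega>
  proof -
    have "(LBINT w:{0..r}. ?k n w * V w \<omega>) = (LBINT w:{0..r}. (- ?\<epsilon> n) * (k w * V w \<omega>))" by (simp add: mult.assoc)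
    also have "\<dots> = - ?\<epsilon> n * (LBINT w:{0..r}. k w * V w \<omega>)" by (rule set_integral_mult_right)
    finally show ?thesis by (simp add: cY_def)
  qed
  have m_e: "continuous_on {0..1} (?e n)" "continuous_on {0..1} (?q n)" for n using I(2,3) by auto
  have ineq: "(LBINT r:{0..1}. k r * ?e n r) \<le> (LINT \<omega>|P. tanh (X 1 \<omega>) * ?C \<omega>)" for n
  proof -
    have lcY: "integrable P (\<lambda>\<omega>. ln (cosh (cY (?k n) 1 \<omega>)))" "integrable P (\<lambda>\<omega>. ln (cosh (X 1 \<omega>)))"
      by (rule integrable_ln_cosh[OF I(6)], rule integrable_ln_cosh[OF X1i])
    have tC: "integrable P (\<lambda>\<omega>. tanh (X 1 \<omega>) * ?C \<omega>)"
    proof (rule integrable_const_bound[where B="1 * K"])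
      show "AE \<omega> in P. norm (tanh (X 1 \<omega>) * ?C \<omega>) \<le> 1 * K"
        unfolding real_norm_def abs_mult using C_le tanh_real_bounds
        by (intro AE_I2 mult_mono) (auto simp: abs_le_iff less_imp_le)
      have "(\<lambda>x::real. tanh x) \<in> borel_measurable borel"
        by (intro borel_measurable_continuous_onI continuous_intros) auto
      then show "(\<lambda>\<omega>. tanh (X 1 \<omega>) * ?C \<omega>) \<in> borel_measurable P" by measurable
    qed
    have "(LINT \<omega>|P. ln (cosh (X 1 \<omega>))) - ?\<epsilon> n * (LINT \<omega>|P. tanh (X 1 \<omega>) * ?C \<omega>)
        = (LINT \<omega>|P. ln (cosh (X 1 \<omega>)) - ?\<epsilon> n * (tanh (X 1 \<omega>) * ?C \<omega>))"
      using lcY(2) tC by simp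
    also have "\<dots> \<le> (LINT \<omega>|P. ln (cosh (cY (?k n) 1 \<omega>)))"
    proof (rule integral_mono)
      fix \<omega>
      \<comment> \<open>Tangent line at the unperturbed end point, with the displacement caused by
        the perturbed gain.\<close>
      have "ln (cosh (X 1 \<omega>)) + (- ?\<epsilon> n * ?C \<omega>) * tanh (X 1 \<omega>) \<le> ln (cosh (X 1 \<omega> + (- ?\<epsilon> n * ?C \<omega>)))"
        by (rule ln_cosh_tangent)
      then show "ln (cosh (X 1 \<omega>)) - ?\<epsilon> n * (tanh (X 1 \<omega>) * ?C \<omega>) \<le> ln (cosh (cY (?k n) 1 \<omega>))"
        unfolding Y by (simp add: mult_ac)
    qed (use lcY tC in auto)
    also have "\<dots> = \<Psi> 0 h + (LBINT r:{0..1}. (b r + ?k n r) * ?e n r) - (LBINT r:{0..1}. \<zeta> r / 2 * \<alpha>\<^sub>0 r * ?q n r)"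
      by (rule I(1))
    also have "\<dots> \<le> \<Psi> 0 h + (LBINT r:{0..1}. \<zeta> r / 2 * \<alpha>\<^sub>0 r * m\<^sub>2 r) - ?\<epsilon> n * (LBINT r:{0..1}. k r * ?e n r)"
    proof -
      have s1: "set_integrable lborel {0..1} (\<lambda>r. b r * ?e n r)" by (rule set_integrable_coeff_continuous[OF b_measurable b_le m_e(1)])
      have s2: "set_integrable lborel {0..1} (\<lambda>r. ?\<epsilon> n * (k r * ?e n r))" by (intro set_integrable_mult_right set_integrable_coeff_continuous[OF k K m_e(1)])
      have s3: "set_integrable lborel {0..1} (\<lambda>r. \<zeta> r / 2 * \<alpha>\<^sub>0 r * ?q n r)" by (rule half_coeff_integrable[OF alpha_measurable al m_e(2)])
      have s4: "set_integrable lborel {0..1} (\<lambda>r. \<zeta> r / 2 * \<alpha>\<^sub>0 r * m\<^sub>2 r)" by (rule half_coeff_integrable[OF alpha_measurable al m2_continuous])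
      have "(LBINT r:{0..1}. (b r + ?k n r) * ?e n r) = (LBINT r:{0..1}. b r * ?e n r - ?\<epsilon> n * (k r * ?e n r))"
        by (rule set_lebesgue_integral_cong) (auto simp: algebra_simps)
      also have "\<dots> = (LBINT r:{0..1}. b r * ?e n r) - ?\<epsilon> n * (LBINT r:{0..1}. k r * ?e n r)"
        unfolding set_integral_diff(2)[OF s1 s2] by (simp only: set_integral_mult_right)
      finally have 1: "(LBINT r:{0..1}. (b r + ?k n r) * ?e n r) = \<dots>" .
      have "(LBINT r:{0..1}. b r * ?e n r) - (LBINT r:{0..1}. \<zeta> r / 2 * \<alpha>\<^sub>0 r * ?q n r) = (LBINT r:{0..1}. b r * ?e n r - \<zeta> r / 2 * \<alpha>\<^sub>0 r * ?q n r)"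
        by (rule set_integral_diff(2)[OF s1 s3, symmetric])
      also have "\<dots> \<le> (LBINT r:{0..1}. \<zeta> r / 2 * \<alpha>\<^sub>0 r * m\<^sub>2 r)"
      proof (rule set_integral_mono[OF set_integral_diff(1)[OF s1 s3] s4])
        fix r :: real assume r: "r \<in> {0..1}"
        have "2 * ?e n r \<le> m\<^sub>2 r + ?q n r" by (rule two_expectation_le[OF r I(4)[OF r] Phi1_le[OF r]])
        \<comment> \<open>The gain \<open>b\<close> is matched to the equation of
          \<open>\<Psi>\<close>, so \<open>b\<close> times the mixed expectation and the quadratic
          term combine into \<open>2 * ?e - ?q\<close>, which the completed square bounds by the
          second moment of the control.\<close>
        then have "(\<zeta> r / 2 * \<alpha>\<^sub>0 r) * (2 * ?e n r - ?q n r) \<le> (\<zeta> r / 2 * \<alpha>\<^sub>0 r) * m\<^sub>2 r"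
          using zeta_nonneg[OF r] alpha_nonneg[of r] by (intro mult_left_mono) auto
        then show "b r * ?e n r - \<zeta> r / 2 * \<alpha>\<^sub>0 r * ?q n r \<le> \<zeta> r / 2 * \<alpha>\<^sub>0 r * m\<^sub>2 r"
          using r by (simp add: b_def zeta_ext_eq right_diff_distrib mult_ac)
      qed
      finally show ?thesis using 1 by linarith
    qed
    also have "\<Psi> 0 h + (LBINT r:{0..1}. \<zeta> r / 2 * \<alpha>\<^sub>0 r * m\<^sub>2 r) = (LINT \<omega>|P. ln (cosh (X 1 \<omega>)))"
      by (rule ito_unperturbed[symmetric])
    finally have "?\<epsilon> n * (LBINT r:{0..1}. k r * ?e n r) \<le> ?\<epsilon> n * (LINT \<omega>|P. tanh (X 1 \<omega>) * ?C \<omega>)" by linarith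
    then show ?thesis using \<epsilon>(1)[of n] by (simp only: mult_le_cancel_left_pos)
  qed
  \<comment> \<open>As the perturbation vanishes, the perturbed state tends to \<open>X\<close>, and
    the mixed expectation becomes the second moment of \<open>V\<close>.\<close>
  have "(\<lambda>n. LBINT r:{0..1}. k r * ?e n r) \<longlonglongrightarrow> (LBINT r:{0..1}. k r * m\<^sub>2 r)"
    unfolding set_lebesgue_integral_def
  proof (rule integral_dominated_convergence[where w="\<lambda>r. K * indicator {0..1} r"])
    show "integrable lborel (\<lambda>r. K * indicator {0..1::real} r)"
      by (intro integrable_mult_right integrable_real_indicator) (auto simp: emeasure_lborel_Icc_eq)
    show "(\<lambda>r. indicator {0..1} r *\<^sub>R (k r * m\<^sub>2 r)) \<in> borel_measurable lborel"
      using set_integrable_coeff_continuous[OF k K m2_continuous] unfolding set_integrable_def by (rule borel_measurable_integrable)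
    show "(\<lambda>r. indicator {0..1} r *\<^sub>R (k r * ?e n r)) \<in> borel_measurable lborel" for n
      using set_integrable_coeff_continuous[OF k K m_e(1)[of n]] unfolding set_integrable_def by (rule borel_measurable_integrable)
    have e_lim: "(\<lambda>n. ?e n r) \<longlonglongrightarrow> m\<^sub>2 r" if r: "r \<in> {0..1}" for r
    proof -
      have "(\<lambda>n. ?e n r) \<longlonglongrightarrow> (LINT \<omega>|P. V r \<omega> * \<Psi>\<^sub>1 r (X r \<omega>))"
      proof (rule integral_dominated_convergence[where w="\<lambda>_. 1"])
        show "(\<lambda>\<omega>. V r \<omega> * \<Psi>\<^sub>1 r (X r \<omega>)) \<in> borel_measurable P"
          unfolding V_def[symmetric] by (intro borel_measurable_times V_measurable r)
        show "(\<lambda>\<omega>. V r \<omega> * \<Psi>\<^sub>1 r (cY (?k n) r \<omega>)) \<in> borel_measurable P" for n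
          using V_measurable[OF r] I(4)[OF r, of n] by (rule borel_measurable_times)
        show "AE \<omega> in P. (\<lambda>n. V r \<omega> * \<Psi>\<^sub>1 r (cY (?k n) r \<omega>)) \<longlonglongrightarrow> V r \<omega> * \<Psi>\<^sub>1 r (X r \<omega>)"
        proof (rule AE_I2)
          fix \<omega>
          have "(\<lambda>n. X r \<omega> - ?\<epsilon> n * (LBINT w:{0..r}. k w * V w \<omega>)) \<longlonglongrightarrow> X r \<omega> - 0 * (LBINT w:{0..r}. k w * V w \<omega>)"
            by (intro tendsto_intros LIMSEQ_inverse_real_of_nat)
          then have "(\<lambda>n. cY (?k n) r \<omega>) \<longlonglongrightarrow> X r \<omega>" unfolding Y by simp
          from isCont_tendsto_compose[OF Phi1_isCont[OF r] this]
          show "(\<lambda>n. V r \<omega> * \<Psi>\<^sub>1 r (cY (?k n) r \<omega>)) \<longlonglongrightarrow> V r \<omega> * \<Psi>\<^sub>1 r (X r \<omega>)" by (intro tendsto_mult tendsto_const)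
        qed
        show "AE \<omega> in P. norm (V r \<omega> * \<Psi>\<^sub>1 r (cY (?k n) r \<omega>)) \<le> 1" for n
          using mult_mono[OF V_le[OF r] Phi1_le[OF r]] by (intro AE_I2) (simp add: abs_mult)
      qed simp
      then show ?thesis by (simp add: m\<^sub>2_def V_def power2_eq_square)
    qed
    show "AE r in lborel. (\<lambda>n. indicator {0..1} r *\<^sub>R (k r * ?e n r)) \<longlonglongrightarrow> indicator {0..1} r *\<^sub>R (k r * m\<^sub>2 r)"
    proof (rule AE_I2)
      fix r :: real
      show "(\<lambda>n. indicator {0..1} r *\<^sub>R (k r * ?e n r)) \<longlonglongrightarrow> indicator {0..1} r *\<^sub>R (k r * m\<^sub>2 r)"
      proof (cases "r \<in> {0..1}")
        case True
        then show ?thesis by (intro tendsto_scaleR tendsto_mult tendsto_const e_lim)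
      qed simp
    qed
    show "AE r in lborel. norm (indicator {0..1} r *\<^sub>R (k r * ?e n r)) \<le> K * indicator {0..1} r" for n
    proof (rule AE_I2)
      fix r :: real
      show "norm (indicator {0..1} r *\<^sub>R (k r * ?e n r)) \<le> K * indicator {0..1} r"
      proof (cases "r \<in> {0..1}")
        case True
        have "\<bar>?e n r\<bar> \<le> 1" by (rule expectation_product_le(2)[OF True I(4)[OF True] Phi1_le[OF True]])
        then have "\<bar>k r\<bar> * \<bar>?e n r\<bar> \<le> K * 1" using K[of r] K0 by (intro mult_mono) auto
        then show ?thesis using True by (simp add: abs_mult)
      qed simp
    qed
  qed
  then show ?thesis by (rule LIMSEQ_le_const2) (use ineq in auto)
qed

end

section \<open>Supporting hyperplane and regularization of the SDE\<close>

context parisi_sde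
begin

text \<open>The control that is optimal for \<open>\<alpha>\<^sub>0\<close> is admissible for \<open>\<alpha>\<close>, and its payoff is convex in \<open>\<alpha>\<close>.\<close>

lemma supporting_hyperplane:
  assumes pde: "parisi_pde \<zeta> \<tau> \<alpha> \<Phi> \<Phi>\<^sub>1 \<Phi>\<^sub>2"
  shows "\<Psi> 0 h + (LBINT r:{0..1}. \<zeta> r / 2 * (\<alpha> r - \<alpha>\<^sub>0 r) * m\<^sub>2 r) \<le> \<Phi> 0 h"
proof -
  interpret p: parisi_pde \<zeta> \<tau> \<alpha> \<Phi> \<Phi>\<^sub>1 \<Phi>\<^sub>2 by (rule pde)
  \<comment> \<open>Chosen so that \<open>b + k = \<zeta> * \<alpha>\<close> on [0,1]: the control
    stays that of \<open>\<mu>\<^sub>0\<close>, while the gain matches the equation of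
    \<open>\<Phi>\<close>.\<close>
  define k where "k r = zeta_ext r * (\<alpha> r - \<alpha>\<^sub>0 r)" for r
  have k[measurable]: "k \<in> borel_measurable borel" unfolding k_def by measurable
  have al: "\<bar>\<alpha> r\<bar> \<le> 1" "\<bar>\<alpha>\<^sub>0 r\<bar> \<le> 1" "\<bar>\<alpha> r - \<alpha>\<^sub>0 r\<bar> \<le> 1" for r
    using alpha_nonneg[of r] alpha_le[of r] p.alpha_nonneg[of r] p.alpha_le[of r] by auto
  have kb: "\<bar>k r\<bar> \<le> Z" for r unfolding k_def by (rule coeff_le[OF al(3)])
  note I = ito[OF pde k kb]
  let ?C = "\<lambda>\<omega>. LBINT w:{0..1}. k w * V w \<omega>"
  define e where "e r = (LINT \<omega>|P. V r \<omega> * \<Phi>\<^sub>1 r (cY k r \<omega>))" for r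
  define q where "q r = (LINT \<omega>|P. (\<Phi>\<^sub>1 r (cY k r \<omega>))\<^sup>2)" for r
  have c: "continuous_on {0..1} e" "continuous_on {0..1} q" using I(2,3) by (simp_all add: e_def[abs_def] q_def[abs_def])
  have X1[measurable]: "X 1 \<in> borel_measurable P" and X1i: "integrable P (X 1)"
    using F_measurable[OF X_adapted[of 1]] X_integrable[of 1] by auto
  have [measurable]: "?C \<in> borel_measurable P"
    using F_measurable[OF noise.drift_measurable[OF k, of 0 1]] by auto
  have C_le: "\<bar>?C \<omega>\<bar> \<le> Z" for \<omega> using noise.drift_le[OF kb order_refl zero_le_one order_refl, where \<omega>=\<omega>] by simp
  have tC: "integrable P (\<lambda>\<omega>. tanh (X 1 \<omega>) * ?C \<omega>)"
  proof (rule integrable_const_bound[where B="1 * Z"])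
    show "AE \<omega> in P. norm (tanh (X 1 \<omega>) * ?C \<omega>) \<le> 1 * Z"
      unfolding real_norm_def abs_mult using C_le tanh_real_bounds
      by (intro AE_I2 mult_mono) (auto simp: abs_le_iff less_imp_le)
    have "(\<lambda>x::real. tanh x) \<in> borel_measurable borel"
      by (intro borel_measurable_continuous_onI continuous_intros) auto
    then show "(\<lambda>\<omega>. tanh (X 1 \<omega>) * ?C \<omega>) \<in> borel_measurable P" by measurable
  qed
  have lc: "integrable P (\<lambda>\<omega>. ln (cosh (cY k 1 \<omega>)))" "integrable P (\<lambda>\<omega>. ln (cosh (X 1 \<omega>)))"
    by (rule integrable_ln_cosh[OF I(6)], rule integrable_ln_cosh[OF X1i])
  \<comment> \<open>The tangent line of \<open>log cosh\<close> leaves the correlation of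
    \<open>tanh (X 1)\<close> with the displacement, and the adjoint inequality replaces it by
    second moments of \<open>V\<close>.\<close>
  have lower: "(LINT \<omega>|P. ln (cosh (X 1 \<omega>))) + (LBINT r:{0..1}. k r * m\<^sub>2 r) \<le> (LINT \<omega>|P. ln (cosh (cY k 1 \<omega>)))"
  proof -
    have "(LINT \<omega>|P. ln (cosh (X 1 \<omega>))) + (LINT \<omega>|P. tanh (X 1 \<omega>) * ?C \<omega>) = (LINT \<omega>|P. ln (cosh (X 1 \<omega>)) + tanh (X 1 \<omega>) * ?C \<omega>)"
      by (rule Bochner_Integration.integral_add[OF lc(2) tC, symmetric])
    also have "\<dots> \<le> (LINT \<omega>|P. ln (cosh (cY k 1 \<omega>)))"
    proof (rule integral_mono)
      show "ln (cosh (X 1 \<omega>)) + tanh (X 1 \<omega>) * ?C \<omega> \<le> ln (cosh (cY k 1 \<omega>))" for \<omega>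
        using ln_cosh_tangent[of "X 1 \<omega>" "?C \<omega>"] by (simp add: cY_def mult.commute)
    qed (use lc tC in auto)
    finally show ?thesis using adjoint_inequality[OF k kb] by linarith
  qed
  have s1: "set_integrable lborel {0..1} (\<lambda>r. (b r + k r) * e r)"
  proof (rule set_integrable_coeff_continuous[OF _ _ c(1)])
    show "\<bar>b r + k r\<bar> \<le> Z + Z" for r using b_le[of r] kb[of r] by linarith
  qed measurable
  have s2: "set_integrable lborel {0..1} (\<lambda>r. \<zeta> r / 2 * \<alpha> r * q r)" by (rule half_coeff_integrable[OF p.alpha_measurable al(1) c(2)])
  have s3: "set_integrable lborel {0..1} (\<lambda>r. \<zeta> r / 2 * \<alpha> r * m\<^sub>2 r)" by (rule half_coeff_integrable[OF p.alpha_measurable al(1) m2_continuous])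
  have s4: "set_integrable lborel {0..1} (\<lambda>r. \<zeta> r / 2 * \<alpha>\<^sub>0 r * m\<^sub>2 r)" by (rule half_coeff_integrable[OF alpha_measurable al(2) m2_continuous])
  have s5: "set_integrable lborel {0..1} (\<lambda>r. k r * m\<^sub>2 r)" by (rule set_integrable_coeff_continuous[OF k kb m2_continuous])
  have "(LINT \<omega>|P. ln (cosh (cY k 1 \<omega>))) = \<Phi> 0 h + (LBINT r:{0..1}. (b r + k r) * e r) - (LBINT r:{0..1}. \<zeta> r / 2 * \<alpha> r * q r)"
    using I(1) by (simp add: e_def q_def)
  moreover have "(LBINT r:{0..1}. (b r + k r) * e r) - (LBINT r:{0..1}. \<zeta> r / 2 * \<alpha> r * q r) = (LBINT r:{0..1}. (b r + k r) * e r - \<zeta> r / 2 * \<alpha> r * q r)"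
    by (rule set_integral_diff(2)[OF s1 s2, symmetric])
  moreover have "\<dots> \<le> (LBINT r:{0..1}. \<zeta> r / 2 * \<alpha> r * m\<^sub>2 r)"
  proof (rule set_integral_mono[OF set_integral_diff(1)[OF s1 s2] s3])
    fix r :: real assume r: "r \<in> {0..1}"
    have "2 * e r \<le> m\<^sub>2 r + q r" unfolding e_def q_def by (rule two_expectation_le[OF r I(4)[OF r] p.Phi1_le[OF r]])
    then have "(\<zeta> r / 2 * \<alpha> r) * (2 * e r - q r) \<le> (\<zeta> r / 2 * \<alpha> r) * m\<^sub>2 r"
      using zeta_nonneg[OF r] p.alpha_nonneg[of r] by (intro mult_left_mono) auto
    moreover have "b r + k r = \<zeta> r * \<alpha> r" using r by (simp add: b_def k_def zeta_ext_eq algebra_simps)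
    ultimately show "(b r + k r) * e r - \<zeta> r / 2 * \<alpha> r * q r \<le> \<zeta> r / 2 * \<alpha> r * m\<^sub>2 r"
      by (simp add: right_diff_distrib mult_ac)
  qed
  \<comment> \<open>Bookkeeping: \<open>k\<close> carries
    \<open>\<zeta> (\<alpha> - \<alpha>\<^sub>0)\<close> in full, and the two half terms take away
    half of it.\<close>
  moreover have "(LBINT r:{0..1}. k r * m\<^sub>2 r) + (LBINT r:{0..1}. \<zeta> r / 2 * \<alpha>\<^sub>0 r * m\<^sub>2 r) - (LBINT r:{0..1}. \<zeta> r / 2 * \<alpha> r * m\<^sub>2 r)
      = (LBINT r:{0..1}. \<zeta> r / 2 * (\<alpha> r - \<alpha>\<^sub>0 r) * m\<^sub>2 r)"
  proof -
    have "(LBINT r:{0..1}. k r * m\<^sub>2 r) + (LBINT r:{0..1}. \<zeta> r / 2 * \<alpha>\<^sub>0 r * m\<^sub>2 r) - (LBINT r:{0..1}. \<zeta> r / 2 * \<alpha> r * m\<^sub>2 r)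
       = (LBINT r:{0..1}. k r * m\<^sub>2 r + \<zeta> r / 2 * \<alpha>\<^sub>0 r * m\<^sub>2 r - \<zeta> r / 2 * \<alpha> r * m\<^sub>2 r)"
      using s3 s4 s5 by (simp only: set_integral_add set_integral_diff)
    also have "\<dots> = (LBINT r:{0..1}. \<zeta> r / 2 * (\<alpha> r - \<alpha>\<^sub>0 r) * m\<^sub>2 r)"
    proof (rule set_lebesgue_integral_cong, simp, intro allI impI)
      fix r :: real assume r: "r \<in> {0..1}"
      obtain z where z: "\<zeta> r / 2 = z" by blast
      have "k r = 2 * z * (\<alpha> r - \<alpha>\<^sub>0 r)" using r by (simp add: k_def zeta_ext_eq flip: z)
      then have "k r * m\<^sub>2 r = 2 * z * (\<alpha> r - \<alpha>\<^sub>0 r) * m\<^sub>2 r" by simp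
      then show "k r * m\<^sub>2 r + \<zeta> r / 2 * \<alpha>\<^sub>0 r * m\<^sub>2 r - \<zeta> r / 2 * \<alpha> r * m\<^sub>2 r = \<zeta> r / 2 * (\<alpha> r - \<alpha>\<^sub>0 r) * m\<^sub>2 r"
        unfolding z by (simp add: algebra_simps)
    qed
    finally show ?thesis .
  qed
  ultimately show ?thesis using lower ito_unperturbed by linarith
qed

end

section \<open>From the given solution of the stochastic equation to a regular version\<close>

context filtered_brownian
begin

lemma stochastic_integral_at_0:
  assumes "has_stochastic_integral P B 0 \<sigma> Y"
  shows "AE \<omega> in P. Y \<omega> = 0"
proof -
  obtain n t c where t: "\<And>k. t k ` {..n k} \<subseteq> {0..(0::real)}"
    and lim: "(\<lambda>k. \<integral>\<^sup>+\<omega>. ennreal ((Y \<omega> - step_integral B (n k) (t k) (c k) \<omega>)\<^sup>2) \<partial>P) \<longlonglongrightarrow> 0"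
    and [measurable]: "Y \<in> borel_measurable P"
    using assms unfolding has_stochastic_integral_def by blast
  have zero: "step_integral B (n k) (t k) (c k) \<omega> = 0" for k \<omega>
    unfolding step_integral_def
  proof (rule sum.neutral, rule ballI)
    fix i assume "i \<in> {..<n k}"
    then have "i \<in> {..n k}" "Suc i \<in> {..n k}" by auto
    then have "t k i = 0" "t k (Suc i) = 0" using t[of k] by (auto simp: image_subset_iff)
    then show "c k i * (B (t k (Suc i)) \<omega> - B (t k i) \<omega>) = 0" by simp
  qed
  have "(\<integral>\<^sup>+\<omega>. ennreal ((Y \<omega>)\<^sup>2) \<partial>P) = 0" using lim unfolding zero by (simp add: LIMSEQ_const_iff)
  then have "AE \<omega> in P. ennreal ((Y \<omega>)\<^sup>2) = 0" by (subst (asm) nn_integral_0_iff_AE) auto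
  then show ?thesis by eventually_elim simp
qed

text \<open>One sufficiently good approximation is enough: it is a finite combination of Gaussian
  increments, and the remainder is square integrable, hence integrable by
  \<open>\<bar>d\<bar> \<le> 1 + d^2\<close>.\<close>

lemma stochastic_integral_integrable:
  assumes "has_stochastic_integral P B r \<sigma> Y"
  shows "integrable P Y"
proof -
  obtain n t c where m: "\<And>k. mono_on {..n k} (t k)" and t: "\<And>k. t k ` {..n k} \<subseteq> {0..r}"
    and lim: "(\<lambda>k. \<integral>\<^sup>+\<omega>. ennreal ((Y \<omega> - step_integral B (n k) (t k) (c k) \<omega>)\<^sup>2) \<partial>P) \<longlonglongrightarrow> 0"
    and Ym[measurable]: "Y \<in> borel_measurable P"
    using assms unfolding has_stochastic_integral_def by blast
  have "eventually (\<lambda>k. (\<integral>\<^sup>+\<omega>. ennreal ((Y \<omega> - step_integral B (n k) (t k) (c k) \<omega>)\<^sup>2) \<partial>P) < 1) sequentially"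
    using lim by (rule order_tendstoD) simp
  then obtain k where k: "(\<integral>\<^sup>+\<omega>. ennreal ((Y \<omega> - step_integral B (n k) (t k) (c k) \<omega>)\<^sup>2) \<partial>P) < 1"
    unfolding eventually_sequentially by blast
  let ?S = "step_integral B (n k) (t k) (c k)"
  have Si: "integrable P ?S"
    unfolding step_integral_def
  proof (intro Bochner_Integration.integrable_sum integrable_mult_right)
    fix i assume "i \<in> {..<n k}"
    then have "t k i \<in> t k ` {..n k}" "t k i \<le> t k (Suc i)" using mono_onD[OF m[of k], of i "Suc i"] by auto
    then have "0 \<le> t k i" "t k i \<le> t k (Suc i)" using t[of k] by auto
    then show "integrable P (\<lambda>\<omega>. B (t k (Suc i)) \<omega> - B (t k i) \<omega>)" by (rule increment_moments(1))
  qed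
  have Sm[measurable]: "?S \<in> borel_measurable P" using Si by (rule borel_measurable_integrable)
  have "integrable P (\<lambda>\<omega>. (Y \<omega> - ?S \<omega>)\<^sup>2)"
    by (rule integrableI_nonneg) (use k in \<open>auto intro: less_trans[OF _ ennreal_one_less_top]\<close>)
  then have "integrable P (\<lambda>\<omega>. 1 + (Y \<omega> - ?S \<omega>)\<^sup>2)" by simp
  then have "integrable P (\<lambda>\<omega>. Y \<omega> - ?S \<omega>)"
  proof (rule Bochner_Integration.integrable_bound)
    have "\<bar>d\<bar> \<le> 1 + d\<^sup>2" for d :: real
      using zero_le_power2[of "\<bar>d\<bar> - 1"] by (simp add: power2_diff)
    then show "AE \<omega> in P. norm (Y \<omega> - ?S \<omega>) \<le> norm (1 + (Y \<omega> - ?S \<omega>)\<^sup>2)" by (intro AE_I2) simp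
  qed measurable
  from Bochner_Integration.integrable_add[OF this Si] show ?thesis by simp
qed

text \<open>Null sets belong to \<open>F 0\<close>, so the exceptional paths can be replaced without losing adaptedness.\<close>

lemma parisi_sde_regularization:
  assumes pde: "parisi_pde \<zeta> \<tau> \<alpha>\<^sub>0 \<Psi> \<Psi>\<^sub>1 \<Psi>\<^sub>2"
    and sde: "sde_solution P F B h (\<lambda>w x. \<alpha>\<^sub>0 w * \<zeta> w * \<Psi>\<^sub>1 w x) (\<lambda>w. sqrt (\<zeta> w)) X"
  obtains X' where "parisi_sde P F B \<zeta> \<tau> \<alpha>\<^sub>0 \<Psi> \<Psi>\<^sub>1 \<Psi>\<^sub>2 X' h" "AE \<omega> in P. \<forall>r. X' r \<omega> = X r \<omega>"
proof -
  interpret parisi_pde \<zeta> \<tau> \<alpha>\<^sub>0 \<Psi> \<Psi>\<^sub>1 \<Psi>\<^sub>2 by (rule pde)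
  obtain I where ad: "\<And>r. r \<in> {0..1} \<Longrightarrow> X r \<in> borel_measurable (F r)"
    and cont: "AE \<omega> in P. continuous_on {0..1} (\<lambda>r. X r \<omega>)"
    and I: "\<And>r. r \<in> {0..1} \<Longrightarrow> has_stochastic_integral P B r (\<lambda>w. sqrt (\<zeta> w)) (I r)"
    and eq: "AE \<omega> in P. \<forall>r\<in>{0..1}. X r \<omega> = h + (LBINT w:{0..r}. \<alpha>\<^sub>0 w * \<zeta> w * \<Psi>\<^sub>1 w (X w \<omega>)) + I r \<omega>"
    using sde unfolding sde_solution_def by blast
  from cont eq have "AE \<omega> in P. continuous_on {0..1} (\<lambda>r. X r \<omega>) \<and>
      (\<forall>r\<in>{0..1}. X r \<omega> = h + (LBINT w:{0..r}. \<alpha>\<^sub>0 w * \<zeta> w * \<Psi>\<^sub>1 w (X w \<omega>)) + I r \<omega>)"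
    by eventually_elim blast
  \<comment> \<open>A single null set outside of which the path is continuous and the equation holds
    at all times simultaneously.\<close>
  then obtain E0 where E0: "{\<omega> \<in> space P. \<not> (continuous_on {0..1} (\<lambda>r. X r \<omega>) \<and>
      (\<forall>r\<in>{0..1}. X r \<omega> = h + (LBINT w:{0..r}. \<alpha>\<^sub>0 w * \<zeta> w * \<Psi>\<^sub>1 w (X w \<omega>)) + I r \<omega>))} \<subseteq> E0"
      "emeasure P E0 = 0" "E0 \<in> sets P"
    by (rule AE_E)
  have null: "E0 \<in> null_sets P" using E0 by auto
  have good: "continuous_on {0..1} (\<lambda>r. X r \<omega>)"
      "\<And>r. r \<in> {0..1} \<Longrightarrow> X r \<omega> = h + (LBINT w:{0..r}. \<alpha>\<^sub>0 w * \<zeta> w * \<Psi>\<^sub>1 w (X w \<omega>)) + I r \<omega>"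
    if "\<omega> \<in> space P" "\<omega> \<notin> E0" for \<omega> using E0(1) that by blast+
  have E0_F: "E0 \<in> sets (F r)" if "0 \<le> r" for r
  proof -
    have "E0 \<in> sets (F 0)" using filtration null unfolding usual_filtered_space_def by blast
    then show ?thesis using F_mono[of 0 r] that by (auto simp: subalgebra_def)
  qed
  \<comment> \<open>On the exceptional set the path is replaced by the constant \<open>h\<close>,
    which is trivially continuous.\<close>
  define X' where "X' r \<omega> = (if \<omega> \<in> E0 then h else X r \<omega>)" for r \<omega>
  have ae: "AE \<omega> in P. \<omega> \<notin> E0" using null by (rule AE_not_in)
  have adapted: "X' r \<in> borel_measurable (F r)" if r: "r \<in> {0..1}" for r
    unfolding X'_def[abs_def]
  proof (rule measurable_If_set)
    show "E0 \<inter> space (F r) \<in> sets (F r)" using E0_F[of r] r by auto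
  qed (use ad[OF r] in auto)
  have continuous: "continuous_on {0..1} (\<lambda>r. X' r \<omega>)" if "\<omega> \<in> space P" for \<omega>
    using good(1)[OF that] by (cases "\<omega> \<in> E0") (auto simp: X'_def)
  have drift_int: "set_integrable lborel {0..1} (\<lambda>w. (zeta_ext w * \<alpha>\<^sub>0 w) * \<Psi>\<^sub>1 w (X' w \<omega>))" if "\<omega> \<in> space P" for \<omega>
  proof (rule set_integrable_coeff_continuous)
    show "\<bar>zeta_ext w * \<alpha>\<^sub>0 w\<bar> \<le> Z * 1" for w
      unfolding abs_mult using zeta_ext_abs_le[of w] alpha_nonneg[of w] alpha_le[of w] Z_nonneg by (intro mult_mono) auto
    show "continuous_on {0..1} (\<lambda>w. \<Psi>\<^sub>1 w (X' w \<omega>))"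
      by (rule cont_comp[OF Phi1_cont continuous_on_id continuous[OF that]]) auto
  qed measurable
  let ?J = "\<lambda>s t \<omega>. LBINT w:{s..t}. zeta_ext w * \<alpha>\<^sub>0 w * \<Psi>\<^sub>1 w (X' w \<omega>)"
  have X'_eq: "X' r \<omega> = h + ?J 0 r \<omega> + I r \<omega>" if r: "r \<in> {0..1}" and \<omega>: "\<omega> \<in> space P" "\<omega> \<notin> E0" for r \<omega>
  proof -
    have "?J 0 r \<omega> = (LBINT w:{0..r}. \<alpha>\<^sub>0 w * \<zeta> w * \<Psi>\<^sub>1 w (X w \<omega>))"
      by (rule set_lebesgue_integral_cong) (use r \<omega> in \<open>auto simp: X'_def zeta_ext_eq\<close>)
    then show ?thesis using good(2)[OF \<omega> r] \<omega> by (simp add: X'_def)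
  qed
  have J_split: "?J 0 t \<omega> = ?J 0 s \<omega> + ?J s t \<omega>" if st: "0 \<le> s" "s \<le> t" "t \<le> 1" and \<omega>: "\<omega> \<in> space P" for s t \<omega>
  proof -
    have "?J 0 t \<omega> = (LBINT w:{0..s} \<union> {s..t}. zeta_ext w * \<alpha>\<^sub>0 w * \<Psi>\<^sub>1 w (X' w \<omega>))" using st by (simp add: ivl_disj_un)
    also have "\<dots> = ?J 0 s \<omega> + ?J s t \<omega>"
    proof (rule set_integral_Un_AE)
      show "AE w in lborel. \<not> (w \<in> {0..s} \<and> w \<in> {s..t})" using AE_lborel_singleton[of s] by eventually_elim auto
      show "set_integrable lborel {0..s} (\<lambda>w. zeta_ext w * \<alpha>\<^sub>0 w * \<Psi>\<^sub>1 w (X' w \<omega>))"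
        "set_integrable lborel {s..t} (\<lambda>w. zeta_ext w * \<alpha>\<^sub>0 w * \<Psi>\<^sub>1 w (X' w \<omega>))"
        by (rule set_integrable_subset[OF drift_int[OF \<omega>]]; use st in auto)+
    qed auto
    finally show ?thesis .
  qed
  have J_le: "\<bar>?J 0 r \<omega>\<bar> \<le> Z * (r - 0)" if r: "r \<in> {0..1}" for r \<omega>
  proof (rule set_integral_abs_le)
    fix w assume "w \<in> {0..r}"
    then have w: "w \<in> {0..1}" using r by auto
    have "\<bar>zeta_ext w * \<alpha>\<^sub>0 w * \<Psi>\<^sub>1 w (X' w \<omega>)\<bar> \<le> Z * 1 * 1"
      unfolding abs_mult using zeta_ext_abs_le[of w] alpha_nonneg[of w] alpha_le[of w] Z_nonneg Phi1_le[OF w, of "X' w \<omega>"]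
      by (intro mult_mono) auto
    then show "\<bar>zeta_ext w * \<alpha>\<^sub>0 w * \<Psi>\<^sub>1 w (X' w \<omega>)\<bar> \<le> Z" by simp
  qed (use r in auto)
  have "parisi_sde P F B \<zeta> \<tau> \<alpha>\<^sub>0 \<Psi> \<Psi>\<^sub>1 \<Psi>\<^sub>2 X' h"
  proof
    show "X' r \<in> borel_measurable (F r)" if "r \<in> {0..1}" for r by (rule adapted[OF that])
    show "continuous_on {0..1} (\<lambda>r. X' r \<omega>)" if "\<omega> \<in> space P" for \<omega> by (rule continuous[OF that])
    show "AE \<omega> in P. X' 0 \<omega> = h"
    proof -
      have "AE \<omega> in P. I 0 \<omega> = 0" using I[of 0] by (intro stochastic_integral_at_0) auto
      then show ?thesis using ae AE_space
      proof eventually_elim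
        case (elim \<omega>)
        then show ?case using X'_eq[of 0 \<omega>] J_le[of 0 \<omega>] by simp
      qed
    qed
    show "integrable P (X' r)" if r: "r \<in> {0..1}" for r
    proof (rule Bochner_Integration.integrable_bound)
      show "integrable P (\<lambda>\<omega>. \<bar>h\<bar> + Z + \<bar>I r \<omega>\<bar>)" using stochastic_integral_integrable[OF I[OF r]] by auto
      show "X' r \<in> borel_measurable P" using F_measurable[OF adapted[OF r]] r by auto
      show "AE \<omega> in P. norm (X' r \<omega>) \<le> norm (\<bar>h\<bar> + Z + \<bar>I r \<omega>\<bar>)"
        using ae AE_space
      proof eventually_elim
        case (elim \<omega>)
        have "Z * (r - 0) \<le> Z" using r Z_nonneg by (simp add: mult_left_le)
        then show ?case using X'_eq[OF r elim(2,1)] J_le[OF r, of \<omega>] Z_nonneg by auto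
      qed
    qed
    fix s t l :: real and E assume st: "0 \<le> s" "s \<le> t" "t \<le> 1" and E: "E \<in> sets (F s)"
    have s01: "s \<in> {0..1}" "t \<in> {0..1}" using st by auto
    have [measurable]: "X' t \<in> borel_measurable P" "X' s \<in> borel_measurable P" "I s \<in> borel_measurable P" "I t \<in> borel_measurable P"
      using F_measurable[OF adapted[OF s01(1)]] F_measurable[OF adapted[OF s01(2)]] st I[OF s01(1)] I[OF s01(2)]
      by (auto simp: has_stochastic_integral_def)
    have [measurable]: "E \<in> sets P" using E F_subalgebra[OF st(1)] by (auto simp: subalgebra_def)
    \<comment> \<open>Almost surely the increment with its drift removed is an increment of the
      Wiener integral, so its characteristic function is already known; the variance is the integral
      of \<open>(sqrt (\<zeta> w))^2\<close>, that is, \<open>\<tau> t - \<tau> s\<close>.\<close>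
    have key: "AE \<omega> in P. I t \<omega> - I s \<omega> = X' t \<omega> - X' s \<omega> - ?J s t \<omega>"
      using ae AE_space
    proof eventually_elim
      case (elim \<omega>)
      then show ?case using X'_eq[OF s01(1) elim(2,1)] X'_eq[OF s01(2) elim(2,1)] J_split[OF st elim(2)] by simp
    qed
    have Jm: "?J s t \<in> borel_measurable P"
    proof -
      have "(\<lambda>p. indicator {s..t} (snd p) * \<Psi>\<^sub>1 (snd p) (X' (snd p) (fst p))) \<in> borel_measurable (P \<Otimes>\<^sub>M borel)"
      proof (rule continuous_paths_joint_measurable[OF st(2)])
        show "(\<lambda>\<omega>. \<Psi>\<^sub>1 r (X' r \<omega>)) \<in> borel_measurable P" if "r \<in> {s..t}" for r
          using that st by (intro measurable_compose[OF F_measurable[OF adapted] Phi1_measurable]) auto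
        show "continuous_on {s..t} (\<lambda>r. \<Psi>\<^sub>1 r (X' r \<omega>))" if "\<omega> \<in> space P" for \<omega>
          using st by (intro continuous_on_subset[OF cont_comp[OF Phi1_cont continuous_on_id continuous[OF that]]]) auto
      qed
      then have "(\<lambda>p. zeta_ext (snd p) * \<alpha>\<^sub>0 (snd p) * (indicator {s..t} (snd p) * \<Psi>\<^sub>1 (snd p) (X' (snd p) (fst p)))) \<in> borel_measurable (P \<Otimes>\<^sub>M borel)"
        by measurable
      moreover have "sets (P \<Otimes>\<^sub>M borel) = sets (P \<Otimes>\<^sub>M (lborel :: real measure))" by (rule sets_pair_measure_cong) auto
      ultimately have "(\<lambda>p. zeta_ext (snd p) * \<alpha>\<^sub>0 (snd p) * (indicator {s..t} (snd p) * \<Psi>\<^sub>1 (snd p) (X' (snd p) (fst p)))) \<in> borel_measurable (P \<Otimes>\<^sub>M lborel)"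
        using measurable_cong_sets by blast
      then have "(\<lambda>(\<omega>, w). indicator {s..t} w *\<^sub>R (zeta_ext w * \<alpha>\<^sub>0 w * \<Psi>\<^sub>1 w (X' w \<omega>))) \<in> borel_measurable (P \<Otimes>\<^sub>M lborel)"
        by (simp add: split_beta' mult_ac)
      from lborel.borel_measurable_lebesgue_integral[OF this] show ?thesis by (simp add: set_lebesgue_integral_def)
    qed
    note [measurable] = Jm
    have "(LINT \<omega>|P. complex_of_real (indicator E \<omega>) * iexp (l * (X' t \<omega> - X' s \<omega> - ?J s t \<omega>)))
        = (LINT \<omega>|P. complex_of_real (indicator E \<omega>) * iexp (l * (I t \<omega> - I s \<omega>)))"
    proof (rule integral_cong_AE)
      show "AE \<omega> in P. complex_of_real (indicator E \<omega>) * iexp (l * (X' t \<omega> - X' s \<omega> - ?J s t \<omega>))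
         = complex_of_real (indicator E \<omega>) * iexp (l * (I t \<omega> - I s \<omega>))"
        using key by eventually_elim (simp only:)
    qed measurable
    also have "\<dots> = (LINT \<omega>|P. complex_of_real (indicator E \<omega>)) * complex_of_real (exp (- (l\<^sup>2 * (LBINT w:{s..t}. (sqrt (\<zeta> w))\<^sup>2) / 2)))"
    proof (rule stochastic_integral_increment_char[OF st(1,2) _ _ I[OF s01(2)] I[OF s01(1)]])
      show "(\<lambda>w. indicator {0..t} w * sqrt (\<zeta> w)) \<in> borel_measurable borel"
      proof -
        have "(\<lambda>w. indicator {0..t} w * sqrt (\<zeta> w)) = (\<lambda>w. indicator {0..t} w * sqrt (zeta_ext w))"
          using st by (auto simp: fun_eq_iff indicator_def zeta_ext_eq)
        then show ?thesis by simp
      qed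
      have "set_integrable lborel {s..t} (\<lambda>w. \<zeta> w)"
        using st by (intro borel_integrable_atLeastAtMost' continuous_on_subset[OF zeta_cont]) auto
      then show "set_integrable lborel {s..t} (\<lambda>w. (sqrt (\<zeta> w))\<^sup>2)"
        by (rule set_integrable_cong[THEN iffD1, rotated -1]) (use st zeta_nonneg in auto)
      show "(\<lambda>\<omega>. complex_of_real (indicator E \<omega>)) \<in> borel_measurable (F s)" using E by measurable
    qed (auto simp: indicator_def)
    also have "(LBINT w:{s..t}. (sqrt (\<zeta> w))\<^sup>2) = (LBINT w:{s..t}. \<zeta> w)"
      by (rule set_lebesgue_integral_cong) (use st zeta_nonneg in auto)
    also have "\<dots> = \<tau> t - \<tau> s" by (rule zeta_integral[OF st])
    finally show "(LINT \<omega>|P. complex_of_real (indicator E \<omega>) * iexp (l * (X' t \<omega> - X' s \<omega> - ?J s t \<omega>)))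
        = (LINT \<omega>|P. complex_of_real (indicator E \<omega>)) * complex_of_real (exp (- (l\<^sup>2 * (\<tau> t - \<tau> s) / 2)))" .
  qed
  moreover have "AE \<omega> in P. \<forall>r. X' r \<omega> = X r \<omega>" using ae by eventually_elim (simp add: X'_def)
  ultimately show ?thesis by (rule that)
qed

end

section \<open>Distribution functions and mixtures\<close>

text \<open>For \<open>s > 1\<close> the interval \<open>{0..s}\<close> is not a measurable subset
  of the space [0,1], so \<open>measure\<close> returns its default 0. Thus \<open>cdf01\<close>
  drops to 0 beyond 1 and is monotone only up to there; writing it as an indicator times a monotone
  function still gives measurability on the line.\<close>

lemma cdf01_eq:
  assumes "\<mu> \<in> prob_measures_01"
  shows "cdf01 \<mu> = (\<lambda>s. indicator {0..1} s * measure \<mu> {0..min s 1})"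
proof
  fix s :: real
  have sets: "sets \<mu> = sets (restrict_space borel {0..1::real})" using assms by (simp add: prob_measures_01_def)
  consider "s < 0" | "0 \<le> s" "s \<le> 1" | "1 < s" by linarith
  then show "cdf01 \<mu> s = indicator {0..1} s * measure \<mu> {0..min s 1}"
  proof cases
    case 3
    then have "\<not> {0..s} \<subseteq> {0..1}" by auto
    then have "{0..s} \<notin> sets \<mu>" unfolding sets by (auto simp: sets_restrict_space_iff)
    then show ?thesis using 3 by (simp add: cdf01_def measure_notin_sets)
  qed (auto simp: cdf01_def min_def)
qed

lemma cdf01_sets:
  assumes "\<mu> \<in> prob_measures_01" "s \<le> 1"
  shows "{0..s} \<in> sets \<mu>"
  using assms by (auto simp: prob_measures_01_def sets_restrict_space_iff)

lemma cdf01_measurable: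
  assumes \<mu>: "\<mu> \<in> prob_measures_01"
  shows "cdf01 \<mu> \<in> borel_measurable borel"
proof -
  interpret prob_space \<mu> using \<mu> by (simp add: prob_measures_01_def)
  have "mono (\<lambda>s. measure \<mu> {0..min s 1})"
    by (rule monoI, rule finite_measure_mono) (auto intro!: cdf01_sets[OF \<mu>])
  then have [measurable]: "(\<lambda>s. measure \<mu> {0..min s 1}) \<in> borel_measurable borel" by (rule borel_measurable_mono)
  show ?thesis unfolding cdf01_eq[OF \<mu>] by measurable
qed

lemma cdf01_bounds:
  assumes "\<mu> \<in> prob_measures_01"
  shows "0 \<le> cdf01 \<mu> s" "cdf01 \<mu> s \<le> 1"
proof -
  interpret prob_space \<mu> using assms by (simp add: prob_measures_01_def)
  show "0 \<le> cdf01 \<mu> s" "cdf01 \<mu> s \<le> 1" by (simp_all add: cdf01_def)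
qed

lemma cdf01_mix:
  assumes "\<mu>\<^sub>0 \<in> prob_measures_01" "\<mu> \<in> prob_measures_01" "0 \<le> \<theta>" "\<theta> \<le> 1" "s \<le> 1"
  shows "cdf01 (mix_measure \<theta> \<mu>\<^sub>0 \<mu>) s = (1 - \<theta>) * cdf01 \<mu>\<^sub>0 s + \<theta> * cdf01 \<mu> s"
proof -
  interpret m0: prob_space \<mu>\<^sub>0 using assms(1) by (simp add: prob_measures_01_def)
  interpret m: prob_space \<mu> using assms(2) by (simp add: prob_measures_01_def)
  have eq: "sets \<mu> = sets \<mu>\<^sub>0" using assms(1,2) by (simp add: prob_measures_01_def)
  have "emeasure (mix_measure \<theta> \<mu>\<^sub>0 \<mu>) {0..s} = ennreal ((1 - \<theta>) * measure \<mu>\<^sub>0 {0..s} + \<theta> * measure \<mu> {0..s})"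
    unfolding emeasure_mix_measure[OF eq cdf01_sets[OF assms(1,5)]] using assms
    by (simp add: m0.emeasure_eq_measure m.emeasure_eq_measure ennreal_mult)
  then have "measure (mix_measure \<theta> \<mu>\<^sub>0 \<mu>) {0..s} = (1 - \<theta>) * measure \<mu>\<^sub>0 {0..s} + \<theta> * measure \<mu> {0..s}"
    using assms(3,4) by (subst measure_def) (simp only: enn2real_ennreal add_nonneg_nonneg mult_nonneg_nonneg measure_nonneg diff_ge_0_iff_ge)
  then show ?thesis by (simp add: cdf01_def)
qed

lemma mix_measure_0:
  assumes "\<mu>\<^sub>0 \<in> prob_measures_01" "\<mu> \<in> prob_measures_01"
  shows "mix_measure 0 \<mu>\<^sub>0 \<mu> = \<mu>\<^sub>0"
proof (rule measure_eqI)
  have eq: "sets \<mu> = sets \<mu>\<^sub>0" using assms by (simp add: prob_measures_01_def)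
  show s: "sets (mix_measure 0 \<mu>\<^sub>0 \<mu>) = sets \<mu>\<^sub>0" by (simp add: mix_measure_def)
  fix A assume "A \<in> sets (mix_measure 0 \<mu>\<^sub>0 \<mu>)"
  then show "emeasure (mix_measure 0 \<mu>\<^sub>0 \<mu>) A = emeasure \<mu>\<^sub>0 A"
    using emeasure_mix_measure[OF eq, of A 0] s by simp
qed

lemma cdf01_dirac:
  assumes "q \<in> {0..1}" "r \<in> {0..1}"
  shows "cdf01 (dirac01 q) r = indicator {..r} q"
proof -
  have "{0..r} \<in> sets (restrict_space borel {0..1::real})" using assms by (auto simp: sets_restrict_space_iff)
  then show ?thesis using assms by (simp add: cdf01_def dirac01_def measure_return indicator_def)
qed

lemma cdf01_integral:
  assumes \<mu>: "\<mu> \<in> prob_measures_01" and r: "r \<in> {0..1}"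
  shows "cdf01 \<mu> r = (LINT q|\<mu>. indicator {..r} q)"
proof -
  have sp: "space \<mu> = {0..1}" using \<mu> sets_eq_imp_space_eq[of \<mu> "restrict_space borel {0..1::real}"]
    by (simp add: prob_measures_01_def space_restrict_space)
  have "(LINT q|\<mu>. indicator {..r} q) = (LINT q|\<mu>. indicator {0..r} q :: real)"
    by (rule Bochner_Integration.integral_cong) (use sp in \<open>auto simp: indicator_def\<close>)
  also have "\<dots> = measure \<mu> ({0..r} \<inter> space \<mu>)" by simp
  also have "{0..r} \<inter> space \<mu> = {0..r}" using sp r by auto
  finally show ?thesis by (simp add: cdf01_def)
qed

text \<open>The directional derivative is affine in \<open>\<mu>\<close>, so its value at \<open>\<mu>\<close> averages its values at the Dirac measures.\<close>

lemma LBINT_cdf01_average: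
  fixes c :: "real \<Rightarrow> real"
  assumes \<mu>: "\<mu> \<in> prob_measures_01" and \<mu>\<^sub>0: "\<mu>\<^sub>0 \<in> prob_measures_01" and c: "continuous_on {0..1} c"
  shows "(LBINT r:{0..1}. c r * (cdf01 \<mu> r - cdf01 \<mu>\<^sub>0 r))
     = (LINT q|\<mu>. (LBINT r:{0..1}. c r * (cdf01 (dirac01 q) r - cdf01 \<mu>\<^sub>0 r)))"
proof -
  interpret prob_space \<mu> using \<mu> by (simp add: prob_measures_01_def)
  interpret pair: pair_sigma_finite \<mu> lborel ..
  have sets: "sets \<mu> = sets (restrict_space borel {0..1::real})" using \<mu> by (simp add: prob_measures_01_def)
  have sp: "space \<mu> = {0..1}" using sets_eq_imp_space_eq[OF sets] by (simp add: space_restrict_space)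
  have idm: "(\<lambda>q. q) \<in> borel_measurable \<mu>"
    unfolding measurable_cong_sets[OF sets refl] by (rule measurable_restrict_space1) simp
  obtain K where K: "\<And>r. r \<in> {0..1} \<Longrightarrow> \<bar>c r\<bar> \<le> K" using continuous_abs_bounded[OF compact_Icc c] by blast
  have K0: "0 \<le> K" using K[of 0] by auto
  define c' where "c' r = indicator {0..1} r * c r" for r
  have [measurable]: "c' \<in> borel_measurable borel"
    using borel_measurable_continuous_on_indicator[OF _ c] by (simp add: c'_def[abs_def])
  note [measurable] = cdf01_measurable[OF \<mu>\<^sub>0]
  \<comment> \<open>For \<open>q\<close> in [0,1], \<open>indicator {..r} q\<close> as a function of
    \<open>r\<close> is the distribution function of the Dirac measure at \<open>q\<close>, while
    its \<open>\<mu>\<close>-average over \<open>q\<close> is the one of \<open>\<mu>\<close>.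
    Exchanging the two integrals is the whole proof.\<close>
  let ?H = "\<lambda>q r. c' r * (indicator {..r} q - cdf01 \<mu>\<^sub>0 r)"
  have [measurable]: "fst \<in> borel_measurable (\<mu> \<Otimes>\<^sub>M (lborel :: real measure))"
    using measurable_compose[OF measurable_fst idm] .
  have H_joint: "(\<lambda>(q, r). ?H q r) \<in> borel_measurable (\<mu> \<Otimes>\<^sub>M lborel)"
  proof -
    have "(\<lambda>p. if fst p \<le> snd p then 1 else 0 :: real) \<in> borel_measurable (\<mu> \<Otimes>\<^sub>M lborel)" by measurable
    then have "(\<lambda>p. c' (snd p) * ((if fst p \<le> snd p then 1 else 0) - cdf01 \<mu>\<^sub>0 (snd p))) \<in> borel_measurable (\<mu> \<Otimes>\<^sub>M lborel)"
      by measurable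
    then show ?thesis by (simp add: split_beta' indicator_def of_bool_def)
  qed
  have H_bd: "\<bar>?H q r\<bar> \<le> K * indicator {0..1} r" for q r
  proof (cases "r \<in> {0..1}")
    case True
    have "\<bar>indicator {..r} q - cdf01 \<mu>\<^sub>0 r\<bar> \<le> 1" using cdf01_bounds[OF \<mu>\<^sub>0, of r] by (auto simp: indicator_def)
    then have "\<bar>c r\<bar> * \<bar>indicator {..r} q - cdf01 \<mu>\<^sub>0 r\<bar> \<le> K * 1" using K[OF True] K0 by (intro mult_mono) auto
    then show ?thesis using True by (simp add: c'_def abs_mult)
  qed (simp add: c'_def)
  have i_ind: "integrable lborel (\<lambda>r. K * indicator {0..1::real} r)"
    by (intro integrable_mult_right integrable_real_indicator) (auto simp: emeasure_lborel_Icc_eq)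
  have H_int: "integrable (\<mu> \<Otimes>\<^sub>M lborel) (\<lambda>(q, r). ?H q r)"
  proof (rule Bochner_Integration.integrable_bound[OF _ H_joint])
    show "integrable (\<mu> \<Otimes>\<^sub>M lborel) (\<lambda>(q, r). K * indicator {0..1::real} r)"
    proof (rule pair.Fubini_integrable)
      show "(\<lambda>(q, r). K * indicator {0..1::real} r) \<in> borel_measurable (\<mu> \<Otimes>\<^sub>M lborel)" by measurable
      show "integrable \<mu> (\<lambda>q. LINT r|lborel. norm (case (q, r) of (q, r) \<Rightarrow> K * indicator {0..1::real} r))" by simp
      show "AE q in \<mu>. integrable lborel (\<lambda>r. case (q, r) of (q, r) \<Rightarrow> K * indicator {0..1::real} r)" using i_ind by simp
    qed
    show "AE p in \<mu> \<Otimes>\<^sub>M lborel. norm (case p of (q, r) \<Rightarrow> ?H q r) \<le> norm (case p of (q, r) \<Rightarrow> K * indicator {0..1::real} r)"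
      using H_bd K0 by (intro AE_I2) (auto simp: split_beta')
  qed
  have inner: "(LINT q|\<mu>. ?H q r) = indicator {0..1} r * (c r * (cdf01 \<mu> r - cdf01 \<mu>\<^sub>0 r))" for r
  proof (cases "r \<in> {0..1}")
    case True
    have "(\<lambda>q. indicator {..r} q :: real) \<in> borel_measurable \<mu>" by (rule measurable_compose[OF idm]) simp
    then have "integrable \<mu> (\<lambda>q. indicator {..r} q :: real)" by (intro integrable_const_bound[where B=1]) auto
    then show ?thesis using True prob_space by (simp add: c'_def cdf01_integral[OF \<mu> True])
  qed (simp add: c'_def)
  have "(LBINT r:{0..1}. c r * (cdf01 \<mu> r - cdf01 \<mu>\<^sub>0 r)) = (LBINT r. (LINT q|\<mu>. ?H q r))"
    unfolding inner by (simp add: set_lebesgue_integral_def)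
  also have "\<dots> = (LINT q|\<mu>. (LBINT r. ?H q r))" by (rule pair.Fubini_integral[OF H_int])
  also have "\<dots> = (LINT q|\<mu>. (LBINT r:{0..1}. c r * (cdf01 (dirac01 q) r - cdf01 \<mu>\<^sub>0 r)))"
  proof (rule Bochner_Integration.integral_cong[OF refl])
    fix q assume "q \<in> space \<mu>"
    then have q: "q \<in> {0..1}" using sp by simp
    show "(LBINT r. ?H q r) = (LBINT r:{0..1}. c r * (cdf01 (dirac01 q) r - cdf01 \<mu>\<^sub>0 r))"
      unfolding set_lebesgue_integral_def
      by (rule Bochner_Integration.integral_cong[OF refl]) (use cdf01_dirac[OF q] in \<open>auto simp: c'_def indicator_def\<close>)
  qed
  finally show ?thesis .
qed

lemma mixture_clock:
  assumes "\<beta> > 0" "\<exists>p\<ge>2. \<gamma> p \<noteq> 0" "summable (\<lambda>p. 2 ^ p * (\<gamma> p)\<^sup>2)"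
  shows "parisi_clock (deriv (deriv (mixture \<beta> \<gamma>))) (deriv (mixture \<beta> \<gamma>))"
proof
  show "(deriv (mixture \<beta> \<gamma>) has_real_derivative deriv (deriv (mixture \<beta> \<gamma>)) s) (at s)" if "s \<in> {0..1}" for s
    using that by (intro mixture_deriv2[OF assms(3)]) auto
  show "continuous_on {0..1} (deriv (deriv (mixture \<beta> \<gamma>)))"
    by (rule continuous_on_subset[OF mixture_deriv2_continuous[OF assms(3)]]) auto
  show "0 < deriv (deriv (mixture \<beta> \<gamma>)) s" if "0 < s" "s \<le> 1" for s
    using that by (intro mixture_deriv2_pos[OF assms(3,1,2)]) auto
qed

lemma parisi_pde_solution_pde:
  assumes clock: "parisi_clock (deriv (deriv \<xi>)) \<tau>" and \<mu>: "\<mu> \<in> prob_measures_01" and sol: "parisi_pde_solution \<xi> \<mu> \<Phi>"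
  shows "parisi_pde (deriv (deriv \<xi>)) \<tau> (cdf01 \<mu>) \<Phi> (\<lambda>s. dx \<Phi> s) (\<lambda>s. dxx \<Phi> s)"
proof -
  interpret parisi_clock "deriv (deriv \<xi>)" \<tau> by (rule clock)
  note sol' = sol[unfolded parisi_pde_solution_def]
  show ?thesis
  proof
    show "cdf01 \<mu> \<in> borel_measurable borel" by (rule cdf01_measurable[OF \<mu>])
    show "0 \<le> cdf01 \<mu> s" "cdf01 \<mu> s \<le> 1" for s by (rule cdf01_bounds[OF \<mu>])+
    show "(\<Phi> s has_real_derivative dx \<Phi> s x) (at x)" if "s \<in> {0..1}" for s x
      using sol' that DERIV_deriv_iff_field_differentiable by blast
    show "(dx \<Phi> s has_real_derivative dxx \<Phi> s x) (at x)" if "s \<in> {0..1}" for s x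
      using sol' that DERIV_deriv_iff_field_differentiable by blast
    show "\<bar>dx \<Phi> s x\<bar> \<le> 1" if "s \<in> {0..1}" for s x using sol' that by blast
    show "continuous_on ({0..1} \<times> UNIV) (case_prod \<Phi>)" using sol' by blast
    show "continuous_on ({0..1} \<times> UNIV) (case_prod (\<lambda>s. dx \<Phi> s))" using sol' by blast
    show "continuous_on ({0..1} \<times> UNIV) (case_prod (\<lambda>s. dxx \<Phi> s))" using sol' by blast
    show "\<Phi> s x = ln (cosh x) + (LBINT r:{s..1}. deriv (deriv \<xi>) r / 2 * (dxx \<Phi> r x + cdf01 \<mu> r * (dx \<Phi> r x)\<^sup>2))"
      if "s \<in> {0..1}" for s x using sol' that by blast
  qed
qed

text \<open>Restricting the filter to \<open>{0..1}\<close> encodes the right derivative at 0, where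
  alone the mixtures are probability measures.\<close>

lemma has_real_derivative_at_0_quadratic:
  fixes f :: "real \<Rightarrow> real"
  assumes "\<And>\<theta>. 0 \<le> \<theta> \<Longrightarrow> \<theta> \<le> 1 \<Longrightarrow> \<bar>f \<theta> - f 0 - \<theta> * D\<bar> \<le> K * \<theta>\<^sup>2"
  shows "(f has_real_derivative D) (at 0 within {0..1})"
proof -
  have "((\<lambda>y. (f y - f 0) / (y - 0) - D) \<longlongrightarrow> 0) (at 0 within {0..1})"
  proof (rule Lim_null_comparison)
    show "\<forall>\<^sub>F y in at 0 within {0..1}. norm ((f y - f 0) / (y - 0) - D) \<le> K * y"
      unfolding eventually_at_filter
    proof (rule always_eventually, intro allI impI)
      fix y :: real assume y: "y \<noteq> 0" "y \<in> {0..1}"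
      have "norm ((f y - f 0) / (y - 0) - D) = \<bar>f y - f 0 - y * D\<bar> / y" using y by (simp add: abs_divide flip: diff_divide_distrib) (simp add: divide_simps mult.commute)
      also have "\<dots> \<le> K * y\<^sup>2 / y" using assms[of y] y by (intro divide_right_mono) auto
      also have "\<dots> = K * y" using y by (simp add: power2_eq_square)
      finally show "norm ((f y - f 0) / (y - 0) - D) \<le> K * y" .
    qed
    have "((\<lambda>y. K * y) \<longlongrightarrow> K * 0) (at 0 within {0..1})" by (intro tendsto_intros)
    then show "((\<lambda>y. K * y) \<longlongrightarrow> 0) (at 0 within {0..1})" by simp
  qed
  from tendsto_add[OF this tendsto_const[of D]] show ?thesis by (simp add: has_field_derivative_iff)
qed

text \<open>Since 0 is a limit point of the unit interval, the difference quotients have at most one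
  limit. Hence the existence of some nonnegative derivative amounts to a sign condition on the
  computed one.\<close>

lemma at_0_within_unit_derivative_unique:
  fixes f :: "real \<Rightarrow> real"
  assumes "(f has_real_derivative D) (at 0 within {0..1})" "(f has_real_derivative E) (at 0 within {0..1})"
  shows "D = E"
proof -
  have nb: "at (0::real) within {0..1} \<noteq> bot" by (simp add: at_within_Icc_at_right)
  show ?thesis using tendsto_unique[OF nb] assms by (simp add: has_field_derivative_iff)
qed

section \<open>The directional derivative of the Parisi functional\<close>

theorem theorem2:
  fixes \<beta> h :: real and \<gamma> :: "nat \<Rightarrow> real"
    and \<xi> \<zeta> :: "real \<Rightarrow> real"
    and \<Phi> :: "real measure \<Rightarrow> real \<Rightarrow> real \<Rightarrow> real"
    and \<P> :: "real measure \<Rightarrow> real"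
    and \<mu>\<^sub>0 :: "real measure"
    and P :: "'a measure" and F :: "real \<Rightarrow> 'a measure"
    and B X u :: "real \<Rightarrow> 'a \<Rightarrow> real"
  assumes beta: "\<beta> > 0"
    and gamma_nonneg: "\<forall>p\<ge>2. \<gamma> p \<ge> 0"
    and gamma_nonzero: "\<exists>p\<ge>2. \<gamma> p \<noteq> 0"
    and gamma_summable: "summable (\<lambda>p. 2 ^ p * (\<gamma> p)\<^sup>2)"
    and xi: "\<xi> = mixture \<beta> \<gamma>"
    and zeta: "\<zeta> = deriv (deriv \<xi>)"
    and Phi: "\<forall>\<mu>\<in>prob_measures_01. parisi_pde_solution \<xi> \<mu> (\<Phi> \<mu>)"
    and functional: "\<P> = parisi_functional \<xi> h \<Phi>"
    and filtered: "usual_filtered_space P F"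
    and brownian: "brownian_motion P F B"
    and mu0: "\<mu>\<^sub>0 \<in> prob_measures_01"
    and X: "sde_solution P F B h (\<lambda>w x. cdf01 \<mu>\<^sub>0 w * \<zeta> w * dx (\<Phi> \<mu>\<^sub>0) w x) (\<lambda>w. sqrt (\<zeta> w)) X"
    and u: "\<forall>r \<omega>. u r \<omega> = dx (\<Phi> \<mu>\<^sub>0) r (X r \<omega>)"
  shows
    "(\<forall>\<mu>\<in>prob_measures_01.
        ((\<lambda>\<theta>. \<P> (mix_measure \<theta> \<mu>\<^sub>0 \<mu>)) has_real_derivative
           1 / 2 * (LBINT r:{0..1}. \<zeta> r * (cdf01 \<mu> r - cdf01 \<mu>\<^sub>0 r) *
                      ((LINT \<omega>|P. (u r \<omega>)\<^sup>2) - r)))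
         (at 0 within {0..1})) \<and>
     (is_parisi_measure \<xi> h \<Phi> \<mu>\<^sub>0 \<longleftrightarrow>
        (\<forall>\<mu>\<in>prob_measures_01. \<exists>D\<ge>0.
           ((\<lambda>\<theta>. \<P> (mix_measure \<theta> \<mu>\<^sub>0 \<mu>)) has_real_derivative D) (at 0 within {0..1}))) \<and>
     (is_parisi_measure \<xi> h \<Phi> \<mu>\<^sub>0 \<longleftrightarrow>
        (\<forall>q\<in>{0..1}. \<exists>D\<ge>0.
           ((\<lambda>\<theta>. \<P> (mix_measure \<theta> \<mu>\<^sub>0 (dirac01 q))) has_real_derivative D) (at 0 within {0..1})))"
proof -
  let ?M = "prob_measures_01"
  define \<tau> where "\<tau> = deriv \<xi>"
  have clock: "parisi_clock \<zeta> \<tau>"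
    unfolding \<tau>_def zeta xi by (rule mixture_clock[OF beta gamma_nonzero gamma_summable])
  have pde: "parisi_pde \<zeta> \<tau> (cdf01 \<mu>) (\<Phi> \<mu>) (\<lambda>s. dx (\<Phi> \<mu>) s) (\<lambda>s. dxx (\<Phi> \<mu>) s)" if "\<mu> \<in> ?M" for \<mu>
    using clock Phi that unfolding zeta by (intro parisi_pde_solution_pde) auto
  have fb: "filtered_brownian P F B"
  proof (intro filtered_brownian.intro filtered_brownian_axioms.intro filtered brownian)
    show "prob_space P" using filtered unfolding usual_filtered_space_def by blast
  qed
  interpret filtered_brownian P F B by (rule fb)
  obtain X' where X': "parisi_sde P F B \<zeta> \<tau> (cdf01 \<mu>\<^sub>0) (\<Phi> \<mu>\<^sub>0) (\<lambda>s. dx (\<Phi> \<mu>\<^sub>0) s) (\<lambda>s. dxx (\<Phi> \<mu>\<^sub>0) s) X' h"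
    and ae: "AE \<omega> in P. \<forall>r. X' r \<omega> = X r \<omega>"
    using parisi_sde_regularization[OF pde[OF mu0] X] by blast
  interpret S: parisi_sde P F B \<zeta> \<tau> "cdf01 \<mu>\<^sub>0" "\<Phi> \<mu>\<^sub>0" "\<lambda>s. dx (\<Phi> \<mu>\<^sub>0) s" "\<lambda>s. dxx (\<Phi> \<mu>\<^sub>0) s" X' h
    by (rule X')
  \<comment> \<open>The regular version agrees with \<open>X\<close> almost surely, so the second
    moment of its control is that of \<open>u\<close>.\<close>
  have m2: "S.m\<^sub>2 r = (LINT \<omega>|P. (u r \<omega>)\<^sup>2)" if r: "r \<in> {0..1}" for r
    unfolding S.m\<^sub>2_def
  proof (rule integral_cong_AE)
    show "(\<lambda>\<omega>. (S.V r \<omega>)\<^sup>2) \<in> borel_measurable P" using S.V_measurable[OF r] by measurable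
    have "X r \<in> borel_measurable P"
      using X r F_measurable[of "X r" r] unfolding sde_solution_def by auto
    from measurable_compose[OF this S.Phi1_measurable[OF r]]
    show "(\<lambda>\<omega>. (u r \<omega>)\<^sup>2) \<in> borel_measurable P" using u by simp
    show "AE \<omega> in P. (S.V r \<omega>)\<^sup>2 = (u r \<omega>)\<^sup>2"
      using ae by eventually_elim (simp add: S.V_def u)
  qed
  define D where "D \<mu> = 1 / 2 * (LBINT r:{0..1}. \<zeta> r * (cdf01 \<mu> r - cdf01 \<mu>\<^sub>0 r) * (S.m\<^sub>2 r - r))" for \<mu>
  have D_eq: "1 / 2 * (LBINT r:{0..1}. \<zeta> r * (cdf01 \<mu> r - cdf01 \<mu>\<^sub>0 r) * ((LINT \<omega>|P. (u r \<omega>)\<^sup>2) - r)) = D \<mu>" for \<mu>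
    unfolding D_def by (rule arg_cong[where f="\<lambda>x. 1 / 2 * x"], rule set_lebesgue_integral_cong) (simp_all add: m2)
  let ?G = "\<lambda>\<mu>. LBINT r:{0..1}. \<zeta> r / 2 * (cdf01 \<mu> r - cdf01 \<mu>\<^sub>0 r) * S.m\<^sub>2 r"
  \<comment> \<open>\<open>D\<close> is \<open>?G\<close> minus half the difference of the linear
    penalty terms. What separates the increment of the functional from \<open>D\<close> is therefore
    exactly the PDE difference minus \<open>?G\<close>, which the supporting hyperplane shows to be
    nonnegative and the expansion shows to be small.\<close>
  have P_diff: "\<P> \<mu> - \<P> \<mu>\<^sub>0 = \<Phi> \<mu> 0 h - \<Phi> \<mu>\<^sub>0 0 h - ?G \<mu> + D \<mu>" if \<mu>: "\<mu> \<in> ?M" for \<mu>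
  proof -
    note [measurable] = cdf01_measurable[OF \<mu>] cdf01_measurable[OF mu0]
    have cs: "continuous_on {0..1} (\<lambda>s. s * \<zeta> s)" by (intro continuous_intros S.zeta_cont)
    have i: "set_integrable lborel {0..1} (\<lambda>s. cdf01 \<nu> s * s * \<zeta> s)" if "\<nu> \<in> ?M" for \<nu>
      unfolding mult.assoc
      by (rule set_integrable_coeff_continuous[where K=1, OF cdf01_measurable[OF that] _ cs]) (use cdf01_bounds[OF that] in auto)
    have g: "set_integrable lborel {0..1} (\<lambda>r. \<zeta> r / 2 * (cdf01 \<mu> r - cdf01 \<mu>\<^sub>0 r) * S.m\<^sub>2 r)"
    proof (rule S.half_coeff_integrable[OF _ _ S.m2_continuous])
      show "\<bar>cdf01 \<mu> r - cdf01 \<mu>\<^sub>0 r\<bar> \<le> 1" for r using cdf01_bounds[OF \<mu>, of r] cdf01_bounds[OF mu0, of r] by auto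
    qed measurable
    let ?L = "\<lambda>\<nu>. LBINT s:{0..1}. cdf01 \<nu> s * s * \<zeta> s"
    have "2 * ?G \<mu> - (?L \<mu> - ?L \<mu>\<^sub>0) = (LBINT r:{0..1}. 2 * (\<zeta> r / 2 * (cdf01 \<mu> r - cdf01 \<mu>\<^sub>0 r) * S.m\<^sub>2 r)) - (LBINT s:{0..1}. cdf01 \<mu> s * s * \<zeta> s - cdf01 \<mu>\<^sub>0 s * s * \<zeta> s)"
      by (simp only: set_integral_diff(2)[OF i[OF \<mu>] i[OF mu0]] set_integral_mult_right)
    also have "\<dots> = (LBINT r:{0..1}. 2 * (\<zeta> r / 2 * (cdf01 \<mu> r - cdf01 \<mu>\<^sub>0 r) * S.m\<^sub>2 r) - (cdf01 \<mu> r * r * \<zeta> r - cdf01 \<mu>\<^sub>0 r * r * \<zeta> r))"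
      by (rule set_integral_diff(2)[symmetric, OF set_integrable_mult_right[OF g] set_integral_diff(1)[OF i[OF \<mu>] i[OF mu0]]])
    also have "\<dots> = 2 * D \<mu>"
      unfolding D_def by (simp, rule set_lebesgue_integral_cong) (auto simp: algebra_simps)
    finally show ?thesis unfolding functional parisi_functional_def zeta[symmetric] by linarith
  qed
  have lower: "\<P> \<mu>\<^sub>0 + D \<mu> \<le> \<P> \<mu>" if "\<mu> \<in> ?M" for \<mu>
    using S.supporting_hyperplane[OF pde[OF that]] P_diff[OF that] by linarith
  \<comment> \<open>The Lipschitz constant of the gradient in the coefficient.\<close>
  define C where "C = 2 * sqrt (\<tau> 1 - \<tau> 0) * exp (64 * (\<tau> 1 - \<tau> 0))"
  have expansion: "\<bar>\<P> (mix_measure \<theta> \<mu>\<^sub>0 \<mu>) - \<P> \<mu>\<^sub>0 - \<theta> * D \<mu>\<bar> \<le> S.Z * (C\<^sup>2 + 2 * C) * \<theta>\<^sup>2"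
    if \<mu>: "\<mu> \<in> ?M" and \<theta>: "0 \<le> \<theta>" "\<theta> \<le> 1" for \<mu> \<theta>
  proof -
    let ?\<nu> = "mix_measure \<theta> \<mu>\<^sub>0 \<mu>"
    have \<nu>: "?\<nu> \<in> ?M" by (rule mix_measure_in[OF mu0 \<mu> \<theta>])
    have cdf: "cdf01 ?\<nu> r - cdf01 \<mu>\<^sub>0 r = \<theta> * (cdf01 \<mu> r - cdf01 \<mu>\<^sub>0 r)" if "r \<in> {0..1}" for r
      using cdf01_mix[OF mu0 \<mu> \<theta>, of r] that by (simp add: algebra_simps)
    have le: "\<bar>cdf01 ?\<nu> r - cdf01 \<mu>\<^sub>0 r\<bar> \<le> \<theta>" if "r \<in> {0..1}" for r
    proof -
      have "\<bar>cdf01 \<mu> r - cdf01 \<mu>\<^sub>0 r\<bar> \<le> 1" using cdf01_bounds[OF \<mu>, of r] cdf01_bounds[OF mu0, of r] by auto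
      then show ?thesis unfolding cdf[OF that] abs_mult using \<theta> by (simp add: mult_left_le)
    qed
    interpret pair: parisi_pde_pair \<zeta> \<tau> "cdf01 ?\<nu>" "\<Phi> ?\<nu>" "\<lambda>s. dx (\<Phi> ?\<nu>) s" "\<lambda>s. dxx (\<Phi> ?\<nu>) s"
        "cdf01 \<mu>\<^sub>0" "\<Phi> \<mu>\<^sub>0" "\<lambda>s. dx (\<Phi> \<mu>\<^sub>0) s" "\<lambda>s. dxx (\<Phi> \<mu>\<^sub>0) s"
      by (intro parisi_pde_pair.intro clock pde \<nu> mu0)
    have "\<bar>dx (\<Phi> ?\<nu>) r x - dx (\<Phi> \<mu>\<^sub>0) r x\<bar> \<le> C * \<theta>" if "r \<in> {0..1}" for r x
      unfolding C_def by (rule pair.gradient_stability[OF le that])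
    \<comment> \<open>With gradient error \<open>C * \<theta>\<close> and coefficient error
      \<open>\<theta>\<close>, every remainder term carries \<open>\<theta>^2\<close>.\<close>
    from S.first_order_expansion[OF pde[OF \<nu>] le this]
    have "\<bar>\<Phi> ?\<nu> 0 h - \<Phi> \<mu>\<^sub>0 0 h - ?G ?\<nu>\<bar> \<le> S.Z * ((C * \<theta>)\<^sup>2 + 2 * \<theta> * (C * \<theta>))" .
    moreover have "S.Z * ((C * \<theta>)\<^sup>2 + 2 * \<theta> * (C * \<theta>)) = S.Z * (C\<^sup>2 + 2 * C) * \<theta>\<^sup>2"
      by (simp add: power2_eq_square algebra_simps)
    moreover have "D ?\<nu> = \<theta> * D \<mu>"
    proof -
      have "(LBINT r:{0..1}. \<zeta> r * (cdf01 ?\<nu> r - cdf01 \<mu>\<^sub>0 r) * (S.m\<^sub>2 r - r)) = (LBINT r:{0..1}. \<theta> * (\<zeta> r * (cdf01 \<mu> r - cdf01 \<mu>\<^sub>0 r) * (S.m\<^sub>2 r - r)))"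
        by (rule set_lebesgue_integral_cong) (simp_all add: cdf mult_ac)
      then show ?thesis unfolding D_def by simp
    qed
    ultimately show ?thesis using P_diff[OF \<nu>] by linarith
  qed
  have deriv: "((\<lambda>\<theta>. \<P> (mix_measure \<theta> \<mu>\<^sub>0 \<mu>)) has_real_derivative D \<mu>) (at 0 within {0..1})" if "\<mu> \<in> ?M" for \<mu>
    by (rule has_real_derivative_at_0_quadratic[where K="S.Z * (C\<^sup>2 + 2 * C)"])
      (use expansion[OF that] mix_measure_0[OF mu0 that] in simp)
  have deriv_iff: "(\<exists>E\<ge>0. ((\<lambda>\<theta>. \<P> (mix_measure \<theta> \<mu>\<^sub>0 \<mu>)) has_real_derivative E) (at 0 within {0..1})) \<longleftrightarrow> 0 \<le> D \<mu>"
    if "\<mu> \<in> ?M" for \<mu>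
    using deriv[OF that] at_0_within_unit_derivative_unique by blast
  have min_iff: "is_parisi_measure \<xi> h \<Phi> \<mu>\<^sub>0 \<longleftrightarrow> (\<forall>\<mu>\<in>?M. \<P> \<mu>\<^sub>0 \<le> \<P> \<mu>)"
    using mu0 by (auto simp: is_parisi_measure_def is_arg_min_def functional not_less)
  \<comment> \<open>Moving from a minimizer towards \<open>\<mu>\<close> by
    \<open>\<theta> = 1 / (n + 1)\<close> cannot decrease the functional; dividing the expansion by
    \<open>\<theta>\<close> leaves an error proportional to \<open>\<theta>\<close>, which vanishes
    as \<open>n\<close> grows.\<close>
  have minimal_D: "0 \<le> D \<mu>" if min: "\<forall>\<mu>\<in>?M. \<P> \<mu>\<^sub>0 \<le> \<P> \<mu>" and \<mu>: "\<mu> \<in> ?M" for \<mu>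
  proof -
    let ?K = "S.Z * (C\<^sup>2 + 2 * C)"
    have "- ?K * inverse (real (Suc n)) \<le> D \<mu>" for n
    proof -
      define \<theta> where "\<theta> = inverse (real (Suc n))"
      have \<theta>: "0 < \<theta>" "\<theta> \<le> 1" by (auto simp: \<theta>_def inverse_le_1_iff)
      have "\<P> \<mu>\<^sub>0 \<le> \<P> (mix_measure \<theta> \<mu>\<^sub>0 \<mu>)" using min mix_measure_in[OF mu0 \<mu>] \<theta> by auto
      then have "0 \<le> \<theta> * D \<mu> + ?K * \<theta>\<^sup>2" using expansion[OF \<mu>, of \<theta>] \<theta> by linarith
      also have "\<dots> = \<theta> * (D \<mu> + ?K * \<theta>)" by (simp add: power2_eq_square algebra_simps)
      finally show ?thesis using \<theta> by (simp add: zero_le_mult_iff \<theta>_def)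
    qed
    moreover have "(\<lambda>n. - ?K * inverse (real (Suc n))) \<longlonglongrightarrow> - ?K * 0"
      by (intro tendsto_intros LIMSEQ_inverse_real_of_nat)
    ultimately show ?thesis using LIMSEQ_le_const2[of "\<lambda>n. - ?K * inverse (real (Suc n))" 0 "D \<mu>"] by auto
  qed
  have D_average: "0 \<le> D \<mu>" if dirac: "\<forall>q\<in>{0..1}. 0 \<le> D (dirac01 q)" and \<mu>: "\<mu> \<in> ?M" for \<mu>
  proof -
    have c: "continuous_on {0..1} (\<lambda>r. \<zeta> r * (S.m\<^sub>2 r - r) / 2)"
      by (intro continuous_intros S.zeta_cont S.m2_continuous) auto
    have D_c: "D \<nu> = (LBINT r:{0..1}. \<zeta> r * (S.m\<^sub>2 r - r) / 2 * (cdf01 \<nu> r - cdf01 \<mu>\<^sub>0 r))" for \<nu>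
    proof -
      have "D \<nu> = (LBINT r:{0..1}. 1 / 2 * (\<zeta> r * (cdf01 \<nu> r - cdf01 \<mu>\<^sub>0 r) * (S.m\<^sub>2 r - r)))"
        unfolding D_def by (rule set_integral_mult_right[symmetric])
      then show ?thesis by (simp add: mult_ac)
    qed
    have sp: "space \<mu> = {0..1}" using \<mu> sets_eq_imp_space_eq[of \<mu> "restrict_space borel {0..1::real}"]
      by (simp add: prob_measures_01_def space_restrict_space)
    have "D \<mu> = (LINT q|\<mu>. D (dirac01 q))"
      unfolding D_c by (rule LBINT_cdf01_average[OF \<mu> mu0 c])
    also have "0 \<le> \<dots>" using dirac sp by (intro integral_nonneg_AE AE_I2) auto
    finally show ?thesis .
  qed
  have i_ii: "is_parisi_measure \<xi> h \<Phi> \<mu>\<^sub>0 \<longleftrightarrow> (\<forall>\<mu>\<in>?M. 0 \<le> D \<mu>)"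
    unfolding min_iff
  proof
    assume "\<forall>\<mu>\<in>?M. 0 \<le> D \<mu>"
    \<comment> \<open>The first-order term supports the functional from below on all of the
      measures, so its nonnegativity alone gives the global minimum.\<close>
    then show "\<forall>\<mu>\<in>?M. \<P> \<mu>\<^sub>0 \<le> \<P> \<mu>" using lower by fastforce
  qed (use minimal_D in blast)
  have ii_iii: "(\<forall>\<mu>\<in>?M. 0 \<le> D \<mu>) \<longleftrightarrow> (\<forall>q\<in>{0..1}. 0 \<le> D (dirac01 q))"
    using D_average dirac01_in by blast
  show ?thesis
  proof (intro conjI)
    show "\<forall>\<mu>\<in>?M. ((\<lambda>\<theta>. \<P> (mix_measure \<theta> \<mu>\<^sub>0 \<mu>)) has_real_derivative
           1 / 2 * (LBINT r:{0..1}. \<zeta> r * (cdf01 \<mu> r - cdf01 \<mu>\<^sub>0 r) * ((LINT \<omega>|P. (u r \<omega>)\<^sup>2) - r)))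
         (at 0 within {0..1})"
      unfolding D_eq using deriv by blast
    show "is_parisi_measure \<xi> h \<Phi> \<mu>\<^sub>0 \<longleftrightarrow>
        (\<forall>\<mu>\<in>?M. \<exists>D\<ge>0. ((\<lambda>\<theta>. \<P> (mix_measure \<theta> \<mu>\<^sub>0 \<mu>)) has_real_derivative D) (at 0 within {0..1}))"
      unfolding i_ii using deriv_iff by blast
    show "is_parisi_measure \<xi> h \<Phi> \<mu>\<^sub>0 \<longleftrightarrow>
        (\<forall>q\<in>{0..1}. \<exists>D\<ge>0. ((\<lambda>\<theta>. \<P> (mix_measure \<theta> \<mu>\<^sub>0 (dirac01 q))) has_real_derivative D) (at 0 within {0..1}))"
      unfolding i_ii ii_iii using deriv_iff dirac01_in by blast
  qed
qed

end
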